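(* Let $F|K$ be a function field. If $K$ is algebraically closed, then the places $P$ of $F|K$ for which $(F|K,P)$ is uniformizable lie dense in the Zariski space of $F|K$ with respect to the Zariski patch topology. If $K$ is perfect, then the set of places $P$ of $F|K$ with the following property is dense in the Zariski space of $F|K$ with respect to the Zariski patch topology: for every choice of finitely many elements $\zeta_1,\ldots,\zeta_m\in\mathcal O_F$ (the valuation ring of $P$ on $F$) there are a finite Galois extension $K'|K$ and an extension of $P$ to $F.K'$ such that $(F.K'|K',P)$ is uniformizable with respect to $\zeta_1,\ldots,\zeta_m$.
   Context: "Function field" means a finitely generated field extension of transcendence degree $\geq 1$. A place of $F|K$ is a place of $F$ whose restriction to $K$ is the identity. The Zariski space of $F|K$ is the set of all places of $F|K$ (up to equivalence). The basic open sets of the Zariski patch topology are the sets $\{P \mid P \text{ a place of } F|K,\ a_1P\neq 0,\ldots,a_kP\neq 0;\ b_1P=0,\ldots,b_\ell P=0\}$ with $a_1,\ldots,a_k,b_1,\ldots,b_\ell\in F\setminus\{0\}$. $F.K'$ is the field compositum (in an algebraic closure of $F$). Uniformizability: let $\mathcal F|\mathcal K$ be a finitely generated field extension and $P$ a place of $\mathcal F$, not necessarily the identity on $\mathcal K$. Let $\mathcal O_{\mathcal F}$, $\mathcal O_{\mathcal K}$ be the valuation rings of $P$ on $\mathcal F$, $\mathcal K$, and write $aP$ for the residue of $a$. For $\zeta_1,\ldots,\zeta_m\in\mathcal O_{\mathcal F}$, $(\mathcal F|\mathcal K,P)$ is uniformizable with respect to $\zeta_1,\ldots,\zeta_m$ if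 there are a transcendence basis $T=\{t_1,\ldots,t_s\}\subset\mathcal O_{\mathcal F}$ of $\mathcal F|\mathcal K$ (possibly empty), elements $\eta_1,\ldots,\eta_n\in\mathcal O_{\mathcal F}$ among which $\zeta_1,\ldots,\zeta_m$ appear, and polynomials $f_i\in\mathcal O_{\mathcal K}[t_1,\ldots,t_s,X_1,\ldots,X_n]$, $1\le i\le n$, such that $\mathcal F=\mathcal K(t_1,\ldots,t_s,\eta_1,\ldots,\eta_n)$ and: (U1) for $i<j$, $X_j$ does not occur in $f_i$; (U2) $f_i(\eta_1,\ldots,\eta_n)=0$ for $1\le i\le n$; (U3) $(\det J_f(\eta_1,\ldots,\eta_n))P\neq 0$, where $J_f=(\partial f_i/\partial X_j)_{i,j}$. $(\mathcal F|\mathcal K,P)$ is uniformizable if it is uniformizable with respect to every choice of finitely many elements of $\mathcal O_{\mathcal F}$. *)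

theory Defs
  imports
    "HOL-Analysis.Abstract_Topology"
    "HOL-Computational_Algebra.Polynomial"
    "HOL-Library.Poly_Mapping"
    "Jordan_Normal_Form.Determinant"
begin

text \<open>
  All fields are subfields, represented as sets, of one ambient field \<open>'a\<close>. In the theorem \<open>'a\<close> is
  an algebraic closure of \<open>F\<close>, so composita and finite extensions of \<open>K\<close> are formed inside it.
\<close>

section \<open>Subrings, subfields and field extensions\<close>

definition is_subring :: "'a::field set \<Rightarrow> bool" where
  "is_subring R \<longleftrightarrow> 0 \<in> R \<and> 1 \<in> R \<and> (\<forall>x\<in>R. \<forall>y\<in>R. x - y \<in> R \<and> x * y \<in> R)"

definition is_subfield :: "'a::field set \<Rightarrow> bool" where
  "is_subfield K \<longleftrightarrow> is_subring K \<and> (\<forall>x\<in>K. inverse x \<in> K)"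

definition field_ext :: "'a::field set \<Rightarrow> 'a set \<Rightarrow> bool" where
  "field_ext F K \<longleftrightarrow> is_subfield F \<and> is_subfield K \<and> K \<subseteq> F"

definition adjoin :: "'a::field set \<Rightarrow> 'a set \<Rightarrow> 'a set" where
  "adjoin K S = is_subfield hull (K \<union> S)"

definition ring_adjoin :: "'a::field set \<Rightarrow> 'a set \<Rightarrow> 'a set" where
  "ring_adjoin R S = is_subring hull (R \<union> S)"

abbreviation compositum :: "'a::field set \<Rightarrow> 'a set \<Rightarrow> 'a set" where
  "compositum F L \<equiv> adjoin F L"

definition finitely_generated :: "'a::field set \<Rightarrow> 'a set \<Rightarrow> bool" where
  "finitely_generated F K \<longleftrightarrow> field_ext F K \<and> (\<exists>S. finite S \<and> F = adjoin K S)"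

definition algebraic_over :: "'a::field set \<Rightarrow> 'a \<Rightarrow> bool" where
  "algebraic_over K x \<longleftrightarrow> (\<exists>p. p \<noteq> 0 \<and> set (coeffs p) \<subseteq> K \<and> poly p x = 0)"

definition is_alg_closed :: "'a::field set \<Rightarrow> bool" where
  "is_alg_closed K \<longleftrightarrow>
     (\<forall>p. set (coeffs p) \<subseteq> K \<and> degree p > 0 \<longrightarrow> (\<exists>x\<in>K. poly p x = 0))"

definition is_perfect :: "'a::field set \<Rightarrow> bool" where
  "is_perfect K \<longleftrightarrow> CHAR('a) = 0 \<or> (\<forall>x\<in>K. \<exists>y\<in>K. y ^ CHAR('a) = x)"

section \<open>Finite Galois extensions\<close>

definition finite_ext :: "'a::field set \<Rightarrow> 'a set \<Rightarrow> bool" where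
  "finite_ext L K \<longleftrightarrow> field_ext L K \<and>
     (\<exists>B. finite B \<and> B \<subseteq> L \<and> (\<forall>x\<in>L. \<exists>c. (\<forall>b\<in>B. c b \<in> K) \<and> x = (\<Sum>b\<in>B. c b * b)))"

definition irreducible_over :: "'a::field set \<Rightarrow> 'a poly \<Rightarrow> bool" where
  "irreducible_over K p \<longleftrightarrow> set (coeffs p) \<subseteq> K \<and> degree p > 0 \<and>
     (\<forall>q r. set (coeffs q) \<subseteq> K \<and> set (coeffs r) \<subseteq> K \<and> p = q * r \<longrightarrow> degree q = 0 \<or> degree r = 0)"

definition splits_in :: "'a::field set \<Rightarrow> 'a poly \<Rightarrow> bool" where
  "splits_in L p \<longleftrightarrow> (\<exists>rs. set rs \<subseteq> L \<and> p = smult (lead_coeff p) (\<Prod>r\<leftarrow>rs. [:- r, 1:]))"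

definition normal_ext :: "'a::field set \<Rightarrow> 'a set \<Rightarrow> bool" where
  "normal_ext L K \<longleftrightarrow>
     (\<forall>p. irreducible_over K p \<and> (\<exists>x\<in>L. poly p x = 0) \<longrightarrow> splits_in L p)"

text \<open>
  \<^const>\<open>rsquarefree\<close> \<open>p\<close> says that \<open>p\<close> has no multiple root in \<open>'a\<close>; as \<open>'a\<close> is algebraically
  closed, this is separability of \<open>p\<close>.
\<close>

definition separable_ext :: "'a::alg_closed_field set \<Rightarrow> 'a set \<Rightarrow> bool" where
  "separable_ext L K \<longleftrightarrow> (\<forall>x\<in>L. \<exists>p. irreducible_over K p \<and> poly p x = 0 \<and> rsquarefree p)"

definition finite_galois :: "'a::alg_closed_field set \<Rightarrow> 'a set \<Rightarrow> bool" where
  "finite_galois L K \<longleftrightarrow> finite_ext L K \<and> normal_ext L K \<and> separable_ext L K"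

section \<open>Polynomials in several variables\<close>

text \<open>
  A monomial is its finitely supported exponent vector, a polynomial the finitely supported map
  from monomials to coefficients. The index type \<open>'v\<close> of the variables is arbitrary.
\<close>

type_synonym ('v, 'a) mpoly = "('v \<Rightarrow>\<^sub>0 nat) \<Rightarrow>\<^sub>0 'a"

definition mpoly_vars :: "('v, 'a::zero) mpoly \<Rightarrow> 'v set" where
  "mpoly_vars p = (\<Union>m\<in>Poly_Mapping.keys p. Poly_Mapping.keys m)"

definition mpoly_coeffs :: "('v, 'a::zero) mpoly \<Rightarrow> 'a set" where
  "mpoly_coeffs p = Poly_Mapping.lookup p ` Poly_Mapping.keys p"

definition mpoly_eval :: "('v \<Rightarrow> 'a::comm_ring_1) \<Rightarrow> ('v, 'a) mpoly \<Rightarrow> 'a" where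
  "mpoly_eval x p = (\<Sum>m\<in>Poly_Mapping.keys p.
     Poly_Mapping.lookup p m * (\<Prod>v\<in>Poly_Mapping.keys m. x v ^ Poly_Mapping.lookup m v))"

definition mpoly_pderiv :: "'v \<Rightarrow> ('v, 'a::comm_ring_1) mpoly \<Rightarrow> ('v, 'a) mpoly" where
  "mpoly_pderiv v p = (\<Sum>m\<in>Poly_Mapping.keys p.
     Poly_Mapping.single (m - Poly_Mapping.single v 1)
       (of_nat (Poly_Mapping.lookup m v) * Poly_Mapping.lookup p m))"

section \<open>Transcendence bases and function fields\<close>

text \<open>Algebraic independence of a set \<open>T\<close>: the elements of \<open>T\<close> serve as the names of the variables.\<close>

definition alg_indep :: "'a::field set \<Rightarrow> 'a set \<Rightarrow> bool" where
  "alg_indep K T \<longleftrightarrow> (\<forall>p :: ('a, 'a) mpoly.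
     mpoly_coeffs p \<subseteq> K \<and> mpoly_vars p \<subseteq> T \<and> mpoly_eval (\<lambda>t. t) p = 0 \<longrightarrow> p = 0)"

definition transcendence_basis :: "'a::field set \<Rightarrow> 'a set \<Rightarrow> 'a set \<Rightarrow> bool" where
  "transcendence_basis F K T \<longleftrightarrow>
     T \<subseteq> F \<and> alg_indep K T \<and> (\<forall>x\<in>F. algebraic_over (adjoin K T) x)"

definition has_trdeg :: "'a::field set \<Rightarrow> 'a set \<Rightarrow> nat \<Rightarrow> bool" where
  "has_trdeg F K d \<longleftrightarrow> (\<exists>T. transcendence_basis F K T \<and> finite T \<and> card T = d)"

definition function_field :: "'a::field set \<Rightarrow> 'a set \<Rightarrow> bool" where
  "function_field F K \<longleftrightarrow> finitely_generated F K \<and> (\<exists>d\<ge>1. has_trdeg F K d)"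

section \<open>Places and the Zariski space\<close>

text \<open>
  A place is a map to a field together with \<open>\<infinity>\<close>; here \<open>\<infinity>\<close> is \<open>None\<close>. Its values outside
  \<open>F\<close> are irrelevant.
\<close>

definition val_ring :: "'a set \<Rightarrow> ('a \<Rightarrow> 'b option) \<Rightarrow> 'a set" where
  "val_ring F P = {x\<in>F. P x \<noteq> None}"

definition is_place :: "'a::field set \<Rightarrow> ('a \<Rightarrow> 'b::field option) \<Rightarrow> bool" where
  "is_place F P \<longleftrightarrow>
     is_subring (val_ring F P) \<and>
     P 1 = Some 1 \<and>
     (\<forall>x\<in>val_ring F P. \<forall>y\<in>val_ring F P.
        P (x + y) = Some (the (P x) + the (P y)) \<and> P (x * y) = Some (the (P x) * the (P y))) \<and>
     (\<forall>x\<in>F. P x = None \<longrightarrow> x \<noteq> 0 \<and> P (inverse x) = Some 0)"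

text \<open>
  Places of \<open>F|K\<close> take their finite values in \<open>'a\<close>, so that ``\<open>P\<close> is the identity on \<open>K\<close>'' can be
  said literally. If \<open>'a\<close> is an algebraic closure of \<open>F\<close>, this loses no equivalence class: lifts of
  elements algebraically independent over \<open>K\<close> are again so, hence the residue field of a place of
  \<open>F|K\<close> has transcendence degree over \<open>K\<close> at most that of \<open>F|K\<close> and embeds over \<open>K\<close> into \<open>'a\<close>.
  Likewise, the residue field of an extension of \<open>P\<close> to an algebraic extension of \<open>F\<close> is algebraic
  over that of \<open>P\<close>, so up to equivalence every extension of \<open>P\<close> is again \<open>'a\<close>-valued and
  extends \<open>P\<close> as a map.
\<close>

definition places :: "'a::field set \<Rightarrow> 'a set \<Rightarrow> ('a \<Rightarrow> 'a option) set" where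
  "places F K = {P. is_place F P \<and> (\<forall>a\<in>K. P a = Some a)}"

definition place_equiv :: "'a::field set \<Rightarrow> 'a set \<Rightarrow> (('a \<Rightarrow> 'a option) \<times> ('a \<Rightarrow> 'a option)) set" where
  "place_equiv F K = {(P, Q). P \<in> places F K \<and> Q \<in> places F K \<and> val_ring F P = val_ring F Q}"

definition zariski_space :: "'a::field set \<Rightarrow> 'a set \<Rightarrow> ('a \<Rightarrow> 'a option) set set" where
  "zariski_space F K = places F K // place_equiv F K"

definition zariski_points ::
  "'a::field set \<Rightarrow> 'a set \<Rightarrow> ('a \<Rightarrow> 'a option) set \<Rightarrow> ('a \<Rightarrow> 'a option) set set" where
  "zariski_points F K \<S> = (\<lambda>P. place_equiv F K `` {P}) ` \<S>"

definition patch_basic :: "'a::field set \<Rightarrow> 'a set \<Rightarrow> 'a set \<Rightarrow> 'a set \<Rightarrow> ('a \<Rightarrow> 'a option) set set" where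
  "patch_basic F K A B = zariski_points F K
     {P \<in> places F K. (\<forall>a\<in>A. P a \<noteq> Some 0) \<and> (\<forall>b\<in>B. P b = Some 0)}"

definition zariski_patch :: "'a::field set \<Rightarrow> 'a set \<Rightarrow> ('a \<Rightarrow> 'a option) set topology" where
  "zariski_patch F K = topology_generated_by
     {patch_basic F K A B | A B. finite A \<and> finite B \<and> A \<subseteq> F - {0} \<and> B \<subseteq> F - {0}}"

lemma equiv_place_equiv: "equiv (places F K) (place_equiv F K)"
  by (rule equivI) (auto simp: place_equiv_def refl_on_def sym_def trans_def)

lemma zariski_points_places: "zariski_points F K (places F K) = zariski_space F K"
  by (auto simp: zariski_points_def zariski_space_def quotient_def)

lemma topspace_zariski_patch: "topspace (zariski_patch F K) = zariski_space F K"
proof -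
  have "patch_basic F K A B \<subseteq> zariski_space F K" for A B
    unfolding zariski_points_places[symmetric] patch_basic_def zariski_points_def by blast
  moreover have "patch_basic F K {} {} = zariski_space F K"
    unfolding zariski_points_places[symmetric] patch_basic_def by simp
  ultimately show ?thesis
    unfolding zariski_patch_def topology_generated_by_topspace by blast
qed

section \<open>Uniformizability\<close>

text \<open>
  The finite set \<open>Z\<close> is \<open>{\<zeta>\<^sub>1, \<dots>, \<zeta>\<^sub>m}\<close>, and the indices \<open>1, \<dots>, n\<close> are shifted to \<open>0, \<dots>, n - 1\<close>.
  A polynomial in \<open>O\<^sub>K[t\<^sub>1, \<dots>, t\<^sub>s, X\<^sub>1, \<dots>, X\<^sub>n]\<close> is a polynomial in \<open>n\<close> variables with coefficients in
  the subring \<open>O\<^sub>K[t\<^sub>1, \<dots>, t\<^sub>s]\<close> of \<open>F\<close>.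
\<close>

definition uniformizable_wrt ::
  "'a::field set \<Rightarrow> 'a set \<Rightarrow> ('a \<Rightarrow> 'b::field option) \<Rightarrow> 'a set \<Rightarrow> bool" where
  "uniformizable_wrt F K P Z \<longleftrightarrow>
    (\<exists>T n (\<eta> :: nat \<Rightarrow> 'a) (f :: nat \<Rightarrow> (nat, 'a) mpoly).
       finite T \<and> T \<subseteq> val_ring F P \<and> transcendence_basis F K T \<and>
       \<eta> ` {..<n} \<subseteq> val_ring F P \<and> Z \<subseteq> \<eta> ` {..<n} \<and>
       F = adjoin K (T \<union> \<eta> ` {..<n}) \<and>
       (\<forall>i<n. mpoly_coeffs (f i) \<subseteq> ring_adjoin (val_ring K P) T \<and> mpoly_vars (f i) \<subseteq> {..<n}) \<and>
       (\<forall>i<n. \<forall>j<n. i < j \<longrightarrow> j \<notin> mpoly_vars (f i)) \<and>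
       (\<forall>i<n. mpoly_eval \<eta> (f i) = 0) \<and>
       P (det (mat n n (\<lambda>(i, j). mpoly_eval \<eta> (mpoly_pderiv j (f i))))) \<noteq> Some 0)"

definition uniformizable :: "'a::field set \<Rightarrow> 'a set \<Rightarrow> ('a \<Rightarrow> 'b::field option) \<Rightarrow> bool" where
  "uniformizable F K P \<longleftrightarrow>
     (\<forall>Z. finite Z \<and> Z \<subseteq> val_ring F P \<longrightarrow> uniformizable_wrt F K P Z)"

end

theory Submission
  imports Defs "HOL-Algebra.Multiplicative_Group"
begin

hide_const (open) up_ring.coeff up_ring.monom

text \<open>
  Only perfect \<open>K\<close> matters, and then \<open>K' = K\<close> suffices. Let \<open>Q\<close> be a place in a basic set. A finite
  set \<open>X \<subseteq> O\<^sub>Q\<close> encodes the conditions on a place of the set, except that one \<open>b \<in> X\<close> must go to \<open>0\<close>.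
  By Noether normalization of \<open>K[X]\<close>, a place that is finite on a certain transcendence basis \<open>Y'\<close> of
  \<open>F|K\<close> is finite on \<open>X\<close>; the norm of \<open>b\<close> to \<open>K(Y')\<close> vanishes at some place trivial on \<open>K(Y)\<close> with
  \<open>Y = Y' - {y}\<close>, and conjugating this place over \<open>K(Y')\<close> yields a place \<open>P\<close> of the basic set. It is
  discrete on \<open>F\<close>, which is a function field of one variable over \<open>k = K(Y)\<close>, and its residue field
  \<open>\<kappa>\<close> is finite over \<open>k\<close>.

  There is a finite \<open>T \<subseteq> O\<^sub>F\<close>, algebraically independent over \<open>K\<close>, such that \<open>F|K(T)\<close> is finite separable
  and immediate. For \<open>p = char K > 0\<close>, lift a \<open>p\<close>-basis of \<open>\<kappa>\<close> to \<open>t\<close>; then \<open>\<kappa>\<close> is separable over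
  \<open>K(t)\<close>, with primitive element lifting to some \<open>x\<close> at which its minimal polynomial over \<open>K(t)\<close> takes
  a uniformizer as value. As \<open>[F : F\<^sup>p] = p [\<kappa> : \<kappa>\<^sup>p]\<close>, the elements of \<open>T = {t, x}\<close> generate \<open>F\<close> over
  \<open>F\<^sup>p\<close>, so \<open>F|K(T)\<close> is separable. In characteristic \<open>0\<close> take \<open>T = {Y, x}\<close>.

  Finally, with \<open>s \<in> K(T)\<close> a uniformizer, each \<open>\<zeta> \<in> O\<^sub>F\<close> is \<open>c + s\<^sup>N \<zeta>'\<close> with \<open>c \<in> K(T)\<close> and \<open>\<zeta>' \<in> O\<^sub>F\<close>.
  For large \<open>N\<close> the separable equation of \<open>\<zeta>\<close> turns into one for \<open>\<zeta>'\<close> with a simple root modulo the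
  maximal ideal. These equations and the linear ones for \<open>\<zeta>\<close> in terms of \<open>\<zeta>'\<close> have a triangular
  Jacobian matrix with units on the diagonal.
\<close>

text \<open>The obstacle is inseparability: K(Y) need not be perfect, so neither F nor \<kappa> need
  be separable over fields built from Y, and Y has to be replaced by T. In characteristic p
  separability is reached by counting degrees over p-th powers: if N is finitely generated over E
  and N = E(N^p), then N|E is finite and separable; and [N : N^p] is unchanged by finite extensions
  and grows at most by the factor p when one element is adjoined. As F is finite over k(c) and
  \<kappa> over k, this gives [F : F^p] <= p [\<kappa> : \<kappa>^p]. Equality comes from values:
  those of F^p(t) are divisible by p, that of a uniformizer is not. Perfectness enters as K = K^p
  \<subseteq> F^p: it makes p-independent elements algebraically independent over K, and it puts
  K(t) into F^p(t), so that x can replace the uniformizer among the generators. The norm of b is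
  used because zeros can be found in K(Y), where fixing all but one variable gives places by
  evaluation. Places are extended to the whole ambient field, so conjugations act on them.\<close>

lemma subring_0: "is_subring R \<Longrightarrow> 0 \<in> R"
  and subring_1: "is_subring R \<Longrightarrow> 1 \<in> R"
  and subring_diff: "is_subring R \<Longrightarrow> x \<in> R \<Longrightarrow> y \<in> R \<Longrightarrow> x - y \<in> R"
  and subring_mult: "is_subring R \<Longrightarrow> x \<in> R \<Longrightarrow> y \<in> R \<Longrightarrow> x * y \<in> R"
  by (auto simp: is_subring_def)

lemma subring_uminus: "is_subring R \<Longrightarrow> x \<in> R \<Longrightarrow> - x \<in> R"
  using subring_diff[of R 0 x] by (simp add: subring_0)

lemma subring_add: "is_subring R \<Longrightarrow> x \<in> R \<Longrightarrow> y \<in> R \<Longrightarrow> x + y \<in> R"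
  using subring_diff[of R x "- y"] by (simp add: subring_uminus)

lemma subring_power: "is_subring R \<Longrightarrow> x \<in> R \<Longrightarrow> x ^ n \<in> R"
  by (induction n) (auto simp: subring_1 subring_mult)

lemma subring_sum: "is_subring R \<Longrightarrow> (\<And>i. i \<in> I \<Longrightarrow> f i \<in> R) \<Longrightarrow> sum f I \<in> R"
  by (induction I rule: infinite_finite_induct) (auto simp: subring_0 subring_add)

lemma subring_prod: "is_subring R \<Longrightarrow> (\<And>i. i \<in> I \<Longrightarrow> f i \<in> R) \<Longrightarrow> prod f I \<in> R"
  by (induction I rule: infinite_finite_induct) (auto simp: subring_1 subring_mult)

lemma subring_of_nat: "is_subring R \<Longrightarrow> of_nat n \<in> R"
  by (induction n) (auto simp: subring_0 subring_1 subring_add)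

lemmas subring_intros = subring_0 subring_1 subring_diff subring_mult subring_uminus subring_add
  subring_power subring_sum subring_prod subring_of_nat

lemma subfield_subring: "is_subfield K \<Longrightarrow> is_subring K"
  by (simp add: is_subfield_def)

lemma subfield_inverse: "is_subfield K \<Longrightarrow> x \<in> K \<Longrightarrow> inverse x \<in> K"
  by (simp add: is_subfield_def)

lemma subfield_divide: "is_subfield K \<Longrightarrow> x \<in> K \<Longrightarrow> y \<in> K \<Longrightarrow> x / y \<in> K"
  by (simp add: divide_inverse subfield_inverse subring_mult subfield_subring)

lemma subfield_power_int: "is_subfield K \<Longrightarrow> x \<in> K \<Longrightarrow> x powi n \<in> K"
  by (auto simp: power_int_def subfield_inverse subring_power subfield_subring)

lemmas subfield_intros = subring_intros[OF subfield_subring] subfield_inverse subfield_divide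
  subfield_power_int

lemma is_subring_UNIV: "is_subring UNIV" and is_subfield_UNIV: "is_subfield UNIV"
  by (auto simp: is_subring_def is_subfield_def)

lemma is_subring_Int: "is_subring R \<Longrightarrow> is_subring S \<Longrightarrow> is_subring (R \<inter> S)"
  by (auto simp: is_subring_def)

lemma is_subfield_adjoin: "is_subfield (adjoin K S)"
  unfolding adjoin_def by (rule hull_in) (auto simp: is_subfield_def is_subring_def)

lemma is_subring_ring_adjoin: "is_subring (ring_adjoin K S)"
  unfolding ring_adjoin_def by (rule hull_in) (auto simp: is_subring_def)

lemma adjoin_base: "K \<subseteq> adjoin K S" and adjoin_gens: "S \<subseteq> adjoin K S"
  unfolding adjoin_def using hull_subset[of "K \<union> S" is_subfield] by auto

lemma ring_adjoin_base: "K \<subseteq> ring_adjoin K S" and ring_adjoin_gens: "S \<subseteq> ring_adjoin K S"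
  unfolding ring_adjoin_def using hull_subset[of "K \<union> S" is_subring] by auto

lemma adjoin_least: "is_subfield L \<Longrightarrow> K \<subseteq> L \<Longrightarrow> S \<subseteq> L \<Longrightarrow> adjoin K S \<subseteq> L"
  unfolding adjoin_def by (rule hull_minimal) auto

lemma ring_adjoin_least: "is_subring L \<Longrightarrow> K \<subseteq> L \<Longrightarrow> S \<subseteq> L \<Longrightarrow> ring_adjoin K S \<subseteq> L"
  unfolding ring_adjoin_def by (rule hull_minimal) auto

lemma ring_adjoin_subset_adjoin: "ring_adjoin K S \<subseteq> adjoin K S"
  by (rule ring_adjoin_least) (auto intro: subfield_subring is_subfield_adjoin
      adjoin_base[THEN subsetD] adjoin_gens[THEN subsetD])

lemma adjoin_mono: "K \<subseteq> L \<Longrightarrow> S \<subseteq> T \<Longrightarrow> adjoin K S \<subseteq> adjoin L T"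
  unfolding adjoin_def by (rule hull_mono) auto

lemma ring_adjoin_mono: "K \<subseteq> L \<Longrightarrow> S \<subseteq> T \<Longrightarrow> ring_adjoin K S \<subseteq> ring_adjoin L T"
  unfolding ring_adjoin_def by (rule hull_mono) auto

lemma adjoin_adjoin: "adjoin (adjoin K S) T = adjoin K (S \<union> T)"
proof
  show "adjoin (adjoin K S) T \<subseteq> adjoin K (S \<union> T)"
    using adjoin_gens[of "S \<union> T" K]
    by (intro adjoin_least is_subfield_adjoin adjoin_mono) auto
  show "adjoin K (S \<union> T) \<subseteq> adjoin (adjoin K S) T"
    using adjoin_gens[of T "adjoin K S"] adjoin_base[of "adjoin K S" T]
      adjoin_gens[of S K] adjoin_base[of K S]
    by (intro adjoin_least is_subfield_adjoin) auto
qed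

lemma adjoin_absorb: "is_subfield K \<Longrightarrow> S \<subseteq> K \<Longrightarrow> adjoin K S = K"
  using adjoin_least[of K K S] adjoin_base[of K S] by auto

subsection \<open>Polynomials over a subset\<close>

text \<open>Membership is tested at all indices, so that closure under ring operations is checked
  coefficientwise. Past the degree the coefficients are 0, hence \<open>0 \<in> R\<close> as soon as
  this set is nonempty.\<close>

definition polys :: "'a::zero set \<Rightarrow> 'a poly set" where
  "polys R = {p. \<forall>i. coeff p i \<in> R}"

lemma polysD: "p \<in> polys R \<Longrightarrow> coeff p i \<in> R"
  by (simp add: polys_def)

lemma polys_mono: "R \<subseteq> S \<Longrightarrow> polys R \<subseteq> polys S"
  by (auto simp: polys_def)

lemma polys_iff_coeffs:
  assumes "0 \<in> R"
  shows "p \<in> polys R \<longleftrightarrow> set (coeffs p) \<subseteq> R"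
proof
  assume "p \<in> polys R"
  then show "set (coeffs p) \<subseteq> R" by (auto simp: polys_def coeffs_def)
next
  assume *: "set (coeffs p) \<subseteq> R"
  have "coeff p i \<in> R" for i
  proof (cases "coeff p i = 0")
    case False
    then have "p \<noteq> 0" "i \<le> degree p" by (auto simp: le_degree)
    then show ?thesis using * coeff_in_coeffs[of p i] by auto
  qed (use assms in simp)
  then show "p \<in> polys R" by (simp add: polys_def)
qed

context
  fixes R :: "'a::field set"
  assumes R: "is_subring R"
begin

lemma polys_0: "0 \<in> polys R" and polys_1: "1 \<in> polys R"
  and polys_add: "p \<in> polys R \<Longrightarrow> q \<in> polys R \<Longrightarrow> p + q \<in> polys R"
  and polys_diff: "p \<in> polys R \<Longrightarrow> q \<in> polys R \<Longrightarrow> p - q \<in> polys R"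
  and polys_uminus: "p \<in> polys R \<Longrightarrow> - p \<in> polys R"
  and polys_smult: "a \<in> R \<Longrightarrow> p \<in> polys R \<Longrightarrow> smult a p \<in> polys R"
  and polys_monom: "a \<in> R \<Longrightarrow> monom a n \<in> polys R"
  and polys_pCons: "a \<in> R \<Longrightarrow> p \<in> polys R \<Longrightarrow> pCons a p \<in> polys R"
  and polys_mult: "p \<in> polys R \<Longrightarrow> q \<in> polys R \<Longrightarrow> p * q \<in> polys R"
  and polys_pderiv: "p \<in> polys R \<Longrightarrow> pderiv p \<in> polys R"
  by (auto simp: polys_def coeff_1 coeff_pCons coeff_mult coeff_pderiv subring_intros[OF R] split: nat.split
      intro!: subring_sum[OF R] subring_mult[OF R] subring_of_nat[OF R] simp del: of_nat_Suc)

lemma polys_power: "p \<in> polys R \<Longrightarrow> p ^ n \<in> polys R"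
  by (induction n) (auto simp: polys_1 polys_mult)

lemma polys_sum: "(\<And>i. i \<in> I \<Longrightarrow> f i \<in> polys R) \<Longrightarrow> sum f I \<in> polys R"
  by (induction I rule: infinite_finite_induct) (auto simp: polys_0 polys_add)

lemma polys_prod: "(\<And>i. i \<in> I \<Longrightarrow> f i \<in> polys R) \<Longrightarrow> prod f I \<in> polys R"
  by (induction I rule: infinite_finite_induct) (auto simp: polys_1 polys_mult)

lemma polys_pcompose: "p \<in> polys R \<Longrightarrow> q \<in> polys R \<Longrightarrow> pcompose p q \<in> polys R"
proof (induction p)
  case (pCons a p)
  then have "a \<in> R" "p \<in> polys R"
    using polysD[of "pCons a p" R 0] polysD[of "pCons a p" R "Suc i" for i] by (auto simp: polys_def)
  then show ?case using pCons by (auto simp: pcompose_pCons polys_add polys_mult polys_pCons polys_0)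
qed (simp add: polys_0)

lemma poly_in: "p \<in> polys R \<Longrightarrow> x \<in> R \<Longrightarrow> poly p x \<in> R"
  by (auto simp: poly_altdef polys_def intro!: subring_intros[OF R])

lemma polys_const: "a \<in> R \<Longrightarrow> [:a:] \<in> polys R"
  by (simp add: polys_pCons polys_0)

lemma polys_X: "[:0, 1:] \<in> polys R"
  by (simp add: polys_pCons polys_0 subring_0[OF R] subring_1[OF R])

lemmas polys_intros = polys_0 polys_1 polys_add polys_diff polys_uminus polys_smult polys_monom
  polys_pCons polys_mult polys_pderiv polys_power polys_sum polys_prod polys_pcompose polys_const

lemma is_subring_poly_image: "is_subring ((\<lambda>p. poly p x) ` polys R)"
  unfolding is_subring_def
proof (intro conjI ballI)
  show "0 \<in> (\<lambda>p. poly p x) ` polys R" by (rule image_eqI[of _ _ 0]) (auto simp: polys_0)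
  show "1 \<in> (\<lambda>p. poly p x) ` polys R" by (rule image_eqI[of _ _ 1]) (auto simp: polys_1)
  fix a b assume "a \<in> (\<lambda>p. poly p x) ` polys R" "b \<in> (\<lambda>p. poly p x) ` polys R"
  then obtain p q where "p \<in> polys R" "q \<in> polys R" "a = poly p x" "b = poly q x" by auto
  then show "a - b \<in> (\<lambda>p. poly p x) ` polys R" "a * b \<in> (\<lambda>p. poly p x) ` polys R"
    using image_eqI[of "a - b" "\<lambda>p. poly p x" "p - q" "polys R"]
      image_eqI[of "a * b" "\<lambda>p. poly p x" "p * q" "polys R"] by (auto simp: polys_diff polys_mult)
qed

lemma ring_adjoin_singleton: "ring_adjoin R {x} = (\<lambda>p. poly p x) ` polys R" (is "?A = ?B")
proof
  show "?A \<subseteq> ?B"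
  proof (rule ring_adjoin_least[OF is_subring_poly_image])
    show "R \<subseteq> ?B"
    proof
      fix a assume "a \<in> R"
      then show "a \<in> ?B" using image_eqI[of a "\<lambda>p. poly p x" "[:a:]" "polys R"] polys_const by simp
    qed
    show "{x} \<subseteq> ?B"
      using image_eqI[of x "\<lambda>p. poly p x" "[:0, 1:]" "polys R"] polys_X by simp
  qed
  have "polys R \<subseteq> polys ?A" by (intro polys_mono ring_adjoin_base)
  then show "?B \<subseteq> ?A"
    using is_subring_ring_adjoin[of R "{x}"] ring_adjoin_gens[of "{x}" R]
    unfolding image_subset_iff poly_altdef
    by (blast intro: subring_sum subring_mult subring_power polysD)
qed

end

section \<open>Division with remainder, simple extensions and minimal polynomials over a
  subfield\<close>

lemma polys_division:
  fixes E :: "'a::field set"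
  assumes E: "is_subfield E" and "p \<in> polys E" "q \<in> polys E" "q \<noteq> 0"
  shows "\<exists>a b. a \<in> polys E \<and> b \<in> polys E \<and> p = q * a + b \<and> (b = 0 \<or> degree b < degree q)"
  using assms(2)
\<comment> \<open>The measure puts 0 strictly below the nonzero constants, which
  \<open>degree\<close> alone does not; this matters when \<open>p\<close> and \<open>q\<close> are
  both constant.\<close>
proof (induction "if p = 0 then 0 else Suc (degree p)" arbitrary: p rule: less_induct)
  case less
  note I = polys_intros[OF subfield_subring[OF E]]
  show ?case
  proof (cases "p = 0 \<or> degree p < degree q")
    case True
    then show ?thesis using less.prems by (intro exI[of _ 0] exI[of _ p]) (auto simp: I)
  next
    case False
    define m where "m = monom (lead_coeff p / lead_coeff q) (degree p - degree q)"
    define r where "r = p - q * m"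
    have m: "m \<in> polys E" unfolding m_def
      by (intro I subfield_divide[OF E] polysD[OF less.prems] polysD[OF assms(3)])
    have r: "r \<in> polys E" unfolding r_def using m less.prems assms(3) by (intro I)
    have "lead_coeff p / lead_coeff q \<noteq> 0" using False assms(4) by auto
    note nz = this
    then have d: "degree (q * m) = degree p"
      using False assms(4) unfolding m_def by (subst degree_mult_eq) (auto simp: degree_monom_eq)
    have "lead_coeff (q * m) = lead_coeff p"
      using assms(4) unfolding lead_coeff_mult m_def lead_coeff_monom by simp
    then have "coeff r (degree p) = 0" unfolding r_def using d by simp
    moreover have "degree r \<le> degree p" unfolding r_def using d by (intro degree_diff_le) auto
    ultimately have "r = 0 \<or> degree r < degree p"
      by (metis le_neq_implies_less leading_coeff_0_iff)
    then have "(if r = 0 then 0 else Suc (degree r)) < (if p = 0 then 0 else Suc (degree p))"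
      using False by auto
    from less.hyps[OF this r] obtain a b where
      "a \<in> polys E" "b \<in> polys E" "r = q * a + b" "b = 0 \<or> degree b < degree q" by blast
    then show ?thesis using m unfolding r_def
      by (intro exI[of _ "a + m"] exI[of _ b]) (auto simp: I algebra_simps)
  qed
qed

lemma adjoin_singleton:
  assumes E: "is_subfield E"
  shows "adjoin E {x} = {poly p x / poly q x | p q. p \<in> polys E \<and> q \<in> polys E \<and> poly q x \<noteq> 0}"
    (is "_ = ?B")
proof
  note I = polys_intros[OF subfield_subring[OF E]]
  have B: "poly p x / poly q x \<in> ?B" if "p \<in> polys E" "q \<in> polys E" "poly q x \<noteq> 0" for p q
    using that by blast
  have B': "poly p x \<in> ?B" if "p \<in> polys E" for p
    using B[of p 1] that by (simp add: I)
  have "is_subfield ?B"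
    unfolding is_subfield_def is_subring_def
  proof (intro conjI ballI)
    show "0 \<in> ?B" "1 \<in> ?B" using B'[of 0] B'[of 1] by (simp_all add: I)
    fix a assume "a \<in> ?B"
    then obtain p q where a: "a = poly p x / poly q x" "p \<in> polys E" "q \<in> polys E" "poly q x \<noteq> 0" by blast
    show "inverse a \<in> ?B"
      using a B[of q p] B'[of 0] by (cases "poly p x = 0") (simp_all add: I)
    fix b assume "b \<in> ?B"
    then obtain r s where b: "b = poly r x / poly s x" "r \<in> polys E" "s \<in> polys E" "poly s x \<noteq> 0" by blast
    have "a - b = poly (p * s - r * q) x / poly (q * s) x" "a * b = poly (p * r) x / poly (q * s) x"
      using a b by (simp_all add: diff_frac_eq)
    moreover have "poly (q * s) x \<noteq> 0" using a b by simp
    ultimately show "a - b \<in> ?B" "a * b \<in> ?B"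
      using B[of "p * s - r * q" "q * s"] B[of "p * r" "q * s"] a b by (simp_all add: I)
  qed
  moreover have "E \<subseteq> ?B" using B'[of "[:_:]"] by (auto simp: I)
  moreover have "{x} \<subseteq> ?B" using B'[of "[:0, 1:]"] polys_X[OF subfield_subring[OF E]] by simp
  ultimately show "adjoin E {x} \<subseteq> ?B" by (rule adjoin_least)
  show "?B \<subseteq> adjoin E {x}"
    using poly_in[OF subfield_subring[OF is_subfield_adjoin], of _ E "{x}" x]
      polys_mono[OF adjoin_base, of E "{x}"] adjoin_gens[of "{x}" E]
    by (auto intro!: subfield_divide is_subfield_adjoin)
qed

text \<open>Minimality is encoded as divisibility with the quotient again over \<open>E\<close>; the
  comparison of degrees follows in \<open>is_minpoly_degree_le\<close>.\<close>

definition is_minpoly :: "'a::field set \<Rightarrow> 'a \<Rightarrow> 'a poly \<Rightarrow> bool" where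
  "is_minpoly E x \<mu> \<longleftrightarrow> \<mu> \<in> polys E \<and> lead_coeff \<mu> = 1 \<and> poly \<mu> x = 0 \<and>
     (\<forall>p\<in>polys E. poly p x = 0 \<longrightarrow> (\<exists>q\<in>polys E. p = \<mu> * q))"

lemma algebraic_over_iff:
  assumes "is_subfield E"
  shows "algebraic_over E x \<longleftrightarrow> (\<exists>p\<in>polys E. p \<noteq> 0 \<and> poly p x = 0)"
  unfolding algebraic_over_def
  using polys_iff_coeffs[OF subring_0[OF subfield_subring[OF assms]]] by blast

lemma ex_minpoly:
  assumes E: "is_subfield E" and x: "algebraic_over E x"
  shows "\<exists>\<mu>. is_minpoly E x \<mu>"
proof -
  note I = polys_intros[OF subfield_subring[OF E]]
  let ?P = "\<lambda>p. p \<in> polys E \<and> p \<noteq> 0 \<and> poly p x = 0"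
  obtain p0 where "?P p0" using x algebraic_over_iff[OF E] by blast
  then obtain p where p: "?P p" and min: "\<And>q. ?P q \<Longrightarrow> degree p \<le> degree q"
    using ex_has_least_nat[of ?P p0 degree] by blast
  define \<mu> where "\<mu> = smult (inverse (lead_coeff p)) p"
  have \<mu>: "\<mu> \<in> polys E" "lead_coeff \<mu> = 1" "poly \<mu> x = 0" "degree \<mu> = degree p" "\<mu> \<noteq> 0"
    using p unfolding \<mu>_def by (auto simp: I polysD subfield_inverse[OF E])
  have "\<exists>q\<in>polys E. r = \<mu> * q" if r: "r \<in> polys E" "poly r x = 0" for r
  proof -
    obtain a b where ab: "a \<in> polys E" "b \<in> polys E" "r = \<mu> * a + b" "b = 0 \<or> degree b < degree \<mu>"
      using polys_division[OF E r(1) \<mu>(1,5)] by blast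
    then have "b = 0" using r \<mu> min[of b] by force
    then show ?thesis using ab by auto
  qed
  then show ?thesis unfolding is_minpoly_def using \<mu> by blast
qed

lemma is_minpolyD:
  assumes "is_minpoly E x \<mu>"
  shows "\<mu> \<in> polys E" "lead_coeff \<mu> = 1" "poly \<mu> x = 0" "\<mu> \<noteq> 0" "degree \<mu> > 0"
proof -
  show *: "\<mu> \<in> polys E" "lead_coeff \<mu> = 1" "poly \<mu> x = 0" using assms by (auto simp: is_minpoly_def)
  then show "\<mu> \<noteq> 0" by auto
  show "degree \<mu> > 0"
  proof (rule ccontr)
    assume "\<not> degree \<mu> > 0"
    then obtain a where "\<mu> = [:a:]" using degree_eq_zeroE by blast
    with * show False by simp
  qed
qed

lemma is_minpoly_dvd:
  assumes "is_minpoly E x \<mu>" "p \<in> polys E" "poly p x = 0"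
  obtains q where "q \<in> polys E" "p = \<mu> * q"
  using assms by (auto simp: is_minpoly_def)

lemma is_minpoly_degree_le:
  assumes "is_minpoly E x \<mu>" "p \<in> polys E" "poly p x = 0" "p \<noteq> 0"
  shows "degree \<mu> \<le> degree p"
proof -
  obtain q where "q \<in> polys E" "p = \<mu> * q" using is_minpoly_dvd[OF assms(1-3)] .
  then show ?thesis using assms(4) by (auto simp: degree_mult_eq)
qed

subsection \<open>Finite-dimensional subspaces\<close>

text \<open>Vectors are elements of the ambient field and families are indexed, so that powers
  \<open>x ^ i\<close> and products of basis elements can be treated before they are known to be
  distinct; \<open>free_inj_on\<close> supplies that afterwards.\<close>

definition lspan :: "'a::field set \<Rightarrow> 'i set \<Rightarrow> ('i \<Rightarrow> 'a) \<Rightarrow> 'a set" where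
  "lspan E I f = {\<Sum>i\<in>I. c i * f i | c. \<forall>i\<in>I. c i \<in> E}"

definition free :: "'a::field set \<Rightarrow> 'i set \<Rightarrow> ('i \<Rightarrow> 'a) \<Rightarrow> bool" where
  "free E I f \<longleftrightarrow> (\<forall>c. (\<forall>i\<in>I. c i \<in> E) \<and> (\<Sum>i\<in>I. c i * f i) = 0 \<longrightarrow> (\<forall>i\<in>I. c i = 0))"

definition has_dim :: "'a::field set \<Rightarrow> 'a set \<Rightarrow> nat \<Rightarrow> bool" where
  "has_dim E M n \<longleftrightarrow> (\<exists>B. finite B \<and> card B = n \<and> free E B (\<lambda>x. x) \<and> lspan E B (\<lambda>x. x) = M)"

lemma lspanI: "(\<And>i. i \<in> I \<Longrightarrow> c i \<in> E) \<Longrightarrow> (\<Sum>i\<in>I. c i * f i) \<in> lspan E I f"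
  by (auto simp: lspan_def)

lemma lspanE:
  assumes "x \<in> lspan E I f"
  obtains c where "\<And>i. i \<in> I \<Longrightarrow> c i \<in> E" "x = (\<Sum>i\<in>I. c i * f i)"
  using assms by (auto simp: lspan_def)

lemma freeD:
  assumes "free E I f" "\<And>i. i \<in> I \<Longrightarrow> c i \<in> E" "(\<Sum>i\<in>I. c i * f i) = 0" "i \<in> I"
  shows "c i = 0"
  using assms unfolding free_def by blast

lemma freeI:
  assumes "\<And>c i. \<lbrakk>\<And>i. i \<in> I \<Longrightarrow> c i \<in> E; (\<Sum>i\<in>I. c i * f i) = 0; i \<in> I\<rbrakk> \<Longrightarrow> c i = 0"
  shows "free E I f"
  using assms unfolding free_def by blast

lemma not_freeE:
  assumes "\<not> free E I f"
  obtains c i where "\<And>i. i \<in> I \<Longrightarrow> c i \<in> E" "(\<Sum>i\<in>I. c i * f i) = 0" "i \<in> I" "c i \<noteq> 0"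
  using assms unfolding free_def by blast

context
  fixes E :: "'a::field set"
  assumes E: "is_subfield E"
begin

lemma lspan_0: "0 \<in> lspan E I f"
  using lspanI[of I "\<lambda>_. 0" E f] subfield_intros[OF E] by simp

lemma lspan_add: "x \<in> lspan E I f \<Longrightarrow> y \<in> lspan E I f \<Longrightarrow> x + y \<in> lspan E I f"
proof (elim lspanE)
  fix c d assume "\<And>i. i \<in> I \<Longrightarrow> c i \<in> E" "\<And>i. i \<in> I \<Longrightarrow> d i \<in> E"
    "x = (\<Sum>i\<in>I. c i * f i)" "y = (\<Sum>i\<in>I. d i * f i)"
  then show ?thesis using lspanI[of I "\<lambda>i. c i + d i" E f]
    by (simp add: subfield_intros[OF E] ring_distribs sum.distrib)
qed

lemma lspan_scale: "a \<in> E \<Longrightarrow> x \<in> lspan E I f \<Longrightarrow> a * x \<in> lspan E I f"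
proof (elim lspanE)
  fix c assume "a \<in> E" "\<And>i. i \<in> I \<Longrightarrow> c i \<in> E" "x = (\<Sum>i\<in>I. c i * f i)"
  then show ?thesis using lspanI[of I "\<lambda>i. a * c i" E f]
    by (simp add: subfield_intros[OF E] sum_distrib_left mult.assoc)
qed

lemma lspan_diff: "x \<in> lspan E I f \<Longrightarrow> y \<in> lspan E I f \<Longrightarrow> x - y \<in> lspan E I f"
  using lspan_add[of x I f "-1 * y"] lspan_scale[of "-1" y I f] by (simp add: subfield_intros[OF E])

lemma lspan_uminus: "x \<in> lspan E I f \<Longrightarrow> - x \<in> lspan E I f"
  using lspan_diff[OF lspan_0] by fastforce

lemma lspan_sum: "(\<And>j. j \<in> J \<Longrightarrow> x j \<in> lspan E I f) \<Longrightarrow> sum x J \<in> lspan E I f"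
  by (induction J rule: infinite_finite_induct) (auto simp: lspan_0 lspan_add)

lemma lspan_base:
  assumes "finite I" "i \<in> I" shows "f i \<in> lspan E I f"
proof -
  have "(\<Sum>j\<in>I. (if j = i then 1 else 0) * f j) = (\<Sum>j\<in>I. if j = i then f j else 0)"
    by (rule sum.cong) auto
  then show ?thesis using assms lspanI[of I "\<lambda>j. if j = i then 1 else 0" E f]
    by (simp add: subfield_intros[OF E])
qed

lemma lspan_insert:
  assumes "finite I" "i \<notin> I"
  shows "x \<in> lspan E (insert i I) f \<longleftrightarrow> (\<exists>a\<in>E. x - a * f i \<in> lspan E I f)"
proof
  assume "x \<in> lspan E (insert i I) f"
  then show "\<exists>a\<in>E. x - a * f i \<in> lspan E I f"
    using assms by (elim lspanE) (auto intro!: bexI lspanI)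
next
  assume "\<exists>a\<in>E. x - a * f i \<in> lspan E I f"
  then obtain a c where *: "a \<in> E" "\<And>j. j \<in> I \<Longrightarrow> c j \<in> E" "x - a * f i = (\<Sum>j\<in>I. c j * f j)"
    by (auto simp: lspan_def)
  have "(\<Sum>j\<in>I. (c(i := a)) j * f j) = (\<Sum>j\<in>I. c j * f j)"
    using assms by (intro sum.cong) auto
  then have "x = (\<Sum>j\<in>insert i I. (c(i := a)) j * f j)"
    using assms *(3) by (simp add: algebra_simps)
  then show "x \<in> lspan E (insert i I) f"
    using * by (auto simp del: sum.insert intro!: lspanI)
qed

lemma lspan_least:
  assumes "0 \<in> V" "\<And>x y. x \<in> V \<Longrightarrow> y \<in> V \<Longrightarrow> x + y \<in> V" "\<And>a x. a \<in> E \<Longrightarrow> x \<in> V \<Longrightarrow> a * x \<in> V"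
    and "\<And>i. i \<in> I \<Longrightarrow> f i \<in> V"
  shows "lspan E I f \<subseteq> V"
proof
  fix x assume "x \<in> lspan E I f"
  then obtain c where c: "\<And>i. i \<in> I \<Longrightarrow> c i \<in> E" "x = (\<Sum>i\<in>I. c i * f i)" by (auto simp: lspan_def)
  have "(\<Sum>i\<in>I'. c i * f i) \<in> V" if "I' \<subseteq> I" for I'
    using that by (induction I' rule: infinite_finite_induct) (auto simp: assms c)
  then show "x \<in> V" using c by auto
qed

lemma lspan_subset_lspan:
  "(\<And>i. i \<in> I \<Longrightarrow> f i \<in> lspan E J g) \<Longrightarrow> lspan E I f \<subseteq> lspan E J g"
  by (rule lspan_least) (auto simp: lspan_0 lspan_add lspan_scale)

lemma lspan_subset_subring:
  assumes "is_subring M" "E \<subseteq> M" "\<And>i. i \<in> I \<Longrightarrow> f i \<in> M"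
  shows "lspan E I f \<subseteq> M"
  using assms by (intro lspan_least) (auto intro: subring_intros)

text \<open>Elimination of the coordinate along \<open>g j\<close>: if some \<open>f k\<close> has a
  nonzero one, subtracting multiples of \<open>f k\<close> from the other vectors moves them into
  the span of \<open>J\<close>, and one vector less faces one generator less.\<close>

lemma steinitz:
  assumes "finite J" "finite I" "\<And>i. i \<in> I \<Longrightarrow> f i \<in> lspan E J g" "card J < card I"
  shows "\<not> free E I f"
  using assms
proof (induction J arbitrary: I f rule: finite_induct)
  case empty
  then obtain i where "i \<in> I" by (metis card.empty ex_in_conv not_less_zero)
  moreover have "f j = 0" if "j \<in> I" for j using empty that by (auto simp: lspan_def)
  ultimately show ?case
    using freeD[of E I f "\<lambda>_. 1" i] subfield_intros(2)[OF E] by auto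
next
  case (insert j J)
  have "\<forall>i\<in>I. \<exists>a\<in>E. f i - a * g j \<in> lspan E J g"
    using insert.prems(2) lspan_insert[OF insert.hyps(1,2)] by blast
  then obtain a where a: "\<And>i. i \<in> I \<Longrightarrow> a i \<in> E" "\<And>i. i \<in> I \<Longrightarrow> f i - a i * g j \<in> lspan E J g" by metis
  show ?case
  proof (cases "\<forall>i\<in>I. a i = 0")
    case True
    then have "f i \<in> lspan E J g" if "i \<in> I" for i using a(2)[OF that] that by simp
    then show ?thesis using insert by (intro insert.IH) auto
  next
    case False
    then obtain k where k: "k \<in> I" "a k \<noteq> 0" by blast
    let ?I = "I - {k}"
    define h where "h i = f i - (a i / a k) * f k" for i
    have "h i \<in> lspan E J g" if "i \<in> ?I" for i
    proof -
      have "h i = (f i - a i * g j) - (a i / a k) * (f k - a k * g j)"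
        unfolding h_def using k by (simp add: algebra_simps)
      moreover have "(f i - a i * g j) - (a i / a k) * (f k - a k * g j) \<in> lspan E J g" using that k a
        by (intro lspan_diff[of "f i - a i * g j"] lspan_scale[of "a i / a k"] subfield_divide[OF E]) auto
      ultimately show ?thesis by simp
    qed
    moreover have "card J < card ?I" using insert.prems insert.hyps k by simp
    ultimately have "\<not> free E ?I h" using insert.IH[of ?I h] insert.prems(1) by simp
    then obtain c i where c: "\<And>i. i \<in> ?I \<Longrightarrow> c i \<in> E" "(\<Sum>i\<in>?I. c i * h i) = 0" "i \<in> ?I" "c i \<noteq> 0"
      by (elim not_freeE) auto
    \<comment> \<open>The relation among the \<open>h i\<close> becomes one among the
      \<open>f i\<close>; the coefficient at \<open>k\<close> collects the subtracted multiples of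
      \<open>f k\<close>.\<close>
    define d where "d = c(k := - (\<Sum>i\<in>?I. c i * (a i / a k)))"
    have "(\<Sum>i\<in>I. d i * f i) = d k * f k + (\<Sum>i\<in>?I. d i * f i)"
      using insert.prems(1) k(1) by (simp add: sum.remove)
    also have "(\<Sum>i\<in>?I. d i * f i) = (\<Sum>i\<in>?I. c i * f i)" by (rule sum.cong) (auto simp: d_def)
    also have "d k * f k = - (\<Sum>i\<in>?I. c i * ((a i / a k) * f k))"
      by (simp add: d_def sum_distrib_right mult.assoc)
    also have "- (\<Sum>i\<in>?I. c i * ((a i / a k) * f k)) + (\<Sum>i\<in>?I. c i * f i) = (\<Sum>i\<in>?I. c i * h i)"
      by (simp add: h_def sum_subtractf right_diff_distrib)
    finally have "(\<Sum>i\<in>I. d i * f i) = 0" using c by simp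
    moreover have "d l \<in> E" if "l \<in> I" for l
      using that c a k unfolding d_def by (auto intro!: subfield_intros[OF E])
    moreover have "d i \<noteq> 0" "i \<in> I" using c by (auto simp: d_def)
    ultimately show ?thesis using freeD[of E I f d i] by blast
  qed
qed

lemma card_le_if_free_span:
  assumes "finite J" "finite I" "free E I f" "f ` I \<subseteq> lspan E J g"
  shows "card I \<le> card J"
proof (rule ccontr)
  assume "\<not> card I \<le> card J"
  then show False using steinitz[of J I f g] assms by (simp add: image_subset_iff)
qed

lemma free_insert:
  assumes "finite I" "i \<notin> I" "free E I f" "f i \<notin> lspan E I f"
  shows "free E (insert i I) f"
proof (rule freeI)
  fix c k assume c: "\<And>j. j \<in> insert i I \<Longrightarrow> c j \<in> E" "(\<Sum>j\<in>insert i I. c j * f j) = 0" "k \<in> insert i I"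
  have eq: "c i * f i + (\<Sum>j\<in>I. c j * f j) = 0" using c assms by simp
  have "c i = 0"
  proof (rule ccontr)
    assume n: "c i \<noteq> 0"
    have "f i = (- inverse (c i)) * (\<Sum>j\<in>I. c j * f j)"
      using eq n by (simp add: field_simps eq_neg_iff_add_eq_0)
    then have "f i \<in> lspan E I f"
      using c by (auto intro!: lspan_uminus lspan_scale lspanI subfield_intros[OF E])
    then show False using assms by blast
  qed
  moreover from this have "c j = 0" if "j \<in> I" for j
    using eq c(1) that by (intro freeD[OF assms(3), of c]) simp_all
  ultimately show "c k = 0" using c(3) by blast
qed

lemma free_inj_on:
  assumes "finite I" "free E I f" shows "inj_on f I"
proof (rule inj_onI, rule ccontr)
  fix i j assume ij: "i \<in> I" "j \<in> I" "f i = f j" "i \<noteq> j"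
  define c :: "'b \<Rightarrow> 'a" where "c = (\<lambda>k. if k = i then 1 else if k = j then -1 else 0)"
  have "(\<Sum>k\<in>I. c k * f k) = (\<Sum>k\<in>{i, j}. c k * f k)"
    using ij assms(1) by (intro sum.mono_neutral_right) (auto simp: c_def)
  also have "\<dots> = 0" using ij by (simp add: c_def)
  finally have "(\<Sum>k\<in>I. c k * f k) = 0" .
  moreover have "c k \<in> E" for k using subfield_intros(1,2,5)[OF E] by (auto simp: c_def)
  ultimately have "c i = 0" using freeD[OF assms(2), of c] ij(1) by blast
  then show False by (simp add: c_def)
qed

lemma has_dimI:
  assumes "finite I" "free E I f" "lspan E I f = M"
  shows "has_dim E M (card I)"
  unfolding has_dim_def
proof (intro exI[of _ "f ` I"] conjI)
  have inj: "inj_on f I" using assms free_inj_on by blast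
  show "finite (f ` I)" "card (f ` I) = card I" using assms inj by (auto simp: card_image)
  have *: "(\<Sum>x\<in>f ` I. c x * x) = (\<Sum>i\<in>I. c (f i) * f i)" for c
    using inj by (simp add: sum.reindex)
  show "free E (f ` I) (\<lambda>x. x)"
  proof (rule freeI)
    fix c y assume c: "\<And>x. x \<in> f ` I \<Longrightarrow> c x \<in> E" "(\<Sum>x\<in>f ` I. c x * x) = 0" "y \<in> f ` I"
    then obtain k where "k \<in> I" "y = f k" by blast
    then show "c y = 0" using freeD[OF assms(2), of "\<lambda>i. c (f i)" k] c(1) c(2)[unfolded *] by simp
  qed
  show "lspan E (f ` I) (\<lambda>x. x) = M"
  proof
    show "lspan E (f ` I) (\<lambda>x. x) \<subseteq> M"
      unfolding assms(3)[symmetric]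
      using assms(1) by (intro lspan_least lspan_0 lspan_add lspan_scale) (auto intro: lspan_base)
    show "M \<subseteq> lspan E (f ` I) (\<lambda>x. x)"
      unfolding assms(3)[symmetric]
      using assms(1) lspan_base[of "f ` I" _ "\<lambda>x. x"] by (intro lspan_subset_lspan) auto
  qed
qed

lemma has_dim_le:
  assumes "has_dim E M m" "has_dim E M n"
  shows "m \<le> n"
proof -
  obtain A where A: "finite A" "card A = m" "free E A (\<lambda>x. x)" "lspan E A (\<lambda>x. x) = M"
    using assms(1) unfolding has_dim_def by blast
  obtain B where B: "finite B" "card B = n" "lspan E B (\<lambda>x. x) = M"
    using assms(2) unfolding has_dim_def by blast
  have "A \<subseteq> M" using lspan_base[OF A(1), of _ "\<lambda>x. x"] A(4) by blast
  then have "(\<lambda>x. x) ` A \<subseteq> lspan E B (\<lambda>x. x)" using B(3) by simp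
  from card_le_if_free_span[OF B(1) A(1,3) this] show ?thesis using A(2) B(2) by simp
qed

lemma has_dim_unique: "has_dim E M m \<Longrightarrow> has_dim E M n \<Longrightarrow> m = n"
  by (intro le_antisym has_dim_le)

lemma ex_dim:
  assumes "finite I"
  shows "\<exists>n\<le>card I. has_dim E (lspan E I f) n"
proof -
  have "\<exists>J\<subseteq>I. free E J f \<and> lspan E J f = lspan E I f"
    using assms
  proof (induction I)
    case empty
    show ?case by (auto simp: free_def)
  next
    case (insert i I)
    then obtain J where J: "J \<subseteq> I" "free E J f" "lspan E J f = lspan E I f" by blast
    have fJ: "finite J" and iJ: "i \<notin> J" using J insert by (auto dest: finite_subset)
    have ins: "lspan E (insert i J) f = lspan E (insert i I) f"
      using lspan_insert[OF insert.hyps, of _ f] lspan_insert[OF fJ iJ, of _ f] J(3) by auto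
    show ?case
    proof (cases "f i \<in> lspan E J f")
      case True
      then have "lspan E (insert i J) f = lspan E J f"
        using fJ by (intro equalityI lspan_subset_lspan) (auto intro: lspan_base)
      then show ?thesis using J ins by auto
    next
      case False
      then show ?thesis using free_insert[OF fJ iJ J(2)] ins J by blast
    qed
  qed
  then obtain J where J: "J \<subseteq> I" "free E J f" "lspan E J f = lspan E I f" by blast
  have "has_dim E (lspan E I f) (card J)"
    using J assms by (intro has_dimI[of J f]) (auto dest: finite_subset)
  then show ?thesis using card_mono[OF assms J(1)] by (intro exI[of _ "card J"]) simp
qed

lemma free_dim_spans:
  assumes "has_dim E M n" "finite I" "free E I f" "f ` I \<subseteq> M" "card I = n"
  shows "lspan E I f = M"
proof -
  obtain B where B: "finite B" "card B = n" "free E B (\<lambda>x. x)" "lspan E B (\<lambda>x. x) = M"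
    using assms(1) unfolding has_dim_def by blast
  show ?thesis
  proof (intro equalityI subsetI)
    fix x assume "x \<in> lspan E I f"
    moreover have "lspan E I f \<subseteq> lspan E B (\<lambda>x. x)"
      by (rule lspan_subset_lspan) (use B(4) assms(4) in blast)
    ultimately show "x \<in> M" using B(4) by blast
  next
    fix x assume x: "x \<in> M"
    show "x \<in> lspan E I f"
    proof (rule ccontr)
      assume n: "x \<notin> lspan E I f"
      \<comment> \<open>The index type need not have a spare element for the additional vector,
        hence the indices \<open>Some i\<close> and the new index \<open>None\<close>.\<close>
      let ?f = "\<lambda>z. case z of None \<Rightarrow> x | Some i \<Rightarrow> f i"
      have fr: "free E (Some ` I) ?f"
      proof (rule freeI)
        fix c k assume c: "\<And>i. i \<in> Some ` I \<Longrightarrow> c i \<in> E" "(\<Sum>i\<in>Some ` I. c i * ?f i) = 0" "k \<in> Some ` I"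
        then obtain i where "i \<in> I" "k = Some i" by blast
        then show "c k = 0" using freeD[OF assms(3), of "\<lambda>i. c (Some i)" i] c(1,2)
          by (simp add: sum.reindex)
      qed
      have sp: "lspan E (Some ` I) ?f = lspan E I f"
        using assms(2) lspan_base[of I _ f] lspan_base[of "Some ` I" _ ?f]
        by (intro equalityI lspan_subset_lspan) force+
      have "free E (insert None (Some ` I)) ?f"
        using assms(2) n sp by (intro free_insert fr) auto
      then have "card (insert None (Some ` I)) \<le> card B"
        using B x assms by (intro card_le_if_free_span[where f="?f" and g="\<lambda>x. x"]) auto
      moreover have "card (insert None (Some ` I)) = Suc n"
        using assms by (subst card_insert_disjoint) (auto simp: card_image)
      ultimately show False using B by simp
    qed
  qed
qed

end

section \<open>Degrees of field extensions\<close>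

lemma has_dim_tower:
  assumes E: "is_subfield E" and M: "is_subfield M" and "E \<subseteq> M" "has_dim E M m" "has_dim M N n"
  shows "has_dim E N (m * n)"
proof -
  obtain B where B: "finite B" "card B = m" "free E B (\<lambda>x. x)" "lspan E B (\<lambda>x. x) = M"
    using assms(4) unfolding has_dim_def by blast
  obtain C where C: "finite C" "card C = n" "free M C (\<lambda>x. x)" "lspan M C (\<lambda>x. x) = N"
    using assms(5) unfolding has_dim_def by blast
  let ?f = "\<lambda>z. fst z * snd z"
  have eq: "(\<Sum>z\<in>B \<times> C. d z * ?f z) = (\<Sum>y\<in>C. (\<Sum>x\<in>B. d (x, y) * x) * y)" for d
    unfolding sum_distrib_right
    by (subst sum.swap) (simp add: sum.cartesian_product mult.assoc split_beta)
  have BM: "B \<subseteq> M" using B lspan_base[OF E B(1), of _ "\<lambda>x. x"] by auto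
  have "free E (B \<times> C) ?f"
  proof (rule freeI)
    fix d z assume d: "\<And>z. z \<in> B \<times> C \<Longrightarrow> d z \<in> E" "(\<Sum>z\<in>B \<times> C. d z * ?f z) = 0" "z \<in> B \<times> C"
    have "(\<Sum>x\<in>B. d (x, y) * x) = 0" if "y \<in> C" for y
      using d BM assms(3) that
      by (intro freeD[OF C(3), of "\<lambda>y. \<Sum>x\<in>B. d (x, y) * x"] subfield_intros[OF M]) (auto simp: eq)
    then show "d z = 0" using freeD[OF B(3), of "\<lambda>x. d (x, snd z)"] d by force
  qed
  moreover have "lspan E (B \<times> C) ?f = N"
  proof
    show "lspan E (B \<times> C) ?f \<subseteq> N"
      unfolding C(4)[symmetric] using BM lspan_base[OF M C(1), of _ "\<lambda>x. x"] assms(3)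
      by (intro lspan_least[OF E] lspan_0[OF M] lspan_add[OF M]) (auto intro!: lspan_scale[OF M])
    show "N \<subseteq> lspan E (B \<times> C) ?f"
    proof
      fix x assume "x \<in> N"
      then obtain c where c: "\<And>y. y \<in> C \<Longrightarrow> c y \<in> M" "x = (\<Sum>y\<in>C. c y * y)" using C(4) by (auto simp: lspan_def)
      then have "\<forall>y\<in>C. \<exists>e. (\<forall>x\<in>B. e x \<in> E) \<and> c y = (\<Sum>x\<in>B. e x * x)"
        unfolding B(4)[symmetric] lspan_def by auto
      then obtain e where e: "\<And>y. y \<in> C \<Longrightarrow> (\<forall>x\<in>B. e y x \<in> E) \<and> c y = (\<Sum>x\<in>B. e y x * x)" by metis
      have "x = (\<Sum>z\<in>B \<times> C. e (snd z) (fst z) * ?f z)" unfolding c(2) eq using e by simp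
      then show "x \<in> lspan E (B \<times> C) ?f" using e by (auto intro!: lspanI)
    qed
  qed
  ultimately show ?thesis
    using has_dimI[OF E, of "B \<times> C" ?f N] B C by (simp add: card_cartesian_product)
qed

lemma algebraic_mono: "E \<subseteq> M \<Longrightarrow> algebraic_over E x \<Longrightarrow> algebraic_over M x"
  unfolding algebraic_over_def by blast

lemma algebraic_in: "is_subfield E \<Longrightarrow> x \<in> E \<Longrightarrow> algebraic_over E x"
  by (subst algebraic_over_iff, assumption, rule bexI[of _ "[:-x, 1:]"])
    (auto intro!: polys_pCons polys_0 subfield_subring subfield_intros)

lemma has_dim_algebraic:
  assumes E: "is_subfield E" and M: "is_subring M" and "has_dim E M n" "x \<in> M"
  shows "algebraic_over E x"
proof -
  obtain B where B: "finite B" "lspan E B (\<lambda>x. x) = M" "card B = n"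
    using assms(3) unfolding has_dim_def by blast
  have "\<not> free E {..n} (\<lambda>i. x ^ i)"
    using B(2,3) subring_power[OF M assms(4)]
    by (intro steinitz[OF E B(1), where g="\<lambda>x. x"]) auto
  then obtain c i where c: "\<And>i. i \<le> n \<Longrightarrow> c i \<in> E" "(\<Sum>i\<le>n. c i * x ^ i) = 0" "i \<le> n" "c i \<noteq> 0"
    by (elim not_freeE) auto
  define p where "p = (\<Sum>i\<le>n. monom (c i) i)"
  have co: "coeff p j = (if j \<le> n then c j else 0)" for j
    by (simp add: p_def coeff_sum)
  have "p \<in> polys E" using c subfield_intros(1)[OF E] by (auto simp: polys_def co)
  moreover have "p \<noteq> 0" using co[of i] c by auto
  moreover have "poly p x = 0" using c by (simp add: p_def poly_sum poly_monom)
  ultimately show ?thesis using algebraic_over_iff[OF E] by blast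
qed

text \<open>The minimal polynomial of x \<noteq> 0 has constant term a \<noteq> 0, since otherwise
  division by X would give an equation of smaller degree; writing it as a + X q, the inverse of x is
  -q(x)/a.\<close>

lemma subring_algebraic_subfield:
  assumes E: "is_subfield E" and M: "is_subring M" "E \<subseteq> M" "\<And>x. x \<in> M \<Longrightarrow> algebraic_over E x"
  shows "is_subfield M"
  unfolding is_subfield_def
proof (intro conjI ballI M(1))
  fix x assume x: "x \<in> M"
  show "inverse x \<in> M"
  proof (cases "x = 0")
    case False
    obtain \<mu> where \<mu>: "is_minpoly E x \<mu>" using ex_minpoly[OF E M(3)[OF x]] by blast
    note d = is_minpolyD[OF \<mu>]
    obtain a q where \<mu>_eq: "\<mu> = pCons a q" by (cases \<mu>)
    have a: "a \<in> E" using polysD[OF d(1), of 0] by (simp add: \<mu>_eq)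
    have q: "q \<in> polys E" using polysD[OF d(1), of "Suc i" for i] by (simp add: \<mu>_eq polys_def)
    have "a \<noteq> 0"
    proof
      assume "a = 0"
      then have "poly q x = 0" using d(3) False by (simp add: \<mu>_eq)
      moreover have "q \<noteq> 0" using d(4) \<open>a = 0\<close> by (auto simp: \<mu>_eq)
      ultimately have "degree \<mu> \<le> degree q" using is_minpoly_degree_le[OF \<mu> q] by blast
      then show False using \<open>q \<noteq> 0\<close> by (simp add: \<mu>_eq)
    qed
    have "a + x * poly q x = 0" using d(3) by (simp add: \<mu>_eq)
    then have "x * (- (poly q x) / a) = 1" using \<open>a \<noteq> 0\<close>
      by (simp add: field_simps add_eq_0_iff)
    then have "inverse x = - (poly q x) / a" by (metis inverse_unique)
    also have "\<dots> = inverse a * - poly q x" by (simp add: divide_inverse)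
    also have "\<dots> \<in> M"
      using M(2) subfield_inverse[OF E a] poly_in[OF M(1) subsetD[OF polys_mono[OF M(2)] q] x]
      by (intro subring_mult[OF M(1)] subring_uminus[OF M(1)]) auto
    finally show ?thesis .
  qed (use subring_0[OF M(1)] in simp)
qed

lemma lspan_minpoly:
  assumes E: "is_subfield E" and \<mu>: "is_minpoly E x \<mu>"
  shows "lspan E {..<degree \<mu>} (\<lambda>i. x ^ i) = (\<lambda>p. poly p x) ` polys E"
    and "free E {..<degree \<mu>} (\<lambda>i. x ^ i)"
proof -
  note I = polys_intros[OF subfield_subring[OF E]]
  note d = is_minpolyD[OF \<mu>]
  define pl where "pl c = (\<Sum>i<degree \<mu>. monom (c i) i)" for c :: "nat \<Rightarrow> 'a"
  have pl: "pl c \<in> polys E" if "\<And>i. i < degree \<mu> \<Longrightarrow> c i \<in> E" for c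
    unfolding pl_def using that by (auto intro!: I)
  have ev: "poly (pl c) x = (\<Sum>i<degree \<mu>. c i * x ^ i)" for c
    by (simp add: pl_def poly_sum poly_monom)
  have co: "coeff (pl c) i = (if i < degree \<mu> then c i else 0)" for c i
    by (simp add: pl_def coeff_sum)
  show "lspan E {..<degree \<mu>} (\<lambda>i. x ^ i) = (\<lambda>p. poly p x) ` polys E"
  proof (intro equalityI subsetI)
    fix y assume "y \<in> lspan E {..<degree \<mu>} (\<lambda>i. x ^ i)"
    then obtain c where "\<And>i. i < degree \<mu> \<Longrightarrow> c i \<in> E" "y = (\<Sum>i<degree \<mu>. c i * x ^ i)"
      by (elim lspanE) auto
    then show "y \<in> (\<lambda>p. poly p x) ` polys E" using pl ev by (intro image_eqI[of _ _ "pl c"]) auto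
  next
    fix y assume "y \<in> (\<lambda>p. poly p x) ` polys E"
    then obtain p where p: "p \<in> polys E" "y = poly p x" by blast
    obtain a b where ab: "a \<in> polys E" "b \<in> polys E" "p = \<mu> * a + b" "b = 0 \<or> degree b < degree \<mu>"
      using polys_division[OF E p(1) d(1,4)] by blast
    have "y = poly b x" using p ab d by simp
    also have "\<dots> = (\<Sum>i<degree \<mu>. coeff b i * x ^ i)"
      unfolding poly_altdef using ab(4) d(5) by (intro sum.mono_neutral_left) (auto simp: coeff_eq_0)
    finally show "y \<in> lspan E {..<degree \<mu>} (\<lambda>i. x ^ i)" using polysD[OF ab(2)] by (simp add: lspanI)
  qed
  show "free E {..<degree \<mu>} (\<lambda>i. x ^ i)"
  proof (rule freeI)
    fix c i assume c: "\<And>i. i \<in> {..<degree \<mu>} \<Longrightarrow> c i \<in> E" "(\<Sum>i<degree \<mu>. c i * x ^ i) = 0" "i \<in> {..<degree \<mu>}"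
    have "pl c = 0"
    proof (rule ccontr)
      assume n: "pl c \<noteq> 0"
      have "degree (pl c) < degree \<mu>"
        using d(5) by (intro degree_lessI) (auto simp: co)
      moreover have "degree \<mu> \<le> degree (pl c)"
        using is_minpoly_degree_le[OF \<mu> pl _ n] c ev by simp
      ultimately show False by simp
    qed
    then show "c i = 0" using co[of c i] c(3) by simp
  qed
qed

lemma adjoin_algebraic:
  assumes E: "is_subfield E" and \<mu>: "is_minpoly E x \<mu>"
  shows "adjoin E {x} = (\<lambda>p. poly p x) ` polys E" and "has_dim E (adjoin E {x}) (degree \<mu>)"
proof -
  let ?M = "(\<lambda>p. poly p x) ` polys E"
  have M: "is_subring ?M" using is_subring_poly_image[OF subfield_subring[OF E]] .
  have dim: "has_dim E ?M (degree \<mu>)"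
    using has_dimI[OF E _ lspan_minpoly(2,1)[OF assms]] by simp
  have EM: "E \<subseteq> ?M"
  proof
    fix a assume "a \<in> E"
    then show "a \<in> ?M" using image_eqI[of a "\<lambda>p. poly p x" "[:a:]"] polys_const[OF subfield_subring[OF E]] by simp
  qed
  have xM: "x \<in> ?M"
    using image_eqI[of x "\<lambda>p. poly p x" "[:0, 1:]"] polys_X[OF subfield_subring[OF E]] by simp
  have "is_subfield ?M"
    using subring_algebraic_subfield[OF E M EM has_dim_algebraic[OF E M dim]] .
  then have "adjoin E {x} \<subseteq> ?M" using adjoin_least EM xM by blast
  moreover have "?M \<subseteq> adjoin E {x}"
    using ring_adjoin_singleton[OF subfield_subring[OF E]] ring_adjoin_subset_adjoin[of E "{x}"] by auto
  ultimately show eq: "adjoin E {x} = ?M" by auto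
  show "has_dim E (adjoin E {x}) (degree \<mu>)" unfolding eq by (rule dim)
qed

lemma has_dim_1: "is_subfield E \<Longrightarrow> has_dim E E 1"
proof -
  assume E: "is_subfield E"
  have "lspan E {1} (\<lambda>x. x) = E" by (auto simp: lspan_def)
  moreover have "free E {1} (\<lambda>x. x)" by (auto simp: free_def)
  ultimately show ?thesis using has_dimI[OF E, of "{1}" "\<lambda>x. x" E] by simp
qed

lemma has_dim_pos: "has_dim E M n \<Longrightarrow> 1 \<in> M \<Longrightarrow> n > 0"
  unfolding has_dim_def by (auto simp: lspan_def card_gt_0_iff)

lemma finite_adjoin_algebraic:
  assumes E: "is_subfield E" and "finite S" "\<And>x. x \<in> S \<Longrightarrow> algebraic_over E x"
  shows "\<exists>n. has_dim E (adjoin E S) n"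
  using assms(2,3)
proof (induction S)
  case empty
  then show ?case using has_dim_1[OF E] adjoin_absorb[OF E, of "{}"] by auto
next
  case (insert x S)
  then obtain n where n: "has_dim E (adjoin E S) n" by blast
  have "algebraic_over (adjoin E S) x"
    using insert.prems algebraic_mono[OF adjoin_base] by blast
  then obtain \<mu> where "is_minpoly (adjoin E S) x \<mu>" using ex_minpoly is_subfield_adjoin by blast
  then have "has_dim (adjoin E S) (adjoin (adjoin E S) {x}) (degree \<mu>)"
    using adjoin_algebraic(2) is_subfield_adjoin by blast
  moreover have "adjoin (adjoin E S) {x} = adjoin E (insert x S)" by (simp add: adjoin_adjoin)
  ultimately show ?case using has_dim_tower[OF E is_subfield_adjoin adjoin_base n] by metis
qed

lemma finite_ext_subfield_algebraic:
  assumes E: "is_subfield E" and M: "is_subring M" "E \<subseteq> M" "has_dim E M n"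
  shows "is_subfield M"
  using subring_algebraic_subfield[OF E M(1,2)] has_dim_algebraic[OF E M(1,3)] by blast

lemma adjoin_singleton_degree_dvd:
  assumes E: "is_subfield E" and M: "is_subfield M" "E \<subseteq> M" "has_dim E M n" "x \<in> M"
  obtains m r where "has_dim E (adjoin E {x}) m" "has_dim (adjoin E {x}) M r" "n = m * r" "m > 0" "r > 0"
proof -
  have "algebraic_over E x" using has_dim_algebraic[OF E subfield_subring[OF M(1)] M(3,4)] .
  then obtain \<mu> where "is_minpoly E x \<mu>" using ex_minpoly[OF E] by blast
  then have m: "has_dim E (adjoin E {x}) (degree \<mu>)" using adjoin_algebraic(2)[OF E] by blast
  have sub: "adjoin E {x} \<subseteq> M" using adjoin_least[OF M(1,2), of "{x}"] M(4) by simp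
  obtain B where B: "finite B" "lspan E B (\<lambda>x. x) = M" using M(3) unfolding has_dim_def by blast
  have BM: "B \<subseteq> M" using lspan_base[OF E B(1), of _ "\<lambda>x. x"] B(2) by blast
  have "lspan (adjoin E {x}) B (\<lambda>x. x) = M"
  proof
    show "lspan (adjoin E {x}) B (\<lambda>x. x) \<subseteq> M"
      using BM sub by (intro lspan_subset_subring[OF is_subfield_adjoin subfield_subring[OF M(1)]]) auto
    show "M \<subseteq> lspan (adjoin E {x}) B (\<lambda>x. x)"
      unfolding B(2)[symmetric] lspan_def using adjoin_base[of E "{x}"] by blast
  qed
  then obtain r where r: "has_dim (adjoin E {x}) M r"
    using ex_dim[OF is_subfield_adjoin B(1), of E "{x}" "\<lambda>x. x"] by auto
  have "has_dim E M (degree \<mu> * r)" using has_dim_tower[OF E is_subfield_adjoin adjoin_base m r] .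
  then have "n = degree \<mu> * r" using has_dim_unique[OF E M(3)] by blast
  then show ?thesis using that m r has_dim_pos[OF M(3)] subfield_intros(2)[OF M(1)] by auto
qed

subsection \<open>Positive characteristic\<close>

definition frob :: "'a::field set \<Rightarrow> 'a set" where
  "frob E = (\<lambda>x. x ^ CHAR('a)) ` E"

context
  fixes p :: nat
  assumes p: "p = CHAR('a::field)" "p > 0"
begin

lemma prime_p: "prime p" using p prime_CHAR_semidom by blast

lemma frob_add: "(x + y :: 'a) ^ p = x ^ p + y ^ p"
  using freshmans_dream prime_p p by blast

lemma frob_diff: "(x - y :: 'a) ^ p = x ^ p - y ^ p"
  using frob_add[of "x - y" y] by (simp add: algebra_simps)

lemma frob_sum: "(\<Sum>i\<in>I. f i :: 'a) ^ p = (\<Sum>i\<in>I. f i ^ p)"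
  using freshmans_dream_sum[of p f I] prime_p p by simp

lemma frob_inj: "(x :: 'a) ^ p = y ^ p \<Longrightarrow> x = y"
  using frob_diff[of x y] p by auto

lemma frobI: "(x::'a) \<in> E \<Longrightarrow> x ^ p \<in> frob E" by (auto simp: frob_def p)

lemma frobE:
  assumes "(y::'a) \<in> frob E" obtains x where "x \<in> E" "y = x ^ p"
  using assms by (auto simp: frob_def p)

lemma frob_subset: "is_subring (E :: 'a set) \<Longrightarrow> frob E \<subseteq> E"
  by (auto simp: frob_def intro: subring_power)

lemma frob_mono: "E \<subseteq> M \<Longrightarrow> frob (E :: 'a set) \<subseteq> frob M"
  by (auto simp: frob_def)

lemma is_subfield_frob:
  assumes E: "is_subfield (E :: 'a set)" shows "is_subfield (frob E)"
  unfolding is_subfield_def is_subring_def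
proof (intro conjI ballI)
  show "0 \<in> frob E" using frobI[of 0 E] subfield_intros(1)[OF E] p by (simp add: power_0_left)
  show "1 \<in> frob E" using frobI[of 1 E] subfield_intros(2)[OF E] by simp
  fix x assume "x \<in> frob E"
  then obtain a where a: "a \<in> E" "x = a ^ p" by (elim frobE)
  show "inverse x \<in> frob E" using a frobI[of "inverse a"] subfield_inverse[OF E] by (simp add: power_inverse)
  fix y assume "y \<in> frob E"
  then obtain b where b: "b \<in> E" "y = b ^ p" by (elim frobE)
  show "x - y \<in> frob E" "x * y \<in> frob E"
    using a b frobI[of "a - b" E] frobI[of "a * b" E] subfield_intros(3,4)[OF E]
    by (simp_all add: frob_diff power_mult_distrib)
qed

text \<open>The Frobenius is additive, multiplicative and injective, so it carries a basis of M over
  E to a basis of M^p over E^p.\<close>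

lemma frob_has_dim:
  assumes "has_dim (E :: 'a set) M n" and E: "is_subfield E"
  shows "has_dim (frob E) (frob M) n"
proof -
  obtain B where B: "finite B" "card B = n" "free E B (\<lambda>x. x)" "lspan E B (\<lambda>x. x) = M"
    using assms(1) unfolding has_dim_def by blast
  have "free (frob E) B (\<lambda>x. x ^ p)"
  proof (rule freeI)
    fix c i assume c: "\<And>i. i \<in> B \<Longrightarrow> c i \<in> frob E" "(\<Sum>i\<in>B. c i * i ^ p) = 0" "i \<in> B"
    then have "\<forall>i\<in>B. \<exists>d\<in>E. c i = d ^ p" by (metis frobE)
    then obtain d where d: "\<And>i. i \<in> B \<Longrightarrow> d i \<in> E \<and> c i = d i ^ p" by metis
    have "(\<Sum>i\<in>B. d i * i) ^ p = (\<Sum>i\<in>B. c i * i ^ p)"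
      using d by (simp add: frob_sum power_mult_distrib)
    then have "(\<Sum>i\<in>B. d i * i) = 0" using c(2) by simp
    then show "c i = 0" using freeD[OF B(3), of d i] d c(3) p by (simp add: power_0_left)
  qed
  moreover have "lspan (frob E) B (\<lambda>x. x ^ p) = frob M"
  proof (intro equalityI subsetI)
    fix x assume "x \<in> lspan (frob E) B (\<lambda>x. x ^ p)"
    then obtain c where c: "\<And>i. i \<in> B \<Longrightarrow> c i \<in> frob E" "x = (\<Sum>i\<in>B. c i * i ^ p)" by (auto simp: lspan_def)
    then have "\<forall>i\<in>B. \<exists>d\<in>E. c i = d ^ p" by (metis frobE)
    then obtain d where d: "\<And>i. i \<in> B \<Longrightarrow> d i \<in> E \<and> c i = d i ^ p" by metis
    have "x = (\<Sum>i\<in>B. d i * i) ^ p" using c d by (simp add: frob_sum power_mult_distrib)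
    moreover have "(\<Sum>i\<in>B. d i * i) \<in> M" using d B(4) by (auto simp: lspan_def)
    ultimately show "x \<in> frob M" using frobI by simp
  next
    fix x assume "x \<in> frob M"
    then obtain y where y: "y \<in> M" "x = y ^ p" by (elim frobE)
    then obtain c where c: "\<And>i. i \<in> B \<Longrightarrow> c i \<in> E" "y = (\<Sum>i\<in>B. c i * i)" using B(4) by (auto simp: lspan_def)
    have "x = (\<Sum>i\<in>B. c i ^ p * i ^ p)" using c y by (simp add: frob_sum power_mult_distrib)
    then show "x \<in> lspan (frob E) B (\<lambda>x. x ^ p)" using c frobI by (auto intro!: lspanI)
  qed
  ultimately show ?thesis
    using has_dimI[OF is_subfield_frob[OF E] B(1)] B(2) by blast
qed

end

text \<open>A zero derivative kills every coefficient whose index is prime to p, so \<mu> is h in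
  X^p. Because of the bound on \<open>degree h\<close>, the element x^p has degree at most deg \<mu>
  / p whenever x is a root of \<mu> \<noteq> 0.\<close>

lemma pderiv_0_poly:
  fixes \<mu> :: "'a::field poly"
  assumes E: "is_subring E" and p: "p = CHAR('a)" "p > 0" and "\<mu> \<in> polys E" "pderiv \<mu> = 0"
  obtains h where "h \<in> polys E" "\<And>x. poly h (x ^ p) = poly \<mu> x" "degree h * p \<le> degree \<mu>"
    "\<mu> \<noteq> 0 \<Longrightarrow> h \<noteq> 0"
proof
  define h where "h = (\<Sum>i\<le>degree \<mu>. monom (coeff \<mu> (p * i)) i)"
  have co: "coeff h i = coeff \<mu> (p * i)" for i
  proof (cases "i \<le> degree \<mu>")
    case False
    have "1 * i \<le> p * i" using p(2) by (intro mult_le_mono1) simp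
    with False have "degree \<mu> < p * i" by linarith
    then show ?thesis using False by (simp add: h_def coeff_sum coeff_eq_0)
  qed (simp add: h_def coeff_sum)
  show "h \<in> polys E" using assms(4) by (simp add: polys_def co)
  have z: "coeff \<mu> n = 0" if "\<not> p dvd n" for n
  proof (cases n)
    case (Suc m)
    have "coeff (pderiv \<mu>) m = 0" using assms(5) by simp
    then have "of_nat n * coeff \<mu> n = 0" by (simp add: coeff_pderiv Suc)
    then show ?thesis using that p(1) of_nat_eq_0_iff_char_dvd[of n, where 'a='a] by auto
  qed (use that in simp)
  have dh: "degree h * p \<le> degree \<mu>" if "h \<noteq> 0"
  proof -
    have "coeff \<mu> (p * degree h) \<noteq> 0" using co[of "degree h"] that by (metis leading_coeff_0_iff)
    then show ?thesis using le_degree[of \<mu> "p * degree h"] by (simp add: mult.commute)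
  qed
  then show "degree h * p \<le> degree \<mu>" by (cases "h = 0") auto
  show "h \<noteq> 0" if "\<mu> \<noteq> 0"
  proof -
    have "p dvd degree \<mu>" using z that by (metis leading_coeff_0_iff)
    then obtain k where "degree \<mu> = p * k" by (elim dvdE)
    then have "coeff h k \<noteq> 0" using that co[of k] by (metis leading_coeff_0_iff)
    then show ?thesis by auto
  qed
  show "poly h (x ^ p) = poly \<mu> x" for x
  proof -
    have "poly h (x ^ p) = (\<Sum>i\<le>degree \<mu>. coeff \<mu> (p * i) * x ^ (p * i))"
      by (simp add: h_def poly_sum poly_monom power_mult)
    also have "\<dots> = (\<Sum>n\<in>(\<lambda>i. p * i) ` {..degree \<mu>}. coeff \<mu> n * x ^ n)"
      using p(2) by (subst sum.reindex) (auto simp: inj_on_def)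
    also have "\<dots> = (\<Sum>n\<le>p * degree \<mu>. coeff \<mu> n * x ^ n)"
    proof (rule sum.mono_neutral_left)
      show "\<forall>n\<in>{..p * degree \<mu>} - (\<lambda>i. p * i) ` {..degree \<mu>}. coeff \<mu> n * x ^ n = 0"
      proof
        fix n assume n: "n \<in> {..p * degree \<mu>} - (\<lambda>i. p * i) ` {..degree \<mu>}"
        have "\<not> p dvd n"
        proof
          assume "p dvd n"
          then obtain k where "n = p * k" by (elim dvdE)
          with n p(2) show False by auto
        qed
        then show "coeff \<mu> n * x ^ n = 0" using z by simp
      qed
    qed auto
    also have "\<dots> = (\<Sum>n\<le>degree \<mu>. coeff \<mu> n * x ^ n)"
      using p(2) by (intro sum.mono_neutral_right) (auto simp: coeff_eq_0)
    finally show ?thesis by (simp add: poly_altdef)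
  qed
qed

context
  fixes p :: nat
  assumes p: "p = CHAR('a::alg_closed_field)" "p > 0"
begin

text \<open>X^p - x^p has x as its only root. So \<mu>, if of degree > 1, has x as a multiple root
  and its derivative vanishes at x; but for a degree strictly between 1 and p the derivative is
  nonzero and of smaller degree, against minimality. Degree 1 would put x into E.\<close>

lemma degree_p_minpoly:
  assumes E: "is_subfield (E :: 'a set)" and "x \<notin> E" "x ^ p \<in> E" and \<mu>: "is_minpoly E x \<mu>"
  shows "degree \<mu> = p"
proof -
  note I = polys_intros[OF subfield_subring[OF E]]
  note d = is_minpolyD[OF \<mu>]
  define X where "X = monom 1 p - [:x ^ p:]"
  have X: "X \<in> polys E" unfolding X_def using assms subfield_intros(2)[OF E] by (intro I)
  have evX: "poly X y = y ^ p - x ^ p" for y by (simp add: X_def poly_monom)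
  have "coeff X p = 1" using p(2) by (cases p) (simp_all add: X_def coeff_pCons)
  then have X0: "X \<noteq> 0" by auto
  have "degree X \<le> p" unfolding X_def by (intro degree_diff_le) (auto simp: degree_monom_le)
  then have le: "degree \<mu> \<le> p" using is_minpoly_degree_le[OF \<mu> X _ X0] evX[of x] by simp
  obtain q where q: "X = \<mu> * q" using is_minpoly_dvd[OF \<mu> X] evX[of x] by auto
  have roots: "r = x" if "poly \<mu> r = 0" for r
    using frob_inj[OF p, of r x] evX[of r] q that by simp
  show ?thesis
  proof (rule ccontr)
    assume n: "degree \<mu> \<noteq> p"
    have "degree \<mu> \<noteq> 1"
    proof
      assume "degree \<mu> = 1"
      then obtain b a where ab: "\<mu> = [:a, b:]" "b \<noteq> 0" using degree1_coeffs[of \<mu>] by metis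
      then have "b = 1" using d(2) by simp
      with ab have "x = - a" "a = coeff \<mu> 0" using d(2,3) by (auto simp: eq_neg_iff_add_eq_0 add.commute)
      then have "x \<in> E" using polysD[OF d(1)] subfield_intros(5)[OF E] by metis
      then show False using assms by blast
    qed
    then have deg: "degree \<mu> > 1" using d(5) by simp
    obtain \<nu> where \<nu>: "\<mu> = [:-x, 1:] * \<nu>" using d(3) by (meson dvdE poly_eq_0_iff_dvd)
    have "\<nu> \<noteq> 0" using d(4) \<nu> by auto
    then have "degree \<mu> = Suc (degree \<nu>)" unfolding \<nu> by (subst degree_mult_eq) auto
    then obtain r where "poly \<nu> r = 0" using alg_closed_imp_poly_has_root[of \<nu>] deg by auto
    moreover from this have "r = x" using roots[of r] \<nu> by simp
    ultimately have "poly \<nu> x = 0" by simp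
    then have "poly (pderiv \<mu>) x = 0" unfolding \<nu> pderiv_mult by simp
    moreover have "coeff (pderiv \<mu>) (degree \<mu> - 1) \<noteq> 0"
    proof -
      have "coeff (pderiv \<mu>) (degree \<mu> - 1) = of_nat (degree \<mu>)"
        using deg d(2) by (simp add: coeff_pderiv)
      moreover have "\<not> p dvd degree \<mu>" using le n deg by (auto dest: dvd_imp_le)
      ultimately show ?thesis using of_nat_eq_0_iff_char_dvd[of "degree \<mu>", where 'a='a] p by simp
    qed
    then have "pderiv \<mu> \<noteq> 0" by auto
    ultimately have "degree \<mu> \<le> degree (pderiv \<mu>)"
      using is_minpoly_degree_le[OF \<mu> I(10)[OF d(1)]] by blast
    moreover have "degree (pderiv \<mu>) \<le> degree \<mu> - 1"       by (intro degree_le) (auto simp: coeff_pderiv coeff_eq_0)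
    ultimately show False using deg by simp
  qed
qed

lemma has_dim_p:
  assumes E: "is_subfield (E :: 'a set)" and "x \<notin> E" "x ^ p \<in> E"
  shows "has_dim E (adjoin E {x}) p" "adjoin E {x} = lspan E {..<p} (\<lambda>i. x ^ i)"
    "free E {..<p} (\<lambda>i. x ^ i)"
proof -
  have "monom 1 p - [:x ^ p:] \<in> polys E"
    using assms subfield_intros(2)[OF E] by (intro polys_intros[OF subfield_subring[OF E]])
  moreover have "coeff (monom 1 p - [:x ^ p:]) p = 1" using p(2) by (cases p) (simp_all add: coeff_pCons)
  then have "monom 1 p - [:x ^ p:] \<noteq> 0" by force
  moreover have "poly (monom 1 p - [:x ^ p:]) x = 0" by (simp add: poly_monom)
  ultimately have "algebraic_over E x" using algebraic_over_iff[OF E] by blast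
  then obtain \<mu> where \<mu>: "is_minpoly E x \<mu>" using ex_minpoly[OF E] by blast
  have "degree \<mu> = p" using degree_p_minpoly[OF assms \<mu>] .
  then show "has_dim E (adjoin E {x}) p" "adjoin E {x} = lspan E {..<p} (\<lambda>i. x ^ i)"
    "free E {..<p} (\<lambda>i. x ^ i)"
    using adjoin_algebraic[OF E \<mu>] lspan_minpoly[OF E \<mu>] by auto
qed

text \<open>[N : E^p] is computed along E and along N^p; as the Frobenius gives [N^p : E^p] =
  [N : E], this factor cancels.\<close>

lemma p_degree_finite_ext:
  assumes E: "is_subfield (E :: 'a set)" and N: "is_subfield N" "E \<subseteq> N" "has_dim E N n"
    and d: "has_dim (frob E) E d"
  shows "has_dim (frob N) N d"
proof -
  note fE = is_subfield_frob[OF p E] and fN = is_subfield_frob[OF p N(1)]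
  have fEN: "frob E \<subseteq> frob N" using frob_mono[OF p N(2)] .
  have 1: "has_dim (frob E) N (d * n)"
    using has_dim_tower[OF fE E frob_subset[OF p subfield_subring[OF E]] d N(3)] .
  then obtain B where B: "finite B" "lspan (frob E) B (\<lambda>x. x) = N" unfolding has_dim_def by blast
  have "B \<subseteq> N" using lspan_base[OF fE B(1), of _ "\<lambda>x. x"] B(2) by blast
  then have "lspan (frob N) B (\<lambda>x. x) \<subseteq> N"
    using frob_subset[OF p subfield_subring[OF N(1)]]
    by (intro lspan_subset_subring[OF fN subfield_subring[OF N(1)]]) auto
  moreover have "lspan (frob E) B (\<lambda>x. x) \<subseteq> lspan (frob N) B (\<lambda>x. x)"
    unfolding lspan_def using fEN by blast
  then have "N \<subseteq> lspan (frob N) B (\<lambda>x. x)" by (simp only: B(2))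
  ultimately have "lspan (frob N) B (\<lambda>x. x) = N" by blast
  then obtain d' where d': "has_dim (frob N) N d'" using ex_dim[OF fN B(1), of "\<lambda>x. x"] by auto
  have "has_dim (frob E) N (n * d')"
    using has_dim_tower[OF fE fN fEN frob_has_dim[OF p N(3) E] d'] .
  then have "d * n = n * d'" using has_dim_unique[OF fE 1] by blast
  moreover have "n > 0" using has_dim_pos[OF N(3)] subfield_intros(2)[OF N(1)] by blast
  ultimately show ?thesis using d' by simp
qed

text \<open>The products of a basis of E over E^p with 1, c, ..., c^(p-1) span E(c) over its p-th
  powers. Here c may be transcendental, which later gives the factor p for k(c).\<close>

lemma p_degree_adjoin:
  assumes E: "is_subfield (E :: 'a set)" and d: "has_dim (frob E) E d"
  shows "\<exists>d'\<le>d * p. has_dim (frob (adjoin E {c})) (adjoin E {c}) d'"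
proof -
  let ?M = "adjoin E {c}"
  have M: "is_subfield ?M" by (rule is_subfield_adjoin)
  note fM = is_subfield_frob[OF p M] and fE = is_subfield_frob[OF p E]
  have EM: "E \<subseteq> ?M" and cM: "c \<in> ?M" using adjoin_base adjoin_gens by blast+
  obtain B where B: "finite B" "card B = d" "lspan (frob E) B (\<lambda>x. x) = E"
    using d unfolding has_dim_def by blast
  have BE: "B \<subseteq> E" using lspan_base[OF fE B(1), of _ "\<lambda>x. x"] B(3) by blast
  let ?f = "\<lambda>z. fst z * c ^ snd z"
  let ?I = "B \<times> {..<p}"
  let ?V = "lspan (frob ?M) ?I ?f"
  have fI: "finite ?I" using B by simp
  note V = lspan_0[OF fM] lspan_add[OF fM] lspan_scale[OF fM] lspan_base[OF fM fI]
  have frM: "frob ?M \<subseteq> ?M" using frob_subset[OF p subfield_subring[OF M]] .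
  have VM: "?V \<subseteq> ?M"
    using BE EM cM frM
    by (intro lspan_subset_subring[OF fM subfield_subring[OF M]])
      (auto intro!: subring_mult[OF subfield_subring[OF M]] subring_power[OF subfield_subring[OF M]])
  have mon: "a * c ^ i \<in> ?V" if "a \<in> E" for a i
  proof -
    have ci: "c ^ i = (c ^ (i div p)) ^ p * c ^ (i mod p)"
      by (simp flip: power_mult power_add)
    have "a \<in> lspan (frob E) B (\<lambda>x. x)" using that by (simp only: B(3))
    then obtain e where e: "\<And>b. b \<in> B \<Longrightarrow> e b \<in> frob E" "a = (\<Sum>b\<in>B. e b * b)"
      by (auto simp: lspan_def)
    have eq: "a * c ^ i = (\<Sum>b\<in>B. (e b * (c ^ (i div p)) ^ p) * (b * c ^ (i mod p)))"
      unfolding e(2) sum_distrib_right ci by (rule sum.cong) simp_all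
    have "b * c ^ (i mod p) \<in> ?V" if "b \<in> B" for b
      using V(4)[of "(b, i mod p)" ?f] that p(2) by simp
    moreover have "e b * (c ^ (i div p)) ^ p \<in> frob ?M" if "b \<in> B" for b
      using e(1)[OF that] frob_mono[OF p EM] frobI[OF p, of "c ^ (i div p)" ?M]
        subring_power[OF subfield_subring[OF M] cM] by (auto intro!: subfield_intros(4)[OF fM])
    ultimately show ?thesis unfolding eq by (intro lspan_sum[OF fM], rule_tac V(3)) auto
  qed
  have pol: "poly q c \<in> ?V" if "q \<in> polys E" for q
    unfolding poly_altdef using polysD[OF that] by (intro lspan_sum[OF fM] mon)
  have "?M \<subseteq> ?V"
  proof
    fix x assume x: "x \<in> ?M"
    then obtain a b where ab: "a \<in> polys E" "b \<in> polys E" "poly b c \<noteq> 0" "x = poly a c / poly b c"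
      unfolding adjoin_singleton[OF E] by blast
    \<comment> \<open>Denominators are turned into p-th powers: a/b = b^(-p) a b^(p-1).\<close>
    have "x = (inverse (poly b c)) ^ p * poly (a * b ^ (p - 1)) c"
      using ab p(2) by (cases p) (simp_all add: field_simps power_inverse)
    moreover have "(inverse (poly b c)) ^ p \<in> frob ?M"
      using ab(2) poly_in[OF subfield_subring[OF M] subsetD[OF polys_mono[OF EM]] cM]
      by (intro frobI[OF p] subfield_inverse[OF M])
    moreover have "poly (a * b ^ (p - 1)) c \<in> ?V"
      using ab polys_intros[OF subfield_subring[OF E]] by (intro pol) auto
    ultimately show "x \<in> ?V" using V(3) by simp
  qed
  then have "?V = ?M" using VM by blast
  then show ?thesis using ex_dim[OF fM fI, of ?f] B by (auto simp: card_cartesian_product)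
qed

text \<open>Since K = K^p, the count starts at degree 1, and every generator contributes at most a
  factor p.\<close>

lemma p_degree_adjoin_perfect:
  assumes K: "is_subfield (K :: 'a set)" "frob K = K" and "finite S"
  shows "\<exists>d\<le>p ^ card S. has_dim (frob (adjoin K S)) (adjoin K S) d"
  using assms(3)
proof (induction S)
  case empty
  then show ?case using has_dim_1[OF K(1)] K adjoin_absorb[OF K(1), of "{}"] by auto
next
  case (insert x S)
  then obtain d where d: "d \<le> p ^ card S" "has_dim (frob (adjoin K S)) (adjoin K S) d" by blast
  have "adjoin (adjoin K S) {x} = adjoin K (insert x S)" by (simp add: adjoin_adjoin)
  then obtain d' where d': "d' \<le> d * p" "has_dim (frob (adjoin K (insert x S))) (adjoin K (insert x S)) d'"
    using p_degree_adjoin[OF is_subfield_adjoin d(2), of x] by auto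
  have "d' \<le> p ^ card S * p" using d'(1) d(1) mult_le_mono1 le_trans by blast
  then have "d' \<le> p ^ card (insert x S)" using insert(1,2) by (simp add: mult.commute)
  then show ?case using d' by blast
qed

end

text \<open>Lists grow at the head. If E contains the p-th powers of the entries, each entry
  multiplies the degree by p (\<open>pchain_dim\<close>), so this is p-independence over E.\<close>

fun pchain :: "'a::field set \<Rightarrow> 'a list \<Rightarrow> bool" where
  "pchain E [] \<longleftrightarrow> True"
| "pchain E (t # ts) \<longleftrightarrow> t \<notin> adjoin E (set ts) \<and> pchain E ts"

lemma pchain_mono: "E \<subseteq> M \<Longrightarrow> pchain M ts \<Longrightarrow> pchain E ts"
proof (induction ts)
  case (Cons t ts)
  then show ?case using adjoin_mono[of E M "set ts" "set ts"] by auto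
qed simp

section \<open>Extensions generated by p-th powers, and p-independence\<close>

context
  fixes p :: nat
  assumes p: "p = CHAR('a::alg_closed_field)" "p > 0"
begin

lemma frob_adjoin_singleton:
  assumes E: "is_subfield (E :: 'a set)"
  shows "frob (adjoin E {z}) \<subseteq> adjoin E {z ^ p}"
proof
  let ?M = "adjoin E {z ^ p}"
  have M: "is_subfield ?M" by (rule is_subfield_adjoin)
  have *: "poly a z ^ p \<in> ?M" if "a \<in> polys E" for a
  proof -
    have "poly a z ^ p = (\<Sum>i\<le>degree a. coeff a i ^ p * (z ^ p) ^ i)"
      by (simp add: poly_altdef frob_sum[OF p] power_mult_distrib power_mult[symmetric] mult.commute)
    also have "\<dots> \<in> ?M"
    proof (rule subfield_intros(8)[OF M])
      fix i
      have "coeff a i \<in> ?M" "z ^ p \<in> ?M"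
        using polysD[OF that] adjoin_base[of E "{z ^ p}"] adjoin_gens[of "{z ^ p}" E] by auto
      then show "coeff a i ^ p * (z ^ p) ^ i \<in> ?M"
        using subfield_intros(4,7)[OF M] by blast
    qed
    finally show ?thesis .
  qed
  fix x assume "x \<in> frob (adjoin E {z})"
  then obtain y where "y \<in> adjoin E {z}" and xy: "x = y ^ p" by (rule frobE[OF p])
  then obtain a b where ab: "a \<in> polys E" "b \<in> polys E" "y = poly a z / poly b z"
    unfolding adjoin_singleton[OF E] by blast
  have "x = poly a z ^ p / poly b z ^ p" by (simp add: xy ab(3) power_divide)
  then show "x \<in> ?M" using *[OF ab(1)] *[OF ab(2)] subfield_divide[OF M] by simp
qed

text \<open>The span of the p-th powers contains N^p, because coefficients from A turn into elements
  of A1, and it is a ring, because products of elements of C lie in N again. Being finite over A1 it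
  is a field; it contains A1 and N^p, which generate N. Hence [N : A1] is at most the size of
  C.\<close>

lemma frob_span:
  assumes A: "is_subfield (A :: 'a set)" and A1: "is_subfield A1" and N: "is_subfield N"
    and sub: "A1 \<subseteq> N" "frob A \<subseteq> A1" and C: "finite C" "lspan A C (\<lambda>x. x) = N"
    and gen: "N \<subseteq> adjoin A1 (frob N)"
  shows "lspan A1 C (\<lambda>x. x ^ p) = N"
proof -
  let ?V = "lspan A1 C (\<lambda>x. x ^ p)"
  have CN: "C \<subseteq> N" using lspan_base[OF A C(1), of _ "\<lambda>x. x"] C(2) by blast
  have VN: "?V \<subseteq> N"
    using CN sub by (intro lspan_subset_subring[OF A1 subfield_subring[OF N]])
      (auto intro: subfield_intros(7)[OF N])
  have pw: "z ^ p \<in> ?V" if zN: "z \<in> N" for z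
  proof -
    have "z \<in> lspan A C (\<lambda>x. x)" using zN C(2) by simp
    then obtain c where c: "\<And>x. x \<in> C \<Longrightarrow> c x \<in> A" "z = (\<Sum>x\<in>C. c x * x)" by (auto simp: lspan_def)
    have "z ^ p = (\<Sum>x\<in>C. c x ^ p * x ^ p)" by (simp add: c(2) frob_sum[OF p] power_mult_distrib)
    moreover have "c x ^ p \<in> A1" if "x \<in> C" for x using c(1)[OF that] frobI[OF p] sub(2) by blast
    ultimately show ?thesis using lspanI[of C "\<lambda>x. c x ^ p" A1 "\<lambda>x. x ^ p"] by simp
  qed
  have 1: "1 \<in> ?V" using pw[of 1] subfield_intros(2)[OF N] by simp
  have A1V: "A1 \<subseteq> ?V" using lspan_scale[OF A1 _ 1] by auto
  have mult: "x * y \<in> ?V" if xV: "x \<in> ?V" and yV: "y \<in> ?V" for x y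
  proof -
    obtain c where c: "\<And>i. i \<in> C \<Longrightarrow> c i \<in> A1" "x = (\<Sum>i\<in>C. c i * i ^ p)" using xV by (auto simp: lspan_def)
    obtain d where d: "\<And>i. i \<in> C \<Longrightarrow> d i \<in> A1" "y = (\<Sum>i\<in>C. d i * i ^ p)" using yV by (auto simp: lspan_def)
    have "x * y = (\<Sum>i\<in>C. \<Sum>j\<in>C. (c i * d j) * (i * j) ^ p)"
      unfolding c(2) d(2) sum_product by (simp add: power_mult_distrib algebra_simps)
    also have "\<dots> \<in> ?V"
      using c(1) d(1) CN
      by (intro lspan_sum[OF A1] lspan_scale[OF A1] pw subfield_intros(4)[OF A1] subfield_intros(4)[OF N]) auto
    finally show ?thesis .
  qed
  have V: "is_subring ?V"
    unfolding is_subring_def using 1 mult lspan_0[OF A1] lspan_diff[OF A1] by auto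
  obtain n where "has_dim A1 ?V n" using ex_dim[OF A1 C(1), of "\<lambda>x. x ^ p"] by blast
  then have "is_subfield ?V" using finite_ext_subfield_algebraic[OF A1 V A1V] by blast
  moreover have "frob N \<subseteq> ?V" using pw by (auto elim!: frobE[OF p])
  ultimately have "adjoin A1 (frob N) \<subseteq> ?V" using adjoin_least A1V by blast
  then show ?thesis using gen VN by blast
qed

text \<open>From z = f(z^p)/g(z^p) and transcendence, X g(X^p) = f(X^p); the degrees are 1 and 0
  modulo p.\<close>

lemma transcendental_notin_adjoin_power:
  assumes E: "is_subfield (E :: 'a set)" and z: "\<not> algebraic_over E z"
  shows "z \<notin> adjoin E {z ^ p}"
proof
  note I = polys_intros[OF subfield_subring[OF E]]
  assume "z \<in> adjoin E {z ^ p}"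
  then obtain f g where fg: "f \<in> polys E" "g \<in> polys E" "poly g (z ^ p) \<noteq> 0" "z = poly f (z ^ p) / poly g (z ^ p)"
    unfolding adjoin_singleton[OF E] by blast
  define h where "h = pCons 0 (pcompose g (monom 1 p)) - pcompose f (monom 1 p)"
  have mon: "monom 1 p \<in> polys E" using subfield_intros(2)[OF E] by (intro I)
  have "h \<in> polys E"
    unfolding h_def using fg mon subfield_intros(1,2)[OF E] by (intro I)
  moreover have "poly h z = 0"
    using fg(3,4) by (simp add: h_def poly_pcompose poly_monom field_simps)
  ultimately have "h = 0" using z algebraic_over_iff[OF E] by blast
  then have eq: "pCons 0 (pcompose g (monom 1 p)) = pcompose f (monom 1 p)" by (simp add: h_def)
  have "pcompose g (monom 1 p) \<noteq> 0"
  proof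
    assume "pcompose g (monom 1 p) = 0"
    then have "poly (pcompose g (monom 1 p)) z = 0" by simp
    then show False using fg(3) by (simp add: poly_pcompose poly_monom)
  qed
  then have "Suc (degree g * p) = degree f * p"
    using arg_cong[OF eq, of degree] by (simp add: degree_pcompose degree_monom_eq)
  then have "p dvd Suc (degree g * p)" by simp
  then have "p dvd 1" using dvd_diff_nat[of p "Suc (degree g * p)" "degree g * p"] by simp
  then show False using prime_p[OF p] by simp
qed

text \<open>The counterpart of vanishing differentials. Generators are removed one at a time while N
  stays finite over what is left: were z transcendental over E', \<open>frob_span\<close> would give
  [N : E'(z^p)] <= [N : E'(z)], although E'(z) has degree p over E'(z^p).\<close>

lemma finite_if_frob_generates:
  assumes E: "is_subfield (E :: 'a set)" and N: "is_subfield N" "E \<subseteq> N"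
    and gen: "N \<subseteq> adjoin E (frob N)" and "finite S" "adjoin E S = N"
  shows "\<exists>n. has_dim E N n"
proof -
  have "\<exists>n. has_dim E N n" if "finite S" "S \<subseteq> N" "has_dim (adjoin E S) N n" for S n
    using that
  proof (induction S arbitrary: n)
    case empty
    then show ?case using adjoin_absorb[OF E, of "{}"] by auto
  next
    case (insert z S)
    let ?E = "adjoin E S"
    let ?A = "adjoin ?E {z}"
    let ?A1 = "adjoin ?E {z ^ p}"
    have E': "is_subfield ?E" and A: "is_subfield ?A" and A1: "is_subfield ?A1" by (rule is_subfield_adjoin)+
    have eqA: "?A = adjoin E (insert z S)" by (simp add: adjoin_adjoin)
    have zN: "z \<in> N" and EN: "?E \<subseteq> N" using adjoin_least[OF N] insert.prems by auto
    have AN: "has_dim ?A N n" unfolding eqA by (rule insert.prems)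
    show ?case
    proof (cases "algebraic_over ?E z")
      case True
      then obtain \<mu> where "is_minpoly ?E z \<mu>" using ex_minpoly[OF E'] by blast
      then have "has_dim ?E ?A (degree \<mu>)" using adjoin_algebraic(2)[OF E'] by blast
      then have "has_dim ?E N (degree \<mu> * n)" using has_dim_tower[OF E' A adjoin_base _ AN] by blast
      then show ?thesis using insert.IH insert.prems by blast
    next
      case False
      obtain C where C: "finite C" "card C = n" "lspan ?A C (\<lambda>x. x) = N"
        using AN unfolding has_dim_def by blast
      have "z ^ p \<in> N" using subfield_intros(7)[OF N(1) zN] .
      then have A1N: "?A1 \<subseteq> N" using adjoin_least[OF N(1) EN, of "{z ^ p}"] by blast
      have "E \<subseteq> ?A1" using adjoin_base[of E S] adjoin_base[of ?E "{z ^ p}"] by blast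
      then have "N \<subseteq> adjoin ?A1 (frob N)" using gen adjoin_mono[of E ?A1 "frob N" "frob N"] by blast
      then have "lspan ?A1 C (\<lambda>x. x ^ p) = N"
        using frob_span[OF A A1 N(1) A1N frob_adjoin_singleton[OF E'] C(1,3)] by blast
      then obtain m where m: "m \<le> n" "has_dim ?A1 N m" using ex_dim[OF A1 C(1), of "\<lambda>x. x ^ p"] C(2) by auto
      have zp: "z ^ p \<in> ?A1" using adjoin_gens by blast
      have zA: "z \<in> ?A" using adjoin_gens by blast
      have A1A: "?A1 \<subseteq> ?A" using adjoin_least[OF A adjoin_base, of "{z ^ p}"] subfield_intros(7)[OF A zA] by simp
      have "adjoin ?A1 {z} = ?A"
      proof
        show "adjoin ?A1 {z} \<subseteq> ?A" using adjoin_least[OF A A1A, of "{z}"] zA by simp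
        show "?A \<subseteq> adjoin ?A1 {z}"
          by (rule adjoin_mono[OF adjoin_base order_refl])
      qed
      then have "has_dim ?A1 ?A p"
        using has_dim_p(1)[OF p A1 transcendental_notin_adjoin_power[OF E' False] zp] by simp
      then have "has_dim ?A1 N (p * n)" using has_dim_tower[OF A1 A A1A _ AN] by blast
      then have "p * n \<le> n" using has_dim_unique[OF A1 m(2)] m(1) by simp
      moreover have "n > 0" using has_dim_pos[OF AN] subfield_intros(2)[OF N(1)] by blast
      ultimately have "p \<le> 1" by simp
      then show ?thesis using prime_gt_1_nat[OF prime_p[OF p]] by simp
    qed
  qed
  moreover have "S \<subseteq> N" "has_dim (adjoin E S) N 1"
    using assms(6) adjoin_gens[of S E] has_dim_1[OF N(1)] by auto
  ultimately show ?thesis using assms(5) by blast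
qed

text \<open>If \<mu>'(x) = 0, then \<mu> is a polynomial in X^p and x^p has degree at most deg \<mu>
  / p over E. But \<open>frob_span\<close> gives [N : E(x^p)] <= [N : E(x)], hence [E(x^p) : E] >=
  [E(x) : E].\<close>

lemma separable_if_frob_generates:
  assumes E: "is_subfield (E :: 'a set)" and N: "is_subfield N" "E \<subseteq> N" "has_dim E N n"
    and gen: "N \<subseteq> adjoin E (frob N)" and x: "x \<in> N" and \<mu>: "is_minpoly E x \<mu>"
  shows "poly (pderiv \<mu>) x \<noteq> 0"
proof
  assume z: "poly (pderiv \<mu>) x = 0"
  let ?M = "adjoin E {x}" and ?M1 = "adjoin E {x ^ p}"
  have M: "is_subfield ?M" and M1: "is_subfield ?M1" by (rule is_subfield_adjoin)+
  note d = is_minpolyD[OF \<mu>]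
  have xp: "x ^ p \<in> N" using subfield_intros(7)[OF N(1) x] .
  obtain m r where m: "has_dim E ?M m" "has_dim ?M N r" "n = m * r" "m > 0" "r > 0"
    using adjoin_singleton_degree_dvd[OF E N x] .
  obtain m1 r1 where m1: "has_dim E ?M1 m1" "has_dim ?M1 N r1" "n = m1 * r1" "m1 > 0" "r1 > 0"
    using adjoin_singleton_degree_dvd[OF E N xp] .
  have mdeg: "m = degree \<mu>" using has_dim_unique[OF E m(1) adjoin_algebraic(2)[OF E \<mu>]] .
  obtain C where C: "finite C" "card C = r" "lspan ?M C (\<lambda>x. x) = N"
    using m(2) unfolding has_dim_def by blast
  have M1N: "?M1 \<subseteq> N" using adjoin_least[OF N(1,2), of "{x ^ p}"] xp by blast
  have "N \<subseteq> adjoin ?M1 (frob N)" using gen adjoin_mono[OF adjoin_base[of E "{x ^ p}"] order_refl[of "frob N"]] by blast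
  then have "lspan ?M1 C (\<lambda>x. x ^ p) = N"
    using frob_span[OF M M1 N(1) M1N frob_adjoin_singleton[OF E] C(1,3)] by blast
  then obtain r' where "r' \<le> r" "has_dim ?M1 N r'" using ex_dim[OF M1 C(1), of "\<lambda>x. x ^ p"] C(2) by auto
  then have "r1 \<le> r" using has_dim_unique[OF M1 m1(2)] by blast
  then have "m * r \<le> m1 * r" using m(3) m1(3) mult_le_mono2[of r1 r m1] by simp
  then have le: "degree \<mu> \<le> m1" using m(5) mdeg by simp
  have "pderiv \<mu> = 0"
  proof (rule ccontr)
    assume "pderiv \<mu> \<noteq> 0"
    then have "degree \<mu> \<le> degree (pderiv \<mu>)"
      using is_minpoly_degree_le[OF \<mu> polys_pderiv[OF subfield_subring[OF E] d(1)] z] by blast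
    moreover have "degree (pderiv \<mu>) \<le> degree \<mu> - 1"
      by (intro degree_le) (auto simp: coeff_pderiv coeff_eq_0)
    ultimately show False using d(5) by simp
  qed
  then obtain h where h: "h \<in> polys E" "\<And>y. poly h (y ^ p) = poly \<mu> y" "degree h * p \<le> degree \<mu>" "\<mu> \<noteq> 0 \<Longrightarrow> h \<noteq> 0"
    using pderiv_0_poly[OF subfield_subring[OF E] p d(1)] by blast
  have "algebraic_over E (x ^ p)"
    using algebraic_over_iff[OF E] h(1) h(2)[of x] h(4) d by auto
  then obtain \<mu>1 where \<mu>1: "is_minpoly E (x ^ p) \<mu>1" using ex_minpoly[OF E] by blast
  have "m1 = degree \<mu>1" using has_dim_unique[OF E m1(1) adjoin_algebraic(2)[OF E \<mu>1]] .
  also have "\<dots> \<le> degree h" using is_minpoly_degree_le[OF \<mu>1 h(1)] h(2)[of x] h(4) d by auto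
  finally have "m1 * p \<le> m1" using h(3) le by (meson le_trans mult_le_mono1)
  then show False using m1(4) prime_gt_1_nat[OF prime_p[OF p]] by simp
qed

lemma pchain_dim:
  assumes E: "is_subfield (E :: 'a set)" and "pchain E ts" "\<And>t. t \<in> set ts \<Longrightarrow> t ^ p \<in> E"
  shows "has_dim E (adjoin E (set ts)) (p ^ length ts)"
  using assms(2,3)
proof (induction ts)
  case Nil
  then show ?case using has_dim_1[OF E] adjoin_absorb[OF E, of "{}"] by simp
next
  case (Cons t ts)
  let ?M = "adjoin E (set ts)"
  have M: "is_subfield ?M" by (rule is_subfield_adjoin)
  have "has_dim ?M (adjoin ?M {t}) p"
    using Cons.prems adjoin_base[of E "set ts"] by (intro has_dim_p(1)[OF p M]) auto
  moreover have "adjoin ?M {t} = adjoin E (set (t # ts))" by (simp add: adjoin_adjoin)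
  ultimately have "has_dim E (adjoin E (set (t # ts))) (p ^ length ts * p)"
    using has_dim_tower[OF E M adjoin_base] Cons by simp
  then show ?case by (simp add: mult.commute)
qed

lemma has_dim_subset_le:
  assumes E: "is_subfield (E :: 'a set)" and "has_dim E M m" "has_dim E N n" "M \<subseteq> N"
  shows "m \<le> n"
proof -
  obtain A where A: "finite A" "card A = m" "free E A (\<lambda>x. x)" "lspan E A (\<lambda>x. x) = M"
    using assms(2) unfolding has_dim_def by blast
  obtain B where B: "finite B" "card B = n" "lspan E B (\<lambda>x. x) = N"
    using assms(3) unfolding has_dim_def by blast
  have "A \<subseteq> N" using lspan_base[OF E A(1), of _ "\<lambda>x. x"] A(4) assms(4) by blast
  then have "(\<lambda>x. x) ` A \<subseteq> lspan E B (\<lambda>x. x)" using B(3) by simp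
  from card_le_if_free_span[OF E B(1) A(1,3) this] show ?thesis using A(2) B(2) by simp
qed

text \<open>The degrees \<open>p ^ length ts\<close> are bounded by D, so a chain of greatest length
  exists; an element outside the field it generates would prolong it.\<close>

lemma ex_pchain:
  assumes E: "is_subfield (E :: 'a set)" and N: "is_subfield N" "E \<subseteq> N" "has_dim E N D"
    and pow: "\<And>x. x \<in> N \<Longrightarrow> x ^ p \<in> E"
  obtains ts where "pchain E ts" "set ts \<subseteq> N" "adjoin E (set ts) = N" "D = p ^ length ts"
proof -
  let ?P = "\<lambda>ts. pchain E ts \<and> set ts \<subseteq> N"
  have sub: "adjoin E (set ts) \<subseteq> N" if "?P ts" for ts using that adjoin_least[OF N(1,2)] by blast
  have dim: "has_dim E (adjoin E (set ts)) (p ^ length ts)" if "?P ts" for ts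
    using that pow by (intro pchain_dim[OF E]) auto
  have "length ts < Suc D" if "?P ts" for ts
  proof -
    have "p ^ length ts \<le> D" using has_dim_subset_le[OF E dim[OF that] N(3) sub[OF that]] .
    moreover have "length ts < p ^ length ts"
      using prime_gt_1_nat[OF prime_p[OF p]] by (intro power_gt_expt) auto
    ultimately show ?thesis by simp
  qed
  then obtain ts where ts: "?P ts" and max: "\<And>us. ?P us \<Longrightarrow> length us \<le> length ts"
    using ex_has_greatest_nat[of ?P "[]" length "Suc D"] by auto
  have eq: "adjoin E (set ts) = N"
  proof (rule ccontr)
    assume "adjoin E (set ts) \<noteq> N"
    then obtain x where "x \<in> N" "x \<notin> adjoin E (set ts)" using sub[OF ts] by blast
    then have "?P (x # ts)" using ts by simp
    then show False using max[of "x # ts"] by simp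
  qed
  then have "D = p ^ length ts" using has_dim_unique[OF E N(3)] dim[OF ts] by simp
  then show ?thesis using that ts eq by blast
qed

text \<open>Were t algebraic over K(ts), the field K(t, ts) would have the same degree over its p-th
  powers as K(ts), at most \<open>p ^ length ts\<close> since K is perfect. But
  \<open>t # ts\<close> is a chain over these p-th powers as well, which makes the degree at least p
  times larger.\<close>

lemma pchain_transcendental:
  assumes K: "is_subfield (K :: 'a set)" "frob K = K" "K \<subseteq> F" and F: "is_subfield F"
    and ts: "pchain (frob F) (t # ts)" "set (t # ts) \<subseteq> F"
  shows "\<not> algebraic_over (adjoin K (set ts)) t"
proof
  let ?E = "adjoin K (set ts)"
  let ?M = "adjoin ?E {t}"
  assume "algebraic_over ?E t"
  then obtain n where n: "has_dim ?E ?M n"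
    using finite_adjoin_algebraic[OF is_subfield_adjoin, of "{t}"] by blast
  have M: "is_subfield ?M" by (rule is_subfield_adjoin)
  have Meq: "?M = adjoin K (set (t # ts))" by (simp add: adjoin_adjoin)
  then have MF: "?M \<subseteq> F" using adjoin_least[OF F K(3) ts(2)] by simp
  obtain d where d: "d \<le> p ^ card (set ts)" "has_dim (frob ?E) ?E d"
    using p_degree_adjoin_perfect[OF p K(1,2), of "set ts"] by auto
  then have dM: "has_dim (frob ?M) ?M d"
    using p_degree_finite_ext[OF p is_subfield_adjoin M adjoin_base n] by blast
  have fM: "is_subfield (frob ?M)" using is_subfield_frob[OF p M] .
  have tM: "set (t # ts) \<subseteq> ?M" unfolding Meq by (rule adjoin_gens)
  have "pchain (frob ?M) (t # ts)" using pchain_mono[OF frob_mono[OF p MF]] ts(1) by blast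
  then have "has_dim (frob ?M) (adjoin (frob ?M) (set (t # ts))) (p ^ length (t # ts))"
    using tM by (intro pchain_dim[OF fM] frobI[OF p]) auto
  moreover have "adjoin (frob ?M) (set (t # ts)) \<subseteq> ?M"
    using adjoin_least[OF M frob_subset[OF p subfield_subring[OF M]] tM] .
  ultimately have "p ^ length (t # ts) \<le> d" using has_dim_subset_le[OF fM _ dM] by blast
  also have "d \<le> p ^ length ts"
    using d(1) power_increasing[OF card_length[of ts], of p] p(2) by simp
  finally have "p \<le> 1" using p(2) by simp
  then show False using prime_gt_1_nat[OF prime_p[OF p]] by simp
qed

end

subsection \<open>Places of the ambient field\<close>

text \<open>With places of the whole ambient field, the valuation ring of every subfield F is simply
  \<open>F \<inter> V\<close>; \<open>place_extend\<close> passes from a place of F to this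
  situation.\<close>

locale place =
  fixes P :: "'a::field \<Rightarrow> 'a option"
  assumes is_place: "is_place UNIV P"
begin

definition V :: "'a set" where "V = {x. P x \<noteq> None}"

definition res :: "'a \<Rightarrow> 'a" where "res x = the (P x)"

lemma val_ring_UNIV: "val_ring UNIV P = V" by (simp add: val_ring_def V_def)

lemma V_subring: "is_subring V"
  using is_place by (simp add: is_place_def val_ring_UNIV)

lemma P_eq_Some: "P x = Some y \<longleftrightarrow> x \<in> V \<and> res x = y"
  by (auto simp: V_def res_def)

lemma res_1 [simp]: "res 1 = 1"
  using is_place by (simp add: is_place_def res_def)

lemma res_add: "x \<in> V \<Longrightarrow> y \<in> V \<Longrightarrow> res (x + y) = res x + res y"
  and res_mult: "x \<in> V \<Longrightarrow> y \<in> V \<Longrightarrow> res (x * y) = res x * res y"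
  using is_place by (simp_all add: is_place_def res_def val_ring_UNIV)

lemma notin_V: "x \<notin> V \<Longrightarrow> x \<noteq> 0" "x \<notin> V \<Longrightarrow> inverse x \<in> V" "x \<notin> V \<Longrightarrow> res (inverse x) = 0"
  using is_place by (auto simp: is_place_def res_def V_def)

lemmas V_intros = subring_intros[OF V_subring]

lemma res_0 [simp]: "res 0 = 0"
  using res_add[of 0 0] V_intros(1) by (metis add_0_right add_left_cancel)

lemma res_uminus: "x \<in> V \<Longrightarrow> res (- x) = - res x"
  using res_add[of x "-x"] V_intros(5) by (simp add: eq_neg_iff_add_eq_0 add.commute)

lemma res_diff: "x \<in> V \<Longrightarrow> y \<in> V \<Longrightarrow> res (x - y) = res x - res y"
  using res_add[of x "- y"] V_intros(5) by (simp add: res_uminus)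

lemma res_power: "x \<in> V \<Longrightarrow> res (x ^ n) = res x ^ n"
  by (induction n) (auto simp: res_mult V_intros)

lemma res_sum: "(\<And>i. i \<in> I \<Longrightarrow> f i \<in> V) \<Longrightarrow> res (sum f I) = (\<Sum>i\<in>I. res (f i))"
  by (induction I rule: infinite_finite_induct) (auto simp: res_add V_intros)

lemma res_inverse:
  assumes "x \<in> V" "res x \<noteq> 0"
  shows "inverse x \<in> V" "res (inverse x) = inverse (res x)"
proof -
  have x0: "x \<noteq> 0" using assms by auto
  show i: "inverse x \<in> V"
  proof (rule ccontr)
    assume "inverse x \<notin> V"
    from notin_V(3)[OF this] show False using assms by simp
  qed
  have "res x * res (inverse x) = 1" using res_mult[OF assms(1) i] x0 by simp
  then show "res (inverse x) = inverse (res x)" by (simp add: inverse_unique)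
qed

lemma res_divide: "x \<in> V \<Longrightarrow> y \<in> V \<Longrightarrow> res y \<noteq> 0 \<Longrightarrow> x / y \<in> V \<and> res (x / y) = res x / res y"
  by (simp add: divide_inverse V_intros res_mult res_inverse)

lemma coeff_map_res [simp]: "coeff (map_poly res p) i = res (coeff p i)"
  by (simp add: coeff_map_poly)

lemma res_poly:
  assumes "p \<in> polys V" "x \<in> V"
  shows "res (poly p x) = poly (map_poly res p) (res x)"
proof -
  have le: "degree (map_poly res p) \<le> degree p" by (intro degree_le) (auto simp: coeff_eq_0)
  have z: "res (coeff p i) = 0" if "degree (map_poly res p) < i" for i
    using coeff_eq_0[OF that] by simp
  have "poly (map_poly res p) (res x) = (\<Sum>i\<le>degree p. res (coeff p i) * res x ^ i)"
    unfolding poly_altdef using le z by (intro sum.mono_neutral_cong_left) (auto simp: not_le)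
  also have "\<dots> = (\<Sum>i\<le>degree p. res (coeff p i * x ^ i))"
    using polysD[OF assms(1)] assms(2) by (intro sum.cong) (auto simp: res_mult res_power V_intros)
  also have "\<dots> = res (poly p x)"
    unfolding poly_altdef using polysD[OF assms(1)] assms(2) by (subst res_sum) (auto simp: V_intros)
  finally show ?thesis by simp
qed

lemma map_res_mult:
  assumes "p \<in> polys V" "q \<in> polys V"
  shows "map_poly res (p * q) = map_poly res p * map_poly res q"
  using polysD[OF assms(1)] polysD[OF assms(2)]
  by (intro poly_eqI) (simp add: coeff_mult res_sum res_mult V_intros)

text \<open>At a pole x, multiply the equation by x^(-n): every term except the leading coefficient
  acquires residue 0.\<close>

lemma integral_in_V:
  assumes "p \<in> polys V" "res (lead_coeff p) \<noteq> 0" "poly p x = 0"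
  shows "x \<in> V"
proof (rule ccontr)
  assume x: "x \<notin> V"
  define n y where "n = degree p" and "y = inverse x"
  note y = notin_V[OF x, folded y_def]
  have xy: "x ^ i * y ^ n = y ^ (n - i)" if "i \<le> n" for i
  proof -
    have "x ^ i * y ^ n = (x * y) ^ i * y ^ (n - i)" using that
      by (simp add: power_mult_distrib power_add[symmetric])
    then show ?thesis using y(1) by (simp add: y_def)
  qed
  have "0 = poly p x * y ^ n" using assms(3) by simp
  also have "\<dots> = (\<Sum>i\<le>n. coeff p i * (x ^ i * y ^ n))"
    by (simp add: poly_altdef n_def sum_distrib_right mult.assoc)
  also have "\<dots> = (\<Sum>i\<le>n. coeff p i * y ^ (n - i))" using xy by simp
  finally have "0 = res (\<Sum>i\<le>n. coeff p i * y ^ (n - i))" by simp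
  also have "\<dots> = (\<Sum>i\<le>n. res (coeff p i) * res y ^ (n - i))"
    using polysD[OF assms(1)] y(2) by (subst res_sum) (auto simp: V_intros res_mult res_power)
  also have "\<dots> = (\<Sum>i\<le>n. if i = n then res (coeff p n) else 0)"
    using y(3) by (intro sum.cong) auto
  finally show False using assms(2) by (simp add: n_def)
qed

text \<open>The element \<open>a j\<close> has least value. As no value group is introduced, values
  are compared by quotients in \<open>V\<close>.\<close>

lemma ex_dominant:
  assumes "finite I" "\<exists>i\<in>I. a i \<noteq> 0"
  shows "\<exists>j\<in>I. a j \<noteq> 0 \<and> (\<forall>i\<in>I. a i / a j \<in> V)"
  using assms
  proof (induction I)
    case (insert k I)
    show ?case
    proof (cases "\<exists>i\<in>I. a i \<noteq> 0")
      case False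
      then have "a k \<noteq> 0" "a i / a k \<in> V" if "i \<in> insert k I" for i
        using insert.prems that by (auto simp: V_intros)
      then show ?thesis by blast
    next
      case True
      then obtain j where j: "j \<in> I" "a j \<noteq> 0" "\<And>i. i \<in> I \<Longrightarrow> a i / a j \<in> V" using insert.IH by blast
      show ?thesis
      proof (cases "a k / a j \<in> V")
        case True
        then show ?thesis using j by blast
      next
        case False
        then have k0: "a k \<noteq> 0" using V_intros(1) by auto
        have jk: "a j / a k \<in> V" using notin_V(2)[OF False] by simp
        have "a i / a k \<in> V" if "i \<in> I" for i
          using V_intros(4)[OF j(3)[OF that] jk] j(2) by simp
        then have "\<forall>i\<in>insert k I. a i / a k \<in> V" using k0 V_intros(2) by simp
        then show ?thesis using k0 by blast
      qed
    qed
  qed simp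

end

subsection \<open>Extension of homomorphisms to places\<close>

locale ring_hom_on =
  fixes S :: "'a::field set" and \<phi> :: "'a \<Rightarrow> 'b::field"
  assumes S: "is_subring S" and hom_1: "\<phi> 1 = 1"
    and hom_add: "x \<in> S \<Longrightarrow> y \<in> S \<Longrightarrow> \<phi> (x + y) = \<phi> x + \<phi> y"
    and hom_mult: "x \<in> S \<Longrightarrow> y \<in> S \<Longrightarrow> \<phi> (x * y) = \<phi> x * \<phi> y"
begin

lemmas S_intros = subring_intros[OF S]

lemma hom_0 [simp]: "\<phi> 0 = 0"
  using hom_add[of 0 0] S_intros(1) by (metis add_0_right add_left_cancel)

lemma hom_uminus: "x \<in> S \<Longrightarrow> \<phi> (- x) = - \<phi> x"
  using hom_add[of x "-x"] S_intros(5) by (simp add: eq_neg_iff_add_eq_0 add.commute)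

lemma hom_diff: "x \<in> S \<Longrightarrow> y \<in> S \<Longrightarrow> \<phi> (x - y) = \<phi> x - \<phi> y"
  using hom_add[of x "- y"] S_intros(5) by (simp add: hom_uminus)

lemma hom_power: "x \<in> S \<Longrightarrow> \<phi> (x ^ n) = \<phi> x ^ n"
  by (induction n) (auto simp: hom_1 hom_mult S_intros)

lemma hom_sum: "(\<And>i. i \<in> I \<Longrightarrow> f i \<in> S) \<Longrightarrow> \<phi> (sum f I) = (\<Sum>i\<in>I. \<phi> (f i))"
  by (induction I rule: infinite_finite_induct) (auto simp: hom_add S_intros)

lemma coeff_map_hom [simp]: "coeff (map_poly \<phi> p) i = \<phi> (coeff p i)"
  by (simp add: coeff_map_poly)

lemma map_hom_diff: "p \<in> polys S \<Longrightarrow> q \<in> polys S \<Longrightarrow> map_poly \<phi> (p - q) = map_poly \<phi> p - map_poly \<phi> q"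
  by (intro poly_eqI) (simp add: hom_diff polysD)

lemma map_hom_mult: "p \<in> polys S \<Longrightarrow> q \<in> polys S \<Longrightarrow> map_poly \<phi> (p * q) = map_poly \<phi> p * map_poly \<phi> q"
  by (intro poly_eqI) (simp add: coeff_mult hom_sum hom_mult polysD S_intros)

lemma map_hom_const: "map_poly \<phi> [:a:] = [:\<phi> a:]"
  by (intro poly_eqI) (simp add: coeff_pCons split: nat.split)

lemma poly_map_hom:
  "poly (map_poly \<phi> p) r = (\<Sum>i\<le>degree p. \<phi> (coeff p i) * r ^ i)"
proof -
  have "degree (map_poly \<phi> p) \<le> degree p" by (intro degree_le) (auto simp: coeff_eq_0)
  moreover have "\<phi> (coeff p i) = 0" if "degree (map_poly \<phi> p) < i" for i
    using coeff_eq_0[OF that] by simp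
  ultimately show ?thesis
    unfolding poly_altdef by (intro sum.mono_neutral_cong_left) (auto simp: not_le)
qed

definition graph :: "('a \<times> 'b) set" where "graph = (\<lambda>x. (x, \<phi> x)) ` S"

text \<open>The candidate for extending \<phi> to S[x] by x \<mapsto> r. As a relation it exists for
  every r; \<open>hom_graph_ext\<close> says when it is single-valued.\<close>

definition ext_graph :: "'a \<Rightarrow> 'b \<Rightarrow> ('a \<times> 'b) set" where
  "ext_graph x r = (\<lambda>p. (poly p x, poly (map_poly \<phi> p) r)) ` polys S"

end

text \<open>Homomorphisms with varying domains are represented by relations, so that Zorn's lemma
  applies to inclusion. Closure under differences allows single-valuedness to be required at 0
  only.\<close>

definition hom_graph :: "('a::field \<times> 'b::field) set \<Rightarrow> bool" where
  "hom_graph G \<longleftrightarrow> (1, 1) \<in> G \<and> (\<forall>b. (0, b) \<in> G \<longrightarrow> b = 0) \<and>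
     (\<forall>x a y b. (x, a) \<in> G \<and> (y, b) \<in> G \<longrightarrow> (x - y, a - b) \<in> G \<and> (x * y, a * b) \<in> G)"

lemma (in ring_hom_on) hom_graph_graph: "hom_graph graph"
  unfolding hom_graph_def graph_def
  by (auto simp: hom_1 hom_diff hom_mult S_intros image_iff)

lemma hom_graph_hom:
  assumes G: "hom_graph G"
  obtains \<phi> where "ring_hom_on (fst ` G) \<phi>" "G = ring_hom_on.graph (fst ` G) \<phi>"
proof -
  have sub: "(x - y, a - b) \<in> G" "(x * y, a * b) \<in> G" if "(x, a) \<in> G" "(y, b) \<in> G" for x y a b
    using G that unfolding hom_graph_def by blast+
  have one: "(1, 1) \<in> G" and z: "\<And>b. (0, b) \<in> G \<Longrightarrow> b = 0" using G unfolding hom_graph_def by blast+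
  have zero: "(0, 0) \<in> G" using sub(1)[OF one one] by simp
  have add: "(x + y, a + b) \<in> G" if "(x, a) \<in> G" "(y, b) \<in> G" for x y a b
    using sub(1)[OF that(1) sub(1)[OF zero that(2)]] by simp
  have uniq: "a = b" if "(x, a) \<in> G" "(x, b) \<in> G" for x a b
    using z[of "a - b"] sub(1)[OF that] by simp
  define \<phi> where "\<phi> x = (SOME a. (x, a) \<in> G)" for x
  have \<phi>': "(x, \<phi> x) \<in> G" if "(x, a) \<in> G" for x a
    unfolding \<phi>_def by (rule someI[of "\<lambda>a. (x, a) \<in> G", OF that])
  then have \<phi>: "(x, \<phi> x) \<in> G" if "x \<in> fst ` G" for x using that by force
  have eq: "\<phi> x = a" if "(x, a) \<in> G" for x a
    using uniq[OF \<phi>'[OF that] that] .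
  have hom: "ring_hom_on (fst ` G) \<phi>"
  proof
    show "is_subring (fst ` G)"
      unfolding is_subring_def
    proof (intro conjI ballI)
      show "0 \<in> fst ` G" "1 \<in> fst ` G" using zero one by force+
      fix x y assume "x \<in> fst ` G" "y \<in> fst ` G"
      then have "(x - y, \<phi> x - \<phi> y) \<in> G" "(x * y, \<phi> x * \<phi> y) \<in> G" using sub[OF \<phi>[of x] \<phi>[of y]] by simp_all
      then show "x - y \<in> fst ` G" "x * y \<in> fst ` G" by force+
    qed
    show "\<phi> 1 = 1" using eq[OF one] .
    fix x y assume "x \<in> fst ` G" "y \<in> fst ` G"
    then show "\<phi> (x + y) = \<phi> x + \<phi> y" "\<phi> (x * y) = \<phi> x * \<phi> y"
      using eq[OF add[OF \<phi>[of x] \<phi>[of y]]] eq[OF sub(2)[OF \<phi>[of x] \<phi>[of y]]] by simp_all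
  qed
  moreover have "G = ring_hom_on.graph (fst ` G) \<phi>"
    unfolding ring_hom_on.graph_def[OF hom]
  proof (intro equalityI subsetI)
    fix z assume "z \<in> G"
    then show "z \<in> (\<lambda>x. (x, \<phi> x)) ` fst ` G" using eq[of "fst z" "snd z"] by force
  next
    fix z assume "z \<in> (\<lambda>x. (x, \<phi> x)) ` fst ` G"
    then show "z \<in> G" using \<phi> by blast
  qed
  ultimately show ?thesis using that by blast
qed

context ring_hom_on
begin

lemma hom_graph_ext:
  assumes "\<And>p. p \<in> polys S \<Longrightarrow> poly p x = 0 \<Longrightarrow> poly (map_poly \<phi> p) r = 0"
  shows "hom_graph (ext_graph x r)" "graph \<subseteq> ext_graph x r" "(x, r) \<in> ext_graph x r"
proof -
  note I = polys_intros[OF S]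
  have mem: "(poly p x, poly (map_poly \<phi> p) r) \<in> ext_graph x r" if "p \<in> polys S" for p
    using that by (auto simp: ext_graph_def)
  show "hom_graph (ext_graph x r)"
    unfolding hom_graph_def
  proof (intro conjI allI impI)
    have "[:1:] \<in> polys S" using I(15) S_intros(2) by blast
    from mem[OF this] show "(1, 1) \<in> ext_graph x r" by (simp add: map_hom_const hom_1)
    show "b = 0" if "(0, b) \<in> ext_graph x r" for b
      using that assms unfolding ext_graph_def by force
    fix y a z b assume *: "(y, a) \<in> ext_graph x r \<and> (z, b) \<in> ext_graph x r"
    then obtain p q where "p \<in> polys S" "q \<in> polys S" "y = poly p x" "a = poly (map_poly \<phi> p) r"
      "z = poly q x" "b = poly (map_poly \<phi> q) r" by (auto simp: ext_graph_def)
    then show "(y - z, a - b) \<in> ext_graph x r" "(y * z, a * b) \<in> ext_graph x r"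
      using mem[of "p - q"] mem[of "p * q"] by (simp_all add: map_hom_diff map_hom_mult I)
  qed
  show "graph \<subseteq> ext_graph x r"
  proof
    fix z assume "z \<in> graph"
    then obtain s where "s \<in> S" "z = (s, \<phi> s)" by (auto simp: graph_def)
    then show "z \<in> ext_graph x r" using mem[of "[:s:]"] I(15) by (simp add: map_hom_const)
  qed
  have "map_poly \<phi> [:0, 1:] = [:0, 1:]"
    by (intro poly_eqI) (simp add: coeff_pCons hom_1 split: nat.split)
  then show "(x, r) \<in> ext_graph x r" using mem[OF polys_X[OF S]] by simp
qed

end

text \<open>The maximal elements in Chevalley's extension theorem; the aim is that S is a valuation
  ring with residue map \<phi>.\<close>

locale maximal_hom = ring_hom_on S \<phi> for S :: "'a::alg_closed_field set" and \<phi> :: "'a \<Rightarrow> 'a" +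
  assumes maximal: "hom_graph G \<Longrightarrow> graph \<subseteq> G \<Longrightarrow> G = graph"
begin

lemma ext_in:
  assumes "\<And>p. p \<in> polys S \<Longrightarrow> poly p x = 0 \<Longrightarrow> poly (map_poly \<phi> p) r = 0"
  shows "x \<in> S"
proof -
  have "(x, r) \<in> graph" using hom_graph_ext[OF assms] maximal by blast
  then show ?thesis by (auto simp: graph_def)
qed

text \<open>Sending 1/s to 1/\<phi>(s) respects all relations: a relation p(1/s) = 0 multiplied by a
  power of s becomes an equation inside S, to which \<phi> applies. Maximality then puts 1/s into
  S.\<close>

lemma unit_inverse:
  assumes s: "s \<in> S" "\<phi> s \<noteq> 0"
  shows "inverse s \<in> S" "\<phi> (inverse s) = inverse (\<phi> s)"
proof -
  have s0: "s \<noteq> 0" using s by auto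
  show inv: "inverse s \<in> S"
  proof (rule ext_in[where r = "inverse (\<phi> s)"])
    fix p assume p: "p \<in> polys S" "poly p (inverse s) = 0"
    let ?n = "degree p"
    have pw: "inverse t ^ i * t ^ ?n = t ^ (?n - i)" if "i \<le> ?n" "t \<noteq> 0" for i and t :: 'a
      using that by (simp add: power_inverse power_diff field_simps)
    have "0 = poly p (inverse s) * s ^ ?n" using p by simp
    also have "\<dots> = (\<Sum>i\<le>?n. coeff p i * s ^ (?n - i))"
      unfolding poly_altdef sum_distrib_right using pw s0 by (intro sum.cong) (auto simp: mult.assoc)
    finally have "0 = \<phi> (\<Sum>i\<le>?n. coeff p i * s ^ (?n - i))" by simp
    also have "\<dots> = (\<Sum>i\<le>?n. \<phi> (coeff p i) * \<phi> s ^ (?n - i))"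
      using polysD[OF p(1)] s by (subst hom_sum) (auto simp: S_intros hom_mult hom_power)
    also have "\<dots> = poly (map_poly \<phi> p) (inverse (\<phi> s)) * \<phi> s ^ ?n"
      unfolding poly_map_hom sum_distrib_right using pw s by (intro sum.cong) (auto simp: mult.assoc)
    finally show "poly (map_poly \<phi> p) (inverse (\<phi> s)) = 0" using s by simp
  qed
  have "\<phi> s * \<phi> (inverse s) = 1" using hom_mult[OF s(1) inv] s0 hom_1 by simp
  then show "\<phi> (inverse s) = inverse (\<phi> s)" by (simp add: inverse_unique)
qed

lemma residue_subfield: "is_subfield (\<phi> ` S)"
  unfolding is_subfield_def is_subring_def
proof (intro conjI ballI)
  show "0 \<in> \<phi> ` S" "1 \<in> \<phi> ` S" using S_intros(1,2) hom_0 hom_1 by force+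
  fix x assume "x \<in> \<phi> ` S"
  then obtain a where a: "a \<in> S" "x = \<phi> a" by blast
  show "inverse x \<in> \<phi> ` S"
    using unit_inverse[OF a(1)] a S_intros(1) hom_0 by (cases "x = 0") force+
  fix y assume "y \<in> \<phi> ` S"
  then obtain b where b: "b \<in> S" "y = \<phi> b" by blast
  show "x - y \<in> \<phi> ` S" "x * y \<in> \<phi> ` S"
    using a b hom_diff hom_mult S_intros(3,4) by (metis image_eqI)+
qed

text \<open>The reductions of the relations of x form an ideal of polynomials over the residue
  field. A common root r would allow the extension x \<mapsto> r; so the nonzero element of least
  degree, which divides all others, has no root in the algebraically closed field and is a
  constant.\<close>

lemma notin_imp_relation:
  assumes x: "x \<notin> S"
  shows "\<exists>p\<in>polys S. poly p x = 0 \<and> map_poly \<phi> p = 1"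
proof -
  note I = polys_intros[OF S]
  define J where "J = {map_poly \<phi> p | p. p \<in> polys S \<and> poly p x = 0}"
  have kJ: "J \<subseteq> polys (\<phi> ` S)" unfolding J_def polys_def by auto
  have J_mult: "map_poly \<phi> a * g \<in> J" if ag: "a \<in> polys S" "g \<in> J" for a g
  proof -
    obtain p where "p \<in> polys S" "poly p x = 0" "g = map_poly \<phi> p" using ag unfolding J_def by blast
    then show ?thesis unfolding J_def using ag by (auto simp: I map_hom_mult intro!: exI[of _ "a * p"])
  qed
  have J_diff: "g - h \<in> J" if gh: "g \<in> J" "h \<in> J" for g h
  proof -
    obtain p q where "p \<in> polys S" "poly p x = 0" "g = map_poly \<phi> p" "q \<in> polys S" "poly q x = 0" "h = map_poly \<phi> q"
      using gh unfolding J_def by blast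
    then show ?thesis unfolding J_def by (auto simp: I map_hom_diff intro!: exI[of _ "p - q"])
  qed
  have lift: "\<exists>a\<in>polys S. b = map_poly \<phi> a" if b: "b \<in> polys (\<phi> ` S)" for b
  proof -
    have "\<forall>i. \<exists>s\<in>S. coeff b i = \<phi> s" using polysD[OF b] by blast
    then obtain s where s: "\<And>i. s i \<in> S \<and> coeff b i = \<phi> (s i)" by metis
    define a where "a = (\<Sum>i\<le>degree b. monom (s i) i)"
    have co: "coeff a i = (if i \<le> degree b then s i else 0)" for i by (simp add: a_def coeff_sum)
    have "a \<in> polys S" using s S_intros(1) by (auto simp: polys_def co)
    moreover have "b = map_poly \<phi> a"
    proof (rule poly_eqI)
      fix i
      show "coeff b i = coeff (map_poly \<phi> a) i"
        using s[of i] by (cases "i \<le> degree b") (simp_all add: co coeff_eq_0)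
    qed
    ultimately show ?thesis by blast
  qed
  have J_ne: "\<exists>g\<in>J. poly g r \<noteq> 0" for r
    using ext_in[of x r] x unfolding J_def by blast
  obtain g0 where "g0 \<in> J" "poly g0 0 \<noteq> 0" using J_ne[of 0] by blast
  then have "g0 \<in> J \<and> g0 \<noteq> 0" by auto
  then obtain \<psi> where \<psi>: "\<psi> \<in> J" "\<psi> \<noteq> 0" and min: "\<And>g. g \<in> J \<and> g \<noteq> 0 \<Longrightarrow> degree \<psi> \<le> degree g"
    using ex_has_least_nat[of "\<lambda>g. g \<in> J \<and> g \<noteq> 0" g0 degree] by blast
  have "degree \<psi> = 0"
  proof (rule ccontr)
    assume "degree \<psi> \<noteq> 0"
    then obtain r where r: "poly \<psi> r = 0" using alg_closed_imp_poly_has_root[of \<psi>] by auto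
    obtain g where g: "g \<in> J" "poly g r \<noteq> 0" using J_ne by blast
    have gk: "g \<in> polys (\<phi> ` S)" "\<psi> \<in> polys (\<phi> ` S)" using g(1) \<psi>(1) kJ by (auto dest: subsetD)
    obtain a b where ab: "a \<in> polys (\<phi> ` S)" "g = \<psi> * a + b" "b = 0 \<or> degree b < degree \<psi>"
      using polys_division[OF residue_subfield gk \<psi>(2)] by blast
    obtain a' where a': "a' \<in> polys S" "a = map_poly \<phi> a'" using lift[OF ab(1)] by blast
    have "g - map_poly \<phi> a' * \<psi> \<in> J" using J_diff[OF g(1) J_mult[OF a'(1) \<psi>(1)]] .
    moreover have "g - map_poly \<phi> a' * \<psi> = b" using ab(2) a'(2) by simp
    ultimately have "b \<in> J" by simp
    then have "b = 0" using min[of b] ab(3) by (cases "b = 0") simp_all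
    then show False using ab(2) g(2) r by simp
  qed
  then obtain c where c: "\<psi> = [:c:]" using degree_eq_zeroE by blast
  then have c0: "c \<noteq> 0" using \<psi>(2) by simp
  have "\<psi> \<in> polys (\<phi> ` S)" using \<psi>(1) kJ by (rule set_rev_mp)
  from polysD[OF this, of 0] have "c \<in> \<phi> ` S" by (simp add: c)
  from subfield_inverse[OF residue_subfield this] obtain s where s: "s \<in> S" "inverse c = \<phi> s" by blast
  have "map_poly \<phi> [:s:] * \<psi> \<in> J" using J_mult[OF I(15)[OF s(1)] \<psi>(1)] .
  moreover have "map_poly \<phi> [:s:] * \<psi> = 1" using s(2) c0 by (simp add: c map_hom_const one_pCons flip: s(2))
  ultimately have "1 \<in> J" by simp
  then show ?thesis unfolding J_def by force
qed

text \<open>Reversing the relation of 1/x gives a relation Q of x with unit leading coefficient and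
  degree at most that of p. A multiple of Q cancels the leading term of p; the factor e has image 0,
  so the reduction stays 1.\<close>

lemma reduce_relation:
  assumes p: "p \<in> polys S" "poly p x = 0" "map_poly \<phi> p = 1" and x: "x \<noteq> 0"
    and q: "q \<in> polys S" "poly q (inverse x) = 0" "map_poly \<phi> q = 1" and le: "degree q \<le> degree p"
  shows "\<exists>p'\<in>polys S. poly p' x = 0 \<and> map_poly \<phi> p' = 1 \<and> degree p' < degree p"
proof -
  note I = polys_intros[OF S]
  let ?n = "degree p" and ?m = "degree q"
  have co: "\<phi> (coeff p i) = (if i = 0 then 1 else 0)" "\<phi> (coeff q i) = (if i = 0 then 1 else 0)" for i
    using arg_cong[OF p(3), of "\<lambda>f. coeff f i"] arg_cong[OF q(3), of "\<lambda>f. coeff f i"] by auto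
  have q0: "coeff q 0 \<noteq> 0" using co(2)[of 0] by auto
  have n0: "?n > 0"
  proof (rule ccontr)
    assume "\<not> ?n > 0"
    then obtain a where "p = [:a:]" using degree_eq_zeroE[of p] by blast
    then show False using p(2) co(1)[of 0] by simp
  qed
  define Q where "Q = reflect_poly q"
  have Q: "Q \<in> polys S" using polysD[OF q(1)] S_intros(1) by (auto simp: polys_def Q_def coeff_reflect_poly)
  have dQ: "degree Q = ?m" unfolding Q_def using q0 by simp
  have lQ: "coeff Q ?m = coeff q 0" unfolding Q_def by (simp add: coeff_reflect_poly)
  have Qx: "poly Q x = 0" unfolding Q_def using poly_reflect_poly_nz[OF x, of q] q(2) by simp
  have iq: "inverse (coeff q 0) \<in> S" using unit_inverse(1)[of "coeff q 0"] polysD[OF q(1)] co(2)[of 0] by simp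
  define e where "e = coeff p ?n * inverse (coeff q 0)"
  have e: "e \<in> S" "\<phi> e = 0"
    using iq polysD[OF p(1)] co(1)[of ?n] n0 by (auto simp: e_def S_intros hom_mult)
  define p' where "p' = p - smult e (monom 1 (?n - ?m) * Q)"
  have mQ: "monom 1 (?n - ?m) * Q \<in> polys S" using Q S_intros(2) by (intro I)
  have sm: "smult e (monom 1 (?n - ?m) * Q) \<in> polys S" using I(6)[OF e(1) mQ] .
  have "p' \<in> polys S" unfolding p'_def using I(4)[OF p(1) sm] .
  moreover have "poly p' x = 0" using p(2) Qx by (simp add: p'_def)
  moreover have "map_poly \<phi> p' = 1"
  proof -
    have "map_poly \<phi> (smult e (monom 1 (?n - ?m) * Q)) = 0"
      using e polysD[OF mQ] by (intro poly_eqI) (simp add: hom_mult)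
    then show ?thesis unfolding p'_def using p sm by (simp add: map_hom_diff)
  qed
  moreover have "degree p' < ?n"
  proof (rule degree_lessI)
    have le': "degree (smult e (monom 1 (?n - ?m) * Q)) \<le> ?n"
      using degree_mult_le[of "monom 1 (?n - ?m)" Q] degree_monom_le[of "1::'a" "?n - ?m"] dQ le
      by (intro order_trans[OF degree_smult_le]) linarith
    show "\<forall>k\<ge>?n. coeff p' k = 0"
    proof (intro allI impI)
      fix k assume k: "?n \<le> k"
      have "coeff (monom 1 (?n - ?m) * Q) ?n = coeff Q ?m"
        using le by (simp add: coeff_monom_mult)
      then have "coeff p' ?n = 0" unfolding p'_def using lQ q0 by (simp add: e_def)
      moreover have "degree p' \<le> ?n" unfolding p'_def using le' by (intro degree_diff_le) auto
      ultimately show "coeff p' k = 0" using k by (cases "k = ?n") (auto simp: coeff_eq_0)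
    qed
  qed (use n0 in simp)
  ultimately show ?thesis by blast
qed

text \<open>Otherwise take relations of least degree for x and for 1/x; the one whose degree is not
  the smaller could be shortened by the other.\<close>

lemma valuation: "x \<in> S \<or> inverse x \<in> S"
proof (rule ccontr)
  assume "\<not> ?thesis"
  then have x: "x \<notin> S" "inverse x \<notin> S" by auto
  have x0: "x \<noteq> 0" using x S_intros(1) by auto
  let ?P = "\<lambda>y p. p \<in> polys S \<and> poly p y = 0 \<and> map_poly \<phi> p = 1"
  have least: "\<exists>p. ?P y p \<and> (\<forall>p'. ?P y p' \<longrightarrow> degree p \<le> degree p')" if "y \<notin> S" for y
  proof -
    obtain p0 where "?P y p0" using notin_imp_relation[OF \<open>y \<notin> S\<close>] by blast
    from ex_has_least_nat[of "?P y", OF this, of degree] show ?thesis .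
  qed
  obtain p where p: "?P x p" and minp: "\<And>p'. ?P x p' \<Longrightarrow> degree p \<le> degree p'"
    using least[OF x(1)] by blast
  obtain q where q: "?P (inverse x) q" and minq: "\<And>q'. ?P (inverse x) q' \<Longrightarrow> degree q \<le> degree q'"
    using least[OF x(2)] by blast
  show False
  proof (cases "degree q \<le> degree p")
    case True
    from p q have "\<exists>p'\<in>polys S. poly p' x = 0 \<and> map_poly \<phi> p' = 1 \<and> degree p' < degree p"
      by (intro reduce_relation[of p x q] x0 True) simp_all
    then obtain p' where "?P x p'" "degree p' < degree p" by blast
    then show False using minp[of p'] by simp
  next
    case False
    from p q x0 False have "\<exists>q'\<in>polys S. poly q' (inverse x) = 0 \<and> map_poly \<phi> q' = 1 \<and> degree q' < degree q"
      by (intro reduce_relation[of q "inverse x" p]) simp_all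
    then obtain q' where "?P (inverse x) q'" "degree q' < degree q" by blast
    then show False using minq[of q'] by simp
  qed
qed

lemma place_of_maximal: "is_place UNIV (\<lambda>x. if x \<in> S then Some (\<phi> x) else None)"
proof -
  have "inverse x \<in> S" "\<phi> (inverse x) = 0" if "x \<notin> S" for x
    using valuation[of x] unit_inverse(1)[of "inverse x"] that by auto
  moreover have "val_ring UNIV (\<lambda>x. if x \<in> S then Some (\<phi> x) else None) = S"
    by (auto simp: val_ring_def)
  ultimately show ?thesis
    unfolding is_place_def using S S_intros hom_1 hom_add hom_mult by auto
qed

end

text \<open>Chevalley's theorem: the union of a chain of graphs is a graph, and a maximal graph
  above that of \<psi> belongs to a \<open>maximal_hom\<close>.\<close>

theorem place_extension:
  fixes \<psi> :: "'c::alg_closed_field \<Rightarrow> 'c"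
  assumes "ring_hom_on S' \<psi>"
  shows "\<exists>P. is_place UNIV P \<and> (\<forall>x\<in>S'. P x = Some (\<psi> x))"
proof -
  interpret h: ring_hom_on S' \<psi> by fact
  let ?A = "{G. hom_graph G \<and> h.graph \<subseteq> G}"
  have "\<exists>M\<in>?A. \<forall>X\<in>?A. M \<subseteq> X \<longrightarrow> X = M"
  proof (rule subset_Zorn_nonempty)
    show "?A \<noteq> {}" using h.hom_graph_graph by blast
    fix C assume C: "C \<noteq> {}" "subset.chain ?A C"
    have CA: "hom_graph G" "h.graph \<subseteq> G" if "G \<in> C" for G
      using C(2) that unfolding subset_chain_def by blast+
    have dir: "\<exists>H\<in>C. G1 \<subseteq> H \<and> G2 \<subseteq> H" if "G1 \<in> C" "G2 \<in> C" for G1 G2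
    proof -
      have "G1 \<subseteq> G2 \<or> G2 \<subseteq> G1" using C(2) that unfolding subset_chain_def by blast
      then show ?thesis using that by (elim disjE) blast+
    qed
    have "hom_graph (\<Union>C)"
      unfolding hom_graph_def
    proof (intro conjI allI impI)
      obtain G where "G \<in> C" using C(1) by blast
      then show "(1, 1) \<in> \<Union>C" using CA(1)[of G] unfolding hom_graph_def by blast
      show "b = 0" if ob: "(0, b) \<in> \<Union>C" for b
      proof -
        obtain G where G: "G \<in> C" "(0, b) \<in> G" using ob by blast
        then show ?thesis using CA(1)[OF G(1)] unfolding hom_graph_def by blast
      qed
      fix x a y b assume "(x, a) \<in> \<Union>C \<and> (y, b) \<in> \<Union>C"
      then obtain G1 G2 where G: "G1 \<in> C" "(x, a) \<in> G1" "G2 \<in> C" "(y, b) \<in> G2" by blast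
      obtain H where H: "H \<in> C" "(x, a) \<in> H" "(y, b) \<in> H"
        using dir[OF G(1,3)] G(2,4) by blast
      then have "(x - y, a - b) \<in> H" "(x * y, a * b) \<in> H" using CA(1)[OF H(1)] unfolding hom_graph_def by blast+
      then show "(x - y, a - b) \<in> \<Union>C" "(x * y, a * b) \<in> \<Union>C" using H by blast+
    qed
    moreover have "h.graph \<subseteq> \<Union>C" using C(1) CA(2) by blast
    ultimately show "\<Union>C \<in> ?A" by simp
  qed
  then obtain M where M': "M \<in> ?A" "\<forall>X\<in>?A. M \<subseteq> X \<longrightarrow> X = M" by (rule bexE)
  then have M: "hom_graph M" "h.graph \<subseteq> M" by simp_all
  have max: "X = M" if "hom_graph X" "M \<subseteq> X" for X
  proof -
    have "X \<in> ?A" using that M(2) by auto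
    then show ?thesis using M'(2) that(2) by simp
  qed
  obtain \<chi> where \<chi>: "ring_hom_on (fst ` M) \<chi>" "M = ring_hom_on.graph (fst ` M) \<chi>"
    by (rule hom_graph_hom[OF M(1)])
  interpret m: ring_hom_on "fst ` M" \<chi> by fact
  interpret m: maximal_hom "fst ` M" \<chi>
    by unfold_locales (use max in \<open>simp flip: \<chi>(2)\<close>)
  have "x \<in> fst ` M \<and> \<chi> x = \<psi> x" if "x \<in> S'" for x
  proof -
    have "(x, \<psi> x) \<in> M" using M(2) that unfolding h.graph_def by blast
    then have "(x, \<psi> x) \<in> m.graph" using \<chi>(2) by simp
    then show ?thesis unfolding m.graph_def by auto
  qed
  then show ?thesis
    using m.place_of_maximal by (intro exI[of _ "\<lambda>x. if x \<in> fst ` M then Some (\<chi> x) else None"]) auto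
qed

subsection \<open>Polynomials in several variables and algebraic independence\<close>

definition mon :: "('v \<Rightarrow> 'a::comm_ring_1) \<Rightarrow> ('v \<Rightarrow>\<^sub>0 nat) \<Rightarrow> 'a" where
  "mon x m = (\<Prod>v\<in>Poly_Mapping.keys m. x v ^ Poly_Mapping.lookup m v)"

definition mpolys :: "'a::zero set \<Rightarrow> 'v set \<Rightarrow> ('v, 'a) mpoly set" where
  "mpolys K Y = {p. mpoly_coeffs p \<subseteq> K \<and> mpoly_vars p \<subseteq> Y}"

lemma mpoly_eval_mon: "mpoly_eval x p = (\<Sum>m\<in>Poly_Mapping.keys p. Poly_Mapping.lookup p m * mon x m)"
  by (simp add: mpoly_eval_def mon_def)

lemma mon_superset:
  assumes "finite A" "Poly_Mapping.keys m \<subseteq> A"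
  shows "mon x m = (\<Prod>v\<in>A. x v ^ Poly_Mapping.lookup m v)"
  unfolding mon_def using assms by (intro prod.mono_neutral_left) (auto simp: in_keys_iff)

lemma mon_add: "mon x (m + n) = mon x m * mon x n"
proof -
  let ?A = "Poly_Mapping.keys m \<union> Poly_Mapping.keys n"
  have "mon x (m + n) = (\<Prod>v\<in>?A. x v ^ Poly_Mapping.lookup (m + n) v)"
    using keys_add[of m n] by (intro mon_superset) auto
  also have "\<dots> = (\<Prod>v\<in>?A. x v ^ Poly_Mapping.lookup m v) * (\<Prod>v\<in>?A. x v ^ Poly_Mapping.lookup n v)"
    by (simp add: lookup_add power_add prod.distrib)
  also have "\<dots> = mon x m * mon x n"
    using mon_superset[of ?A m x] mon_superset[of ?A n x] by simp
  finally show ?thesis .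
qed

lemma mon_0: "mon x 0 = 1" by (simp add: mon_def)

lemma mon_single: "mon x (Poly_Mapping.single v k) = x v ^ k"
  by (simp add: mon_def)

lemma mpoly_eval_0: "mpoly_eval x 0 = 0" by (simp add: mpoly_eval_def)

lemma mpoly_eval_single: "mpoly_eval x (Poly_Mapping.single m c) = c * mon x m"
  by (simp add: mpoly_eval_mon)

lemma mpoly_eval_add: "mpoly_eval x (p + q) = mpoly_eval x p + mpoly_eval x q"
  unfolding mpoly_eval_mon
  by (rule setsum_keys_plus_distrib) (simp_all add: distrib_right)

lemma mpoly_eval_sum: "mpoly_eval x (\<Sum>i\<in>I. f i) = (\<Sum>i\<in>I. mpoly_eval x (f i))"
  by (induction I rule: infinite_finite_induct) (simp_all add: mpoly_eval_0 mpoly_eval_add)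

lemma mpolysI:
  assumes "\<And>m. Poly_Mapping.lookup p m \<in> K"
    and "\<And>m. Poly_Mapping.lookup p m \<noteq> 0 \<Longrightarrow> Poly_Mapping.keys m \<subseteq> Y"
  shows "p \<in> mpolys K Y"
  using assms by (auto simp: mpolys_def mpoly_coeffs_def mpoly_vars_def in_keys_iff)

lemma mpolysD:
  assumes "p \<in> mpolys K Y"
  shows "0 \<in> K \<Longrightarrow> Poly_Mapping.lookup p m \<in> K"
    and "m \<in> Poly_Mapping.keys p \<Longrightarrow> Poly_Mapping.keys m \<subseteq> Y"
    and "m \<in> Poly_Mapping.keys p \<Longrightarrow> Poly_Mapping.lookup p m \<in> K"
proof -
  show *: "m \<in> Poly_Mapping.keys p \<Longrightarrow> Poly_Mapping.lookup p m \<in> K"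
    using assms by (auto simp: mpolys_def mpoly_coeffs_def)
  show "0 \<in> K \<Longrightarrow> Poly_Mapping.lookup p m \<in> K"
    using * by (cases "m \<in> Poly_Mapping.keys p") (auto simp: in_keys_iff)
  show "m \<in> Poly_Mapping.keys p \<Longrightarrow> Poly_Mapping.keys m \<subseteq> Y"
    using assms by (auto simp: mpolys_def mpoly_vars_def)
qed

lemma mpolys_single:
  "0 \<in> K \<Longrightarrow> c \<in> K \<Longrightarrow> Poly_Mapping.keys m \<subseteq> Y \<Longrightarrow> Poly_Mapping.single m c \<in> mpolys K Y"
  by (rule mpolysI) (auto simp: lookup_single when_def split: if_splits)

lemma mpolys_add:
  assumes K: "is_subring K" and "p \<in> mpolys K Y" "q \<in> mpolys K Y"
  shows "p + q \<in> mpolys K Y"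
proof (rule mpolysI)
  fix m
  show "Poly_Mapping.lookup (p + q) m \<in> K"
    using mpolysD(1)[OF assms(2)] mpolysD(1)[OF assms(3)] subring_intros(1,6)[OF K] by (simp add: lookup_add)
  assume "Poly_Mapping.lookup (p + q) m \<noteq> 0"
  then have "m \<in> Poly_Mapping.keys p \<or> m \<in> Poly_Mapping.keys q" by (auto simp: lookup_add in_keys_iff)
  then show "Poly_Mapping.keys m \<subseteq> Y" using mpolysD(2)[OF assms(2)] mpolysD(2)[OF assms(3)] by blast
qed

lemma mpolys_sum:
  assumes K: "is_subring K" and "\<And>i. i \<in> I \<Longrightarrow> f i \<in> mpolys K Y"
  shows "(\<Sum>i\<in>I. f i) \<in> mpolys K Y"
  using assms(2)
proof (induction I rule: infinite_finite_induct)
  case (insert i I)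
  then show ?case by (simp add: mpolys_add[OF K])
qed (auto intro!: mpolysI subring_0[OF K])

lemma mon_in:
  assumes "is_subring R" "\<And>v. v \<in> Poly_Mapping.keys m \<Longrightarrow> x v \<in> R"
  shows "mon x m \<in> R"
  unfolding mon_def using assms by (intro subring_intros(9)[OF assms(1)] subring_intros(7)[OF assms(1)]) auto

lemma mpoly_eval_in:
  assumes R: "is_subring R" and "K \<subseteq> R" "p \<in> mpolys K Y" "\<And>v. v \<in> Y \<Longrightarrow> x v \<in> R"
  shows "mpoly_eval x p \<in> R"
  unfolding mpoly_eval_mon
proof (rule subring_intros(8)[OF R])
  fix m assume m: "m \<in> Poly_Mapping.keys p"
  have "mon x m \<in> R" using mpolysD(2)[OF assms(3) m] assms(4) by (intro mon_in[OF R]) auto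
  then show "Poly_Mapping.lookup p m * mon x m \<in> R"
    using mpolysD(3)[OF assms(3) m] assms(2) subring_intros(4)[OF R] by blast
qed

lemma ring_adjoin_mpolys:
  assumes K: "is_subring (K :: 'a::field set)"
  shows "ring_adjoin K Y = mpoly_eval (\<lambda>t. t) ` mpolys K Y" (is "_ = ?B")
proof
  let ?e = "mpoly_eval (\<lambda>t. t)"
  have B: "?e p \<in> ?B" if "p \<in> mpolys K Y" for p using that by blast
  note one_zero = subring_intros(1,2)[OF K]
  have "is_subring ?B"
    unfolding is_subring_def
  proof (intro conjI ballI)
    show "0 \<in> ?B" using B[OF mpolysI[of 0 K Y]] one_zero by (simp add: mpoly_eval_0)
    show "1 \<in> ?B" using B[OF mpolys_single[of K 1 0 Y]] one_zero by (simp only: mpoly_eval_single mon_0) simp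
    fix a b assume "a \<in> ?B" "b \<in> ?B"
    then obtain p q where p: "p \<in> mpolys K Y" "a = ?e p" and q: "q \<in> mpolys K Y" "b = ?e q" by blast
    define s where "s = (\<Sum>m\<in>Poly_Mapping.keys q. Poly_Mapping.single m (- Poly_Mapping.lookup q m))"
    have s: "s \<in> mpolys K Y" unfolding s_def
      using mpolysD[OF q(1)] one_zero subring_intros(5)[OF K] by (intro mpolys_sum[OF K] mpolys_single) auto
    have "?e s = (\<Sum>m\<in>Poly_Mapping.keys q. - Poly_Mapping.lookup q m * mon (\<lambda>t. t) m)"
      unfolding s_def by (simp only: mpoly_eval_sum mpoly_eval_single)
    also have "\<dots> = - b" unfolding q(2) mpoly_eval_mon by (simp add: sum_negf)
    finally have "?e s = - b" .
    then have "?e (p + s) = a - b" using p by (simp add: mpoly_eval_add)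
    then show "a - b \<in> ?B" using B[OF mpolys_add[OF K p(1) s]] by simp
    define r where "r = (\<Sum>m\<in>Poly_Mapping.keys p. \<Sum>n\<in>Poly_Mapping.keys q.
      Poly_Mapping.single (m + n) (Poly_Mapping.lookup p m * Poly_Mapping.lookup q n))"
    have r: "r \<in> mpolys K Y" unfolding r_def
    proof (intro mpolys_sum[OF K] mpolys_single)
      fix m n assume mn: "m \<in> Poly_Mapping.keys p" "n \<in> Poly_Mapping.keys q"
      show "Poly_Mapping.keys (m + n) \<subseteq> Y"
        using keys_add[of m n] mpolysD(2)[OF p(1) mn(1)] mpolysD(2)[OF q(1) mn(2)] by blast
      show "Poly_Mapping.lookup p m * Poly_Mapping.lookup q n \<in> K"
        using mpolysD(3)[OF p(1) mn(1)] mpolysD(3)[OF q(1) mn(2)] subring_intros(4)[OF K] by blast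
    qed (rule one_zero)
    have "?e r = (\<Sum>m\<in>Poly_Mapping.keys p. \<Sum>n\<in>Poly_Mapping.keys q.
      (Poly_Mapping.lookup p m * Poly_Mapping.lookup q n) * (mon (\<lambda>t. t) m * mon (\<lambda>t. t) n))"
      unfolding r_def by (simp only: mpoly_eval_sum mpoly_eval_single mon_add)
    also have "\<dots> = a * b" unfolding p(2) q(2) mpoly_eval_mon sum_product
      by (intro sum.cong refl) (simp add: algebra_simps)
    finally have "?e r = a * b" .
    then show "a * b \<in> ?B" using B[OF r] by simp
  qed
  moreover have "K \<subseteq> ?B"
  proof
    fix c assume "c \<in> K"
    then show "c \<in> ?B" using B[OF mpolys_single[of K c 0 Y]] one_zero by (simp only: mpoly_eval_single mon_0) simp
  qed
  moreover have "Y \<subseteq> ?B"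
  proof
    fix y assume "y \<in> Y"
    then show "y \<in> ?B" using B[OF mpolys_single[of K 1 "Poly_Mapping.single y 1" Y]] one_zero
      by (simp only: mpoly_eval_single mon_single) simp
  qed
  ultimately show "ring_adjoin K Y \<subseteq> ?B" by (rule ring_adjoin_least)
  show "?B \<subseteq> ring_adjoin K Y"
    using ring_adjoin_base[of K Y] ring_adjoin_gens[of Y K]
    by (auto intro!: mpoly_eval_in[OF is_subring_ring_adjoin, of K])
qed

lemma adjoin_fractions:
  assumes K: "is_subfield K"
  shows "adjoin K Y = {a / b | a b. a \<in> ring_adjoin K Y \<and> b \<in> ring_adjoin K Y \<and> b \<noteq> 0}" (is "_ = ?B")
proof
  let ?R = "ring_adjoin K Y"
  have R: "is_subring ?R" by (rule is_subring_ring_adjoin)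
  note I = subring_intros[OF R]
  have B: "a / b \<in> ?B" if "a \<in> ?R" "b \<in> ?R" "b \<noteq> 0" for a b using that by blast
  have B': "a \<in> ?B" if "a \<in> ?R" for a using B[OF that I(2)] by simp
  have "is_subfield ?B"
    unfolding is_subfield_def is_subring_def
  proof (intro conjI ballI)
    show "0 \<in> ?B" "1 \<in> ?B" using B'[OF I(1)] B'[OF I(2)] by simp_all
    fix x assume "x \<in> ?B"
    then obtain a b where x: "x = a / b" "a \<in> ?R" "b \<in> ?R" "b \<noteq> 0" by blast
    show "inverse x \<in> ?B" using B[OF x(3,2)] B'[OF I(1)] x by (cases "a = 0") simp_all
    fix y assume "y \<in> ?B"
    then obtain c d where y: "y = c / d" "c \<in> ?R" "d \<in> ?R" "d \<noteq> 0" by blast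
    have "x - y = (a * d - c * b) / (b * d)" "x * y = (a * c) / (b * d)"
      using x y by (simp_all add: diff_frac_eq)
    moreover have "(a * d - c * b) / (b * d) \<in> ?B" "(a * c) / (b * d) \<in> ?B"
      using x y by (intro B I; simp)+
    ultimately show "x - y \<in> ?B" "x * y \<in> ?B" by simp_all
  qed
  moreover have "K \<subseteq> ?B" "Y \<subseteq> ?B" using B' ring_adjoin_base ring_adjoin_gens by blast+
  ultimately show "adjoin K Y \<subseteq> ?B" by (rule adjoin_least)
  show "?B \<subseteq> adjoin K Y"
    using ring_adjoin_subset_adjoin[of K Y] subfield_divide[OF is_subfield_adjoin] by blast
qed

lemma common_denominator:
  assumes K: "is_subfield K" and "finite I" "\<And>i. i \<in> I \<Longrightarrow> f i \<in> adjoin K Y"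
  shows "\<exists>d\<in>ring_adjoin K Y. d \<noteq> 0 \<and> (\<forall>i\<in>I. d * f i \<in> ring_adjoin K Y)"
  using assms(2,3)
proof (induction I)
  case empty
  show ?case using subring_1[OF is_subring_ring_adjoin, of K Y] by (intro bexI[of _ 1]) simp_all
next
  case (insert i I)
  let ?R = "ring_adjoin K Y"
  note J = subring_intros(4)[OF is_subring_ring_adjoin]
  have "\<exists>d\<in>?R. d \<noteq> 0 \<and> (\<forall>i\<in>I. d * f i \<in> ?R)"
    by (rule insert.IH) (rule insert.prems, simp)
  then obtain d where d: "d \<in> ?R" "d \<noteq> 0" "\<forall>i\<in>I. d * f i \<in> ?R" by blast
  have "f i \<in> adjoin K Y" using insert.prems by simp
  then obtain a b where ab: "f i = a / b" "a \<in> ?R" "b \<in> ?R" "b \<noteq> 0"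
    unfolding adjoin_fractions[OF K] by blast
  have "(d * b) * f j \<in> ?R" if "j \<in> insert i I" for j
  proof (cases "j = i")
    case True
    then have "(d * b) * f j = d * a" using ab by simp
    then show ?thesis using J[OF d(1) ab(2)] by (simp only:)
  next
    case False
    then have "d * f j \<in> ?R" using d(3) that by simp
    then have "b * (d * f j) \<in> ?R" using J[OF ab(3)] by blast
    then show ?thesis by (simp add: algebra_simps)
  qed
  then have "\<forall>j\<in>insert i I. (d * b) * f j \<in> ?R" by blast
  then show ?case using J[OF d(1) ab(3)] d(2) ab(4) by (intro bexI[of _ "d * b"] conjI) simp_all
qed

lemma alg_indepD:
  "alg_indep K Y \<Longrightarrow> p \<in> mpolys K Y \<Longrightarrow> mpoly_eval (\<lambda>t. t) p = 0 \<Longrightarrow> p = 0"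
  unfolding alg_indep_def mpolys_def by blast

text \<open>Clearing denominators turns an equation for y over K(Y - {y}) into a polynomial relation
  among the elements of Y. The polynomials \<open>q i\<close> do not involve the variable y, so
  different powers of y cannot cancel and the relation is nontrivial.\<close>

lemma alg_indep_transcendental:
  assumes K: "is_subfield (K :: 'a::field set)" and ind: "alg_indep K Y" and y: "y \<in> Y"
  shows "\<not> algebraic_over (adjoin K (Y - {y})) y"
proof
  let ?Y = "Y - {y}" and ?e = "mpoly_eval (\<lambda>t::'a. t)"
  have K': "is_subring K" using subfield_subring[OF K] .
  assume "algebraic_over (adjoin K ?Y) y"
  then obtain f where f: "f \<in> polys (adjoin K ?Y)" "f \<noteq> 0" "poly f y = 0"
    using algebraic_over_iff[OF is_subfield_adjoin] by blast
  obtain d where d: "d \<noteq> 0" "\<forall>i\<in>{..degree f}. d * coeff f i \<in> ring_adjoin K ?Y"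
    using common_denominator[OF K, of "{..degree f}" "coeff f" ?Y] polysD[OF f(1)] by auto
  then have "\<forall>i\<in>{..degree f}. \<exists>q. q \<in> mpolys K ?Y \<and> d * coeff f i = ?e q"
    unfolding ring_adjoin_mpolys[OF K'] by (simp add: image_iff Bex_def)
  from bchoice[OF this] obtain q where "\<forall>i\<in>{..degree f}. q i \<in> mpolys K ?Y \<and> d * coeff f i = ?e (q i)" ..
  then have q: "q i \<in> mpolys K ?Y \<and> d * coeff f i = ?e (q i)" if "i \<le> degree f" for i using that by simp
  define S where "S i m = Poly_Mapping.single (m + Poly_Mapping.single y i) (Poly_Mapping.lookup (q i) m)" for i m
  define p where "p = (\<Sum>i\<le>degree f. \<Sum>m\<in>Poly_Mapping.keys (q i). S i m)"
  have "p \<in> mpolys K Y" unfolding p_def S_def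
  proof (intro mpolys_sum[OF K'] mpolys_single)
    fix i m assume im: "i \<in> {..degree f}" "m \<in> Poly_Mapping.keys (q i)"
    have qi: "q i \<in> mpolys K ?Y" using q im by simp
    show "Poly_Mapping.lookup (q i) m \<in> K" using mpolysD(3)[OF qi im(2)] .
    show "Poly_Mapping.keys (m + Poly_Mapping.single y i) \<subseteq> Y"
      using keys_add[of m "Poly_Mapping.single y i"] mpolysD(2)[OF qi im(2)] y by (auto split: if_splits)
  qed (rule subring_0[OF K'])
  moreover have "?e p = 0"
  proof -
    have "?e p = (\<Sum>i\<le>degree f. \<Sum>m\<in>Poly_Mapping.keys (q i). Poly_Mapping.lookup (q i) m * (mon (\<lambda>t. t) m * y ^ i))"
      unfolding p_def S_def by (simp only: mpoly_eval_sum mpoly_eval_single mon_add mon_single)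
    also have "\<dots> = (\<Sum>i\<le>degree f. ?e (q i) * y ^ i)"
      unfolding mpoly_eval_mon sum_distrib_right by (simp add: mult.assoc)
    also have "\<dots> = (\<Sum>i\<le>degree f. d * coeff f i * y ^ i)"
      by (rule sum.cong) (use q in auto)
    also have "\<dots> = d * poly f y" by (simp add: poly_altdef sum_distrib_left mult.assoc)
    finally show ?thesis using f(3) by simp
  qed
  ultimately have p0: "p = 0" using alg_indepD[OF ind] by blast
  let ?n = "degree f"
  have "?e (q ?n) \<noteq> 0" using q[of ?n] d(1) f(2) by (metis le_refl leading_coeff_0_iff mult_eq_0_iff)
  then have "q ?n \<noteq> 0" by (auto simp: mpoly_eval_0)
  then obtain m where m: "m \<in> Poly_Mapping.keys (q ?n)" by (metis keys_eq_empty ex_in_conv)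
  have my: "Poly_Mapping.lookup k y = 0" if "k \<in> Poly_Mapping.keys (q i)" "i \<le> ?n" for k i
    using mpolysD(2)[of "q i" K ?Y k] q[OF that(2)] that(1) by (auto simp: in_keys_iff)
  \<comment> \<open>The product of y^n with a monomial m of the top coefficient; among all summands
    only \<open>S ?n m\<close> contributes to it.\<close>
  let ?k = "m + Poly_Mapping.single y ?n"
  have S0: "Poly_Mapping.lookup (S i k) ?k = (if i = ?n \<and> k = m then Poly_Mapping.lookup (q ?n) m else 0)"
    if "i \<le> ?n" "k \<in> Poly_Mapping.keys (q i)" for i k
  proof (cases "k + Poly_Mapping.single y i = ?k")
    case True
    from arg_cong[OF True, of "\<lambda>z. Poly_Mapping.lookup z y"] have "i = ?n"
      using my[OF that(2,1)] my[OF m] by (simp add: lookup_add)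
    then show ?thesis using True by (simp add: S_def)
  next
    case False
    then show ?thesis by (auto simp: S_def lookup_single)
  qed
  have "Poly_Mapping.lookup p ?k = (\<Sum>i\<le>?n. \<Sum>k\<in>Poly_Mapping.keys (q i). Poly_Mapping.lookup (S i k) ?k)"
    by (simp add: p_def lookup_sum)
  also have "\<dots> = (\<Sum>i\<le>?n. \<Sum>k\<in>Poly_Mapping.keys (q i). if i = ?n \<and> k = m then Poly_Mapping.lookup (q ?n) m else 0)"
    using S0 by (intro sum.cong refl) auto
  also have "\<dots> = (\<Sum>i\<le>?n. if i = ?n then Poly_Mapping.lookup (q ?n) m else 0)"
    using m by (intro sum.cong refl) auto
  also have "\<dots> = Poly_Mapping.lookup (q ?n) m" by simp
  finally show False using p0 m by (simp add: in_keys_iff)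
qed

text \<open>A relation is sorted by powers of x. Its coefficients vanish as elements of K(Y) because
  x is transcendental, and then as polynomials because Y is independent.\<close>

lemma alg_indep_insert:
  assumes K: "is_subfield (K :: 'a::field set)" and ind: "alg_indep K Y"
    and x: "\<not> algebraic_over (adjoin K Y) x" "x \<notin> Y"
  shows "alg_indep K (insert x Y)"
  unfolding alg_indep_def
proof (intro allI impI)
  fix p :: "('a, 'a) mpoly"
  let ?e = "mpoly_eval (\<lambda>t::'a. t)"
  assume *: "mpoly_coeffs p \<subseteq> K \<and> mpoly_vars p \<subseteq> insert x Y \<and> ?e p = 0"
  then have p: "p \<in> mpolys K (insert x Y)" by (simp add: mpolys_def)
  have K': "is_subring K" using subfield_subring[OF K] .
  let ?M = "Poly_Mapping.keys p"
  \<comment> \<open>\<open>del m\<close> removes x from the monomial m. Below, \<open>q i\<close> is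
    the coefficient of x^i as a polynomial in the other variables, and \<open>f\<close> is the same
    relation read as a polynomial in x over K(Y).\<close>
  define del where "del m = m - Poly_Mapping.single x (Poly_Mapping.lookup m x)" for m :: "'a \<Rightarrow>\<^sub>0 nat"
  have del: "del m + Poly_Mapping.single x (Poly_Mapping.lookup m x) = m" for m
    by (rule poly_mapping_eqI) (simp add: del_def lookup_add lookup_minus lookup_single when_def)
  have delx: "Poly_Mapping.lookup (del m) x = 0" for m by (simp add: del_def lookup_minus)
  have delY: "Poly_Mapping.keys (del m) \<subseteq> Y" if "m \<in> ?M" for m
  proof
    fix v assume v: "v \<in> Poly_Mapping.keys (del m)"
    then have "v \<noteq> x" using delx by (auto simp: in_keys_iff)
    moreover have "v \<in> Poly_Mapping.keys m" using v by (auto simp: in_keys_iff del_def lookup_minus)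
    ultimately show "v \<in> Y" using mpolysD(2)[OF p that] by auto
  qed
  define q where "q i = (\<Sum>m | m \<in> ?M \<and> Poly_Mapping.lookup m x = i. Poly_Mapping.single (del m) (Poly_Mapping.lookup p m))" for i
  have q: "q i \<in> mpolys K Y" for i unfolding q_def
    using delY mpolysD(3)[OF p] subring_0[OF K'] by (intro mpolys_sum[OF K'] mpolys_single) auto
  define f where "f = (\<Sum>m\<in>?M. monom (Poly_Mapping.lookup p m * mon (\<lambda>t. t) (del m)) (Poly_Mapping.lookup m x))"
  have cf: "coeff f i = ?e (q i)" for i
  proof -
    have "coeff f i = (\<Sum>m\<in>?M. if Poly_Mapping.lookup m x = i then Poly_Mapping.lookup p m * mon (\<lambda>t. t) (del m) else 0)"
      unfolding f_def coeff_sum coeff_monom ..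
    also have "\<dots> = (\<Sum>m\<in>{m \<in> ?M. Poly_Mapping.lookup m x = i}. Poly_Mapping.lookup p m * mon (\<lambda>t. t) (del m))"
      by (rule sum.inter_filter[symmetric]) simp
    also have "\<dots> = ?e (q i)" unfolding q_def by (simp only: mpoly_eval_sum mpoly_eval_single)
    finally show ?thesis .
  qed
  have "f \<in> polys (adjoin K Y)"
  proof -
    have "?e (q i) \<in> ring_adjoin K Y" for i
      unfolding ring_adjoin_mpolys[OF K'] by (rule imageI[OF q])
    then have "?e (q i) \<in> adjoin K Y" for i using ring_adjoin_subset_adjoin by (rule set_mp[rotated])
    then show ?thesis by (simp add: polys_def cf)
  qed
  moreover have "poly f x = 0"
  proof -
    have "poly f x = (\<Sum>m\<in>?M. Poly_Mapping.lookup p m * mon (\<lambda>t. t) m)"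
      unfolding f_def poly_sum poly_monom
    proof (rule sum.cong[OF refl])
      fix m
      have "mon (\<lambda>t. t) m = mon (\<lambda>t. t) (del m) * x ^ Poly_Mapping.lookup m x"
        using mon_add[of "\<lambda>t. t" "del m" "Poly_Mapping.single x (Poly_Mapping.lookup m x)"] del[of m]
        by (simp add: mon_single)
      then show "Poly_Mapping.lookup p m * mon (\<lambda>t. t) (del m) * x ^ Poly_Mapping.lookup m x = Poly_Mapping.lookup p m * mon (\<lambda>t. t) m"
        by simp
    qed
    then show ?thesis using * by (simp add: mpoly_eval_mon)
  qed
  ultimately have f0: "f = 0" using x(1) algebraic_over_iff[OF is_subfield_adjoin] by blast
  have q0: "q i = 0" for i using alg_indepD[OF ind q] cf[of i] f0 by simp
  show "p = 0"
  proof (rule ccontr)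
    assume "p \<noteq> 0"
    then obtain m where m: "m \<in> ?M" by (metis keys_eq_empty ex_in_conv)
    let ?i = "Poly_Mapping.lookup m x"
    have "Poly_Mapping.lookup (q ?i) (del m) = (\<Sum>k | k \<in> ?M \<and> Poly_Mapping.lookup k x = ?i. if k = m then Poly_Mapping.lookup p m else 0)"
      unfolding q_def lookup_sum
    proof (rule sum.cong[OF refl])
      fix k assume k: "k \<in> {k. k \<in> ?M \<and> Poly_Mapping.lookup k x = ?i}"
      have "k = m" if "del k = del m"
      proof -
        have "k = del k + Poly_Mapping.single x ?i" using del[of k] k by simp
        then show ?thesis unfolding that using del[of m] by simp
      qed
      then have "del k = del m \<longleftrightarrow> k = m" by blast
      then show "Poly_Mapping.lookup (Poly_Mapping.single (del k) (Poly_Mapping.lookup p k)) (del m) = (if k = m then Poly_Mapping.lookup p m else 0)"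
        by (auto simp: lookup_single)
    qed
    also have "\<dots> = Poly_Mapping.lookup p m" using m by simp
    finally show False using q0[of ?i] m by (simp add: in_keys_iff)
  qed
qed

lemma alg_indep_empty: "alg_indep K {}"
  unfolding alg_indep_def
proof (intro allI impI)
  fix p :: "('a, 'a) mpoly"
  assume *: "mpoly_coeffs p \<subseteq> K \<and> mpoly_vars p \<subseteq> {} \<and> mpoly_eval (\<lambda>t. t) p = 0"
  then have k: "Poly_Mapping.keys p \<subseteq> {0}" by (auto simp: mpoly_vars_def)
  show "p = 0"
  proof (rule ccontr)
    assume "p \<noteq> 0"
    then have "Poly_Mapping.keys p = {0}" using subset_singletonD[OF k] by simp
    then have "mpoly_eval (\<lambda>t. t) p = Poly_Mapping.lookup p 0" "Poly_Mapping.lookup p 0 \<noteq> 0"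
      by (simp_all add: mpoly_eval_mon mon_0 flip: in_keys_iff)
    then show False using * by simp
  qed
qed

section \<open>Algebraic elements, evaluation places and conjugation\<close>

lemma algebraic_trans_finite:
  assumes E: "is_subfield E" and "is_subfield M" "E \<subseteq> M" "has_dim E M n" "algebraic_over M x"
  shows "algebraic_over E x"
proof -
  obtain \<mu> where \<mu>: "is_minpoly M x \<mu>" using ex_minpoly[OF assms(2,5)] by blast
  have "has_dim E (adjoin M {x}) (n * degree \<mu>)"
    using has_dim_tower[OF E assms(2,3,4) adjoin_algebraic(2)[OF assms(2) \<mu>]] .
  moreover have "x \<in> adjoin M {x}" using adjoin_gens by blast
  ultimately show ?thesis
    using has_dim_algebraic[OF E subfield_subring[OF is_subfield_adjoin]] by blast
qed

lemma algebraic_adjoin: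
  assumes E: "is_subfield E" and "finite S" "\<And>s. s \<in> S \<Longrightarrow> algebraic_over E s" "x \<in> adjoin E S"
  shows "algebraic_over E x"
proof -
  obtain n where "has_dim E (adjoin E S) n" using finite_adjoin_algebraic[OF E assms(2,3)] by blast
  then show ?thesis using has_dim_algebraic[OF E subfield_subring[OF is_subfield_adjoin]] assms(4) by blast
qed

lemma algebraic_inverse:
  assumes E: "is_subfield E" and "algebraic_over E x"
  shows "algebraic_over E (inverse x)"
proof (rule algebraic_adjoin[OF E, of "{x}"])
  show "inverse x \<in> adjoin E {x}" using adjoin_gens[of "{x}" E] by (intro subfield_inverse[OF is_subfield_adjoin]) auto
qed (use assms in auto)

text \<open>The hypothesis says that x \<mapsto> r is well defined on E[x]; Chevalley's theorem
  extends it. For x transcendental over E the value r is arbitrary.\<close>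

lemma eval_place:
  fixes x r :: "'a::alg_closed_field"
  assumes E: "is_subfield E" and wd: "\<And>p. p \<in> polys E \<Longrightarrow> poly p x = 0 \<Longrightarrow> poly p r = 0"
  shows "\<exists>P. is_place UNIV P \<and> (\<forall>e\<in>E. P e = Some e) \<and> P x = Some r"
proof -
  interpret i: ring_hom_on E "\<lambda>x. x"
    by unfold_locales (use subfield_subring[OF E] in auto)
  have mp: "map_poly (\<lambda>x. x) p = p" for p :: "'a poly" by (intro poly_eqI) simp
  have wd': "poly (map_poly (\<lambda>x. x) p) r = 0" if "p \<in> polys E" "poly p x = 0" for p
    unfolding mp using that by (rule wd)
  let ?G = "i.ext_graph x r"
  have g: "hom_graph ?G" "i.graph \<subseteq> ?G" "(x, r) \<in> ?G"
    by (rule i.hom_graph_ext, erule (1) wd')+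
  obtain \<chi> where \<chi>: "ring_hom_on (fst ` ?G) \<chi>" "?G = ring_hom_on.graph (fst ` ?G) \<chi>"
    by (rule hom_graph_hom[OF g(1)])
  interpret c: ring_hom_on "fst ` ?G" \<chi> by fact
  have val: "y \<in> fst ` ?G \<and> \<chi> y = a" if "(y, a) \<in> ?G" for y a
  proof -
    have "(y, a) \<in> c.graph" using that \<chi>(2) by simp
    then show ?thesis unfolding c.graph_def by auto
  qed
  obtain P where P: "is_place UNIV P" "\<forall>y\<in>fst ` ?G. P y = Some (\<chi> y)"
    using place_extension[OF \<chi>(1)] by blast
  have "P e = Some e" if "e \<in> E" for e
  proof -
    have "(e, e) \<in> ?G" using g(2) that unfolding i.graph_def by blast
    from val[OF this] have "e \<in> fst ` ?G" "\<chi> e = e" by simp_all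
    from bspec[OF P(2) this(1)] this(2) show ?thesis by (simp only:)
  qed
  moreover have "P x = Some r"
  proof -
    from val[OF g(3)] have "x \<in> fst ` ?G" "\<chi> x = r" by simp_all
    from bspec[OF P(2) this(1)] this(2) show ?thesis by (simp only:)
  qed
  ultimately show ?thesis using P(1) by (intro exI[of _ P]) simp
qed

text \<open>Extending the residue map from the valuation ring of F keeps the poles: where Q has a
  pole, the inverse goes to 0 and cannot become a unit.\<close>

lemma place_extend:
  fixes F :: "'a::alg_closed_field set" and Q :: "'a \<Rightarrow> 'a option"
  assumes F: "is_subfield F" and Q: "is_place F Q"
  shows "\<exists>P. is_place UNIV P \<and> (\<forall>x\<in>F. P x = Q x)"
proof -
  let ?S = "val_ring F Q"
  note Q' = Q[unfolded is_place_def]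
  have "ring_hom_on ?S (the \<circ> Q)"
    by unfold_locales (use Q' in auto)
  then obtain P where P: "is_place UNIV P" "\<forall>x\<in>?S. P x = Some (the (Q x))"
    using place_extension by fastforce
  interpret place P by unfold_locales (rule P)
  have "P x = Q x" if x: "x \<in> F" for x
  proof (cases "Q x")
    case None
    then have *: "x \<noteq> 0" "Q (inverse x) = Some 0" using Q' x by auto
    then have "inverse x \<in> ?S" using subfield_inverse[OF F x] by (simp add: val_ring_def)
    then have "P (inverse x) = Some 0" using P(2) * by simp
    then have i: "inverse x \<in> V" "res (inverse x) = 0" by (simp_all add: P_eq_Some)
    have "x \<notin> V"
    proof
      assume "x \<in> V"
      from res_mult[OF this i(1)] show False using i(2) *(1) by simp
    qed
    then show ?thesis using None by (simp add: V_def)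
  next
    case (Some a)
    then have "x \<in> ?S" using x by (simp add: val_ring_def)
    then show ?thesis using P(2) Some by simp
  qed
  then show ?thesis using P(1) by blast
qed

context place
begin

lemma place_subfieldD:
  assumes "\<And>e. e \<in> E \<Longrightarrow> P e = Some e"
  shows "E \<subseteq> V" "e \<in> E \<Longrightarrow> res e = e"
  using assms by (auto simp: P_eq_Some)

lemma algebraic_in_V:
  assumes E: "is_subfield E" "\<And>e. e \<in> E \<Longrightarrow> P e = Some e" and "algebraic_over E x"
  shows "x \<in> V" "x \<noteq> 0 \<Longrightarrow> res x \<noteq> 0"
proof -
  have *: "y \<in> V" if y: "algebraic_over E y" for y
  proof -
    obtain \<mu> where \<mu>: "is_minpoly E y \<mu>" using ex_minpoly[OF E(1) y] by blast
    note d = is_minpolyD[OF \<mu>]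
    have "\<mu> \<in> polys V" using d(1) polys_mono[OF place_subfieldD(1)[OF E(2)]] by blast
    then show ?thesis using d(2,3) by (intro integral_in_V[of \<mu>]) auto
  qed
  show x: "x \<in> V" using *[OF assms(3)] .
  assume "x \<noteq> 0"
  then show "res x \<noteq> 0"
    using res_mult[OF x *[OF algebraic_inverse[OF E(1) assms(3)]]] by auto
qed

end

text \<open>A place that is the identity on E has no poles among elements algebraic over E. So the
  place with b \<mapsto> b' is finite on the whole ambient field and is a homomorphism.\<close>

lemma conj_hom:
  fixes b b' :: "'a::alg_closed_field"
  assumes E: "is_subfield E" and alg: "\<And>x::'a. algebraic_over E x"
    and \<mu>: "is_minpoly E b \<mu>" and b': "poly \<mu> b' = 0"
  shows "\<exists>\<sigma>. ring_hom_on UNIV \<sigma> \<and> (\<forall>e\<in>E. \<sigma> e = e) \<and> \<sigma> b = b'"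
proof -
  have "poly p b' = 0" if "p \<in> polys E" "poly p b = 0" for p
    using is_minpoly_dvd[OF \<mu> that] b' by (metis mult_zero_left poly_mult)
  then obtain P where P: "is_place UNIV P" "\<forall>e\<in>E. P e = Some e" "P b = Some b'"
    using eval_place[OF E] by blast
  interpret place P by unfold_locales (rule P)
  have V: "x \<in> V" for x using algebraic_in_V(1)[OF E _ alg] P(2) by blast
  have "ring_hom_on UNIV res"
    by unfold_locales (simp_all add: is_subring_UNIV res_add res_mult V)
  then show ?thesis using P(2,3) by (intro exI[of _ res]) (auto simp: P_eq_Some)
qed

lemma hom_UNIV_inj:
  assumes "ring_hom_on UNIV (\<sigma> :: 'a::field \<Rightarrow> 'b::field)" "\<sigma> x = 0"
  shows "x = 0"
proof (rule ccontr)
  interpret ring_hom_on UNIV \<sigma> by fact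
  assume "x \<noteq> 0"
  then show False using hom_mult[of x "inverse x"] assms(2) hom_1 by simp
qed

lemma hom_UNIV_inverse:
  assumes "ring_hom_on UNIV (\<sigma> :: 'a::field \<Rightarrow> 'b::field)"
  shows "\<sigma> (inverse x) = inverse (\<sigma> x)"
proof (cases "x = 0")
  interpret ring_hom_on UNIV \<sigma> by fact
  case True
  then show ?thesis by simp
next
  interpret ring_hom_on UNIV \<sigma> by fact
  case False
  then have "\<sigma> x * \<sigma> (inverse x) = 1" using hom_mult[of x "inverse x"] hom_1 by simp
  then show ?thesis by (simp add: inverse_unique)
qed

lemma place_comp:
  fixes P :: "'a::field \<Rightarrow> 'a option" and \<sigma> :: "'a \<Rightarrow> 'a"
  assumes P: "is_place UNIV P" and \<sigma>: "ring_hom_on UNIV \<sigma>"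
  shows "is_place UNIV (\<lambda>x. P (\<sigma> x))"
proof -
  interpret place P by unfold_locales (rule P)
  interpret h: ring_hom_on UNIV \<sigma> by fact
  have V': "val_ring UNIV (\<lambda>x. P (\<sigma> x)) = {x. \<sigma> x \<in> V}" by (auto simp: val_ring_def V_def)
  have r: "the (P (\<sigma> x)) = res (\<sigma> x)" for x by (simp add: res_def)
  show ?thesis
    unfolding is_place_def V' r
  proof (intro conjI ballI impI)
    show "is_subring {x. \<sigma> x \<in> V}"
      by (auto simp: is_subring_def h.hom_1 h.hom_diff h.hom_mult V_intros)
    show "P (\<sigma> 1) = Some 1" by (simp add: h.hom_1 P_eq_Some V_intros)
    fix x y assume "x \<in> {x. \<sigma> x \<in> V}" "y \<in> {x. \<sigma> x \<in> V}"
    then show "P (\<sigma> (x + y)) = Some (res (\<sigma> x) + res (\<sigma> y))" "P (\<sigma> (x * y)) = Some (res (\<sigma> x) * res (\<sigma> y))"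
      by (simp_all add: P_eq_Some h.hom_add h.hom_mult V_intros res_add res_mult)
  next
    fix x assume "P (\<sigma> x) = None"
    then have "\<sigma> x \<notin> V" by (simp add: V_def)
    from notin_V[OF this] show "x \<noteq> 0" "P (\<sigma> (inverse x)) = Some 0"
      by (auto simp: P_eq_Some hom_UNIV_inverse[OF \<sigma>])
  qed
qed

subsection \<open>Noether normalization\<close>

text \<open>A positional system: the weight of a new variable exceeds every weighted degree reached
  before, so its exponent and the remaining degree are recovered by division. The weight of w is 1
  because w is the variable left in place by the substitution.\<close>

lemma separating_weights:
  fixes M :: "('a \<Rightarrow> nat) set"
  assumes "finite M" "finite X"
  shows "\<exists>e :: 'a \<Rightarrow> nat. e w = 1 \<and> (\<forall>v. e v > 0) \<and>
    (\<forall>m\<in>M. \<forall>n\<in>M. (\<Sum>v\<in>insert w X. m v * e v) = (\<Sum>v\<in>insert w X. n v * e v) \<longrightarrow> (\<forall>v\<in>insert w X. m v = n v))"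
  using assms(2)
proof (induction X)
  case empty
  show ?case by (intro exI[of _ "\<lambda>_. 1"]) simp
next
  case (insert u X)
  from insert.IH obtain e :: "'a \<Rightarrow> nat" where e0: "e w = 1 \<and> (\<forall>v. e v > 0) \<and>
    (\<forall>m\<in>M. \<forall>n\<in>M. (\<Sum>v\<in>insert w X. m v * e v) = (\<Sum>v\<in>insert w X. n v * e v) \<longrightarrow> (\<forall>v\<in>insert w X. m v = n v))"
    by (rule exE)
  then have e: "e w = 1" "\<And>v. e v > 0"
    "\<And>m n. m \<in> M \<Longrightarrow> n \<in> M \<Longrightarrow> (\<Sum>v\<in>insert w X. m v * e v) = (\<Sum>v\<in>insert w X. n v * e v) \<Longrightarrow> (\<forall>v\<in>insert w X. m v = n v)"
    by simp_all
  show ?case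
  proof (cases "u = w")
    case True
    then have "insert w (insert u X) = insert w X" by simp
    then show ?thesis using e by (intro exI[of _ e]) simp
  next
    case False
    let ?W = "insert w X"
    define s where "s m = (\<Sum>v\<in>?W. m v * e v)" for m :: "'a \<Rightarrow> nat"
    define B where "B = Suc (\<Sum>m\<in>M. s m)"
    have sB: "s m < B" if "m \<in> M" for m
      using member_le_sum[OF that, of s] assms(1) by (simp add: B_def)
    define e' where "e' = e(u := B)"
    have split: "(\<Sum>v\<in>insert w (insert u X). m v * e' v) = s m + m u * B" for m :: "'a \<Rightarrow> nat"
    proof -
      have "insert w (insert u X) = insert u ?W" "u \<notin> ?W" using insert.hyps False by auto
      then have "(\<Sum>v\<in>insert w (insert u X). m v * e' v) = m u * e' u + (\<Sum>v\<in>?W. m v * e' v)"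
        using insert.hyps by simp
      also have "(\<Sum>v\<in>?W. m v * e' v) = s m"
        unfolding s_def using \<open>u \<notin> ?W\<close> by (intro sum.cong) (auto simp: e'_def)
      finally show ?thesis by (simp add: e'_def)
    qed
    have key: "\<forall>v\<in>insert w (insert u X). m v = n v"
      if mn: "m \<in> M" "n \<in> M" and eq: "s m + m u * B = s n + n u * B" for m n
    proof -
      have "(s m + m u * B) div B = m u" "(s n + n u * B) div B = n u"
        using sB[OF mn(1)] sB[OF mn(2)] by simp_all
      then have u: "m u = n u" using eq by simp
      then have "s m = s n" using eq by simp
      then show ?thesis using e(3)[OF mn] u unfolding s_def by auto
    qed
    have e': "e' w = 1" "e' v > 0" for v using e False by (auto simp: e'_def B_def)
    show ?thesis
    proof (intro exI[of _ e'] conjI e' allI ballI impI)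
      fix m n v
      assume mn: "m \<in> M" "n \<in> M" and v: "v \<in> insert w (insert u X)"
        and eq: "(\<Sum>v\<in>insert w (insert u X). m v * e' v) = (\<Sum>v\<in>insert w (insert u X). n v * e' v)"
      show "m v = n v" using key[OF mn eq[unfolded split]] v by (rule bspec)
    qed
  qed
qed

lemma lead_coeff_prod_monic:
  fixes f :: "'i \<Rightarrow> 'a::field poly"
  assumes "\<And>i. i \<in> I \<Longrightarrow> lead_coeff (f i) = 1"
  shows "lead_coeff (\<Prod>i\<in>I. f i) = 1" "degree (\<Prod>i\<in>I. f i) = (\<Sum>i\<in>I. degree (f i))"
proof -
  have nz: "f i \<noteq> 0" if "i \<in> I" for i using assms[OF that] by auto
  show "lead_coeff (\<Prod>i\<in>I. f i) = 1" using assms by (simp add: lead_coeff_prod)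
  show "degree (\<Prod>i\<in>I. f i) = (\<Sum>i\<in>I. degree (f i))" using nz by (intro degree_prod_eq_sum_degree) auto
qed

text \<open>Nagata's substitution \<open>v \<mapsto> v - w\<^bsup>e v\<^esup>\<close> makes a relation between the elements of \<open>X\<close>
  monic in \<open>w\<close>, since the weights \<open>e\<close> separate its monomials.\<close>

lemma noether_step:
  fixes K :: "'a::alg_closed_field set"
  assumes K: "is_subfield K" and X: "finite X" and dep: "\<not> alg_indep K X"
  shows "\<exists>Z. finite Z \<and> card Z < card X \<and> Z \<subseteq> ring_adjoin K X \<and>
    (\<forall>P. is_place UNIV P \<and> (\<forall>a\<in>K. P a = Some a) \<and> (\<forall>z\<in>Z. P z \<noteq> None) \<longrightarrow> (\<forall>x\<in>X. P x \<noteq> None))"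
proof -
  obtain p where p: "p \<in> mpolys K X" "mpoly_eval (\<lambda>t. t) p = 0" "p \<noteq> 0"
    using dep unfolding alg_indep_def mpolys_def by blast
  have "X \<noteq> {}" using dep alg_indep_empty by blast
  then obtain w where w: "w \<in> X" by blast
  let ?M = "Poly_Mapping.keys p" and ?l = "Poly_Mapping.lookup"
  have X': "insert w X = X" using w by blast
  have "\<exists>e :: 'a \<Rightarrow> nat. e w = 1 \<and> (\<forall>v. e v > 0) \<and>
    (\<forall>m\<in>?l ` ?M. \<forall>n\<in>?l ` ?M. (\<Sum>v\<in>X. m v * e v) = (\<Sum>v\<in>X. n v * e v) \<longrightarrow> (\<forall>v\<in>X. m v = n v))"
    using separating_weights[of "?l ` ?M" X w] X unfolding X' by simp
  then obtain e :: "'a \<Rightarrow> nat" where e0: "e w = 1 \<and> (\<forall>v. e v > 0) \<and>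
    (\<forall>m\<in>?l ` ?M. \<forall>n\<in>?l ` ?M. (\<Sum>v\<in>X. m v * e v) = (\<Sum>v\<in>X. n v * e v) \<longrightarrow> (\<forall>v\<in>X. m v = n v))"
    by (rule exE)
  then have e: "e w = 1" "\<And>v. e v > 0" by simp_all
  have e_inj0: "\<forall>v\<in>X. m v = n v"
    if "m \<in> ?l ` ?M" "n \<in> ?l ` ?M" "(\<Sum>v\<in>X. m v * e v) = (\<Sum>v\<in>X. n v * e v)" for m n
    using conjunct2[OF conjunct2[OF e0]] that by blast
  have kM: "Poly_Mapping.keys m \<subseteq> X" if "m \<in> ?M" for m using mpolysD(2)[OF p(1) that] .
  define W where "W m = (\<Sum>v\<in>X. ?l m v * e v)" for m
  have e_inj: "m = n" if "m \<in> ?M" "n \<in> ?M" "W m = W n" for m n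
  proof (rule poly_mapping_eqI)
    fix v
    have "\<forall>v\<in>X. ?l m v = ?l n v" using e_inj0[of "?l m" "?l n"] that unfolding W_def by blast
    moreover have "?l m v = 0" "?l n v = 0" if "v \<notin> X"
      using kM[OF \<open>m \<in> ?M\<close>] kM[OF \<open>n \<in> ?M\<close>] that by (auto simp: in_keys_iff)
    ultimately show "?l m v = ?l n v" by (cases "v \<in> X") auto
  qed
  define z where "z v = v - w ^ e v" for v
  let ?Z = "z ` (X - {w})"
  \<comment> \<open>\<open>f v\<close> expresses v as a polynomial in w with constant term
    \<open>z v\<close>, by v = z v + w^(e v). It is monic of degree \<open>e v\<close>, also for v =
    w because \<open>e w = 1\<close>.\<close>
  define f where "f v = (if v = w then [:0, 1:] else [:z v:] + monom 1 (e v))" for v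
  have fw: "poly (f v) w = v" for v by (simp add: f_def z_def poly_monom)
  have fd: "degree (f v) = e v" "lead_coeff (f v) = 1" for v
  proof -
    have *: "degree (f v) = e v"
      unfolding f_def using e(1) e(2)[of v] by (auto simp: degree_add_eq_right degree_monom_eq)
    show "degree (f v) = e v" by (rule *)
    show "lead_coeff (f v) = 1"
      unfolding * using e(1) e(2)[of v] by (auto simp: f_def coeff_pCons split: nat.split)
  qed
  define g where "g m = (\<Prod>v\<in>X. f v ^ ?l m v)" for m
  have gw: "poly (g m) w = mon (\<lambda>t. t) m" if "m \<in> ?M" for m
    unfolding g_def poly_prod poly_power fw using mon_superset[OF X kM[OF that], of "\<lambda>t. t"] by simp
  have gl: "lead_coeff (g m) = 1" and gd: "degree (g m) = W m" for m
  proof -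
    have *: "lead_coeff (f v ^ ?l m v) = 1" for v
      using lead_coeff_power[of "f v" "?l m v"] fd(2)[of v] by (simp only: power_one)
    show "lead_coeff (g m) = 1" unfolding g_def by (rule lead_coeff_prod_monic(1)[OF *])
    have "degree (g m) = (\<Sum>v\<in>X. degree (f v ^ ?l m v))"
      unfolding g_def by (rule lead_coeff_prod_monic(2)[OF *])
    also have "\<dots> = W m" unfolding W_def
    proof (rule sum.cong[OF refl])
      fix v
      have "f v \<noteq> 0" using fd(2)[of v] by auto
      then show "degree (f v ^ ?l m v) = ?l m v * e v" by (simp add: degree_power_eq fd(1))
    qed
    finally show "degree (g m) = W m" .
  qed
  define G where "G = (\<Sum>m\<in>?M. smult (?l p m) (g m))"
  have Gw: "poly G w = 0"
    using p(2) gw unfolding G_def mpoly_eval_mon by (simp add: poly_sum)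
  have "?M \<noteq> {}" using p(3) by simp
  then have ne: "W ` ?M \<noteq> {}" "finite (W ` ?M)" by auto
  \<comment> \<open>Distinct monomials of p have distinct weights, so m0 alone has the top weight.
    The leading coefficient of G is therefore a nonzero element of K, a unit at every place that is
    the identity on K.\<close>
  obtain m0 where m0: "m0 \<in> ?M" "W m0 = Max (W ` ?M)" using Max_in[OF ne(2,1)] by auto
  have less: "W m < W m0" if "m \<in> ?M" "m \<noteq> m0" for m
  proof -
    have "W m \<le> W m0" using Max_ge[OF ne(2) imageI[OF that(1)]] m0(2) by simp
    moreover have "W m \<noteq> W m0" using e_inj[OF that(1) m0(1)] that(2) by blast
    ultimately show ?thesis by simp
  qed
  have coG: "coeff G (W m0) = ?l p m0"
  proof -
    have "coeff G (W m0) = (\<Sum>m\<in>?M. if m = m0 then ?l p m0 else 0)"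
      unfolding G_def coeff_sum
    proof (rule sum.cong[OF refl])
      fix m assume m: "m \<in> ?M"
      show "coeff (smult (?l p m) (g m)) (W m0) = (if m = m0 then ?l p m0 else 0)"
        using gl[of m0] gd[of m0] less[OF m] coeff_eq_0[of "g m" "W m0"] gd[of m] by auto
    qed
    then show ?thesis using m0(1) by simp
  qed
  have "degree G \<le> W m0" unfolding G_def
  proof (rule degree_sum_le)
    fix m assume m: "m \<in> ?M"
    have "degree (smult (?l p m) (g m)) \<le> W m" using degree_smult_le[of _ "g m"] gd[of m] by simp
    also have "W m \<le> W m0" using less[OF m] by (cases "m = m0") auto
    finally show "degree (smult (?l p m) (g m)) \<le> W m0" .
  qed simp
  moreover have pm0: "?l p m0 \<noteq> 0" using m0(1) by (simp add: in_keys_iff)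
  ultimately have dG: "degree G = W m0" using coG le_degree[of G "W m0"] by simp
  have lG: "lead_coeff G = ?l p m0" unfolding dG by (rule coG)
  have pK: "?l p m \<in> K" if "m \<in> ?M" for m using mpolysD(3)[OF p(1) that] .
  have fin: "x \<in> place.V P" if P: "is_place UNIV P" "\<forall>a\<in>K. P a = Some a" "\<forall>u\<in>?Z. P u \<noteq> None" "x \<in> X" for P x
  proof -
    interpret place P by unfold_locales (rule P)
    have KV: "K \<subseteq> V" and rK: "res a = a" if "a \<in> K" for a using P(2) that by (auto simp: P_eq_Some)
    have zV: "z v \<in> V" if "v \<in> X" "v \<noteq> w" for v using P(3) that by (auto simp: V_def)
    note I = polys_intros[OF V_subring]
    have fV: "f v \<in> polys V" if "v \<in> X" for v
      using zV[OF that] I(15)[of "z v"] I(7)[of 1 "e v"] polys_X[OF V_subring] V_intros(2)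
      by (auto simp: f_def intro!: I(3))
    have gV: "g m \<in> polys V" for m
      unfolding g_def by (intro I(13) I(11) fV)
    have "G \<in> polys V"
      unfolding G_def
    proof (rule I(12))
      fix m assume "m \<in> ?M"
      then have "?l p m \<in> V" using pK KV by blast
      then show "smult (?l p m) (g m) \<in> polys V" using gV by (rule I(6))
    qed
    then have wV: "w \<in> V"
      using integral_in_V[of G w] Gw lG rK[OF pK[OF m0(1)]] pm0 by simp
    show "x \<in> V"
    proof (cases "x = w")
      case False
      have "z x + w ^ e x \<in> V" using zV[OF P(4) False] wV by (intro V_intros)
      then show ?thesis by (simp add: z_def)
    qed (use wV in simp)
  qed
  show ?thesis
  proof (intro exI[of _ ?Z] conjI allI impI ballI)
    show "finite ?Z" using X by simp
    have "card ?Z \<le> card (X - {w})" using X by (intro card_image_le) simp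
    also have "\<dots> < card X" using X w by (rule card_Diff1_less)
    finally show "card ?Z < card X" .
    show "?Z \<subseteq> ring_adjoin K X"
      using ring_adjoin_gens[of X K] w
      by (auto simp: z_def intro!: subring_intros[OF is_subring_ring_adjoin])
    fix P x assume "is_place UNIV P \<and> (\<forall>a\<in>K. P a = Some a) \<and> (\<forall>z\<in>?Z. P z \<noteq> None)" "x \<in> X"
    then have pl: "is_place UNIV P" and "x \<in> place.V P" using fin[of P x] by blast+
    then show "P x \<noteq> None" using place.V_def[OF place.intro[OF pl]] by simp
  qed
qed

text \<open>Integrality of X over K[Y] appears in its valuative form, finiteness of places passing
  from Y to X; this form composes along the induction on the size of X.\<close>

lemma noether_normalization:
  fixes K :: "'a::alg_closed_field set"
  assumes K: "is_subfield K" and X: "finite X"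
  shows "\<exists>Y. finite Y \<and> alg_indep K Y \<and> Y \<subseteq> ring_adjoin K X \<and>
    (\<forall>P. is_place UNIV P \<and> (\<forall>a\<in>K. P a = Some a) \<and> (\<forall>y\<in>Y. P y \<noteq> None) \<longrightarrow> (\<forall>x\<in>X. P x \<noteq> None))"
  using X
proof (induction "card X" arbitrary: X rule: less_induct)
  case less
  let ?fin = "\<lambda>Y X. \<forall>P. is_place UNIV P \<and> (\<forall>a\<in>K. P a = Some a) \<and> (\<forall>y\<in>Y. P y \<noteq> None) \<longrightarrow> (\<forall>x\<in>X. P x \<noteq> None)"
  show ?case
  proof (cases "alg_indep K X")
    case True
    have "?fin X X" by simp
    with True less.prems ring_adjoin_gens[of X K] show ?thesis by (intro exI[of _ X] conjI)
  next
    case False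
    from noether_step[OF K less.prems False] obtain Z where
      Z: "finite Z \<and> card Z < card X \<and> Z \<subseteq> ring_adjoin K X \<and> ?fin Z X" by (rule exE)
    then have Z': "card Z < card X" "finite Z" "Z \<subseteq> ring_adjoin K X" "?fin Z X" by simp_all
    from less.hyps[OF Z'(1,2)] obtain Y where
      Y: "finite Y \<and> alg_indep K Y \<and> Y \<subseteq> ring_adjoin K Z \<and> ?fin Y Z" by (rule exE)
    then have Y': "finite Y" "alg_indep K Y" "Y \<subseteq> ring_adjoin K Z" "?fin Y Z" by simp_all
    have "ring_adjoin K Z \<subseteq> ring_adjoin K X"
      by (rule ring_adjoin_least[OF is_subring_ring_adjoin ring_adjoin_base Z'(3)])
    then have "Y \<subseteq> ring_adjoin K X" using Y'(3) by (rule order_trans[rotated])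
    moreover have "?fin Y X"
    proof (intro allI impI)
      fix P assume P: "is_place UNIV P \<and> (\<forall>a\<in>K. P a = Some a) \<and> (\<forall>y\<in>Y. P y \<noteq> None)"
      have "\<forall>z\<in>Z. P z \<noteq> None" by (rule mp[OF spec[OF Y'(4), of P] P])
      with P show "\<forall>x\<in>X. P x \<noteq> None" by (intro mp[OF spec[OF Z'(4), of P]] conjI) (elim conjE, assumption)+
    qed
    ultimately show ?thesis using Y'(1,2) by (intro exI[of _ Y] conjI)
  qed
qed

subsection \<open>Places of codimension one\<close>

text \<open>Adjoining the elements of Y one after the other, y is the one with which c first
  appears. This exhibits c as a nonconstant rational function of y over K(W).\<close>

lemma split_off_generator:
  assumes "is_subfield K" "finite Y" "c \<in> adjoin K Y" "c \<notin> K"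
  shows "\<exists>y\<in>Y. \<exists>W\<subseteq>Y - {y}. c \<in> adjoin (adjoin K W) {y} \<and> c \<notin> adjoin K W"
  using assms(2,3)
proof (induction Y)
  case empty
  then show ?case using adjoin_absorb[OF assms(1), of "{}"] assms(4) by simp
next
  case (insert y Y)
  show ?case
  proof (cases "c \<in> adjoin K Y")
    case True
    then show ?thesis using insert.IH by blast
  next
    case False
    have "adjoin (adjoin K Y) {y} = adjoin K (insert y Y)" by (simp add: adjoin_adjoin)
    then have "c \<in> adjoin (adjoin K Y) {y}" using insert.prems by simp
    moreover have "Y \<subseteq> insert y Y - {y}" using insert.hyps by blast
    ultimately show ?thesis using False by blast
  qed
qed

text \<open>Coprime numerator and denominator have no common root in the algebraically closed ambient
  field, since both would be divisible by its minimal polynomial.\<close>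

lemma coprime_fraction:
  fixes y :: "'a::alg_closed_field"
  assumes E: "is_subfield E" and y: "\<not> algebraic_over E y" and c: "c \<in> adjoin E {y}"
  shows "\<exists>g h. g \<in> polys E \<and> h \<in> polys E \<and> h \<noteq> 0 \<and> c * poly h y = poly g y \<and>
    (\<forall>\<rho>. \<not> (poly g \<rho> = 0 \<and> poly h \<rho> = 0))"
proof -
  let ?P = "\<lambda>(g, h). g \<in> polys E \<and> h \<in> polys E \<and> h \<noteq> 0 \<and> c * poly h y = poly g y"
  obtain g0 h0 where "g0 \<in> polys E" "h0 \<in> polys E" "poly h0 y \<noteq> 0" "c = poly g0 y / poly h0 y"
    using c unfolding adjoin_singleton[OF E] by blast
  then have "?P (g0, h0)" by auto
  from ex_has_least_nat[of ?P, OF this, of "\<lambda>(g, h). degree h"] obtain g h where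
    gh: "?P (g, h)" and min: "\<And>g' h'. ?P (g', h') \<Longrightarrow> degree h \<le> degree h'" by auto
  have "\<not> (poly g \<rho> = 0 \<and> poly h \<rho> = 0)" for \<rho>
  proof
    assume \<rho>: "poly g \<rho> = 0 \<and> poly h \<rho> = 0"
    then have "algebraic_over E \<rho>" using gh algebraic_over_iff[OF E] by blast
    then obtain \<nu> where \<nu>: "is_minpoly E \<rho> \<nu>" using ex_minpoly[OF E] by blast
    note d = is_minpolyD[OF \<nu>]
    obtain g' where g': "g' \<in> polys E" "g = \<nu> * g'" using is_minpoly_dvd[OF \<nu>, of g] gh \<rho> by auto
    obtain h' where h': "h' \<in> polys E" "h = \<nu> * h'" using is_minpoly_dvd[OF \<nu>, of h] gh \<rho> by auto
    have "poly \<nu> y \<noteq> 0" using y d(1,4) algebraic_over_iff[OF E] by blast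
    then have "?P (g', h')" using gh g' h' by auto
    then have "degree h \<le> degree h'" by (rule min)
    moreover have "h' \<noteq> 0" using gh h' by auto
    ultimately show False using h'(2) d(4,5) by (simp add: degree_mult_eq)
  qed
  then show ?thesis using gh by (intro exI[of _ g] exI[of _ h]) simp
qed

text \<open>For the minimal polynomial of b, this writes the constant term, up to sign the norm of
  b, as a product over its conjugates. The multiset keeps multiplicities, as \<mu> may be
  inseparable.\<close>

lemma poly_0_factorization:
  fixes \<mu> :: "'a::alg_closed_field poly"
  assumes "lead_coeff \<mu> = 1"
  obtains A where "poly \<mu> 0 = (\<Prod>x\<in>#A. - x)" "\<And>x. x \<in># A \<longleftrightarrow> poly \<mu> x = 0"
proof -
  have "\<mu> \<noteq> 0" using assms by auto
  then obtain A where A: "\<mu> = smult (lead_coeff \<mu>) (\<Prod>x\<in>#A. [:-x, 1:])"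
    using alg_closed_imp_factorization by blast
  then have A': "\<mu> = (\<Prod>x\<in>#A. [:-x, 1:])" using assms by simp
  have ev: "poly \<mu> z = (\<Prod>x\<in>#A. z - x)" for z
    unfolding A' by (simp add: poly_prod_mset image_mset.compositionality o_def)
  have "poly \<mu> 0 = (\<Prod>x\<in>#A. - x)"
    unfolding ev by (rule arg_cong[where f = prod_mset], rule image_mset_cong) simp
  moreover have "x \<in># A \<longleftrightarrow> poly \<mu> x = 0" for x
    unfolding ev by (auto simp: prod_mset_zero_iff)
  ultimately show ?thesis using that by blast
qed

lemma (in place) res_prod_mset_neg:
  assumes "\<And>x. x \<in># A \<Longrightarrow> x \<in> V"
  shows "(\<Prod>x\<in>#A. - x) \<in> V \<and> (res (\<Prod>x\<in>#A. - x) = 0 \<longleftrightarrow> (\<exists>x\<in>#A. res x = 0))"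
  using assms
proof (induction A)
  case (add x A)
  then have IH: "(\<Prod>x\<in>#A. - x) \<in> V" "res (\<Prod>x\<in>#A. - x) = 0 \<longleftrightarrow> (\<exists>x\<in>#A. res x = 0)" and x: "x \<in> V" by auto
  have "res (- x * (\<Prod>x\<in>#A. - x)) = - res x * res (\<Prod>x\<in>#A. - x)"
    using res_mult[OF V_intros(5)[OF x] IH(1)] res_uminus[OF x] by simp
  then show ?case using IH(2) V_intros(4)[OF V_intros(5)[OF x] IH(1)] by auto
qed (simp add: V_intros)

lemma algebraic_UNIV:
  fixes F E :: "'a::alg_closed_field set"
  assumes E: "is_subfield E" and "finite S" "\<And>s. s \<in> S \<Longrightarrow> algebraic_over E s"
    and "F \<subseteq> adjoin E S" "algebraic_over F x"
  shows "algebraic_over E x"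
proof -
  obtain n where "has_dim E (adjoin E S) n" using finite_adjoin_algebraic[OF E assms(2,3)] by blast
  then show ?thesis
    using algebraic_trans_finite[OF E is_subfield_adjoin adjoin_base] algebraic_mono[OF assms(4,5)] by blast
qed

text \<open>The hypotheses on a place of \<open>F|K\<close> under which it will be uniformized: it is the identity on
  \<open>k = K(Y)\<close>, and \<open>F\<close> is a function field of one variable over \<open>k\<close>.\<close>

definition divisorial ::
  "'a::alg_closed_field set \<Rightarrow> 'a set \<Rightarrow> ('a \<Rightarrow> 'a option) \<Rightarrow> 'a set \<Rightarrow> 'a \<Rightarrow> bool" where
  "divisorial F K P Y c \<longleftrightarrow> is_place UNIV P \<and> finite Y \<and> Y \<subseteq> F \<and> alg_indep K Y \<and>
     (\<forall>a\<in>adjoin K Y. P a = Some a) \<and> c \<in> F \<and> c \<noteq> 0 \<and> P c = Some 0 \<and>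
     (\<forall>x\<in>F. algebraic_over (adjoin K (insert c Y)) x)"

text \<open>The valuative substitute for X being integral over K[Y], as
  \<open>noether_normalization\<close> provides it.\<close>

definition controls :: "'a::field set \<Rightarrow> 'a set \<Rightarrow> 'a set \<Rightarrow> bool" where
  "controls K Y X \<longleftrightarrow> (\<forall>P. is_place UNIV (P :: 'a \<Rightarrow> 'a option) \<and> (\<forall>a\<in>K. P a = Some a) \<and> (\<forall>y\<in>Y. P y \<noteq> None) \<longrightarrow>
     (\<forall>x\<in>X. P x \<noteq> None))"

lemma controlsD:
  assumes "controls K Y X" "is_place UNIV P" "\<And>a. a \<in> K \<Longrightarrow> P a = Some a"
    "\<And>y. y \<in> Y \<Longrightarrow> P y \<noteq> None" "x \<in> X"
  shows "P x \<noteq> None"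
  using assms unfolding controls_def by blast

context
  fixes F K S X :: "'a::alg_closed_field set" and t :: 'a
  assumes K: "is_subfield K" and F: "is_subfield F" "K \<subseteq> F"
    and S: "finite S" "F = adjoin K S"
    and algF: "\<And>x::'a. algebraic_over F x"
    and t: "t \<in> F" "\<not> algebraic_over K t"
    and X: "finite X" "X \<subseteq> F" "\<And>s. s \<in> S \<Longrightarrow> s \<in> X \<or> inverse s \<in> X"
begin

text \<open>X contains each generator of F or its inverse. An x in X transcendental over K(Y) would
  have a pole at some place trivial on K(Y), against \<open>controls\<close>; so F is algebraic over
  K(Y), and t forces Y to be nonempty.\<close>

lemma ex_normalization:
  "\<exists>Y. finite Y \<and> Y \<noteq> {} \<and> alg_indep K Y \<and> Y \<subseteq> ring_adjoin K X \<and> Y \<subseteq> F \<and> controls K Y X \<and>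
    (\<forall>s\<in>S. algebraic_over (adjoin K Y) s)"
proof -
  from noether_normalization[OF K X(1)] obtain Y where
    "finite Y \<and> alg_indep K Y \<and> Y \<subseteq> ring_adjoin K X \<and> controls K Y X"
    unfolding controls_def by (rule exE)
  then have Y: "finite Y" "alg_indep K Y" "Y \<subseteq> ring_adjoin K X" and fin: "controls K Y X" by simp_all
  let ?E = "adjoin K Y"
  have E: "is_subfield ?E" by (rule is_subfield_adjoin)
  have algX: "algebraic_over ?E x" if x: "x \<in> X" for x
  proof (rule ccontr)
    assume n: "\<not> algebraic_over ?E x"
    then have n': "\<not> algebraic_over ?E (inverse x)" using algebraic_inverse[OF E, of "inverse x"] by auto
    have "poly p 0 = 0" if "p \<in> polys ?E" "poly p (inverse x) = 0" for p
      using n' that algebraic_over_iff[OF E] by (cases "p = 0") auto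
    then obtain P where P: "is_place UNIV P" "\<forall>e\<in>?E. P e = Some e" "P (inverse x) = Some 0"
      using eval_place[OF E] by blast
    interpret place P by unfold_locales (rule P)
    have "P x \<noteq> None"
      using P(2) adjoin_base[of K Y] adjoin_gens[of Y K] by (intro controlsD[OF fin P(1) _ _ x]) auto
    then have "x \<in> V" by (simp add: V_def)
    moreover have "inverse x \<in> V" "res (inverse x) = 0" using P(3) by (simp_all add: P_eq_Some)
    moreover have "x \<noteq> 0" using n algebraic_in[OF E subfield_intros(1)[OF E]] by auto
    ultimately show False using res_mult[of x "inverse x"] by simp
  qed
  have algS: "algebraic_over ?E s" if "s \<in> S" for s
    using X(3)[OF that] algX algebraic_inverse[OF E algX, of "inverse s"] by auto
  have "Y \<noteq> {}"
  proof
    assume "Y = {}"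
    then have eq: "?E = K" using adjoin_absorb[OF K, of "{}"] by simp
    then have "algebraic_over K t"
      using algebraic_adjoin[OF K S(1), of t] algS t(1) S(2) by simp
    then show False using t(2) by blast
  qed
  moreover have "ring_adjoin K X \<subseteq> F" using ring_adjoin_least[OF subfield_subring[OF F(1)] F(2) X(2)] .
  ultimately show ?thesis using Y fin algS by (intro exI[of _ Y]) simp
qed

text \<open>Without a vanishing condition it is enough to send one y in Y to 0 and to fix the
  others; this place is finite on Y and hence on X.\<close>

lemma ex_divisorial_trivial:
  "\<exists>P Y c. divisorial F K P Y c \<and> (\<forall>x\<in>X. P x \<noteq> None)"
proof -
  obtain Y where "finite Y \<and> Y \<noteq> {} \<and> alg_indep K Y \<and> Y \<subseteq> ring_adjoin K X \<and> Y \<subseteq> F \<and> controls K Y X \<and>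
    (\<forall>s\<in>S. algebraic_over (adjoin K Y) s)"
    using ex_normalization by (rule exE)
  then have Y: "finite Y" "Y \<noteq> {}" "alg_indep K Y" "Y \<subseteq> ring_adjoin K X" "Y \<subseteq> F"
    and fin: "controls K Y X" and algS: "\<And>s. s \<in> S \<Longrightarrow> algebraic_over (adjoin K Y) s" by simp_all
  obtain y where y: "y \<in> Y" using Y(2) by blast
  let ?Y = "Y - {y}"
  let ?k = "adjoin K ?Y"
  have k: "is_subfield ?k" by (rule is_subfield_adjoin)
  have tr: "\<not> algebraic_over ?k y" using alg_indep_transcendental[OF K Y(3) y] .
  then have "poly p 0 = 0" if "p \<in> polys ?k" "poly p y = 0" for p
    using that algebraic_over_iff[OF k] by (cases "p = 0") auto
  then obtain P where P: "is_place UNIV P" "\<forall>e\<in>?k. P e = Some e" "P y = Some 0"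
    using eval_place[OF k] by blast
  have ind: "alg_indep K ?Y" using Y(3) unfolding alg_indep_def by blast
  have "P x \<noteq> None" if "x \<in> X" for x
  proof (rule controlsD[OF fin P(1) _ _ that])
    show "P a = Some a" if "a \<in> K" for a using P(2) adjoin_base[of K ?Y] that by blast
    show "P z \<noteq> None" if "z \<in> Y" for z
      using P(2,3) adjoin_gens[of ?Y K] that by (cases "z = y") auto
  qed
  moreover have "algebraic_over (adjoin K (insert y ?Y)) x" if "x \<in> F" for x
  proof -
    have "insert y ?Y = Y" using y by blast
    moreover have "adjoin K S \<subseteq> adjoin (adjoin K Y) S" by (rule adjoin_mono[OF adjoin_base order_refl])
    then have "x \<in> adjoin (adjoin K Y) S" using that S(2) by blast
    then have "algebraic_over (adjoin K Y) x" using algebraic_adjoin[OF is_subfield_adjoin S(1) algS] by blast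
    ultimately show ?thesis by simp
  qed
  moreover have "y \<noteq> 0" using tr algebraic_in[OF k subfield_intros(1)[OF k]] by blast
  ultimately have "divisorial F K P ?Y y"
    unfolding divisorial_def using P Y ind y by auto
  then show ?thesis using \<open>\<And>x. x \<in> X \<Longrightarrow> P x \<noteq> None\<close> by blast
qed

text \<open>A product c of conjugates of b has no poles at places finite on Y, since X is controlled
  by Y. Being nonconstant as a rational function of some y, it must then have a zero, and there some
  conjugate of b vanishes.\<close>

lemma ex_divisorial:
  assumes Q: "is_place F Q" "\<And>a. a \<in> K \<Longrightarrow> Q a = Some a" "\<And>x. x \<in> X \<Longrightarrow> Q x \<noteq> None"
    and b: "b \<in> X" "b \<noteq> 0" "Q b = Some 0"
  shows "\<exists>P Y c. divisorial F K P Y c \<and> (\<forall>x\<in>X. P x \<noteq> None) \<and> P b = Some 0"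
proof -
  obtain Y where "finite Y \<and> Y \<noteq> {} \<and> alg_indep K Y \<and> Y \<subseteq> ring_adjoin K X \<and> Y \<subseteq> F \<and> controls K Y X \<and>
    (\<forall>s\<in>S. algebraic_over (adjoin K Y) s)"
    using ex_normalization by (rule exE)
  then have Y: "finite Y" "Y \<noteq> {}" "alg_indep K Y" "Y \<subseteq> ring_adjoin K X" "Y \<subseteq> F"
    and fin: "controls K Y X" and algS: "\<And>s. s \<in> S \<Longrightarrow> algebraic_over (adjoin K Y) s" by simp_all
  let ?E = "adjoin K Y"
  have E: "is_subfield ?E" by (rule is_subfield_adjoin)
  have KE: "K \<subseteq> ?E" and YE: "Y \<subseteq> ?E" by (rule adjoin_base, rule adjoin_gens)
  have EF: "?E \<subseteq> F" using adjoin_least[OF F Y(5)] .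
  have FE: "F \<subseteq> adjoin ?E S" unfolding S(2) by (rule adjoin_mono[OF adjoin_base order_refl])
  have algE: "algebraic_over ?E x" for x using algebraic_UNIV[OF E S(1) algS FE algF] .
  obtain \<mu> where \<mu>: "is_minpoly ?E b \<mu>" using ex_minpoly[OF E algE] by blast
  note d = is_minpolyD[OF \<mu>]
  define c where "c = poly \<mu> 0"
  obtain A where A: "c = (\<Prod>x\<in>#A. - x)" "\<And>x. x \<in># A \<longleftrightarrow> poly \<mu> x = 0"
    using poly_0_factorization[OF d(2)] unfolding c_def by blast
  have conj: "\<exists>\<sigma>. ring_hom_on UNIV \<sigma> \<and> (\<forall>e\<in>?E. \<sigma> e = e) \<and> \<sigma> b = x" if "x \<in># A" for x
    using conj_hom[OF E algE \<mu>] that A(2) by blast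
  have cE: "c \<in> ?E" unfolding c_def by (intro poly_in[OF subfield_subring[OF E] d(1)] subfield_intros(1)[OF E])
  have c0: "c \<noteq> 0"
  proof
    assume "c = 0"
    then have "0 \<in># A" using A(2)[of 0] c_def by simp
    from conj[OF this] obtain \<sigma> :: "'a \<Rightarrow> 'a" where "ring_hom_on UNIV \<sigma>" "\<sigma> b = 0" by blast
    then show False using hom_UNIV_inj[of \<sigma> b] b(2) by blast
  qed
  \<comment> \<open>\<open>controls\<close> is applied to P composed with a conjugation, which
    agrees with P on K(Y); so every conjugate of b is finite.\<close>
  have finA: "P x \<noteq> None"
    if P: "is_place UNIV P" "\<And>a. a \<in> K \<Longrightarrow> P a = Some a" "\<And>y. y \<in> Y \<Longrightarrow> P y \<noteq> None" and x: "x \<in># A" for P x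
  proof -
    obtain \<sigma> where \<sigma>: "ring_hom_on UNIV \<sigma>" "\<And>e. e \<in> ?E \<Longrightarrow> \<sigma> e = e" "\<sigma> b = x" using conj[OF x] by blast
    have "P (\<sigma> b) \<noteq> None"
    proof (rule controlsD[OF fin place_comp[OF P(1) \<sigma>(1)] _ _ b(1)])
      fix a assume "a \<in> K" then show "P (\<sigma> a) = Some a" using \<sigma>(2) KE P(2) by auto
    next
      fix y assume "y \<in> Y" then show "P (\<sigma> y) \<noteq> None" using \<sigma>(2) YE P(3) by auto
    qed
    then show ?thesis using \<sigma>(3) by simp
  qed
  \<comment> \<open>Here the given place Q enters: at an extension of Q all conjugates of b are
    finite and b goes to 0, hence so does c, whereas a nonzero element of K is fixed.\<close>
  have cK: "c \<notin> K"
  proof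
    assume "c \<in> K"
    obtain Q' where Q': "is_place UNIV Q'" "\<forall>x\<in>F. Q' x = Q x" using place_extend[OF F(1) Q(1)] by blast
    interpret place Q' by unfold_locales (rule Q')
    have idK: "Q' a = Some a" if "a \<in> K" for a using Q(2)[OF that] Q'(2) F(2) that by auto
    have KV: "K \<subseteq> V" using idK by (auto simp: P_eq_Some)
    have "X \<subseteq> V" using Q(3) Q'(2) X(2) by (auto simp: V_def)
    then have "ring_adjoin K X \<subseteq> V" using ring_adjoin_least[OF V_subring KV] by blast
    then have YV: "Q' y \<noteq> None" if "y \<in> Y" for y using Y(4) that by (auto simp: V_def)
    have "x \<in> V" if "x \<in># A" for x using finA[OF Q'(1) idK YV that] by (simp add: V_def)
    then have "res c = 0 \<longleftrightarrow> (\<exists>x\<in>#A. res x = 0)" unfolding A(1) using res_prod_mset_neg by blast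
    moreover have "b \<in># A" using A(2) d(3) by simp
    moreover have "res b = 0" using b(1,3) Q'(2) X(2) by (auto simp: res_def)
    ultimately have "res c = 0" by blast
    moreover have "res c = c" using idK[OF \<open>c \<in> K\<close>] by (simp add: res_def)
    ultimately show False using c0 by simp
  qed
  obtain y W where y: "y \<in> Y" and W: "W \<subseteq> Y - {y}" and cW: "c \<in> adjoin (adjoin K W) {y}" "c \<notin> adjoin K W"
    using split_off_generator[OF K Y(1) cE cK] by blast
  let ?E' = "adjoin K W" and ?Y = "Y - {y}"
  let ?k = "adjoin K ?Y"
  have E': "is_subfield ?E'" and k: "is_subfield ?k" by (rule is_subfield_adjoin)+
  have E'k: "?E' \<subseteq> ?k" by (rule adjoin_mono[OF order_refl W])
  have kE: "?k \<subseteq> ?E" by (rule adjoin_mono[OF order_refl]) blast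
  have tr: "\<not> algebraic_over ?k y" using alg_indep_transcendental[OF K Y(3) y] .
  then have tr': "\<not> algebraic_over ?E' y" using algebraic_mono[OF E'k] by blast
  obtain g h where gh: "g \<in> polys ?E'" "h \<in> polys ?E'" "h \<noteq> 0" "c * poly h y = poly g y"
    "\<And>\<rho>. \<not> (poly g \<rho> = 0 \<and> poly h \<rho> = 0)"
    using coprime_fraction[OF E' tr' cW(1)] by blast
  have ghk: "g \<in> polys ?k" "h \<in> polys ?k" using gh(1,2) polys_mono[OF E'k] by blast+
  have hy: "poly h y \<noteq> 0" using tr' gh(2,3) algebraic_over_iff[OF E'] by blast
  have gy: "poly g y \<noteq> 0" using gh(4) hy c0 by (metis mult_eq_0_iff)
  have ev: "\<exists>P. is_place UNIV P \<and> (\<forall>e\<in>?k. P e = Some e) \<and> P y = Some \<rho>" for \<rho>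
  proof (rule eval_place[OF k])
    fix p assume "p \<in> polys ?k" "poly p y = 0"
    then have "p = 0" using tr algebraic_over_iff[OF k] by blast
    then show "poly p \<rho> = 0" by simp
  qed
  \<comment> \<open>The product c of negated conjugates is finite, and 0 only if some conjugate is.
    Taking residues in c h(y) = g(y) relates its value to those of g and h at \<rho>.\<close>
  have main: "P c \<noteq> None \<and> (P c = Some 0 \<longrightarrow> (\<exists>x\<in>#A. P x = Some 0)) \<and> (P c = Some r \<longrightarrow> r * poly h \<rho> = poly g \<rho>)"
    if P: "is_place UNIV P" "\<forall>e\<in>?k. P e = Some e" "P y = Some \<rho>" for P \<rho> r
  proof -
    interpret place P by unfold_locales (rule P)
    have idk: "P e = Some e" if "e \<in> ?k" for e using P(2) that by blast
    have idK: "P a = Some a" if "a \<in> K" for a using idk adjoin_base[of K ?Y] that by blast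
    have YV: "P z \<noteq> None" if "z \<in> Y" for z
      using idk adjoin_gens[of ?Y K] P(3) that by (cases "z = y") auto
    have AV: "x \<in> V" if "x \<in># A" for x using finA[OF P(1) idK YV that] by (simp add: V_def)
    have 1: "c \<in> V" "res c = 0 \<longleftrightarrow> (\<exists>x\<in>#A. res x = 0)" unfolding A(1) using res_prod_mset_neg[OF AV] by blast+
    have yV: "y \<in> V" "res y = \<rho>" using P(3) by (simp_all add: P_eq_Some)
    have kV: "?k \<subseteq> V" "\<And>e. e \<in> ?k \<Longrightarrow> res e = e" using idk by (auto simp: P_eq_Some)
    have mp: "q \<in> polys V \<and> map_poly res q = q" if "q \<in> polys ?k" for q
      using polysD[OF that] kV by (auto simp: polys_def intro!: poly_eqI)
    have "res c * res (poly h y) = res (poly g y)"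
      using res_mult[OF 1(1), of "poly h y"] gh(4) poly_in[OF V_subring _ yV(1)] mp[OF ghk(2)] by simp
    then have "res c * poly h \<rho> = poly g \<rho>"
      using res_poly[OF _ yV(1)] mp ghk yV(2) by auto
    then have 2: "P c = Some r \<longrightarrow> r * poly h \<rho> = poly g \<rho>" unfolding P_eq_Some by blast
    have 3: "P c = Some 0 \<longrightarrow> (\<exists>x\<in>#A. P x = Some 0)" unfolding P_eq_Some 1(2) using AV by blast
    have "P c \<noteq> None" using 1(1) by (simp add: V_def)
    with 2 3 show ?thesis by (intro conjI)
  qed
  \<comment> \<open>If g were constant, h would not be, since c is not in K(W), and sending y to a
    root of h would give c a pole, which \<open>main\<close> excludes. A root of g is then a zero of
    c, as h does not vanish there.\<close>
  have "degree g > 0"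
  proof (rule ccontr)
    assume "\<not> degree g > 0"
    then obtain a where a: "g = [:a:]" using degree_eq_zeroE by blast
    then have a0: "a \<noteq> 0" using gy by auto
    have "degree h > 0"
    proof (rule ccontr)
      assume "\<not> degree h > 0"
      then obtain e where e: "h = [:e:]" using degree_eq_zeroE by blast
      then have "e \<noteq> 0" using gh(3) by auto
      then have "c = a / e" using gh(4) a e by (simp add: field_simps)
      moreover have "a \<in> ?E'" "e \<in> ?E'" using polysD[OF gh(1), of 0] polysD[OF gh(2), of 0] a e by auto
      ultimately show False using cW(2) subfield_divide[OF E'] by blast
    qed
    then obtain \<rho> where \<rho>: "poly h \<rho> = 0" using alg_closed_imp_poly_has_root by blast
    obtain P where P: "is_place UNIV P" "\<forall>e\<in>?k. P e = Some e" "P y = Some \<rho>" using ev by blast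
    obtain r where "P c = Some r" using main[OF P] by blast
    then have "r * poly h \<rho> = poly g \<rho>" using main[OF P] by blast
    then show False using \<rho> a a0 by simp
  qed
  then obtain \<rho> where \<rho>: "poly g \<rho> = 0" using alg_closed_imp_poly_has_root by blast
  then have h\<rho>: "poly h \<rho> \<noteq> 0" using gh(5) by blast
  obtain P where P: "is_place UNIV P" "\<forall>e\<in>?k. P e = Some e" "P y = Some \<rho>" using ev by blast
  obtain r where r: "P c = Some r" using main[OF P] by blast
  then have "r * poly h \<rho> = poly g \<rho>" using main[OF P] by blast
  then have Pc: "P c = Some 0" using r \<rho> h\<rho> by simp
  then obtain x where x: "x \<in># A" "P x = Some 0" using main[OF P] by blast
  obtain \<sigma> where \<sigma>: "ring_hom_on UNIV \<sigma>" "\<And>e. e \<in> ?E \<Longrightarrow> \<sigma> e = e" "\<sigma> b = x" using conj[OF x(1)] by blast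
  \<comment> \<open>Composition with the conjugation taking b to x turns the zero of P at x into a
    zero of R at b and leaves the values on K(Y) unchanged.\<close>
  define R where "R z = P (\<sigma> z)" for z
  have R: "is_place UNIV R" unfolding R_def by (rule place_comp[OF P(1) \<sigma>(1)])
  have RE: "R e = P e" if "e \<in> ?E" for e using \<sigma>(2)[OF that] by (simp add: R_def)
  have Rk: "R e = Some e" if "e \<in> ?k" for e using RE[of e] P(2) kE that by auto
  have RX: "R z \<noteq> None" if "z \<in> X" for z
  proof (rule controlsD[OF fin R _ _ that])
    show "R a = Some a" if "a \<in> K" for a using Rk adjoin_base[of K ?Y] that by blast
    show "R z \<noteq> None" if "z \<in> Y" for z
      using Rk[of z] RE[of y] P(3) adjoin_gens[of ?Y K] YE that by (cases "z = y") auto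
  qed
  have Rb: "R b = Some 0" using \<sigma>(3) x(2) by (simp add: R_def)
  have Rc: "R c = Some 0" using RE[OF cE] Pc by simp
  have ind: "alg_indep K ?Y" using Y(3) unfolding alg_indep_def by blast
  let ?M = "adjoin K (insert c ?Y)"
  have M: "is_subfield ?M" by (rule is_subfield_adjoin)
  have kM: "?k \<subseteq> ?M" and cM: "c \<in> ?M"
    by (rule adjoin_mono[OF order_refl]) (use adjoin_gens[of "insert c ?Y" K] in auto)
  \<comment> \<open>y is a root of g - c h. This polynomial is not 0, because otherwise c would be a
    quotient of coefficients of g and h and lie in K(W).\<close>
  have "algebraic_over ?M y"
    unfolding algebraic_over_iff[OF M]
  proof (intro bexI conjI)
    let ?q = "g - smult c h"
    show "?q \<in> polys ?M"
      using subsetD[OF polys_mono[OF kM] ghk(1)] subsetD[OF polys_mono[OF kM] ghk(2)] cM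
      by (intro polys_diff[OF subfield_subring[OF M]] polys_smult[OF subfield_subring[OF M]])
    show "poly ?q y = 0" using gh(4) by simp
    show "?q \<noteq> 0"
    proof
      assume "?q = 0"
      then have "coeff g i = c * coeff h i" for i by (metis coeff_smult eq_iff_diff_eq_0)
      from this[of "degree h"] have "c = coeff g (degree h) / lead_coeff h" using gh(3) by simp
      then show False using cW(2) subfield_divide[OF E' polysD[OF gh(1)] polysD[OF gh(2)]] by metis
    qed
  qed
  then obtain n where n: "has_dim ?M (adjoin ?M {y}) n" using finite_adjoin_algebraic[OF M, of "{y}"] by blast
  have "?E \<subseteq> adjoin ?M {y}"
    unfolding adjoin_adjoin by (rule adjoin_mono[OF order_refl]) blast
  then have "algebraic_over (adjoin ?M {y}) z" for z using algE algebraic_mono by blast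
  then have algM: "algebraic_over ?M z" for z
    using algebraic_trans_finite[OF M is_subfield_adjoin adjoin_base n] by blast
  have "divisorial F K R ?Y c"
    unfolding divisorial_def using R Y(1,5) ind Rk cE EF c0 Rc algM by auto
  then show ?thesis using RX Rb by blast
qed

end

section \<open>Units, uniformizers and residue fields of discrete places\<close>

lemma bounded_free_dim:
  assumes E: "is_subfield E"
    and V: "0 \<in> V" "\<And>x y. x \<in> V \<Longrightarrow> y \<in> V \<Longrightarrow> x + y \<in> V" "\<And>a x. a \<in> E \<Longrightarrow> x \<in> V \<Longrightarrow> a * x \<in> V"
    and bound: "\<And>C. finite C \<Longrightarrow> C \<subseteq> V \<Longrightarrow> free E C (\<lambda>x. x) \<Longrightarrow> card C \<le> n"
  shows "\<exists>m. has_dim E V m"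
proof -
  let ?P = "\<lambda>C. finite C \<and> C \<subseteq> V \<and> free E C (\<lambda>x. x)"
  have "?P {}" by (auto simp: free_def)
  then obtain C where C: "?P C" and max: "\<And>D. ?P D \<Longrightarrow> card D \<le> card C"
    using ex_has_greatest_nat[of ?P "{}" card "Suc n"] bound by (auto simp: less_Suc_eq_le)
  have "lspan E C (\<lambda>x. x) = V"
  proof
    show "lspan E C (\<lambda>x. x) \<subseteq> V" using C V by (intro lspan_least[OF E]) auto
    show "V \<subseteq> lspan E C (\<lambda>x. x)"
    proof (rule ccontr)
      assume "\<not> V \<subseteq> lspan E C (\<lambda>x. x)"
      then obtain x where x: "x \<in> V" "x \<notin> lspan E C (\<lambda>x. x)" by blast
      then have "x \<notin> C" using C lspan_base[OF E, of C x "\<lambda>x. x"] by blast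
      then show False using max[of "insert x C"] free_insert[OF E, of C x "\<lambda>x. x"] C x by auto
    qed
  qed
  then show ?thesis using C unfolding has_dim_def by blast
qed

context place
begin

text \<open>In place of a value group, \<open>unit (z / c powi n)\<close> says that z has n times
  the value of c; \<open>V_iff_power_int\<close> reads off the signs.\<close>

definition unit :: "'a \<Rightarrow> bool" where "unit u \<longleftrightarrow> u \<in> V \<and> res u \<noteq> 0"

lemma unit_nz: "unit u \<Longrightarrow> u \<noteq> 0" by (auto simp: unit_def)

lemma unit_V: "unit u \<Longrightarrow> u \<in> V" by (simp add: unit_def)

lemma unit_1: "unit 1" by (simp add: unit_def V_intros)

lemma unit_mult: "unit u \<Longrightarrow> unit w \<Longrightarrow> unit (u * w)"
  by (simp add: unit_def V_intros res_mult)

lemma unit_inverse: "unit u \<Longrightarrow> unit (inverse u)"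
  by (simp add: unit_def res_inverse)

lemma unit_divide: "unit u \<Longrightarrow> unit w \<Longrightarrow> unit (u / w)"
  by (simp add: divide_inverse unit_mult unit_inverse)

lemma unit_power: "unit u \<Longrightarrow> unit (u ^ n)"
  by (induction n) (auto simp: unit_1 unit_mult)

lemma unit_power_int: "unit u \<Longrightarrow> unit (u powi n)"
  by (auto simp: power_int_def unit_power unit_inverse)

lemma unit_mult_cancel: "unit u \<Longrightarrow> unit (u * w) \<longleftrightarrow> unit w"
proof
  assume "unit u" "unit (u * w)"
  then have "unit (u * w / u)" by (rule_tac unit_divide)
  then show "unit w" using unit_nz[OF \<open>unit u\<close>] by simp
qed (rule unit_mult)

lemma power_in_V: "x ^ n \<in> V \<Longrightarrow> n > 0 \<Longrightarrow> x \<in> V"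
proof (rule ccontr)
  assume *: "x ^ n \<in> V" "n > 0" "x \<notin> V"
  note i = notin_V[OF *(3)]
  have "res (x ^ n) * res (inverse x ^ n) = 1"
    using res_mult[OF *(1) V_intros(7)[OF i(2), of n]] i(1) by (simp add: power_inverse)
  moreover have "res (inverse x ^ n) = 0" using res_power[OF i(2), of n] i(3) *(2) by simp
  ultimately show False by simp
qed

lemma unit_of_power: "unit (x ^ n) \<Longrightarrow> n > 0 \<Longrightarrow> unit x"
  using power_in_V[of x n] res_power[of x n] by (auto simp: unit_def)

lemma unit_of_power_int:
  assumes "unit (x powi n)" "n \<noteq> 0" shows "unit x"
proof -
  have "unit (x ^ nat \<bar>n\<bar>)"
  proof (cases "n \<ge> 0")
    case True
    then show ?thesis using assms(1) by (simp add: power_int_def)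
  next
    case False
    then show ?thesis using unit_inverse[OF assms(1)] by (simp add: power_int_def power_inverse)
  qed
  then show ?thesis using unit_of_power assms(2) by simp
qed

lemma power_int_not_unit: "c \<in> V \<Longrightarrow> res c = 0 \<Longrightarrow> unit (c powi n) \<Longrightarrow> n = 0"
  using unit_of_power_int[of c n] by (auto simp: unit_def)

lemma V_iff_power_int:
  assumes "c \<in> V" "res c = 0" "c \<noteq> 0" "unit (z / c powi n)"
  shows "z \<in> V \<longleftrightarrow> n \<ge> 0" "z \<in> V \<Longrightarrow> res z = 0 \<longleftrightarrow> n > 0"
proof -
  let ?u = "z / c powi n"
  have z: "z = ?u * c powi n" using assms(3) by simp
  have pos: "z \<in> V \<and> (res z = 0 \<longleftrightarrow> n > 0)" if "n \<ge> 0"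
  proof -
    have e: "c powi n = c ^ nat n" using that by (simp add: power_int_def)
    have "c ^ nat n \<in> V" "res (c ^ nat n) = res c ^ nat n" using assms(1) by (simp_all add: V_intros res_power)
    moreover have "res z = res ?u * res (c ^ nat n)"
      using res_mult[OF unit_V[OF assms(4)] \<open>c ^ nat n \<in> V\<close>] z e by simp
    moreover have "z \<in> V" using V_intros(4)[OF unit_V[OF assms(4)] \<open>c ^ nat n \<in> V\<close>] z e by simp
    ultimately show ?thesis using assms(2,4) that by (auto simp: unit_def zero_less_nat_eq)
  qed
  have neg: "z \<notin> V" if "n < 0"
  proof
    assume "z \<in> V"
    have "c ^ nat (- n) = ?u * inverse z"
      using that assms(3) unit_nz[OF assms(4)] by (simp add: power_int_def field_simps power_inverse)
    then have "c ^ nat (- n) * z = ?u" using unit_nz[OF assms(4)] by simp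
    moreover have "res (c ^ nat (- n) * z) = 0"
      using res_mult[OF V_intros(7)[OF assms(1)] \<open>z \<in> V\<close>] res_power[OF assms(1)] assms(2) that by simp
    ultimately show False using assms(4) by (simp add: unit_def)
  qed
  show "z \<in> V \<longleftrightarrow> n \<ge> 0" using pos neg by (cases "n \<ge> 0") auto
  show "z \<in> V \<Longrightarrow> res z = 0 \<longleftrightarrow> n > 0" using pos neg by (cases "n \<ge> 0") auto
qed

text \<open>In a vanishing sum the least value is attained twice: after division by a dominant term
  the residues add up to 0, and one of them is 1.\<close>

lemma sum_zero_unit_ratio:
  assumes I: "finite I" "i0 \<in> I" "a i0 \<noteq> 0" and sum: "(\<Sum>i\<in>I. a i) = 0"
  shows "\<exists>i\<in>I. \<exists>j\<in>I. i \<noteq> j \<and> a i \<noteq> 0 \<and> a j \<noteq> 0 \<and> unit (a i / a j)"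
proof -
  obtain j where j: "j \<in> I" "a j \<noteq> 0" "\<forall>i\<in>I. a i / a j \<in> V" using ex_dominant[of I a] I by blast
  have "(\<Sum>i\<in>I. a i / a j) = 0" using sum by (simp add: sum_divide_distrib[symmetric])
  then have "0 = res (\<Sum>i\<in>I. a i / a j)" by simp
  also have "\<dots> = (\<Sum>i\<in>I. res (a i / a j))" using j(3) by (intro res_sum) simp
  also have "\<dots> = res (a j / a j) + (\<Sum>i\<in>I - {j}. res (a i / a j))" using I(1) j(1) by (rule sum.remove)
  finally have "(\<Sum>i\<in>I - {j}. res (a i / a j)) \<noteq> 0" using j(2) by auto
  then obtain i where i: "i \<in> I - {j}" "res (a i / a j) \<noteq> 0" by (rule sum.not_neutral_contains_not_neutral)
  moreover have "a i \<noteq> 0" using i(2) by auto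
  ultimately show ?thesis using j by (intro bexI[of _ i] bexI[of _ j]) (auto simp: unit_def)
qed

definition uniformizer :: "'a set \<Rightarrow> 'a \<Rightarrow> bool" where
  "uniformizer F \<pi> \<longleftrightarrow> \<pi> \<in> F \<and> \<pi> \<noteq> 0 \<and> \<pi> \<in> V \<and> res \<pi> = 0 \<and>
     (\<forall>z\<in>F. z \<noteq> 0 \<longrightarrow> (\<exists>i::int. unit (z / \<pi> powi i)))"

lemma is_subfield_residue:
  assumes F: "is_subfield F" shows "is_subfield (res ` (F \<inter> V))"
  unfolding is_subfield_def is_subring_def
proof (intro conjI ballI)
  have FV: "is_subring (F \<inter> V)" using is_subring_Int[OF subfield_subring[OF F] V_subring] .
  show "0 \<in> res ` (F \<inter> V)" using imageI[OF subring_0[OF FV], of res] by simp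
  show "1 \<in> res ` (F \<inter> V)" using imageI[OF subring_1[OF FV], of res] by simp
  fix x assume "x \<in> res ` (F \<inter> V)"
  then obtain a where a: "a \<in> F \<inter> V" "x = res a" by blast
  show "inverse x \<in> res ` (F \<inter> V)"
  proof (cases "x = 0")
    case True
    then show ?thesis using imageI[OF subring_0[OF FV], of res] by simp
  next
    case False
    then have "inverse a \<in> F \<inter> V" "inverse x = res (inverse a)"
      using a res_inverse[of a] subfield_inverse[OF F, of a] by auto
    then show ?thesis by blast
  qed
  fix y assume "y \<in> res ` (F \<inter> V)"
  then obtain b where b: "b \<in> F \<inter> V" "y = res b" by blast
  have "x - y = res (a - b)" "x * y = res (a * b)" using a b by (simp_all add: res_diff res_mult)
  moreover have "a - b \<in> F \<inter> V" "a * b \<in> F \<inter> V"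
    using subring_intros(3,4)[OF FV a(1) b(1)] by simp_all
  ultimately show "x - y \<in> res ` (F \<inter> V)" "x * y \<in> res ` (F \<inter> V)" by blast+
qed

end

text \<open>The setting of a function field of one variable over k with parameter c. Discreteness of
  the place and finiteness of its residue field are both deduced from the degree n of F over
  k(c).\<close>

locale div_place = place P for P :: "'a::alg_closed_field \<Rightarrow> 'a option" +
  fixes F k :: "'a set" and c :: 'a and n :: nat
  assumes F: "is_subfield F" and k: "is_subfield k" "k \<subseteq> F" and idk: "e \<in> k \<Longrightarrow> P e = Some e"
    and c: "c \<in> F" "c \<noteq> 0" "P c = Some 0" and dim: "has_dim (adjoin k {c}) F n"
begin

abbreviation "M \<equiv> adjoin k {c}"

lemma cV: "c \<in> V" "res c = 0" using c(3) by (simp_all add: P_eq_Some)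

lemma kV: "k \<subseteq> V" "e \<in> k \<Longrightarrow> res e = e"
  using idk by (auto simp: P_eq_Some)

lemma M: "is_subfield M" by (rule is_subfield_adjoin)

text \<open>Constants are fixed and c goes to 0, so a polynomial with constant term a \<noteq> 0 has
  residue a; otherwise a factor c splits off. The place is thus c-adic on k(c), with residue field
  k.\<close>

lemma poly_c_value:
  assumes "p \<in> polys k" "p \<noteq> 0"
  shows "\<exists>i u. poly p c = c ^ i * u \<and> unit u \<and> res u \<in> k"
  using assms
proof (induction p)
  case (pCons a p)
  have a: "a \<in> k" using polysD[OF pCons.prems(1), of 0] by simp
  have p: "p \<in> polys k" using polysD[OF pCons.prems(1), of "Suc i" for i] by (simp add: polys_def)
  show ?case
  proof (cases "a = 0")
    case True
    then have "p \<noteq> 0" using pCons.prems(2) by simp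
    from pCons.IH[OF p this] obtain i u where "poly p c = c ^ i * u \<and> unit u \<and> res u \<in> k" by (elim exE)
    then show ?thesis using True by (intro exI[of _ "Suc i"] exI[of _ u]) simp
  next
    case False
    have "poly p c \<in> V" using poly_in[OF V_subring subsetD[OF polys_mono[OF kV(1)] p] cV(1)] .
    then have "c * poly p c \<in> V" "res (c * poly p c) = 0" using cV by (simp_all add: V_intros res_mult)
    then have "poly (pCons a p) c \<in> V" "res (poly (pCons a p) c) = a"
      using a kV by (auto simp: V_intros res_add)
    then show ?thesis using False a by (intro exI[of _ 0] exI[of _ "poly (pCons a p) c"]) (simp add: unit_def)
  qed
qed simp

lemma M_value:
  assumes "z \<in> M" "z \<noteq> 0"
  shows "\<exists>i::int. unit (z / c powi i) \<and> res (z / c powi i) \<in> k"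
proof -
  obtain p q where pq: "p \<in> polys k" "q \<in> polys k" "poly q c \<noteq> 0" "z = poly p c / poly q c"
    using assms(1) unfolding adjoin_singleton[OF k(1)] by blast
  then have "p \<noteq> 0" "q \<noteq> 0" using assms(2) by auto
  from poly_c_value[OF pq(1) this(1)] obtain i u where u: "poly p c = c ^ i * u" "unit u" "res u \<in> k" by blast
  from poly_c_value[OF pq(2) \<open>q \<noteq> 0\<close>] obtain j w where w: "poly q c = c ^ j * w" "unit w" "res w \<in> k" by blast
  have "c powi (int i - int j) = c ^ i / c ^ j" using c(2) by (simp add: power_int_diff)
  then have "z / c powi (int i - int j) = u / w" using pq(4) u w c(2) unit_nz[OF w(2)] by simp
  moreover have "unit (u / w)" by (rule unit_divide[OF u(2) w(2)])
  moreover have "res (u / w) = res u / res w" using res_divide[of u w] u w by (simp add: unit_def)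
  ultimately show ?thesis using u w subfield_divide[OF k(1)] by (intro exI[of _ "int i - int j"]) simp
qed

lemma res_M: 
  assumes "z \<in> M" "z \<in> V" shows "res z \<in> k"
proof (cases "res z = 0")
  case False
  then have "z \<noteq> 0" by auto
  obtain i :: int where i: "unit (z / c powi i)" "res (z / c powi i) \<in> k" using M_value[OF assms(1) \<open>z \<noteq> 0\<close>] by blast
  have "i = 0" using V_iff_power_int[OF cV c(2) i(1)] assms(2) False by auto
  then show ?thesis using i(2) by simp
qed (use subfield_intros(1)[OF k(1)] in simp)

text \<open>The powers 1, z, ..., z^n are dependent over k(c), so two terms of a relation have equal
  value and z^(i-j) has the value of a power of c. Since |i-j| <= n divides n!, the exponent n!
  serves all z at once.\<close>

lemma ex_value:
  assumes z: "z \<in> F" "z \<noteq> 0"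
  shows "\<exists>m::int. unit (z ^ fact n / c powi m)"
proof -
  obtain B where B: "finite B" "card B = n" "lspan M B (\<lambda>x. x) = F" using dim unfolding has_dim_def by blast
  have "\<not> free M {..n} (\<lambda>i. z ^ i)"
    using B(2,3) subfield_intros(7)[OF F z(1)] by (intro steinitz[OF M B(1), where g = "\<lambda>x. x"]) auto
  then obtain a i0 where a: "\<And>i. i \<in> {..n} \<Longrightarrow> a i \<in> M" "(\<Sum>i\<in>{..n}. a i * z ^ i) = 0" "i0 \<in> {..n}" "a i0 \<noteq> 0"
    by (elim not_freeE) auto
  have "a i0 * z ^ i0 \<noteq> 0" using a(4) z(2) by simp
  from sum_zero_unit_ratio[OF _ a(3) this a(2)] obtain i j where
    ij: "i \<le> n" "j \<le> n" "i \<noteq> j" "a i * z ^ i \<noteq> 0" "a j * z ^ j \<noteq> 0" "unit ((a i * z ^ i) / (a j * z ^ j))" by auto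
  have "a i / a j \<in> M" using a(1) ij by (intro subfield_divide[OF M]) auto
  moreover have "a i / a j \<noteq> 0" using ij by simp
  ultimately obtain e :: int where e: "unit (a i / a j / c powi e)" using M_value by blast
  define d where "d = int i - int j"
  have zd: "z powi d = z ^ i / z ^ j" using z(2) by (simp add: d_def power_int_diff)
  have eq: "(a i * z ^ i) / (a j * z ^ j) = (a i / a j / c powi e) * (z powi d * c powi e)"
    using c(2) by (simp add: zd)
  have u: "unit (z powi d * c powi e)" using ij(6) unfolding eq unit_mult_cancel[OF e] .
  have "d \<noteq> 0" "\<bar>d\<bar> \<le> int n" using ij by (auto simp: d_def)
  then have "nat \<bar>d\<bar> dvd fact n" by (intro dvd_fact) auto
  then have "d dvd int (fact n)" by (metis abs_ge_zero int_dvd_int_iff nat_0_le dvd_abs_iff abs_dvd_iff)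
  then obtain q where q: "int (fact n) = d * q" by (elim dvdE)
  have "(z powi d * c powi e) powi q = z powi (d * q) * c powi (e * q)"
    by (simp add: power_int_mult_distrib power_int_mult)
  also have "z powi (d * q) = z ^ fact n" unfolding q[symmetric] by (rule power_int_of_nat)
  also have "z ^ fact n * c powi (e * q) = z ^ fact n / c powi (- (e * q))"
    by (simp add: power_int_minus field_simps)
  finally show ?thesis using unit_power_int[OF u, of q] by (intro exI[of _ "- (e * q)"]) simp
qed

text \<open>\<open>v z\<close> measures z^(n!) in terms of c, which is an integer-valued valuation
  on F with v(c) = n!. An element of least positive value is a uniformizer, by division of
  \<open>v z\<close> with remainder.\<close>

lemma ex_uniformizer: "\<exists>\<pi>. uniformizer F \<pi>"
proof -
  define N where "N = (fact n :: nat)"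
  have N: "N > 0" by (simp add: N_def)
  define v where "v z = (SOME m::int. unit (z ^ N / c powi m))" for z
  have v: "unit (z ^ N / c powi v z)" if "z \<in> F" "z \<noteq> 0" for z
    unfolding v_def N_def by (rule someI_ex[OF ex_value[OF that]])
  have veq: "v z = m" if "z \<in> F" "z \<noteq> 0" "unit (z ^ N / c powi m)" for z m
  proof -
    have "unit ((z ^ N / c powi m) / (z ^ N / c powi v z))" using unit_divide[OF that(3) v[OF that(1,2)]] .
    moreover have "(z ^ N / c powi m) / (z ^ N / c powi v z) = c powi (v z - m)"
      using that(2) c(2) by (simp add: power_int_diff)
    ultimately show ?thesis using power_int_not_unit[OF cV, of "v z - m"] by simp
  qed
  have "v c = int N" using veq[OF c(1,2), of "int N"] c(2) unit_1 by simp
  then have "\<exists>z. z \<in> F \<and> z \<noteq> 0 \<and> v z > 0" using N c by (intro exI[of _ c]) simp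
  then obtain z0 where "z0 \<in> F \<and> z0 \<noteq> 0 \<and> v z0 > 0" by (rule exE)
  from ex_has_least_nat[of "\<lambda>z. z \<in> F \<and> z \<noteq> 0 \<and> v z > 0", OF this, of "\<lambda>z. nat (v z)"]
  obtain \<pi> where \<pi>: "\<pi> \<in> F" "\<pi> \<noteq> 0" "v \<pi> > 0"
    and min: "\<forall>z. z \<in> F \<and> z \<noteq> 0 \<and> v z > 0 \<longrightarrow> nat (v \<pi>) \<le> nat (v z)" by auto
  have "\<pi> ^ N \<in> V" "res (\<pi> ^ N) = 0"
    using V_iff_power_int[OF cV c(2) v[OF \<pi>(1,2)]] \<pi>(3) by auto
  then have \<pi>V: "\<pi> \<in> V" "res \<pi> = 0" using power_in_V[of \<pi> N] N res_power[of \<pi> N] by auto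
  have "\<exists>i::int. unit (z / \<pi> powi i)" if z: "z \<in> F" "z \<noteq> 0" for z
  proof -
    define q where "q = v z div v \<pi>"
    define w where "w = z / \<pi> powi q"
    have w: "w \<in> F" "w \<noteq> 0" using z \<pi> subfield_intros(12,13)[OF F] by (auto simp: w_def)
    have "w ^ N / c powi (v z - q * v \<pi>) = (z ^ N / c powi v z) / (\<pi> ^ N / c powi v \<pi>) powi q"
      using c(2) \<pi>(2) unfolding w_def
      by (simp add: power_divide power_int_diff power_int_divide_distrib power_int_mult mult.commute[of q] flip: power_int_of_nat power_int_mult)
    then have "unit (w ^ N / c powi (v z - q * v \<pi>))"
      using unit_divide[OF v[OF z] unit_power_int[OF v[OF \<pi>(1,2)], of q]] by simp
    then have "v w = v z - q * v \<pi>" using veq[OF w] by blast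
    also have "\<dots> = v z mod v \<pi>" by (simp add: q_def minus_div_mult_eq_mod)
    finally have vw: "v w = v z mod v \<pi>" .
    have "v w = 0"
    proof (rule ccontr)
      assume "v w \<noteq> 0"
      then have "v w > 0" using vw pos_mod_sign[OF \<pi>(3), of "v z"] by simp
      then have "nat (v \<pi>) \<le> nat (v w)" using min w by blast
      then show False using vw pos_mod_bound[OF \<pi>(3), of "v z"] \<pi>(3) by linarith
    qed
    then have "unit (w ^ N)" using v[OF w] by simp
    then have "unit w" using unit_of_power N by blast
    then show ?thesis unfolding w_def by blast
  qed
  then show ?thesis unfolding uniformizer_def using \<pi> \<pi>V by blast
qed

definition \<kappa> :: "'a set" where "\<kappa> = res ` (F \<inter> V)"

lemma \<kappa>: "is_subfield \<kappa>" unfolding \<kappa>_def by (rule is_subfield_residue[OF F])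

lemma res_\<kappa>: "x \<in> F \<Longrightarrow> x \<in> V \<Longrightarrow> res x \<in> \<kappa>" by (auto simp: \<kappa>_def)

lemma k_\<kappa>: "k \<subseteq> \<kappa>"
proof
  fix e assume "e \<in> k"
  then have "e \<in> F" "e \<in> V" "res e = e" using k(2) kV by auto
  then show "e \<in> \<kappa>" using res_\<kappa>[of e] by simp
qed

text \<open>Lifts of residues independent over k are independent over k(c): divide a relation by its
  dominant coefficient and take residues, which lie in k on k(c). So at most n residues are
  independent.\<close>

lemma ex_residue_dim: "\<exists>m. has_dim k \<kappa> m"
proof (rule bounded_free_dim[OF k(1)])
  note I = subfield_intros[OF \<kappa>]
  show "0 \<in> \<kappa>" "\<And>x y. x \<in> \<kappa> \<Longrightarrow> y \<in> \<kappa> \<Longrightarrow> x + y \<in> \<kappa>" by (rule I; assumption)+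
  show "\<And>a x. a \<in> k \<Longrightarrow> x \<in> \<kappa> \<Longrightarrow> a * x \<in> \<kappa>" using k_\<kappa> I(4) by blast
  fix C assume C: "finite C" "C \<subseteq> \<kappa>" "free k C (\<lambda>x. x)"
  have "\<forall>x\<in>C. \<exists>y. y \<in> F \<inter> V \<and> res y = x" using C(2) unfolding \<kappa>_def by auto
  from bchoice[OF this] obtain l where l: "\<forall>x\<in>C. l x \<in> F \<inter> V \<and> res (l x) = x" by (rule exE)
  have "free M C l"
  proof (rule ccontr)
    assume "\<not> free M C l"
    then obtain a i where a: "\<And>i. i \<in> C \<Longrightarrow> a i \<in> M" "(\<Sum>i\<in>C. a i * l i) = 0" "i \<in> C" "a i \<noteq> 0" by (elim not_freeE) auto
    obtain j where j: "j \<in> C" "a j \<noteq> 0" "\<forall>i\<in>C. a i / a j \<in> V" using ex_dominant[OF C(1), of a] a(3,4) by blast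
    have "(\<Sum>i\<in>C. a i / a j * l i) = (\<Sum>i\<in>C. a i * l i) / a j" by (simp add: sum_divide_distrib)
    then have "0 = res (\<Sum>i\<in>C. a i / a j * l i)" using a(2) by simp
    also have "\<dots> = (\<Sum>i\<in>C. res (a i / a j * l i))" using j(3) l by (intro res_sum V_intros(4)) auto
    also have "\<dots> = (\<Sum>i\<in>C. res (a i / a j) * i)"
    proof (rule sum.cong[OF refl])
      fix i assume "i \<in> C"
      then have "a i / a j \<in> V" "l i \<in> V" "res (l i) = i" using j(3) l by auto
      then show "res (a i / a j * l i) = res (a i / a j) * i" by (simp only: res_mult)
    qed
    finally have "(\<Sum>i\<in>C. res (a i / a j) * i) = 0" by simp
    moreover have "res (a i / a j) \<in> k" if "i \<in> C" for i
      using a(1) j that by (intro res_M subfield_divide[OF M]) auto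
    ultimately have "res (a j / a j) = 0" using freeD[OF C(3), of "\<lambda>i. res (a i / a j)"] j(1) by blast
    then show False using j(2) by simp
  qed
  moreover obtain B where B: "finite B" "card B = n" "lspan M B (\<lambda>x. x) = F" using dim unfolding has_dim_def by blast
  moreover have "l ` C \<subseteq> lspan M B (\<lambda>x. x)" using l B(3) by auto
  ultimately show "card C \<le> n" using card_le_if_free_span[OF M B(1) C(1)] by blast
qed

end

text \<open>The increment is itself a polynomial, since a substitution X \<mapsto> c + s^N X will be
  expanded around z; constant increments are the case \<open>taylor2\<close>.\<close>

lemma poly_taylor:
  assumes R: "is_subring R" and "f \<in> polys R" "z \<in> R" "H \<in> polys R"
  shows "\<exists>r\<in>polys R. pcompose f ([:z:] + H) = [:poly f z:] + [:poly (pderiv f) z:] * H + H ^ 2 * r"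
  using assms(2)
proof (induction f)
  case 0
  show ?case using polys_0[OF R] by (intro bexI[of _ 0]) simp_all
next
  case (pCons a f)
  have f: "f \<in> polys R" using polysD[OF pCons.prems(1), of "Suc i" for i] by (simp add: polys_def)
  define A where "A = [:poly f z:]"
  define B where "B = [:poly (pderiv f) z:]"
  define Z where "Z = [:z:]"
  from pCons.IH[OF f] obtain r where r: "r \<in> polys R" "pcompose f (Z + H) = A + B * H + H ^ 2 * r"
    unfolding A_def B_def Z_def by (elim bexE)
  define r' where "r' = Z * r + B + H * r"
  have "poly (pderiv f) z \<in> R" using poly_in[OF R polys_pderiv[OF R f] assms(3)] .
  then have r': "r' \<in> polys R" unfolding r'_def B_def Z_def
    using r(1) assms(3,4) by (intro polys_add[OF R] polys_const[OF R] polys_mult[OF R])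
  have "pcompose (pCons a f) (Z + H) = [:a:] + (Z + H) * (A + B * H + H ^ 2 * r)"
    by (simp add: pcompose_pCons r(2))
  also have "\<dots> = ([:a:] + Z * A) + (A + Z * B) * H + H ^ 2 * r'"
    by (simp add: r'_def algebra_simps power2_eq_square)
  also have "[:a:] + Z * A = [:poly (pCons a f) z:]" by (simp add: Z_def A_def)
  also have "A + Z * B = [:poly (pderiv (pCons a f)) z:]" by (simp add: Z_def A_def B_def pderiv_pCons)
  finally show ?case using r' unfolding Z_def by (intro bexI[of _ r'])
qed

lemma taylor2:
  assumes R: "is_subring R" and "f \<in> polys R" "z \<in> R" "h \<in> R"
  shows "\<exists>r\<in>R. poly f (z + h) = poly f z + poly (pderiv f) z * h + h ^ 2 * r"
proof -
  from poly_taylor[OF R assms(2,3) polys_const[OF R assms(4)]] obtain r where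
    r: "r \<in> polys R" "pcompose f ([:z:] + [:h:]) = [:poly f z:] + [:poly (pderiv f) z:] * [:h:] + [:h:] ^ 2 * r" by (elim bexE)
  from arg_cong[OF r(2), of "\<lambda>q. poly q 0"] have "poly f (z + h) = poly f z + poly (pderiv f) z * h + h ^ 2 * poly r 0"
    by (simp add: poly_pcompose)
  then show ?thesis using poly_in[OF R r(1) subring_0[OF R]] by blast
qed

subsection \<open>The primitive element theorem\<close>

text \<open>With \<theta> = a + l b, the element b is the only common root of \<mu> and
  \<alpha>(\<theta> - l X) when l avoids finitely many values, and it is a simple root of \<mu>. So
  the minimal polynomial of b over E(\<theta>) is linear.\<close>

lemma primitive_pair:
  fixes a b :: "'a::alg_closed_field"
  assumes E: "is_subfield E" and inf: "infinite E" and a: "algebraic_over E a"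
    and \<mu>: "is_minpoly E b \<mu>" and sep: "poly (pderiv \<mu>) b \<noteq> 0"
  shows "\<exists>\<theta>\<in>adjoin E {a, b}. {a, b} \<subseteq> adjoin E {\<theta>}"
proof -
  obtain \<alpha> where \<alpha>: "is_minpoly E a \<alpha>" using ex_minpoly[OF E a] by blast
  note d\<alpha> = is_minpolyD[OF \<alpha>] and d\<mu> = is_minpolyD[OF \<mu>]
  let ?A = "{x. poly \<alpha> x = 0}" and ?B = "{x. poly \<mu> x = 0}"
  \<comment> \<open>l is bad if \<theta> = x + l y for conjugates x of a and y \<noteq> b of b. For
    y = b the division yields 0, so 0 is avoided too.\<close>
  let ?bad = "(\<lambda>(x, y). (x - a) / (b - y)) ` (?A \<times> ?B)"
  have "finite ?bad" using poly_roots_finite[OF d\<alpha>(4)] poly_roots_finite[OF d\<mu>(4)] by simp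
  then obtain l where l: "l \<in> E" "l \<notin> ?bad" using inf by (meson finite_subset subsetI)
  define \<theta> where "\<theta> = a + l * b"
  let ?L = "adjoin E {\<theta>}"
  have L: "is_subfield ?L" by (rule is_subfield_adjoin)
  have EL: "E \<subseteq> ?L" and \<theta>L: "\<theta> \<in> ?L" using adjoin_base adjoin_gens by blast+
  have "algebraic_over E b" using algebraic_over_iff[OF E] d\<mu> by blast
  then obtain \<nu> where \<nu>: "is_minpoly ?L b \<nu>" using ex_minpoly[OF L algebraic_mono[OF EL]] by blast
  note d\<nu> = is_minpolyD[OF \<nu>]
  have \<mu>L: "\<mu> \<in> polys ?L" and \<alpha>L: "\<alpha> \<in> polys ?L" using polys_mono[OF EL] d\<mu>(1) d\<alpha>(1) by blast+
  obtain q where q: "q \<in> polys ?L" "\<mu> = \<nu> * q" using is_minpoly_dvd[OF \<nu> \<mu>L d\<mu>(3)] .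
  have lin: "[:\<theta>, - l:] \<in> polys ?L"
    using \<theta>L l(1) EL subfield_intros(5)[OF L] by (intro polys_pCons[OF subfield_subring[OF L]] polys_0[OF subfield_subring[OF L]]) auto
  define h where "h = pcompose \<alpha> [:\<theta>, - l:]"
  have hL: "h \<in> polys ?L" unfolding h_def by (rule polys_pcompose[OF subfield_subring[OF L] \<alpha>L lin])
  have hev: "poly h r = poly \<alpha> (\<theta> - l * r)" for r by (simp add: h_def poly_pcompose mult.commute)
  have hb: "poly h b = 0" using hev[of b] d\<alpha>(3) by (simp add: \<theta>_def)
  obtain q' where q': "q' \<in> polys ?L" "h = \<nu> * q'" using is_minpoly_dvd[OF \<nu> hL hb] .
  have root: "r = b" if r: "poly \<nu> r = 0" for r
  proof (rule ccontr)
    assume "r \<noteq> b"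
    have "poly \<mu> r = 0" using r q(2) by simp
    moreover have "poly \<alpha> (\<theta> - l * r) = 0" using r q'(2) hev[of r] by simp
    moreover have "l = ((\<theta> - l * r) - a) / (b - r)" using \<open>r \<noteq> b\<close> by (simp add: \<theta>_def field_simps)
    ultimately have "l \<in> ?bad" by (intro image_eqI[of _ _ "(\<theta> - l * r, r)"]) auto
    then show False using l(2) by blast
  qed
  obtain \<nu>' where \<nu>': "\<nu> = [:-b, 1:] * \<nu>'" using d\<nu>(3) by (meson dvdE poly_eq_0_iff_dvd)
  have "poly \<nu>' b \<noteq> 0"
  proof
    assume *: "poly \<nu>' b = 0"
    have "pderiv \<mu> = \<nu> * pderiv q + q * pderiv \<nu>" unfolding q(2) by (simp add: pderiv_mult)
    moreover have "poly (pderiv \<nu>) b = 0" unfolding \<nu>' pderiv_mult using * by simp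
    ultimately show False using sep d\<nu>(3) by simp
  qed
  then have "degree \<nu>' = 0"
    using alg_closed_imp_poly_has_root[of \<nu>'] root \<nu>' by (metis mult_zero_right not_gr_zero poly_mult)
  then obtain e where e: "\<nu>' = [:e:]" using degree_eq_zeroE by blast
  then have "e = 1" using d\<nu>(2,4) \<nu>' by auto
  then have "\<nu> = [:-b, 1:]" using \<nu>' e by simp
  then have "- b \<in> ?L" using polysD[OF d\<nu>(1), of 0] by simp
  then have bL: "b \<in> ?L" using subfield_intros(5)[OF L] by fastforce
  moreover have "a = \<theta> - l * b" by (simp add: \<theta>_def)
  then have "a \<in> ?L" using \<theta>L bL l(1) EL subfield_intros(3,4)[OF L] by auto
  moreover have "\<theta> \<in> adjoin E {a, b}"
  proof -
    have N: "is_subfield (adjoin E {a, b})" by (rule is_subfield_adjoin)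
    have "a \<in> adjoin E {a, b}" "b \<in> adjoin E {a, b}" "l \<in> adjoin E {a, b}"
      using adjoin_gens[of "{a, b}" E] adjoin_base[of E "{a, b}"] l(1) by auto
    then show ?thesis unfolding \<theta>_def using subfield_intros(4,6)[OF N] by blast
  qed
  ultimately show ?thesis by blast
qed

text \<open>Over a finite field a suitable l need not exist; there the cyclic multiplicative group,
  transferred from a ring structure with carrier N, supplies the generator.\<close>

lemma finite_field_primitive:
  fixes N :: "'a::field set"
  assumes N: "is_subfield N" and fin: "finite N"
  shows "\<exists>g\<in>N. \<forall>x\<in>N. x \<noteq> 0 \<longrightarrow> (\<exists>i::nat. x = g ^ i)"
proof -
  let ?R = "\<lparr>carrier = N, mult = (*), one = 1, zero = 0, add = (+)\<rparr> :: 'a ring"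
  note I = subfield_intros[OF N]
  have "\<exists>y\<in>N. x + y = 0" if "x \<in> N" for x using I(5)[OF that] by (intro bexI[of _ "- x"]) simp_all
  then have "abelian_group ?R"
    by (intro abelian_groupI) (simp_all add: I algebra_simps)
  moreover have "Group.comm_monoid ?R"
    by (intro comm_monoidI) (simp_all add: I algebra_simps)
  ultimately have cr: "cring ?R"
    by (intro cringI) (simp_all add: distrib_right)
  interpret R: cring ?R by (rule cr)
  have "field ?R"
  proof (rule R.cring_fieldI2)
    show "\<zero>\<^bsub>?R\<^esub> \<noteq> \<one>\<^bsub>?R\<^esub>" by simp
    fix a assume "a \<in> carrier ?R" "a \<noteq> \<zero>\<^bsub>?R\<^esub>"
    then show "\<exists>b\<in>carrier ?R. a \<otimes>\<^bsub>?R\<^esub> b = \<one>\<^bsub>?R\<^esub>"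
      using I(11) by (intro bexI[of _ "inverse a"]) simp_all
  qed
  then interpret R: field ?R .
  have pw: "x [^]\<^bsub>?R\<^esub> i = x ^ i" for x and i :: nat
    by (induction i) (simp_all add: mult.commute)
  obtain g where g: "g \<in> carrier (mult_of ?R)" "carrier (mult_of ?R) = {g [^]\<^bsub>?R\<^esub> i | i::nat. i \<in> UNIV}"
    using R.finite_field_mult_group_has_gen fin by auto
  then have "g \<in> N" "N - {0} = {g ^ i | i::nat. i \<in> UNIV}" by (simp_all add: pw)
  then show ?thesis by blast
qed

lemma primitive_element:
  fixes E N :: "'a::alg_closed_field set"
  assumes E: "is_subfield E" and N: "is_subfield N" "E \<subseteq> N" "has_dim E N n"
    and sep: "\<And>x \<mu>. x \<in> N \<Longrightarrow> is_minpoly E x \<mu> \<Longrightarrow> poly (pderiv \<mu>) x \<noteq> 0"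
  shows "\<exists>\<theta>\<in>N. adjoin E {\<theta>} = N"
proof -
  obtain B where B: "finite B" "lspan E B (\<lambda>x. x) = N" using N(3) unfolding has_dim_def by blast
  have sub: "adjoin E {\<theta>} \<subseteq> N" if "\<theta> \<in> N" for \<theta> using adjoin_least[OF N(1,2), of "{\<theta>}"] that by simp
  show ?thesis
  proof (cases "finite E")
    case True
    have "N \<subseteq> (\<lambda>c. \<Sum>x\<in>B. c x * x) ` (B \<rightarrow>\<^sub>E E)"
    proof
      fix x assume "x \<in> N"
      then have "x \<in> lspan E B (\<lambda>x. x)" using B(2) by simp
      then obtain c where c: "\<forall>i\<in>B. c i \<in> E" "x = (\<Sum>i\<in>B. c i * i)" by (auto simp: lspan_def)
      have "x = (\<Sum>i\<in>B. restrict c B i * i)" using c(2) by simp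
      moreover have "restrict c B \<in> B \<rightarrow>\<^sub>E E" using c(1) by auto
      ultimately show "x \<in> (\<lambda>c. \<Sum>x\<in>B. c x * x) ` (B \<rightarrow>\<^sub>E E)" by blast
    qed
    moreover have "finite (B \<rightarrow>\<^sub>E E)" using B(1) True by (intro finite_PiE) auto
    ultimately have "finite N" using finite_surj by blast
    from finite_field_primitive[OF N(1) this] obtain g where g: "g \<in> N" "\<And>x. x \<in> N \<Longrightarrow> x \<noteq> 0 \<Longrightarrow> \<exists>i::nat. x = g ^ i" by blast
    have L: "is_subfield (adjoin E {g})" by (rule is_subfield_adjoin)
    have "x \<in> adjoin E {g}" if x: "x \<in> N" for x
    proof (cases "x = 0")
      case False
      then obtain i where "x = g ^ i" using g(2)[OF x] by blast
      then show ?thesis using subfield_intros(7)[OF L, of g i] adjoin_gens[of "{g}" E] by simp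
    qed (use subfield_intros(1)[OF L] in simp)
    then show ?thesis using g(1) sub[OF g(1)] by blast
  next
    case False
    have "\<exists>\<theta>\<in>N. C \<subseteq> adjoin E {\<theta>}" if "finite C" "C \<subseteq> N" for C
      using that
    proof (induction C)
      case empty
      show ?case using subfield_intros(1)[OF N(1)] by blast
    next
      case (insert b C)
      then obtain a where a: "a \<in> N" "C \<subseteq> adjoin E {a}" by auto
      have bN: "b \<in> N" using insert.prems by simp
      have alg: "algebraic_over E x" if "x \<in> N" for x
        using has_dim_algebraic[OF E subfield_subring[OF N(1)] N(3) that] .
      obtain \<mu> where \<mu>: "is_minpoly E b \<mu>" using ex_minpoly[OF E alg[OF bN]] by blast
      from primitive_pair[OF E False alg[OF a(1)] \<mu> sep[OF bN \<mu>]] obtain \<theta> where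
        \<theta>: "\<theta> \<in> adjoin E {a, b}" "{a, b} \<subseteq> adjoin E {\<theta>}" by (elim bexE)
      have "adjoin E {a, b} \<subseteq> N" using adjoin_least[OF N(1,2), of "{a, b}"] a(1) bN by simp
      then have "\<theta> \<in> N" using \<theta>(1) by blast
      moreover have "adjoin E {a} \<subseteq> adjoin E {\<theta>}"
        using adjoin_least[OF is_subfield_adjoin adjoin_base, of "{a}"] \<theta>(2) by simp
      ultimately show ?case using a(2) \<theta>(2) by (intro bexI[of _ \<theta>]) auto
    qed
    moreover have "B \<subseteq> N" using lspan_base[OF E B(1), of _ "\<lambda>x. x"] B(2) by blast
    ultimately obtain \<theta> where \<theta>: "\<theta> \<in> N" "B \<subseteq> adjoin E {\<theta>}" using B(1) by blast
    have "lspan E B (\<lambda>x. x) \<subseteq> adjoin E {\<theta>}"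
      by (rule lspan_subset_subring[OF E subfield_subring[OF is_subfield_adjoin] adjoin_base]) (rule subsetD[OF \<theta>(2)])
    then show ?thesis using \<theta>(1) sub[OF \<theta>(1)] B(2) by blast
  qed
qed

text \<open>After clearing denominators, the equation of x over E(c) is a polynomial relation
  between x and c, which \<open>g\<close> reads as an equation for c over E(x).\<close>

lemma algebraic_exchange:
  assumes E: "is_subfield E" and x: "algebraic_over (adjoin E {c}) x" "\<not> algebraic_over E x"
  shows "algebraic_over (adjoin E {x}) c"
proof -
  let ?L = "adjoin E {x}"
  have L: "is_subfield ?L" by (rule is_subfield_adjoin)
  have EL: "E \<subseteq> ?L" and xL: "x \<in> ?L" using adjoin_base adjoin_gens by blast+
  obtain f where f: "f \<in> polys (adjoin E {c})" "f \<noteq> 0" "poly f x = 0"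
    using x(1) algebraic_over_iff[OF is_subfield_adjoin] by blast
  obtain d where d: "d \<noteq> 0" "\<forall>i\<in>{..degree f}. d * coeff f i \<in> ring_adjoin E {c}"
    using common_denominator[OF E, of "{..degree f}" "coeff f" "{c}"] polysD[OF f(1)] by auto
  then have "\<forall>i\<in>{..degree f}. \<exists>q. q \<in> polys E \<and> d * coeff f i = poly q c"
    unfolding ring_adjoin_singleton[OF subfield_subring[OF E]] by (simp add: image_iff Bex_def)
  from bchoice[OF this] obtain q where "\<forall>i\<in>{..degree f}. q i \<in> polys E \<and> d * coeff f i = poly (q i) c" ..
  then have q: "q i \<in> polys E" "d * coeff f i = poly (q i) c" if "i \<le> degree f" for i using that by simp_all
  define g where "g = (\<Sum>i\<le>degree f. smult (x ^ i) (q i))"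
  have "g \<in> polys ?L" unfolding g_def
  proof (rule polys_sum[OF subfield_subring[OF L]])
    fix i assume "i \<in> {..degree f}"
    then have "q i \<in> polys ?L" using q(1)[of i] polys_mono[OF EL] by auto
    then show "smult (x ^ i) (q i) \<in> polys ?L"
      using polys_smult[OF subfield_subring[OF L] subfield_intros(7)[OF L xL]] by blast
  qed
  moreover have "poly g c = 0"
  proof -
    have "poly g c = (\<Sum>i\<le>degree f. x ^ i * (d * coeff f i))" using q(2) by (simp add: g_def poly_sum)
    also have "\<dots> = d * poly f x" unfolding poly_altdef sum_distrib_left by (intro sum.cong refl) (simp add: algebra_simps)
    finally show ?thesis using f(3) by simp
  qed
  moreover have "g \<noteq> 0"
  proof
    assume g0: "g = 0"
    let ?n = "degree f"
    have "poly (q ?n) c \<noteq> 0" using q(2)[of ?n] d(1) f(2) by (metis le_refl leading_coeff_0_iff mult_eq_0_iff)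
    then have "q ?n \<noteq> 0" by auto
    then obtain j where j: "coeff (q ?n) j \<noteq> 0" using leading_coeff_0_iff by blast
    \<comment> \<open>Were g zero, the coefficients of the j-th powers in the \<open>q i\<close>
      would form a nonzero polynomial over E with root x.\<close>
    define h where "h = (\<Sum>i\<le>?n. monom (coeff (q i) j) i)"
    have co: "coeff h i = (if i \<le> ?n then coeff (q i) j else 0)" for i by (simp add: h_def coeff_sum)
    have "h \<in> polys E" using polysD[OF q(1)] subfield_intros(1)[OF E] by (simp add: polys_def co)
    moreover have "h \<noteq> 0" using co[of ?n] j by auto
    moreover have "poly h x = coeff g j"
      by (simp add: h_def g_def poly_sum poly_monom coeff_sum mult.commute)
    ultimately have "algebraic_over E x" using g0 algebraic_over_iff[OF E] by auto
    then show False using x(2) by blast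
  qed
  ultimately show ?thesis using algebraic_over_iff[OF L] by blast
qed

section \<open>Lifting subfields and polynomials along the residue map\<close>

context place
begin

lemma res_of_nat: "res (of_nat m) = of_nat m"
  by (induction m) (simp_all add: res_add V_intros)

lemma map_res_pderiv:
  assumes "f \<in> polys V" shows "map_poly res (pderiv f) = pderiv (map_poly res f)"
proof (rule poly_eqI)
  fix i
  have "res (of_nat (Suc i) * coeff f (Suc i)) = of_nat (Suc i) * res (coeff f (Suc i))"
    using res_mult[OF V_intros(10) polysD[OF assms], of "Suc i" "Suc i"] by (simp only: res_of_nat)
  then show "coeff (map_poly res (pderiv f)) i = coeff (pderiv (map_poly res f)) i"
    by (simp only: coeff_map_res coeff_pderiv)
qed

lemma map_res_diff:
  "p \<in> polys V \<Longrightarrow> q \<in> polys V \<Longrightarrow> map_poly res (p - q) = map_poly res p - map_poly res q"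
  by (intro poly_eqI) (simp add: res_diff polysD)

lemma res_inj:
  assumes "is_subfield E" "E \<subseteq> V" "a \<in> E" "res a = 0" shows "a = 0"
proof (rule ccontr)
  assume "a \<noteq> 0"
  moreover have "a \<in> V" "inverse a \<in> V" using assms subfield_inverse by blast+
  ultimately show False using res_mult[of a "inverse a"] assms(4) by simp
qed

lemma unit_subfield: "is_subfield E \<Longrightarrow> E \<subseteq> V \<Longrightarrow> a \<in> E \<Longrightarrow> a \<noteq> 0 \<Longrightarrow> unit a"
  using res_inj unfolding unit_def by blast

lemma is_subfield_res_image: "is_subfield E \<Longrightarrow> E \<subseteq> V \<Longrightarrow> is_subfield (res ` E)"
  using is_subfield_residue[of E] by (simp add: Int_absorb2)

lemma map_res_polys: "q \<in> polys E \<Longrightarrow> map_poly res q \<in> polys (res ` E)"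
  using polysD[of q E] by (auto simp: polys_def)

lemma map_res_eq_0:
  assumes "is_subfield E" "E \<subseteq> V" "q \<in> polys E" "map_poly res q = 0" shows "q = 0"
proof (rule poly_eqI)
  fix i
  have "res (coeff q i) = 0" using arg_cong[OF assms(4), of "\<lambda>f. coeff f i"] by simp
  then show "coeff q i = coeff 0 i" using res_inj[OF assms(1,2) polysD[OF assms(3)]] by simp
qed

lemma lift_poly:
  assumes "0 \<in> E" "q \<in> polys (res ` E)"
  shows "\<exists>f\<in>polys E. map_poly res f = q"
proof -
  have "\<forall>i. \<exists>a. a \<in> E \<and> res a = coeff q i" using polysD[OF assms(2)] by (metis imageE)
  from choice[OF this] obtain a where a: "\<forall>i. a i \<in> E \<and> res (a i) = coeff q i" by (rule exE)
  define f where "f = (\<Sum>i\<le>degree q. monom (a i) i)"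
  have co: "coeff f i = (if i \<le> degree q then a i else 0)" for i by (simp add: f_def coeff_sum)
  have "f \<in> polys E" using a assms(1) by (simp add: polys_def co)
  moreover have "map_poly res f = q"
  proof (rule poly_eqI)
    fix i show "coeff (map_poly res f) i = coeff q i" using a by (cases "i \<le> degree q") (simp_all add: co coeff_eq_0)
  qed
  ultimately show ?thesis by blast
qed

text \<open>As \<open>res\<close> is injective on E, a nonzero polynomial over E keeps a nonzero
  value at t modulo the maximal ideal when \<open>res t\<close> is transcendental; so all fractions
  in E(t) are finite.\<close>

lemma adjoin_transcendental_residue:
  assumes E: "is_subfield E" "E \<subseteq> V" and t: "t \<in> V" and tr: "\<not> algebraic_over (res ` E) (res t)"
  shows "adjoin E {t} \<subseteq> V" "res ` adjoin E {t} = adjoin (res ` E) {res t}"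
proof -
  have l: "is_subfield (res ` E)" using is_subfield_res_image[OF E] .
  let ?L = "adjoin (res ` E) {res t}"
  have L: "is_subfield ?L" by (rule is_subfield_adjoin)
  have lL: "res ` E \<subseteq> ?L" and tL: "res t \<in> ?L" using adjoin_base adjoin_gens by blast+
  have EV: "q \<in> polys V" if "q \<in> polys E" for q using that polys_mono[OF E(2)] by blast
  have ev: "poly q t \<in> V \<and> res (poly q t) \<in> ?L" if q: "q \<in> polys E" for q
  proof -
    have "res (poly q t) = poly (map_poly res q) (res t)" using res_poly[OF EV[OF q] t] .
    moreover have "map_poly res q \<in> polys ?L" using map_res_polys[OF q] polys_mono[OF lL] by blast
    ultimately show ?thesis
      using poly_in[OF V_subring EV[OF q] t] poly_in[OF subfield_subring[OF L] _ tL] by simp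
  qed
  have un: "unit (poly q t)" if q: "q \<in> polys E" "q \<noteq> 0" for q
  proof -
    have "map_poly res q \<noteq> 0" using map_res_eq_0[OF E q(1)] q(2) by blast
    then have "poly (map_poly res q) (res t) \<noteq> 0"
      using tr algebraic_over_iff[OF l] map_res_polys[OF q(1)] by blast
    then show ?thesis using res_poly[OF EV[OF q(1)] t] ev[OF q(1)] by (simp add: unit_def)
  qed
  have main: "z \<in> V \<and> res z \<in> ?L" if z: "z \<in> adjoin E {t}" for z
  proof -
    obtain p q where pq: "p \<in> polys E" "q \<in> polys E" "poly q t \<noteq> 0" "z = poly p t / poly q t"
      using z unfolding adjoin_singleton[OF E(1)] by blast
    have "q \<noteq> 0" using pq(3) by auto
    then have "unit (poly q t)" using un pq(2) by blast
    then have "poly p t / poly q t \<in> V \<and> res (poly p t / poly q t) = res (poly p t) / res (poly q t)"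
      using ev[OF pq(1)] by (intro res_divide) (simp_all add: unit_def)
    then show ?thesis using pq(4) ev[OF pq(1)] ev[OF pq(2)] subfield_divide[OF L] by simp
  qed
  then show sub: "adjoin E {t} \<subseteq> V" by blast
  have "is_subfield (res ` adjoin E {t})" using is_subfield_res_image[OF is_subfield_adjoin sub] .
  moreover have "res ` E \<subseteq> res ` adjoin E {t}" using adjoin_base by blast
  moreover have "res t \<in> res ` adjoin E {t}" using adjoin_gens by blast
  ultimately have "?L \<subseteq> res ` adjoin E {t}" using adjoin_least by (metis empty_subsetI insert_subset)
  then show "res ` adjoin E {t} = ?L" using main by blast
qed

lemma uniformizer_times_unit:
  assumes \<pi>: "uniformizer F \<pi>" and "unit u" "\<pi> * u \<in> F"
  shows "uniformizer F (\<pi> * u)"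
  unfolding uniformizer_def
proof (intro conjI ballI impI)
  note d = \<pi>[unfolded uniformizer_def]
  show "\<pi> * u \<in> F" by fact
  show "\<pi> * u \<noteq> 0" using d unit_nz[OF assms(2)] by simp
  show "\<pi> * u \<in> V" "res (\<pi> * u) = 0" using d unit_V[OF assms(2)] by (simp_all add: V_intros res_mult)
  fix z assume z: "z \<in> F" "z \<noteq> 0"
  then obtain i :: int where i: "unit (z / \<pi> powi i)" using d by blast
  have eq: "z / (\<pi> * u) powi i = (z / \<pi> powi i) / u powi i" by (simp add: power_int_mult_distrib)
  have "unit (z / (\<pi> * u) powi i)" unfolding eq by (rule unit_divide[OF i unit_power_int[OF assms(2)]])
  then show "\<exists>i::int. unit (z / (\<pi> * u) powi i)" by blast
qed

lemma uniformizerD: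
  assumes "uniformizer F \<pi>"
  shows "\<pi> \<in> F" "\<pi> \<noteq> 0" "\<pi> \<in> V" "res \<pi> = 0"
    and "z \<in> F \<Longrightarrow> z \<noteq> 0 \<Longrightarrow> \<exists>i::int. unit (z / \<pi> powi i)"
  using assms unfolding uniformizer_def by blast+

text \<open>\<open>K(T) \<subseteq> F\<close> is an immediate extension, \<open>F|K(T)\<close> is separable, and the valuation ring of
  \<open>K(T)\<close> is a localization of \<open>K[T]\<close>.\<close>

definition immediate :: "'a set \<Rightarrow> 'a set \<Rightarrow> 'a set \<Rightarrow> bool" where
  "immediate F K T \<longleftrightarrow> finite T \<and> T \<subseteq> F \<inter> V \<and> alg_indep K T \<and>
     (\<forall>z\<in>adjoin K T \<inter> V. \<exists>u\<in>ring_adjoin K T. \<exists>w\<in>ring_adjoin K T. unit w \<and> z = u / w) \<and>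
     (\<exists>s\<in>adjoin K T. uniformizer F s) \<and>
     (\<forall>z\<in>F \<inter> V. \<exists>z'\<in>adjoin K T \<inter> V. res z' = res z) \<and>
     (\<forall>z\<in>F. \<exists>f\<in>polys (adjoin K T). poly f z = 0 \<and> poly (pderiv f) z \<noteq> 0)"

text \<open>Since \<open>res\<close> is injective on E, divisibility of the reduction of q by the
  minimal polynomial of \<open>res x\<close> lifts to an exact factorization q = G r. The place on
  E(x) is thus the G-adic one.\<close>

lemma unit_poly_factor:
  assumes E: "is_subfield E" "E \<subseteq> V" and x: "x \<in> V" and G: "G \<in> polys E"
    and \<mu>: "is_minpoly (res ` E) (res x) (map_poly res G)" and s: "s = poly G x"
    and q: "q \<in> polys E" "poly q x \<noteq> 0"
  shows "\<exists>i r. r \<in> polys E \<and> poly q x = s ^ i * poly r x \<and> unit (poly r x)"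
  using q
proof (induction "degree q" arbitrary: q rule: less_induct)
  case less
  have EV: "f \<in> polys V" if "f \<in> polys E" for f using that polys_mono[OF E(2)] by blast
  have qV: "poly q x \<in> V" using poly_in[OF V_subring EV[OF less.prems(1)] x] .
  note d = is_minpolyD[OF \<mu>]
  show ?case
  proof (cases "res (poly q x) = 0")
    case False
    then show ?thesis using less.prems(1) qV by (intro exI[of _ 0] exI[of _ q]) (simp add: unit_def)
  next
    case True
    then have "poly (map_poly res q) (res x) = 0" using res_poly[OF EV[OF less.prems(1)] x] by simp
    then obtain r' where r': "r' \<in> polys (res ` E)" "map_poly res q = map_poly res G * r'"
      using is_minpoly_dvd[OF \<mu> map_res_polys[OF less.prems(1)]] by blast
    obtain r where r: "r \<in> polys E" "map_poly res r = r'"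
      using lift_poly[OF subfield_intros(1)[OF E(1)] r'(1)] by blast
    have Gr: "G * r \<in> polys E" using polys_mult[OF subfield_subring[OF E(1)] G r(1)] .
    have "map_poly res (q - G * r) = map_poly res q - map_poly res G * map_poly res r"
      using map_res_diff[OF EV[OF less.prems(1)] EV[OF Gr]] map_res_mult[OF EV[OF G] EV[OF r(1)]] by simp
    then have "map_poly res (q - G * r) = 0" using r'(2) r(2) by simp
    then have qG: "q = G * r"
      using map_res_eq_0[OF E polys_diff[OF subfield_subring[OF E(1)] less.prems(1) Gr]] by simp
    have "degree (map_poly res G) \<le> degree G" by (intro degree_le) (auto simp: coeff_eq_0)
    then have "degree G > 0" using d(5) by simp
    moreover have "G \<noteq> 0" "r \<noteq> 0" using qG less.prems(2) by auto
    ultimately have "degree r < degree q" unfolding qG by (simp add: degree_mult_eq)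
    moreover have "poly r x \<noteq> 0" using qG less.prems(2) by auto
    ultimately obtain i f where "f \<in> polys E" "poly r x = s ^ i * poly f x" "unit (poly f x)"
      using less.hyps[OF _ r(1)] by blast
    then show ?thesis using qG s by (intro exI[of _ "Suc i"] exI[of _ f]) simp
  qed
qed

end

context div_place
begin

text \<open>Correction as in Newton's method: if G(x) is not already a uniformizer, its value is at
  least 2, and G(x + \<pi>) = G(x) + G'(x) \<pi> + ... has value 1 because G'(x) is a unit by
  separability. The residue of x is unchanged.\<close>

lemma lift_primitive:
  assumes E: "is_subfield E" "E \<subseteq> F \<inter> V" and dimE: "has_dim (res ` E) \<kappa> m"
    and sep: "\<And>x \<mu>. x \<in> \<kappa> \<Longrightarrow> is_minpoly (res ` E) x \<mu> \<Longrightarrow> poly (pderiv \<mu>) x \<noteq> 0"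
  shows "\<exists>x G. x \<in> F \<inter> V \<and> G \<in> polys E \<and> uniformizer F (poly G x) \<and>
    is_minpoly (res ` E) (res x) (map_poly res G) \<and> \<kappa> = (\<lambda>p. poly p (res x)) ` polys (res ` E)"
proof -
  let ?l = "res ` E"
  have EV: "E \<subseteq> V" and EF: "E \<subseteq> F" using E(2) by blast+
  have l: "is_subfield ?l" using is_subfield_res_image[OF E(1) EV] .
  have l\<kappa>: "?l \<subseteq> \<kappa>" using E(2) unfolding \<kappa>_def by blast
  have "\<exists>\<theta>\<in>\<kappa>. adjoin ?l {\<theta>} = \<kappa>" by (rule primitive_element[OF l \<kappa> l\<kappa> dimE]) (rule sep)
  then obtain \<theta> where \<theta>: "\<theta> \<in> \<kappa>" "adjoin ?l {\<theta>} = \<kappa>" by (elim bexE)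
  have "algebraic_over ?l \<theta>" using has_dim_algebraic[OF l subfield_subring[OF \<kappa>] dimE \<theta>(1)] .
  then obtain \<mu> where \<mu>: "is_minpoly ?l \<theta> \<mu>" using ex_minpoly[OF l] by blast
  note d = is_minpolyD[OF \<mu>]
  have \<kappa>eq: "\<kappa> = (\<lambda>p. poly p \<theta>) ` polys ?l" using adjoin_algebraic(1)[OF l \<mu>] \<theta>(2) by simp
  obtain G where G: "G \<in> polys E" "map_poly res G = \<mu>" using lift_poly[OF subfield_intros(1)[OF E(1)] d(1)] by blast
  have GV: "G \<in> polys V" and GF: "G \<in> polys F" using G(1) polys_mono[OF EV] polys_mono[OF EF] by blast+
  obtain x where x: "x \<in> F" "x \<in> V" "res x = \<theta>" using \<theta>(1) unfolding \<kappa>_def by blast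
  obtain \<pi> where \<pi>: "uniformizer F \<pi>" using ex_uniformizer by blast
  note u = uniformizerD[OF \<pi>]
  define y where "y = poly G x"
  have y: "y \<in> F" "y \<in> V" "res y = 0"
    using poly_in[OF subfield_subring[OF F] GF x(1)] poly_in[OF V_subring GV x(2)] res_poly[OF GV x(2)] G(2) x(3) d(3)
    by (simp_all add: y_def)
  have "\<exists>x'. x' \<in> F \<and> x' \<in> V \<and> res x' = \<theta> \<and> uniformizer F (poly G x')"
  proof (cases "y \<noteq> 0 \<and> unit (y / \<pi>)")
    case True
    then have "uniformizer F (\<pi> * (y / \<pi>))" using y(1) u(2) by (intro uniformizer_times_unit[OF \<pi>]) auto
    then have "uniformizer F (poly G x)" using u(2) by (simp add: y_def)
    then show ?thesis using x by blast
  next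
    case False
    have "\<exists>w\<in>V. y = \<pi> ^ 2 * w"
    proof (cases "y = 0")
      case True
      then show ?thesis using V_intros(1) by (intro bexI[of _ 0]) simp_all
    next
      case ny: False
      obtain i :: int where i: "unit (y / \<pi> powi i)" using u(5)[OF y(1) ny] by blast
      have "i > 0" using V_iff_power_int(2)[OF u(3,4,2) i y(2)] y(3) by simp
      moreover have "i \<noteq> 1" using i False ny by auto
      ultimately have i2: "i - 2 \<ge> 0" by simp
      have "\<pi> powi (i - 2) = \<pi> powi i / \<pi> ^ 2" using u(2) by (simp add: power_int_diff)
      then have "unit ((y / \<pi> ^ 2) / \<pi> powi (i - 2))" using i u(2) by simp
      then have "y / \<pi> ^ 2 \<in> V" using V_iff_power_int(1)[OF u(3,4,2)] i2 by blast
      then show ?thesis using u(2) by (intro bexI[of _ "y / \<pi> ^ 2"]) simp_all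
    qed
    then obtain w where w: "w \<in> V" "y = \<pi> ^ 2 * w" by blast
    from taylor2[OF V_subring GV x(2) u(3)] obtain r where
      r: "r \<in> V" "poly G (x + \<pi>) = poly G x + poly (pderiv G) x * \<pi> + \<pi> ^ 2 * r" by (elim bexE)
    define v where "v = poly (pderiv G) x + \<pi> * (w + r)"
    have eq: "poly G (x + \<pi>) = \<pi> * v"
      using r(2) w(2) by (simp add: v_def y_def[symmetric] algebra_simps power2_eq_square)
    have pV: "pderiv G \<in> polys V" using polys_pderiv[OF V_subring GV] .
    have "res (poly (pderiv G) x) = poly (pderiv \<mu>) \<theta>"
      using res_poly[OF pV x(2)] map_res_pderiv[OF GV] G(2) x(3) by simp
    moreover have pin: "poly (pderiv G) x \<in> V" using poly_in[OF V_subring pV x(2)] .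
    moreover have in2: "\<pi> * (w + r) \<in> V" "res (\<pi> * (w + r)) = 0"
      using u(3,4) w(1) r(1) by (simp_all add: V_intros res_mult)
    ultimately have "unit v" unfolding unit_def v_def using sep[OF \<theta>(1) \<mu>] res_add[OF pin in2(1)] V_intros(6)[OF pin in2(1)] by simp
    have xF: "x + \<pi> \<in> F" "x + \<pi> \<in> V" "res (x + \<pi>) = \<theta>"
      using x u(1,3,4) subfield_intros(6)[OF F] by (simp_all add: V_intros res_add)
    have "poly G (x + \<pi>) \<in> F" using poly_in[OF subfield_subring[OF F] GF xF(1)] .
    then have "uniformizer F (poly G (x + \<pi>))"
      unfolding eq by (rule uniformizer_times_unit[OF \<pi> \<open>unit v\<close>])
    then show ?thesis using xF by blast
  qed
  then obtain x' where "x' \<in> F" "x' \<in> V" "res x' = \<theta>" "uniformizer F (poly G x')" by blast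
  then show ?thesis using G \<mu> \<kappa>eq by (intro exI[of _ x'] exI[of _ G]) simp
qed

text \<open>The place on K(T) = E(x) is G-adic by \<open>unit_poly_factor\<close>, so a finite
  element is a quotient of polynomials in x with unit denominator. Clearing the denominators of the
  coefficients costs a nonzero factor from E \<subseteq> V, which is a unit.\<close>

lemma immediate_structure:
  assumes K: "is_subfield K" and T0: "finite T0" and E: "E = adjoin K T0" "E \<subseteq> F \<inter> V"
    and x: "x \<in> F \<inter> V" and G: "G \<in> polys E" and uni: "uniformizer F (poly G x)"
    and \<mu>: "is_minpoly (res ` E) (res x) (map_poly res G)" and \<kappa>eq: "\<kappa> = (\<lambda>p. poly p (res x)) ` polys (res ` E)"
    and ind: "alg_indep K (insert x T0)"
    and sep: "\<And>z. z \<in> F \<Longrightarrow> \<exists>f\<in>polys (adjoin K (insert x T0)). poly f z = 0 \<and> poly (pderiv f) z \<noteq> 0"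
  shows "immediate F K (insert x T0)"
proof -
  let ?T = "insert x T0" and ?s = "poly G x"
  let ?R = "ring_adjoin K ?T"
  have Ef: "is_subfield E" unfolding E(1) by (rule is_subfield_adjoin)
  have EV: "E \<subseteq> V" and xV: "x \<in> V" using E(2) x by blast+
  have ET: "adjoin E {x} = adjoin K ?T" unfolding E(1) by (simp add: adjoin_adjoin)
  have AT: "is_subfield (adjoin K ?T)" by (rule is_subfield_adjoin)
  have EAT: "E \<subseteq> adjoin K ?T" unfolding E(1) by (rule adjoin_mono) auto
  have xAT: "x \<in> adjoin K ?T" using adjoin_gens[of ?T K] by blast
  note u = uniformizerD[OF uni]
  have R: "is_subring ?R" by (rule is_subring_ring_adjoin)
  have xR: "x \<in> ?R" using ring_adjoin_gens[of ?T K] by blast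
  have R0: "ring_adjoin K T0 \<subseteq> ?R" by (rule ring_adjoin_mono) auto
  have T0F: "T0 \<subseteq> F \<inter> V" using E adjoin_gens[of T0 K] by blast
  have 1: "\<exists>u\<in>?R. \<exists>w\<in>?R. unit w \<and> z = u / w" if z: "z \<in> adjoin K ?T \<inter> V" for z
  proof (cases "z = 0")
    case True
    then show ?thesis using subring_intros(1,2)[OF R] unit_1 by (intro bexI[of _ 0] bexI[of _ 1]) simp_all
  next
    case False
    have "z \<in> adjoin E {x}" using z unfolding ET by blast
    then obtain a b where ab: "a \<in> polys E" "b \<in> polys E" "poly b x \<noteq> 0" "z = poly a x / poly b x"
      unfolding adjoin_singleton[OF Ef] by blast
    have a0: "poly a x \<noteq> 0" using False ab(4) by auto
    from unit_poly_factor[OF Ef EV xV G \<mu> refl ab(1) a0] obtain i a' where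
      a': "a' \<in> polys E" "poly a x = ?s ^ i * poly a' x" "unit (poly a' x)" by blast
    from unit_poly_factor[OF Ef EV xV G \<mu> refl ab(2,3)] obtain j b' where
      b': "b' \<in> polys E" "poly b x = ?s ^ j * poly b' x" "unit (poly b' x)" by blast
    have "z / ?s powi (int i - int j) = poly a' x / poly b' x"
      using ab(4) a'(2) b'(2) u(2) unit_nz[OF b'(3)] by (simp add: power_int_diff field_simps)
    then have "unit (z / ?s powi (int i - int j))" using unit_divide[OF a'(3) b'(3)] by simp
    then have "int i - int j \<ge> 0" using V_iff_power_int(1)[OF u(3,4,2)] z by blast
    then have "?s ^ i = ?s ^ (i - j) * ?s ^ j" by (simp flip: power_add)
    then have zeq: "z = poly (G ^ (i - j) * a') x / poly b' x"
      using ab(4) a'(2) b'(2) u(2) unit_nz[OF b'(3)] by (simp add: field_simps)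
    define A where "A = G ^ (i - j) * a'"
    have A: "A \<in> polys E" unfolding A_def
      using polys_mult[OF subfield_subring[OF Ef] polys_power[OF subfield_subring[OF Ef] G] a'(1)] .
    \<comment> \<open>The tags 0 and 1 gather the coefficients of numerator and denominator into one
      index set, so that a single d serves both.\<close>
    let ?I = "(\<lambda>n. (0::nat, n)) ` {..degree A} \<union> (\<lambda>n. (1::nat, n)) ` {..degree b'}"
    let ?f = "\<lambda>(m, n). if m = (0::nat) then coeff A n else coeff b' n"
    have "\<exists>d\<in>ring_adjoin K T0. d \<noteq> 0 \<and> (\<forall>i\<in>?I. d * ?f i \<in> ring_adjoin K T0)"
      using polysD[OF A] polysD[OF b'(1)] unfolding E(1) by (intro common_denominator[OF K]) auto
    then obtain d where d: "d \<in> ring_adjoin K T0" "d \<noteq> 0" "\<forall>i\<in>?I. d * ?f i \<in> ring_adjoin K T0" by blast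
    have dA: "d * coeff A n \<in> ?R" for n
      using d(3) R0 subring_intros(1)[OF R] by (cases "n \<le> degree A") (force simp: coeff_eq_0)+
    have db: "d * coeff b' n \<in> ?R" for n
      using d(3) R0 subring_intros(1)[OF R] by (cases "n \<le> degree b'") (force simp: coeff_eq_0)+
    have "smult d A \<in> polys ?R" "smult d b' \<in> polys ?R" using dA db by (simp_all add: polys_def)
    then have "d * poly A x \<in> ?R" "d * poly b' x \<in> ?R"
      using poly_in[OF R _ xR, of "smult d A"] poly_in[OF R _ xR, of "smult d b'"] by simp_all
    moreover have "d \<in> E" using d(1) ring_adjoin_subset_adjoin unfolding E(1) by blast
    then have "unit (d * poly b' x)" using unit_mult[OF unit_subfield[OF Ef EV] b'(3)] d(2) by blast
    moreover have "z = (d * poly A x) / (d * poly b' x)" using zeq d(2) by (simp add: A_def)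
    ultimately show ?thesis by blast
  qed
  have 2: "?s \<in> adjoin K ?T" using poly_in[OF subfield_subring[OF AT] subsetD[OF polys_mono[OF EAT] G] xAT] .
  have 3: "\<exists>z'\<in>adjoin K ?T \<inter> V. res z' = res z" if z: "z \<in> F \<inter> V" for z
  proof -
    have "res z \<in> \<kappa>" using z res_\<kappa> by blast
    then obtain p where p: "p \<in> polys (res ` E)" "res z = poly p (res x)" unfolding \<kappa>eq by blast
    obtain q where q: "q \<in> polys E" "map_poly res q = p" using lift_poly[OF subfield_intros(1)[OF Ef] p(1)] by blast
    have qV: "q \<in> polys V" using q(1) polys_mono[OF EV] by blast
    have "poly q x \<in> V" "res (poly q x) = res z"
      using poly_in[OF V_subring qV xV] res_poly[OF qV xV] q(2) p(2) by simp_all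
    moreover have "poly q x \<in> adjoin K ?T" using poly_in[OF subfield_subring[OF AT] subsetD[OF polys_mono[OF EAT] q(1)] xAT] .
    ultimately show ?thesis by blast
  qed
  show ?thesis unfolding immediate_def
    using T0 T0F x ind 1 2 uni 3 sep by (intro conjI ballI) auto
qed

end

context div_place
begin

text \<open>If x were algebraic over E \<subseteq> V, then E(x) would be integral over E and thus a
  field inside V, whose nonzero elements are units; but G(x) \<noteq> 0 has residue 0.\<close>

lemma transcendental_of_uniformizer:
  assumes E: "is_subfield E" "E \<subseteq> F \<inter> V" and "x \<in> F \<inter> V" "G \<in> polys E" "uniformizer F (poly G x)"
  shows "\<not> algebraic_over E x"
proof
  assume alg: "algebraic_over E x"
  have EV: "E \<subseteq> V" using E(2) by blast
  have u: "unit z" if "z \<in> adjoin E {x}" "z \<noteq> 0" for z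
  proof -
    have "algebraic_over E y" if "y \<in> adjoin E {x}" for y
      using algebraic_adjoin[OF E(1), of "{x}" y] alg that by simp
    then have int: "y \<in> V" if y: "y \<in> adjoin E {x}" for y
    proof -
      obtain \<mu> where \<mu>: "is_minpoly E y \<mu>" using ex_minpoly[OF E(1)] \<open>\<And>y. y \<in> adjoin E {x} \<Longrightarrow> algebraic_over E y\<close> y by blast
      note d = is_minpolyD[OF \<mu>]
      have "\<mu> \<in> polys V" using d(1) polys_mono[OF EV] by blast
      then show ?thesis using d(2,3) by (intro integral_in_V[of \<mu>]) auto
    qed
    then have "adjoin E {x} \<subseteq> V" by blast
    then show ?thesis using unit_subfield[OF is_subfield_adjoin] that by blast
  qed
  have "poly G x \<in> adjoin E {x}"
    using ring_adjoin_singleton[OF subfield_subring[OF E(1)], of x] ring_adjoin_subset_adjoin[of E "{x}"] assms(4) by blast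
  then have "unit (poly G x)" using u uniformizerD(2)[OF assms(5)] by blast
  then show False using uniformizerD(4)[OF assms(5)] by (simp add: unit_def)
qed

lemma minpoly_separable_char_0:
  fixes E :: "'a set"
  assumes "CHAR('a) = 0" "is_subfield E" "is_minpoly E x \<mu>"
  shows "poly (pderiv \<mu>) x \<noteq> 0"
proof
  assume z: "poly (pderiv \<mu>) x = 0"
  note d = is_minpolyD[OF assms(3)]
  have "coeff (pderiv \<mu>) (degree \<mu> - 1) = of_nat (degree \<mu>)" using d(2,5) by (simp add: coeff_pderiv)
  moreover have "of_nat (degree \<mu>) \<noteq> (0::'a)" using of_nat_eq_0_iff_char_dvd[of "degree \<mu>", where 'a='a] assms(1) d(5) by simp
  ultimately have "pderiv \<mu> \<noteq> 0" by auto
  then have "degree \<mu> \<le> degree (pderiv \<mu>)"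
    using is_minpoly_degree_le[OF assms(3) polys_pderiv[OF subfield_subring[OF assms(2)] d(1)] z] by blast
  moreover have "degree (pderiv \<mu>) \<le> degree \<mu> - 1"
    by (intro degree_le) (auto simp: coeff_pderiv coeff_eq_0)
  ultimately show False using d(5) by simp
qed

text \<open>The residue map fixes k and all minimal polynomials are separable, so only x has to be
  found. Exchanging c and x shows that F is algebraic over k(x).\<close>

lemma immediate_char_0:
  assumes char: "CHAR('a) = 0" and K: "is_subfield K" and Y: "finite Y" "alg_indep K Y" "k = adjoin K Y"
    and S: "finite S" "F = adjoin K S"
  shows "\<exists>T. immediate F K T"
proof -
  have kFV: "k \<subseteq> F \<inter> V" using k(2) kV by blast
  have resk: "res ` k = k" using kV(2) by force
  obtain m where "has_dim k \<kappa> m" using ex_residue_dim by blast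
  then have m: "has_dim (res ` k) \<kappa> m" by (simp only: resk)
  have "\<exists>x G. x \<in> F \<inter> V \<and> G \<in> polys k \<and> uniformizer F (poly G x) \<and>
    is_minpoly (res ` k) (res x) (map_poly res G) \<and> \<kappa> = (\<lambda>p. poly p (res x)) ` polys (res ` k)"
    by (rule lift_primitive[OF k(1) kFV m], rule minpoly_separable_char_0[OF char, of "res ` k"])
      (simp only: resk k(1))
  then obtain x G where xG: "x \<in> F \<inter> V" "G \<in> polys k" "uniformizer F (poly G x)"
    "is_minpoly (res ` k) (res x) (map_poly res G)" "\<kappa> = (\<lambda>p. poly p (res x)) ` polys (res ` k)" by blast
  have tr: "\<not> algebraic_over k x" using transcendental_of_uniformizer[OF k(1) kFV xG(1,2,3)] .
  then have "x \<notin> Y" using algebraic_in[OF k(1)] adjoin_gens[of Y K] Y(3) by blast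
  then have ind: "alg_indep K (insert x Y)" using alg_indep_insert[OF K Y(2)] tr Y(3) by blast
  let ?L = "adjoin k {x}"
  have L: "is_subfield ?L" by (rule is_subfield_adjoin)
  have Leq: "?L = adjoin K (insert x Y)" unfolding Y(3) by (simp add: adjoin_adjoin)
  have algM: "algebraic_over M z" if "z \<in> F" for z
    using has_dim_algebraic[OF M subfield_subring[OF F] dim that] .
  have "algebraic_over ?L c" using algebraic_exchange[OF k(1) algM tr] xG(1) by blast
  then obtain r where r: "has_dim ?L (adjoin ?L {c}) r" using finite_adjoin_algebraic[OF L, of "{c}"] by blast
  have "M \<subseteq> adjoin ?L {c}" by (rule adjoin_mono[OF adjoin_base order_refl])
  then have algL: "algebraic_over ?L z" if "z \<in> F" for z
    using algebraic_trans_finite[OF L is_subfield_adjoin adjoin_base r] algebraic_mono algM[OF that] by blast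
  have "immediate F K (insert x Y)"
  proof (rule immediate_structure[OF K Y(1,3) kFV xG ind])
    fix z assume "z \<in> F"
    then obtain \<mu> where \<mu>: "is_minpoly ?L z \<mu>" using ex_minpoly[OF L algL] by blast
    show "\<exists>f\<in>polys (adjoin K (insert x Y)). poly f z = 0 \<and> poly (pderiv f) z \<noteq> 0"
      using is_minpolyD[OF \<mu>] minpoly_separable_char_0[OF char L \<mu>] unfolding Leq by blast
  qed
  then show ?thesis by blast
qed

end

lemma has_dim_eq:
  assumes E: "is_subfield E" and "has_dim E A n" "has_dim E B n" "A \<subseteq> B"
  shows "A = B"
proof -
  obtain C where C: "finite C" "card C = n" "free E C (\<lambda>x. x)" "lspan E C (\<lambda>x. x) = A"
    using assms(2) unfolding has_dim_def by blast
  have "(\<lambda>x. x) ` C \<subseteq> B" using lspan_base[OF E C(1), of _ "\<lambda>x. x"] C(4) assms(4) by auto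
  from free_dim_spans[OF E assms(3) C(1,3) this C(2)] show ?thesis using C(4) by simp
qed

section \<open>Positive characteristic: lifting a p-basis of the residue field\<close>

context div_place
begin

context
  fixes p :: nat
  assumes p: "p = CHAR('a)" "p > 0"
begin

abbreviation "Fp ts \<equiv> adjoin (frob F) (set ts)"
abbreviation "kp ts \<equiv> adjoin (frob \<kappa>) (set (map res ts))"

text \<open>Division by w^p normalizes the value of z, so that the value being divisible by p and
  the residue lying in \<open>kp ts\<close> are stated together, in the form that the induction on
  \<open>ts\<close> uses.\<close>

definition tame :: "'a list \<Rightarrow> bool" where
  "tame ts \<longleftrightarrow> (\<forall>z\<in>Fp ts. z \<noteq> 0 \<longrightarrow> (\<exists>w\<in>F. w \<noteq> 0 \<and> unit (z / w ^ p) \<and> res (z / w ^ p) \<in> kp ts))"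

lemma tame_res:
  assumes "tame ts" "z \<in> Fp ts" "z \<in> V"
  shows "res z \<in> kp ts"
proof (cases "z = 0")
  case True
  then show ?thesis using subfield_intros(1)[OF is_subfield_adjoin] by simp
next
  case False
  then obtain w where w: "w \<in> F" "w \<noteq> 0" "unit (z / w ^ p)" "res (z / w ^ p) \<in> kp ts"
    using assms(1,2) unfolding tame_def by blast
  let ?u = "z / w ^ p"
  have "w ^ p = z * inverse ?u" using False w(2) by simp
  then have "w ^ p \<in> V" using V_intros(4)[OF assms(3) unit_V[OF unit_inverse[OF w(3)]]] by simp
  then have wV: "w \<in> V" using power_in_V p(2) by blast
  have "z = w ^ p * ?u" using w(2) by simp
  then have "res z = res (w ^ p) * res ?u" using res_mult[OF \<open>w ^ p \<in> V\<close> unit_V[OF w(3)]] by simp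
  moreover have "res (w ^ p) = res w ^ p" using res_power[OF wV] .
  moreover have "res w ^ p \<in> kp ts"
    using frobI[OF p res_\<kappa>[OF w(1) wV]] adjoin_base[of "frob \<kappa>"] by blast
  ultimately show ?thesis using subfield_intros(4)[OF is_subfield_adjoin] w(4) by simp
qed

text \<open>If the residues of \<open>ts\<close> are \<open>p\<close>-independent, the values of \<open>F\<^sup>p(ts)\<close> are divisible by \<open>p\<close>
  and its residues lie in the \<open>\<kappa>\<^sup>p\<close>-span of the residues of \<open>ts\<close>.\<close>

lemma pchain_tame:
  assumes "pchain (frob \<kappa>) (map res ts)" "set ts \<subseteq> F \<inter> V"
  shows "tame ts \<and> pchain (frob F) ts"
  using assms
proof (induction ts)
  case Nil
  have "Fp [] = frob F" using adjoin_absorb[OF is_subfield_frob[OF p F], of "{}"] by simp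
  moreover have "\<exists>w\<in>F. w \<noteq> 0 \<and> unit (z / w ^ p) \<and> res (z / w ^ p) \<in> kp []" if z: "z \<in> frob F" "z \<noteq> 0" for z
  proof -
    obtain w where w: "w \<in> F" "z = w ^ p" using frobE[OF p z(1)] .
    then have "w \<noteq> 0" using z(2) p(2) by (auto simp: power_0_left)
    then show ?thesis using w unit_1 subfield_intros(2)[OF is_subfield_adjoin] by (intro bexI[of _ w]) simp_all
  qed
  ultimately show ?case by (simp add: tame_def)
next
  case (Cons t ts)
  let ?E = "Fp ts" and ?k = "kp ts"
  have E: "is_subfield ?E" and k': "is_subfield ?k" by (rule is_subfield_adjoin)+
  have IH: "tame ts" "pchain (frob F) ts" using Cons by auto
  have t: "t \<in> F" "t \<in> V" using Cons.prems(2) by auto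
  have resnot: "res t \<notin> ?k" using Cons.prems(1) by simp
  have tnot: "t \<notin> ?E" using tame_res[OF IH(1) _ t(2)] resnot by blast
  have tp: "t ^ p \<in> ?E" using frobI[OF p t(1)] adjoin_base[of "frob F"] by blast
  have rtp: "res t ^ p \<in> ?k" using frobI[OF p res_\<kappa>[OF t]] adjoin_base[of "frob \<kappa>"] by blast
  have span: "Fp (t # ts) = lspan ?E {..<p} (\<lambda>i. t ^ i)"
    using has_dim_p(2)[OF p E tnot tp] by (simp add: adjoin_adjoin)
  have fr: "free ?k {..<p} (\<lambda>i. res t ^ i)" by (rule has_dim_p(3)[OF p k' resnot rtp])
  have kt: "?k \<subseteq> kp (t # ts)" "res t \<in> kp (t # ts)"
    by (rule adjoin_mono[OF order_refl]) (use adjoin_gens[of "set (map res (t # ts))"] in auto)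
  have "\<exists>w\<in>F. w \<noteq> 0 \<and> unit (z / w ^ p) \<and> res (z / w ^ p) \<in> kp (t # ts)"
    if z: "z \<in> Fp (t # ts)" "z \<noteq> 0" for z
  proof -
    have "z \<in> lspan ?E {..<p} (\<lambda>i. t ^ i)" using z(1) unfolding span .
    then obtain a where a: "\<forall>i<p. a i \<in> ?E" "z = (\<Sum>i<p. a i * t ^ i)" by (auto simp: lspan_def)
    have "\<forall>i. \<exists>w. i < p \<and> a i \<noteq> 0 \<longrightarrow> w \<in> F \<and> w \<noteq> 0 \<and> unit (a i / w ^ p) \<and> res (a i / w ^ p) \<in> ?k"
      using IH(1) a(1) unfolding tame_def by blast
    from choice[OF this] obtain w0 where w0:
      "\<forall>i. i < p \<and> a i \<noteq> 0 \<longrightarrow> w0 i \<in> F \<and> w0 i \<noteq> 0 \<and> unit (a i / w0 i ^ p) \<and> res (a i / w0 i ^ p) \<in> ?k" by (rule exE)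
    \<comment> \<open>For i < p, a nonzero \<open>a i\<close> has p times the value of
      \<open>w i\<close>, and \<open>w i\<close> is 0 exactly when \<open>a i\<close> is; so
      \<open>ex_dominant\<close> for w finds a coefficient \<open>a j\<close> of least
      value.\<close>
    define w where "w i = (if a i = 0 then 0 else w0 i)" for i
    have "\<exists>i\<in>{..<p}. a i \<noteq> 0"
    proof (rule ccontr)
      assume "\<not> ?thesis"
      then have "z = 0" unfolding a(2) by (intro sum.neutral) simp
      then show False using z(2) by blast
    qed
    then have "\<exists>i\<in>{..<p}. w i \<noteq> 0" using w0 by (auto simp: w_def)
    from ex_dominant[OF finite_lessThan this] obtain j where
      j: "j < p" "w j \<noteq> 0" "\<forall>i\<in>{..<p}. w i / w j \<in> V" by blast
    have aj: "a j \<noteq> 0" "w j = w0 j" using j(2) by (auto simp: w_def split: if_splits)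
    define W where "W = w j"
    have W: "W \<in> F" "W \<noteq> 0" using w0 j aj by (auto simp: W_def)
    have Wp: "W ^ p \<in> ?E" using frobI[OF p W(1)] adjoin_base[of "frob F"] by blast
    define b where "b i = a i / W ^ p" for i
    have b: "b i \<in> V \<and> res (b i) \<in> ?k" if i: "i < p" for i
    proof (cases "a i = 0")
      case True
      then show ?thesis using V_intros(1) subfield_intros(1)[OF k'] by (simp add: b_def)
    next
      case False
      then have wi: "w i \<in> F" "w i \<noteq> 0" "unit (a i / w i ^ p)" using w0 i by (auto simp: w_def)
      have "w i / W \<in> V" using j(3) i by (simp add: W_def)
      have eq: "b i = (w i / W) ^ p * (a i / w i ^ p)" using wi(2) by (simp add: b_def power_divide)
      have bV: "b i \<in> V" unfolding eq by (rule V_intros(4)[OF V_intros(7)[OF \<open>w i / W \<in> V\<close>] unit_V[OF wi(3)]])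
      moreover have "b i \<in> ?E" unfolding b_def using a(1) i Wp subfield_divide[OF E] by blast
      ultimately show ?thesis using tame_res[OF IH(1)] by blast
    qed
    have "res (b j) \<noteq> 0" using w0 j(1) aj by (simp add: b_def W_def unit_def)
    define u where "u = (\<Sum>i<p. b i * t ^ i)"
    have zu: "z / W ^ p = u" unfolding a(2) u_def b_def by (simp add: sum_divide_distrib)
    have uV: "u \<in> V" unfolding u_def using b t(2) by (intro V_intros(8) V_intros(4) V_intros(7)) auto
    have "res u = (\<Sum>i<p. res (b i * t ^ i))" unfolding u_def using b t(2) by (intro res_sum V_intros(4) V_intros(7)) auto
    also have "\<dots> = (\<Sum>i<p. res (b i) * res t ^ i)"
    proof (rule sum.cong[OF refl])
      fix i assume "i \<in> {..<p}"
      then have "b i \<in> V" using b by simp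
      then show "res (b i * t ^ i) = res (b i) * res t ^ i"
        using res_mult[OF _ V_intros(7)[OF t(2)], of "b i" i] res_power[OF t(2), of i] by simp
    qed
    finally have ru: "res u = (\<Sum>i<p. res (b i) * res t ^ i)" .
    \<comment> \<open>No cancellation occurs: the powers of \<open>res t\<close> below p are free
      over \<open>kp ts\<close>, and the coefficient at j is nonzero.\<close>
    have "res u \<noteq> 0"
    proof
      assume "res u = 0"
      then have "res (b j) = 0"
        using b j(1) ru by (intro freeD[OF fr, of "\<lambda>i. res (b i)"]) auto
      then show False using \<open>res (b j) \<noteq> 0\<close> by blast
    qed
    moreover have "res u \<in> kp (t # ts)"
    proof -
      have Kt: "is_subfield (kp (t # ts))" by (rule is_subfield_adjoin)
      have "res (b i) * res t ^ i \<in> kp (t # ts)" if "i < p" for i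
        using b[OF that] kt subfield_intros(4,7)[OF Kt] by blast
      then show ?thesis unfolding ru by (intro subfield_intros(8)[OF Kt]) simp
    qed
    ultimately show ?thesis using W uV zu by (intro bexI[of _ W]) (simp_all add: unit_def)
  qed
  then have "tame (t # ts)" unfolding tame_def by blast
  moreover have "pchain (frob F) (t # ts)" using IH(2) tnot by simp
  ultimately show ?case by blast
qed

text \<open>In terms of s, all values on F^p(ts) are multiples of p, while s has value 1.\<close>

lemma uniformizer_notin_Fp:
  assumes "tame ts" "uniformizer F s"
  shows "s \<notin> Fp ts"
proof
  note u = uniformizerD[OF assms(2)]
  assume "s \<in> Fp ts"
  then obtain w where w: "w \<in> F" "w \<noteq> 0" "unit (s / w ^ p)" using assms(1) u(2) unfolding tame_def by blast
  obtain i :: int where i: "unit (w / s powi i)" using u(5)[OF w(1,2)] by blast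
  have "s powi (1 - i * int p) = (s / w ^ p) * (w / s powi i) ^ p"
    using u(2) w(2) by (simp add: power_divide power_int_diff power_int_mult)
  then have "unit (s powi (1 - i * int p))" using unit_mult[OF w(3) unit_power[OF i]] by simp
  then have "1 = i * int p" using power_int_not_unit[OF u(3,4)] by fastforce
  then have "int p dvd 1" by (metis dvd_triv_right)
  then show False using prime_gt_1_nat[OF prime_p[OF p]] by simp
qed

text \<open>In \<kappa>, p-independent elements are algebraically independent over the perfect field
  K. So each t has residue transcendental over the residue field built so far, and
  \<open>adjoin_transcendental_residue\<close> applies.\<close>

lemma residue_chain_field:
  assumes K: "is_subfield K" "frob K = K" "K \<subseteq> k" and ts: "pchain (frob \<kappa>) (map res ts)" "set ts \<subseteq> F \<inter> V"
  shows "adjoin K (set ts) \<subseteq> V \<and> res ` adjoin K (set ts) = adjoin K (set (map res ts))"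
  using ts
proof (induction ts)
  case Nil
  have "res ` K = K" using kV K(3) by force
  then show ?case using adjoin_absorb[OF K(1), of "{}"] kV K(3) by auto
next
  case (Cons t ts)
  let ?E = "adjoin K (set ts)"
  have IH: "?E \<subseteq> V" "res ` ?E = adjoin K (set (map res ts))" using Cons by auto
  have E: "is_subfield ?E" by (rule is_subfield_adjoin)
  have "set (map res (t # ts)) \<subseteq> \<kappa>" using Cons.prems(2) by (auto simp: \<kappa>_def)
  then have "\<not> algebraic_over (adjoin K (set (map res ts))) (res t)"
    using pchain_transcendental[OF p K(1,2) _ \<kappa>, of "res t" "map res ts"] Cons.prems(1) K(3) k_\<kappa> by auto
  then have tr: "\<not> algebraic_over (res ` ?E) (res t)" by (simp only: IH(2)) simp
  have tV: "t \<in> V" using Cons.prems(2) by simp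
  have "adjoin ?E {t} = adjoin K (set (t # ts))" by (simp add: adjoin_adjoin)
  moreover have "adjoin (res ` ?E) {res t} = adjoin K (set (map res (t # ts)))" unfolding IH(2) by (simp add: adjoin_adjoin)
  ultimately show ?case using adjoin_transcendental_residue[OF E IH(1) tV tr] by simp
qed

lemma pchain_alg_indep:
  assumes K: "is_subfield K" "frob K = K" "K \<subseteq> F" and ts: "pchain (frob F) ts" "set ts \<subseteq> F"
  shows "alg_indep K (set ts)"
  using ts
proof (induction ts)
  case Nil
  then show ?case using alg_indep_empty by simp
next
  case (Cons t ts)
  have tr: "\<not> algebraic_over (adjoin K (set ts)) t"
    using pchain_transcendental[OF p K(1,2,3) F Cons.prems(1,2)] .
  then have "t \<notin> set ts" using algebraic_in[OF is_subfield_adjoin] adjoin_gens[of "set ts" K] by blast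
  then show ?case using alg_indep_insert[OF K(1) _ tr] Cons by simp
qed

lemma immediate_char_p:
  assumes K: "is_subfield K" "frob K = K" and Y: "finite Y" "k = adjoin K Y"
    and S: "finite S" "F = adjoin K S"
  shows "\<exists>T. immediate F K T"
proof -
  have Kk: "K \<subseteq> k" unfolding Y(2) by (rule adjoin_base)
  have K\<kappa>: "K \<subseteq> \<kappa>" and KF: "K \<subseteq> F" using Kk k_\<kappa> k(2) by blast+
  have f\<kappa>: "is_subfield (frob \<kappa>)" and fF: "is_subfield (frob F)" using is_subfield_frob[OF p] \<kappa> F by blast+
  \<comment> \<open>D = [k : k^p] equals [\<kappa> : \<kappa>^p] because \<kappa> is finite over k;
    it determines the length of the p-basis \<open>tbs\<close>.\<close>
  obtain D where D: "has_dim (frob k) k D" using p_degree_adjoin_perfect[OF p K Y(1)] unfolding Y(2) by blast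
  obtain m where m: "has_dim k \<kappa> m" using ex_residue_dim by blast
  have D\<kappa>: "has_dim (frob \<kappa>) \<kappa> D" using p_degree_finite_ext[OF p k(1) \<kappa> k_\<kappa> m D] .
  obtain tbs where tbs: "pchain (frob \<kappa>) tbs" "set tbs \<subseteq> \<kappa>" "adjoin (frob \<kappa>) (set tbs) = \<kappa>" "D = p ^ length tbs"
    using ex_pchain[OF p f\<kappa> \<kappa> frob_subset[OF p subfield_subring[OF \<kappa>]] D\<kappa> frobI[OF p]] .
  have "\<forall>x\<in>\<kappa>. \<exists>y. y \<in> F \<inter> V \<and> res y = x" unfolding \<kappa>_def by blast
  from bchoice[OF this] obtain l where l: "\<forall>x\<in>\<kappa>. l x \<in> F \<inter> V \<and> res (l x) = x" by (rule exE)
  define ts where "ts = map l tbs"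
  have mts: "map res ts = tbs" unfolding ts_def using l tbs(2) by (simp add: map_idI subset_iff)
  have tsFV: "set ts \<subseteq> F \<inter> V" unfolding ts_def using l tbs(2) by auto
  have tame: "tame ts" "pchain (frob F) ts" using pchain_tame[of ts] tbs(1) tsFV mts by simp_all
  let ?E = "adjoin K (set ts)"
  have E: "is_subfield ?E" by (rule is_subfield_adjoin)
  have EV: "?E \<subseteq> V" and lE: "res ` ?E = adjoin K (set tbs)"
    using residue_chain_field[OF K Kk _ tsFV] tbs(1) mts by simp_all
  have EF: "?E \<subseteq> F" using adjoin_least[OF F KF] tsFV by blast
  let ?l = "adjoin K (set tbs)"
  have lf: "is_subfield ?l" by (rule is_subfield_adjoin)
  have l\<kappa>: "?l \<subseteq> \<kappa>" using adjoin_least[OF \<kappa> K\<kappa> tbs(2)] .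
  \<comment> \<open>The p-basis lies in K(tbs), so \<kappa> is generated over K(tbs) by its p-th
    powers, which is the criterion for a finite separable extension.\<close>
  have gen\<kappa>: "\<kappa> \<subseteq> adjoin ?l (frob \<kappa>)"
  proof -
    have "adjoin (frob \<kappa>) (set tbs) \<subseteq> adjoin ?l (frob \<kappa>)"
      using adjoin_gens[of "set tbs" K] adjoin_base[of ?l "frob \<kappa>"]
      by (intro adjoin_least[OF is_subfield_adjoin adjoin_gens]) blast
    then show ?thesis by (simp only: tbs(3))
  qed
  obtain B where B: "finite B" "lspan k B (\<lambda>x. x) = \<kappa>" using m unfolding has_dim_def by blast
  have B\<kappa>: "B \<subseteq> \<kappa>" using lspan_base[OF k(1) B(1), of _ "\<lambda>x. x"] B(2) by blast
  have Y\<kappa>: "Y \<subseteq> \<kappa>" using k_\<kappa> adjoin_gens[of Y K] unfolding Y(2) by blast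
  \<comment> \<open>Finite generation, the other hypothesis of the criterion: Y generates k over K,
    and B spans \<kappa> over k.\<close>
  have "adjoin ?l (Y \<union> B) = \<kappa>"
  proof
    show "adjoin ?l (Y \<union> B) \<subseteq> \<kappa>" using adjoin_least[OF \<kappa> l\<kappa>] Y\<kappa> B\<kappa> by blast
    have A: "is_subfield (adjoin ?l (Y \<union> B))" by (rule is_subfield_adjoin)
    have YB: "Y \<union> B \<subseteq> adjoin ?l (Y \<union> B)" by (rule adjoin_gens)
    have "K \<subseteq> adjoin ?l (Y \<union> B)" using adjoin_base[of K "set tbs"] adjoin_base[of ?l "Y \<union> B"] by blast
    then have "k \<subseteq> adjoin ?l (Y \<union> B)" unfolding Y(2) using adjoin_least[OF A] YB by blast
    then have "lspan k B (\<lambda>x. x) \<subseteq> adjoin ?l (Y \<union> B)"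
      using YB by (intro lspan_subset_subring[OF k(1) subfield_subring[OF A]]) auto
    then show "\<kappa> \<subseteq> adjoin ?l (Y \<union> B)" by (simp only: B(2))
  qed
  then obtain m' where m': "has_dim ?l \<kappa> m'"
    using finite_if_frob_generates[OF p lf \<kappa> l\<kappa> gen\<kappa>, of "Y \<union> B"] Y(1) B(1) by auto
  have "\<exists>x G. x \<in> F \<inter> V \<and> G \<in> polys ?E \<and> uniformizer F (poly G x) \<and>
    is_minpoly (res ` ?E) (res x) (map_poly res G) \<and> \<kappa> = (\<lambda>p. poly p (res x)) ` polys (res ` ?E)"
  proof (rule lift_primitive[OF E])
    show "?E \<subseteq> F \<inter> V" using EF EV by blast
    show "has_dim (res ` ?E) \<kappa> m'" unfolding lE by (rule m')
    fix x \<mu> assume x: "x \<in> \<kappa>" "is_minpoly (res ` ?E) x \<mu>"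
    show "poly (pderiv \<mu>) x \<noteq> 0"
      using separable_if_frob_generates[OF p lf \<kappa> l\<kappa> m' gen\<kappa> x(1)] x(2) unfolding lE by blast
  qed
  then obtain x G where xG: "x \<in> F \<inter> V" "G \<in> polys ?E" "uniformizer F (poly G x)"
    "is_minpoly (res ` ?E) (res x) (map_poly res G)" "\<kappa> = (\<lambda>p. poly p (res x)) ` polys (res ` ?E)" by blast
  let ?s = "poly G x"
  \<comment> \<open>[F : F^p] = [k(c) : k(c)^p] <= D p, while the chain consisting of s and
    \<open>ts\<close> already has degree D p over F^p; so it generates F.\<close>
  obtain DM where DM: "DM \<le> D * p" "has_dim (frob M) M DM" using p_degree_adjoin[OF p k(1) D, of c] by blast
  have MF: "M \<subseteq> F" using adjoin_least[OF F k(2), of "{c}"] c(1) by simp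
  have DF: "has_dim (frob F) F DM" using p_degree_finite_ext[OF p M F MF dim DM(2)] .
  have len: "length ts = length tbs" by (simp add: ts_def)
  have ch: "pchain (frob F) (?s # ts)" using tame(2) uniformizer_notin_Fp[OF tame(1) xG(3)] by simp
  have stF: "set (?s # ts) \<subseteq> F" using uniformizerD(1)[OF xG(3)] tsFV by auto
  have dch: "has_dim (frob F) (Fp (?s # ts)) (p ^ Suc (length ts))"
    using pchain_dim[OF p fF ch] stF frobI[OF p] by auto
  have subF: "Fp us \<subseteq> F" if "set us \<subseteq> F" for us
    using adjoin_least[OF F frob_subset[OF p subfield_subring[OF F]] that] .
  have "p ^ Suc (length ts) \<le> DM" using has_dim_subset_le[OF p fF dch DF subF[OF stF]] .
  moreover have "DM \<le> p ^ Suc (length ts)" using DM(1) tbs(4) len by (simp add: mult.commute)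
  ultimately have DMeq: "DM = p ^ Suc (length ts)" by simp
  have Fs: "Fp (?s # ts) = F" using has_dim_eq[OF fF dch DF[unfolded DMeq] subF[OF stF]] .
  have KfF: "K \<subseteq> frob F" using frob_mono[OF p KF] K(2) by simp
  \<comment> \<open>Perfectness of K puts K(ts) into F^p(ts). Hence s = G(x) lies in F^p(x, ts), and
    x can replace s as a generator.\<close>
  have EFp: "?E \<subseteq> Fp (x # ts)" by (rule adjoin_mono[OF KfF]) auto
  have "?s \<in> Fp (x # ts)"
    using poly_in[OF subfield_subring[OF is_subfield_adjoin] subsetD[OF polys_mono[OF EFp] xG(2)]]
      adjoin_gens[of "set (x # ts)" "frob F"] by simp
  then have "Fp (?s # ts) \<subseteq> Fp (x # ts)"
    using adjoin_gens[of "set (x # ts)" "frob F"] by (intro adjoin_least[OF is_subfield_adjoin adjoin_base]) auto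
  moreover have xtF: "set (x # ts) \<subseteq> F" using xG(1) tsFV by auto
  ultimately have Fx: "Fp (x # ts) = F" using subF[OF xtF] Fs by blast
  \<comment> \<open>Otherwise F = F^p(ts), whose degree over F^p is too small by the factor p. So x
    prolongs the chain \<open>ts\<close>.\<close>
  have "x \<notin> Fp ts"
  proof
    assume "x \<in> Fp ts"
    then have "Fp (x # ts) \<subseteq> Fp ts"
      using adjoin_gens[of "set ts" "frob F"] by (intro adjoin_least[OF is_subfield_adjoin adjoin_base]) auto
    then have "Fp ts = F" using Fx subF[of ts] tsFV by blast
    moreover have "has_dim (frob F) (Fp ts) (p ^ length ts)"
      using tsFV frobI[OF p] by (intro pchain_dim[OF p fF tame(2)]) auto
    ultimately have "p ^ length ts = p ^ Suc (length ts)" using has_dim_unique[OF fF _ DF] DMeq by metis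
    then show False using prime_gt_1_nat[OF prime_p[OF p]] p(2) by simp
  qed
  then have "pchain (frob F) (x # ts)" using tame(2) by simp
  from pchain_alg_indep[OF K KF this xtF] have ind: "alg_indep K (insert x (set ts))" by simp
  let ?L = "adjoin K (insert x (set ts))"
  have L: "is_subfield ?L" by (rule is_subfield_adjoin)
  have LF: "?L \<subseteq> F" using adjoin_least[OF F KF, of "insert x (set ts)"] xtF by simp
  have genF: "F \<subseteq> adjoin ?L (frob F)"
  proof -
    have "Fp (x # ts) \<subseteq> adjoin ?L (frob F)"
      using adjoin_gens[of "insert x (set ts)" K] adjoin_base[of ?L "frob F"]
      by (intro adjoin_least[OF is_subfield_adjoin adjoin_gens]) auto
    then show ?thesis by (simp only: Fx)
  qed
  have SF: "S \<subseteq> F" unfolding S(2) by (rule adjoin_gens)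
  have "adjoin ?L S = F"
  proof
    show "adjoin ?L S \<subseteq> F" using adjoin_least[OF F LF SF] .
    show "F \<subseteq> adjoin ?L S" unfolding S(2) by (rule adjoin_mono[OF adjoin_base order_refl])
  qed
  then obtain r where r: "has_dim ?L F r" using finite_if_frob_generates[OF p L F LF genF S(1)] by blast
  have "immediate F K (insert x (set ts))"
  proof (rule immediate_structure[OF K(1) _ refl _ xG ind])
    show "finite (set ts)" by simp
    show "?E \<subseteq> F \<inter> V" using EF EV by blast
    fix z assume z: "z \<in> F"
    have "algebraic_over ?L z" using has_dim_algebraic[OF L subfield_subring[OF F] r z] .
    then obtain \<mu> where \<mu>: "is_minpoly ?L z \<mu>" using ex_minpoly[OF L] by blast
    show "\<exists>f\<in>polys ?L. poly f z = 0 \<and> poly (pderiv f) z \<noteq> 0"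
      using is_minpolyD[OF \<mu>] separable_if_frob_generates[OF p L F LF r genF z \<mu>] by blast
  qed
  then show ?thesis by blast
qed

end

end

subsection \<open>Uniformization\<close>

text \<open>The polynomial g read in the variable v; every equation of the final system is a sum of
  at most two of these.\<close>

definition uni :: "'v \<Rightarrow> 'a::comm_ring_1 poly \<Rightarrow> ('v, 'a) mpoly" where
  "uni v g = (\<Sum>i\<le>degree g. Poly_Mapping.single (Poly_Mapping.single v i) (coeff g i))"

lemma uni_mpolys: "is_subring R \<Longrightarrow> g \<in> polys R \<Longrightarrow> v \<in> Y \<Longrightarrow> uni v g \<in> mpolys R Y"
  unfolding uni_def by (intro mpolys_sum mpolys_single) (auto simp: subring_0 polysD)

lemma mpoly_eval_uni: "mpoly_eval x (uni v g) = poly g (x v)"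
  by (simp add: uni_def mpoly_eval_sum mpoly_eval_single mon_single poly_altdef)

lemma mpoly_eval_pderiv:
  "mpoly_eval x (mpoly_pderiv v p) = (\<Sum>m\<in>Poly_Mapping.keys p.
     of_nat (Poly_Mapping.lookup m v) * Poly_Mapping.lookup p m * mon x (m - Poly_Mapping.single v 1))"
  by (simp add: mpoly_pderiv_def mpoly_eval_sum mpoly_eval_single)

lemma mpoly_eval_pderiv_add:
  "mpoly_eval x (mpoly_pderiv v (p + q)) = mpoly_eval x (mpoly_pderiv v p) + mpoly_eval x (mpoly_pderiv v q)"
  unfolding mpoly_eval_pderiv
  by (rule setsum_keys_plus_distrib) (simp_all add: algebra_simps)

lemma mpoly_eval_pderiv_sum:
  "mpoly_eval x (mpoly_pderiv v (\<Sum>i\<in>I. f i)) = (\<Sum>i\<in>I. mpoly_eval x (mpoly_pderiv v (f i)))"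
proof (induction I rule: infinite_finite_induct)
  case (insert i I)
  then show ?case by (simp add: mpoly_eval_pderiv_add)
qed (simp_all add: mpoly_pderiv_def mpoly_eval_0)

lemma mpoly_eval_pderiv_notin:
  assumes "p \<in> mpolys R Y" "v \<notin> Y" shows "mpoly_eval x (mpoly_pderiv v p) = 0"
  unfolding mpoly_eval_pderiv
proof (rule sum.neutral, rule ballI)
  fix m assume "m \<in> Poly_Mapping.keys p"
  then have "v \<notin> Poly_Mapping.keys m" using mpolysD(2)[OF assms(1)] assms(2) by blast
  then show "of_nat (Poly_Mapping.lookup m v) * Poly_Mapping.lookup p m * mon x (m - Poly_Mapping.single v 1) = 0"
    by (simp add: in_keys_iff)
qed

lemma mpoly_eval_pderiv_uni: "mpoly_eval x (mpoly_pderiv v (uni v g)) = poly (pderiv g) (x v)"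
proof -
  have "mpoly_eval x (mpoly_pderiv v (uni v g)) = (\<Sum>i\<le>degree g. of_nat i * coeff g i * x v ^ (i - 1))"
    unfolding uni_def mpoly_eval_pderiv_sum
    by (intro sum.cong refl) (simp add: mpoly_eval_pderiv mon_single flip: single_diff)
  also have "\<dots> = poly (\<Sum>i\<le>degree g. pderiv (monom (coeff g i) i)) (x v)"
    by (simp add: poly_sum pderiv_monom poly_monom)
  also have "(\<Sum>i\<le>degree g. pderiv (monom (coeff g i) i)) = pderiv (\<Sum>i\<le>degree g. monom (coeff g i) i)"
    by (rule sum_comp_morphism[of pderiv, unfolded o_def]) (simp_all add: pderiv_add)
  also have "(\<Sum>i\<le>degree g. monom (coeff g i) i) = g" by (rule poly_as_sum_of_monoms)
  finally show ?thesis .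
qed

context place
begin

lemma uniformizer_divide:
  assumes s: "uniformizer F s" and y: "y \<in> F" "y \<in> V" "res y = 0"
  shows "y / s \<in> V"
proof (cases "y = 0")
  case True
  then show ?thesis using V_intros(1) by simp
next
  case False
  note u = uniformizerD[OF s]
  obtain i :: int where i: "unit (y / s powi i)" using u(5)[OF y(1) False] by (elim exE)
  then have "i > 0" using V_iff_power_int(2)[OF u(3,4,2) i y(2)] y(3) by simp
  then have eq: "y / s = (y / s powi i) * s ^ nat (i - 1)"
    using u(2) by (simp add: power_int_def nat_diff_distrib power_diff field_simps)
  show ?thesis unfolding eq by (rule V_intros(4)[OF unit_V[OF i] V_intros(7)[OF u(3)]])
qed

lemma uniformizer_order:
  assumes s: "uniformizer F s" and y: "y \<in> F" "y \<in> V" "y \<noteq> 0"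
  shows "\<exists>e u. unit u \<and> y = s ^ e * u"
proof -
  note u = uniformizerD[OF s]
  obtain i :: int where i: "unit (y / s powi i)" using u(5)[OF y(1,3)] by (elim exE)
  then have "i \<ge> 0" using V_iff_power_int(1)[OF u(3,4,2) i] y(2) by simp
  then have "y = s ^ nat i * (y / s powi i)" using u(2) by (simp add: power_int_def)
  then show ?thesis using i by blast
qed

text \<open>This is the density of \<open>E\<close> in the completion of \<open>F\<close>.\<close>

lemma uniformizer_approximation:
  assumes F: "is_subfield F" and E: "is_subfield E" "E \<subseteq> F" and s: "s \<in> E" "uniformizer F s"
    and res: "\<forall>z\<in>F \<inter> V. \<exists>z'\<in>E \<inter> V. res z' = res z" and z: "z \<in> F \<inter> V"
  shows "\<exists>c\<in>E \<inter> V. \<exists>z'\<in>F \<inter> V. z = c + s ^ N * z'"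
proof (induction N)
  case 0
  then show ?case using z subfield_intros(1)[OF E(1)] V_intros(1) by (intro bexI[of _ 0] bexI[of _ z]) auto
next
  case (Suc N)
  then obtain c z' where c: "c \<in> E \<inter> V" "z' \<in> F \<inter> V" "z = c + s ^ N * z'" by blast
  from bspec[OF res c(2)] obtain a where a: "a \<in> E \<inter> V" "res a = res z'" by (elim bexE)
  note u = uniformizerD[OF s(2)]
  have aF: "a \<in> F" using a(1) E(2) by blast
  have d: "z' - a \<in> F" "z' - a \<in> V" "res (z' - a) = 0"
    using c(2) a aF subfield_intros(3)[OF F] V_intros(3) res_diff by auto
  have "(z' - a) / s \<in> F \<inter> V" using uniformizer_divide[OF s(2) d] subfield_divide[OF F d(1) u(1)] by blast
  moreover have "c + s ^ N * a \<in> E \<inter> V"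
    using c(1) a(1) s(1) u(3) by (auto intro!: subfield_intros(4,6,7)[OF E(1)] V_intros(4,6,7))
  moreover have "z = (c + s ^ N * a) + s ^ Suc N * ((z' - a) / s)"
    unfolding c(3) using u(2) by (simp add: field_simps)
  ultimately show ?case by blast
qed

text \<open>If \<open>f(\<zeta>) = 0\<close> and \<open>f'(\<zeta>)\<close> has value \<open>e\<close>, then \<open>\<zeta> = c + s\<^sup>N \<zeta>'\<close> with \<open>N = e + 1\<close> turns \<open>f\<close> into
  \<open>s\<^bsup>e+N\<^esup> g\<close> where \<open>g\<close> is integral and \<open>g'(\<zeta>')\<close> is a unit.\<close>

lemma simple_root_model:
  assumes F: "is_subfield F" and E: "is_subfield E" "E \<subseteq> F" and s: "s \<in> E" "uniformizer F s"
    and res: "\<forall>z\<in>F \<inter> V. \<exists>z'\<in>E \<inter> V. res z' = res z" and z: "z \<in> F \<inter> V"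
    and f: "f \<in> polys E" "poly f z = 0" "poly (pderiv f) z \<noteq> 0"
  shows "\<exists>c\<in>E \<inter> V. \<exists>b\<in>E \<inter> V. \<exists>z'\<in>F \<inter> V. \<exists>g\<in>polys (E \<inter> V).
    z = c + b * z' \<and> poly g z' = 0 \<and> unit (poly (pderiv g) z')"
proof -
  note u = uniformizerD[OF s(2)]
  have R: "is_subring (F \<inter> V)" by (rule is_subring_Int[OF subfield_subring[OF F] V_subring])
  have "f \<noteq> 0" using f(3) by auto
  then have "\<exists>i\<in>{..degree f}. coeff f i \<noteq> 0" by (intro bexI[of _ "degree f"]) auto
  from ex_dominant[OF finite_atMost this] obtain j where
    j: "coeff f j \<noteq> 0" "\<forall>i\<in>{..degree f}. coeff f i / coeff f j \<in> V" by blast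
  \<comment> \<open>Division by a dominant coefficient makes all coefficients finite without leaving
    E.\<close>
  define f1 where "f1 = smult (1 / coeff f j) f"
  have "coeff f1 i \<in> V" for i
    using j(2) V_intros(1) by (cases "i \<le> degree f") (auto simp: f1_def coeff_eq_0)
  moreover have f1E: "f1 \<in> polys E" unfolding f1_def
    using polysD[OF f(1)] subfield_intros(2,12)[OF E(1)] by (intro polys_smult[OF subfield_subring[OF E(1)] _ f(1)]) auto
  ultimately have f1: "f1 \<in> polys (F \<inter> V)" using E(2) by (auto simp: polys_def)
  have f1z: "poly f1 z = 0" "poly (pderiv f1) z \<noteq> 0" using f(2,3) j(1) by (simp_all add: f1_def pderiv_smult)
  have "poly (pderiv f1) z \<in> F \<inter> V" using poly_in[OF R polys_pderiv[OF R f1] z] .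
  then obtain e v where v: "unit v" "poly (pderiv f1) z = s ^ e * v"
    using uniformizer_order[OF s(2) _ _ f1z(2)] by blast
  define N where "N = Suc e"
  obtain c z' where c: "c \<in> E \<inter> V" "z' \<in> F \<inter> V" "z = c + s ^ N * z'"
    using uniformizer_approximation[OF F E s res z, of N] by blast
  \<comment> \<open>L = X - z' and H = s^N L, so that z + H = c + s^N X; the Taylor expansion at z
    then computes f1(c + s^N X).\<close>
  define L where "L = [:- z', 1:]"
  define H where "H = smult (s ^ N) L"
  have sF: "s \<in> F \<inter> V" using u(1,3) by blast
  have LR: "L \<in> polys (F \<inter> V)" unfolding L_def
    by (intro polys_intros(8)[OF R] polys_0[OF R] subring_intros(1,2)[OF R] subring_intros(5)[OF R c(2)])
  have HR: "H \<in> polys (F \<inter> V)" unfolding H_def by (rule polys_smult[OF R subring_intros(7)[OF R sF] LR])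
  from poly_taylor[OF R f1 z HR] obtain r where r: "r \<in> polys (F \<inter> V)"
    "pcompose f1 ([:z:] + H) = [:poly f1 z:] + [:poly (pderiv f1) z:] * H + H ^ 2 * r" by (elim bexE)
  \<comment> \<open>The linear term carries s^(e+N) and the quadratic one s^(2N) = s^(e+N) s;
    removing s^(e+N) leaves this g, whose derivative at z' is v since L vanishes there.\<close>
  define g where "g = smult v L + smult s (L ^ 2 * r)"
  have cH: "[:z:] + H = [:c, s ^ N:]" by (simp add: H_def L_def c(3))
  have H2: "H ^ 2 = smult (s ^ (e + N) * s) (L ^ 2)"
  proof -
    have "(s ^ N) ^ 2 = s ^ (e + N) * s" by (simp add: N_def power2_eq_square power_add)
    then show ?thesis by (simp add: H_def smult_power)
  qed
  have "pcompose f1 [:c, s ^ N:] = smult (s ^ e * v * s ^ N) L + smult (s ^ (e + N) * s) (L ^ 2 * r)"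
    using r(2) unfolding cH f1z(1) v(2) H2 by (simp add: H_def mult_ac)
  also have "\<dots> = smult (s ^ (e + N)) g"
    by (simp add: g_def smult_add_right power_add mult_ac)
  finally have comp: "pcompose f1 [:c, s ^ N:] = smult (s ^ (e + N)) g" .
  have vF: "v \<in> F \<inter> V"
  proof -
    have "v = poly (pderiv f1) z / s ^ e" using v(2) u(2) by simp
    then have "v \<in> F" using \<open>poly (pderiv f1) z \<in> F \<inter> V\<close> subfield_divide[OF F _ subfield_intros(7)[OF F u(1)]] by simp
    then show ?thesis using unit_V[OF v(1)] by blast
  qed
  have gR: "g \<in> polys (F \<inter> V)" unfolding g_def
    by (intro polys_add[OF R] polys_smult[OF R] polys_mult[OF R] polys_power[OF R] vF sF LR r(1))
  \<comment> \<open>Two descriptions of g are combined: the Taylor formula shows that its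
    coefficients are finite, the substitution into f1 that they lie in E.\<close>
  have "g = smult (1 / s ^ (e + N)) (pcompose f1 [:c, s ^ N:])" unfolding comp using u(2) by simp
  moreover have "smult (1 / s ^ (e + N)) (pcompose f1 [:c, s ^ N:]) \<in> polys E"
    using c(1) s(1) subfield_intros(1,2,7,12)[OF E(1)] subfield_subring[OF E(1)] f1E
    by (intro polys_smult polys_pcompose polys_intros(8) polys_0) auto
  ultimately have gE: "g \<in> polys (E \<inter> V)" using gR by (auto simp: polys_def)
  have L: "poly L z' = 0" "poly (pderiv L) z' = 1" by (simp_all add: L_def pderiv_pCons)
  have "poly g z' = 0" by (simp add: g_def L)
  moreover have "poly (pderiv g) z' = v"
    by (simp add: g_def pderiv_add pderiv_smult pderiv_mult power2_eq_square L)
  then have "unit (poly (pderiv g) z')" using v(1) by simp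
  moreover have "s ^ N \<in> E \<inter> V" using s(1) u(3) subfield_intros(7)[OF E(1)] V_intros(7) by blast
  ultimately show ?thesis using c gE by blast
qed

lemma common_unit_denominator:
  assumes R: "is_subring R" and "finite A"
    and "\<And>a. a \<in> A \<Longrightarrow> \<exists>x\<in>R. \<exists>w\<in>R. unit w \<and> a = x / w"
  shows "\<exists>w\<in>R. unit w \<and> (\<forall>a\<in>A. w * a \<in> R)"
  using assms(2,3)
proof (induction A)
  case empty
  then show ?case using subring_1[OF R] unit_1 by blast
next
  case (insert a A)
  have "\<exists>w\<in>R. unit w \<and> (\<forall>b\<in>A. w * b \<in> R)" by (rule insert.IH, rule insert.prems, rule insertI2)
  then obtain w where w: "w \<in> R" "unit w" "\<forall>b\<in>A. w * b \<in> R" by (elim bexE conjE)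
  from insert.prems[OF insertI1] obtain x y where xy: "x \<in> R" "y \<in> R" "unit y" "a = x / y" by (elim bexE conjE)
  have "w * y * a \<in> R" using subring_intros(4)[OF R w(1) xy(1)] unit_nz[OF xy(3)] by (simp add: xy(4))
  moreover have "w * y * b \<in> R" if "b \<in> A" for b
    using subring_intros(4)[OF R _ xy(2), of "w * b"] w(3) that by (simp add: mult_ac)
  ultimately show ?case using subring_intros(4)[OF R w(1) xy(2)] unit_mult[OF w(2) xy(3)]
    by (intro bexI[of _ "w * y"]) auto
qed

lemma unit_prod_list: "(\<And>x. x \<in> set xs \<Longrightarrow> unit x) \<Longrightarrow> unit (prod_list xs)"
  by (induction xs) (simp_all add: unit_1 unit_mult)

text \<open>Uniformizability asks for coefficients in K[T], whereas \<open>simple_root_model\<close>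
  yields them in the valuation ring of K(T). As that ring is a localization of K[T], denominators
  are cleared by units, and the derivative at z' remains a unit.\<close>

lemma immediate_model:
  assumes F: "is_subfield F" and K: "is_subfield K" "K \<subseteq> F \<inter> V" and T: "immediate F K T" and z: "z \<in> F \<inter> V"
  shows "\<exists>z'\<in>F \<inter> V. \<exists>g\<in>polys (ring_adjoin K T). \<exists>h\<in>ring_adjoin K T. \<exists>a\<in>ring_adjoin K T. \<exists>b\<in>ring_adjoin K T.
    poly g z' = 0 \<and> unit (poly (pderiv g) z') \<and> unit h \<and> h * z = a + b * z'"
proof -
  let ?E = "adjoin K T" and ?R = "ring_adjoin K T"
  note i = T[unfolded immediate_def]
  have E: "is_subfield ?E" by (rule is_subfield_adjoin)
  have EF: "?E \<subseteq> F" using adjoin_least[OF F, of K T] K(2) i by blast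
  have R: "is_subring ?R" by (rule is_subring_ring_adjoin)
  have fr: "\<exists>x\<in>?R. \<exists>w\<in>?R. unit w \<and> y = x / w" if "y \<in> ?E \<inter> V" for y using i that by blast
  obtain s where s: "s \<in> ?E" "uniformizer F s" using i by blast
  obtain f where f: "f \<in> polys ?E" "poly f z = 0" "poly (pderiv f) z \<noteq> 0" using i z by blast
  have rs: "\<forall>y\<in>F \<inter> V. \<exists>z'\<in>?E \<inter> V. res z' = res y" using i by (elim conjE)
  from simple_root_model[OF F E EF s rs z f] obtain c b z' g where
    c: "c \<in> ?E \<inter> V" "b \<in> ?E \<inter> V" and z': "z' \<in> F \<inter> V" and g: "g \<in> polys (?E \<inter> V)"
    "z = c + b * z'" "poly g z' = 0" "unit (poly (pderiv g) z')" by (elim bexE conjE)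
  have 1: "\<exists>w\<in>?R. unit w \<and> (\<forall>a\<in>coeff g ` {..degree g}. w * a \<in> ?R)"
    by (rule common_unit_denominator[OF R], simp, rule fr) (use polysD[OF g(1)] in blast)
  obtain w where w: "w \<in> ?R" "unit w" "\<forall>a\<in>coeff g ` {..degree g}. w * a \<in> ?R" using 1 by (elim bexE conjE)
  have wg: "smult w g \<in> polys ?R"
    unfolding polys_def
  proof (intro CollectI allI)
    fix i show "coeff (smult w g) i \<in> ?R"
      using w(3) subring_0[OF R] by (cases "i \<le> degree g") (auto simp: coeff_eq_0)
  qed
  have 2: "\<exists>w\<in>?R. unit w \<and> (\<forall>a\<in>{c, b}. w * a \<in> ?R)"
    by (rule common_unit_denominator[OF R], simp, rule fr) (use c in blast)
  obtain h where h: "h \<in> ?R" "unit h" "\<forall>a\<in>{c, b}. h * a \<in> ?R" using 2 by (elim bexE conjE)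
  have "h * z = h * c + h * b * z'" using g(2) by (simp add: algebra_simps)
  moreover have "poly (smult w g) z' = 0" "unit (poly (pderiv (smult w g)) z')"
    using g(3) unit_mult[OF w(2) g(4)] by (simp_all add: pderiv_smult)
  moreover have "h * c \<in> ?R" "h * b \<in> ?R" using h(3) by simp_all
  ultimately show ?thesis using z' wg h(1,2) by blast
qed

lemma immediate_uniformizable:
  assumes F: "is_subfield F" and K: "is_subfield K" "K \<subseteq> F" "\<And>a. a \<in> K \<Longrightarrow> P a = Some a"
    and S: "finite S" "F = adjoin K S" and T: "immediate F K T"
  shows "uniformizable F K P"
  unfolding uniformizable_def
proof (intro allI impI)
  fix Z assume Z: "finite Z \<and> Z \<subseteq> val_ring F P"
  have KV: "K \<subseteq> V" using K(3) P_eq_Some by blast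
  have vF: "val_ring F P = F \<inter> V" and vK: "val_ring K P = K"
    using KV by (auto simp: val_ring_def V_def)
  let ?R = "ring_adjoin K T"
  have R: "is_subring ?R" by (rule is_subring_ring_adjoin)
  note im = T[unfolded immediate_def]
  define g0 where "g0 x = (if x \<in> V then x else inverse x)" for x
  have g0V: "g0 x \<in> V" for x using notin_V(2) by (simp add: g0_def)
  have SF: "S \<subseteq> F" using S(2) adjoin_gens by blast
  have g0F: "g0 x \<in> F" if "x \<in> S" for x using that SF subfield_inverse[OF F] by (auto simp: g0_def)
  obtain zs where zs: "set zs = Z \<union> g0 ` S" using finite_list Z S(1) by (metis finite_Un finite_imageI)
  define m where "m = length zs"
  have zV: "zs ! i \<in> F \<inter> V" if "i < m" for i
  proof -
    have "zs ! i \<in> Z \<union> g0 ` S" using that zs nth_mem unfolding m_def by blast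
    then show ?thesis
    proof (elim UnE imageE)
      assume "zs ! i \<in> Z" then show ?thesis using Z unfolding vF by blast
    next
      fix s assume s: "zs ! i = g0 s" "s \<in> S"
      show ?thesis unfolding s(1) using g0V[of s] g0F[OF s(2)] by (rule IntI[rotated])
    qed
  qed
  have KFV: "K \<subseteq> F \<inter> V" using K(2) KV by blast
  have "\<forall>i. \<exists>z' g h a b. i < m \<longrightarrow> z' \<in> F \<inter> V \<and> g \<in> polys ?R \<and> h \<in> ?R \<and> a \<in> ?R \<and> b \<in> ?R \<and>
    poly g z' = 0 \<and> unit (poly (pderiv g) z') \<and> unit h \<and> h * zs ! i = a + b * z'"
  proof
    fix i show "\<exists>z' g h a b. i < m \<longrightarrow> z' \<in> F \<inter> V \<and> g \<in> polys ?R \<and> h \<in> ?R \<and> a \<in> ?R \<and> b \<in> ?R \<and>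
      poly g z' = 0 \<and> unit (poly (pderiv g) z') \<and> unit h \<and> h * zs ! i = a + b * z'"
    proof (cases "i < m")
      case True
      from immediate_model[OF F K(1) KFV T zV[OF True]] show ?thesis
        by (elim bexE conjE) (intro exI conjI impI)
    qed simp
  qed
  then obtain z' g h a b where d: "\<forall>i. i < m \<longrightarrow> z' i \<in> F \<inter> V \<and> g i \<in> polys ?R \<and> h i \<in> ?R \<and> a i \<in> ?R \<and> b i \<in> ?R \<and>
    poly (g i) (z' i) = 0 \<and> unit (poly (pderiv (g i)) (z' i)) \<and> unit (h i) \<and> h i * zs ! i = a i + b i * z' i"
    unfolding choice_iff by (elim exE)
  note d = d[rule_format]
  \<comment> \<open>The first m variables stand for the auxiliary z', the last m for the elements of
    \<open>zs\<close>. Equation m + k is linear in the variable m + k, with coefficient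
    \<open>h k\<close>, and otherwise involves only the variable k; so the Jacobian matrix is lower
    triangular with the values g'(z') and h on the diagonal.\<close>
  define \<eta> where "\<eta> i = (if i < m then z' i else zs ! (i - m))" for i
  define f where "f i = (if i < m then uni i (g i) else
    uni i [:- a (i - m), h (i - m):] + uni (i - m) [:0, - b (i - m):])" for i
  define n where "n = 2 * m"
  have cases: "i < m \<or> (\<exists>k<m. i = m + k)" if "i < n" for i
    using that unfolding n_def by presburger
  have \<eta>V: "\<eta> i \<in> F \<inter> V" if "i < n" for i
    using cases[OF that] d zV by (auto simp: \<eta>_def)
  have \<eta>Z: "Z \<union> g0 ` S \<subseteq> \<eta> ` {..<n}"
  proof
    fix y assume "y \<in> Z \<union> g0 ` S"
    then obtain k where "k < m" "y = zs ! k" using zs unfolding m_def by (metis in_set_conv_nth)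
    then have "y = \<eta> (m + k)" "m + k \<in> {..<n}" by (simp_all add: \<eta>_def n_def)
    then show "y \<in> \<eta> ` {..<n}" by blast
  qed
  have fvars: "f i \<in> mpolys ?R {..i}" if "i < n" for i
  proof (cases "i < m")
    case True
    then show ?thesis using uni_mpolys[OF R, of "g i" i "{..i}"] d by (simp add: f_def)
  next
    case False
    define k where "k = i - m"
    have k: "k < m" "k \<le> i" using False that by (auto simp: k_def n_def)
    have "[:- a k, h k:] \<in> polys ?R" "[:0, - b k:] \<in> polys ?R"
      using d[OF k(1)] subring_intros(1,5)[OF R] by (intro polys_intros(8)[OF R] polys_0[OF R]; blast)+
    then have "uni i [:- a k, h k:] + uni k [:0, - b k:] \<in> mpolys ?R {..i}"
      using k(2) by (intro mpolys_add[OF R] uni_mpolys[OF R]) auto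
    then show ?thesis using False by (simp add: f_def k_def)
  qed
  have diag: "unit (mpoly_eval \<eta> (mpoly_pderiv i (f i)))" if "i < n" for i
    using cases[OF that]
  proof (elim disjE exE conjE)
    assume "i < m"
    then show ?thesis using d by (simp add: f_def \<eta>_def mpoly_eval_pderiv_uni)
  next
    fix k assume k: "k < m" "i = m + k"
    have "uni k [:0, - b k:] \<in> mpolys UNIV {k}" by (rule uni_mpolys[OF is_subring_UNIV]) (auto simp: polys_def)
    then have "mpoly_eval \<eta> (mpoly_pderiv i (uni k [:0, - b k:])) = 0"
      using k by (intro mpoly_eval_pderiv_notin) auto
    moreover have "f i = uni i [:- a k, h k:] + uni k [:0, - b k:]" using k by (simp add: f_def)
    ultimately have "mpoly_eval \<eta> (mpoly_pderiv i (f i)) = h k"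
      by (simp only: mpoly_eval_pderiv_add mpoly_eval_pderiv_uni) (simp add: pderiv_pCons)
    then show ?thesis using d[OF k(1)] by simp
  qed
  show "uniformizable_wrt F K P Z"
    unfolding uniformizable_wrt_def vF vK
  proof (intro exI[of _ T] exI[of _ n] exI[of _ \<eta>] exI[of _ f] conjI)
    show "finite T" "T \<subseteq> F \<inter> V" using im by blast+
    show "transcendence_basis F K T" unfolding transcendence_basis_def
    proof (intro conjI ballI)
      show "T \<subseteq> F" "alg_indep K T" using im by blast+
      fix x assume "x \<in> F"
      then obtain q where q: "q \<in> polys (adjoin K T)" "poly q x = 0" "poly (pderiv q) x \<noteq> 0" using im by blast
      then have "q \<noteq> 0" by auto
      then show "algebraic_over (adjoin K T) x" unfolding algebraic_over_def
        using q polys_iff_coeffs[OF subfield_intros(1)[OF is_subfield_adjoin]] by blast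
    qed
    show "\<eta> ` {..<n} \<subseteq> F \<inter> V" using \<eta>V by blast
    show "Z \<subseteq> \<eta> ` {..<n}" using \<eta>Z by blast
    let ?A = "adjoin K (T \<union> \<eta> ` {..<n})"
    have A: "is_subfield ?A" by (rule is_subfield_adjoin)
    show "F = ?A"
    proof
      have "T \<subseteq> F" using im by blast
      moreover have "\<eta> ` {..<n} \<subseteq> F" by (rule image_subsetI) (use \<eta>V in simp)
      ultimately show "?A \<subseteq> F" by (intro adjoin_least[OF F K(2)] Un_least)
      have "x \<in> ?A" if "x \<in> S" for x
      proof -
        have "g0 x \<in> ?A" using \<eta>Z adjoin_gens[of "T \<union> \<eta> ` {..<n}" K] that by blast
        then show ?thesis using subfield_inverse[OF A, of "g0 x"] by (auto simp: g0_def split: if_splits)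
      qed
      then show "F \<subseteq> ?A" unfolding S(2) by (intro adjoin_least[OF A adjoin_base]) blast
    qed
    have fv: "mpoly_coeffs (f i) \<subseteq> ?R" "mpoly_vars (f i) \<subseteq> {..i}" if "i < n" for i
      using fvars[OF that] by (simp_all add: mpolys_def)
    have "mpoly_vars (f i) \<subseteq> {..<n}" if "i < n" for i by (rule order_trans[OF fv(2)[OF that]]) (use that in auto)
    then show "\<forall>i<n. mpoly_coeffs (f i) \<subseteq> ?R \<and> mpoly_vars (f i) \<subseteq> {..<n}" using fv(1) by simp
    show "\<forall>i<n. \<forall>j<n. i < j \<longrightarrow> j \<notin> mpoly_vars (f i)"
    proof (intro allI impI notI)
      fix i j assume "i < n" "i < j" "j \<in> mpoly_vars (f i)"
      then show False using subsetD[OF fv(2)[OF \<open>i < n\<close>]] by fastforce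
    qed
    show "\<forall>i<n. mpoly_eval \<eta> (f i) = 0"
    proof (intro allI impI)
      fix i assume "i < n"
      from cases[OF this] show "mpoly_eval \<eta> (f i) = 0"
      proof (elim disjE exE conjE)
        assume "i < m"
        then show ?thesis using d by (simp add: f_def \<eta>_def mpoly_eval_uni)
      next
        fix k assume k: "k < m" "i = m + k"
        then have "h k * zs ! k = a k + b k * z' k" using d by blast
        then show ?thesis using k by (simp add: f_def \<eta>_def mpoly_eval_uni mpoly_eval_add algebra_simps)
      qed
    qed
    let ?J = "mat n n (\<lambda>(i, j). mpoly_eval \<eta> (mpoly_pderiv j (f i)))"
    have "det ?J = prod_list (diag_mat ?J)"
    proof (rule det_lower_triangular)
      fix i j assume ij: "i < j" "j < n"
      then have "mpoly_eval \<eta> (mpoly_pderiv j (f i)) = 0"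
        by (intro mpoly_eval_pderiv_notin[OF fvars]) auto
      then show "?J $$ (i, j) = 0" using ij by simp
    qed simp
    moreover have "unit (prod_list (diag_mat ?J))"
      using diag by (intro unit_prod_list) (auto simp: diag_mat_def)
    ultimately show "P (det ?J) \<noteq> Some 0" by (simp add: P_eq_Some unit_def)
  qed
qed

end

subsection \<open>Density in the patch topology\<close>

text \<open>Vanishing at a is expressed by the valuation ring alone. So it depends only on the
  equivalence class, and \<open>P a \<noteq> Some 0\<close> becomes finiteness of P at
  \<open>inverse a\<close>.\<close>

lemma place_eq_0_iff:
  assumes F: "is_subfield F" and P: "is_place F P" and a: "a \<in> F" "a \<noteq> 0"
  shows "P a = Some 0 \<longleftrightarrow> inverse a \<notin> val_ring F P"
proof
  have ia: "inverse a \<in> F" using subfield_inverse[OF F a(1)] .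
  note p = P[unfolded is_place_def]
  show "inverse a \<notin> val_ring F P" if "P a = Some 0"
  proof
    assume i: "inverse a \<in> val_ring F P"
    have "a \<in> val_ring F P" using that a(1) by (simp add: val_ring_def)
    then have "P (a * inverse a) = Some (the (P a) * the (P (inverse a)))" using p i by blast
    then show False using that a(2) p by simp
  qed
  show "P a = Some 0" if "inverse a \<notin> val_ring F P"
  proof -
    have "P (inverse a) = None" using that ia by (simp add: val_ring_def)
    then have "P (inverse (inverse a)) = Some 0" using p ia by blast
    then show ?thesis by simp
  qed
qed

text \<open>The intersection property of the generating sets passes through the inductive
  construction of open sets, so these sets form a base.\<close>

lemma openin_generated_base:
  assumes "generate_topology_on \<B> U" "x \<in> U"
    and Int: "\<And>A B x. A \<in> \<B> \<Longrightarrow> B \<in> \<B> \<Longrightarrow> x \<in> A \<Longrightarrow> x \<in> B \<Longrightarrow> \<exists>C\<in>\<B>. x \<in> C \<and> C \<subseteq> A \<inter> B"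
  shows "\<exists>B\<in>\<B>. x \<in> B \<and> B \<subseteq> U"
  using assms(1,2)
proof (induction arbitrary: x)
  case (Int U U')
  then obtain A B where AB: "A \<in> \<B>" "x \<in> A" "A \<subseteq> U" "B \<in> \<B>" "x \<in> B" "B \<subseteq> U'" by blast
  from assms(3)[OF AB(1,4,2,5)] AB(3,6) show ?case by blast
next
  case (UN \<K>)
  then obtain U where "U \<in> \<K>" "x \<in> U" by blast
  from UN.IH[OF this] \<open>U \<in> \<K>\<close> show ?case by (elim bexE conjE) (intro bexI conjI, assumption, rule order_trans, assumption, rule Union_upper)
next
  case (Basis U)
  then show ?case by (intro bexI[of _ U]) simp_all
qed simp

text \<open>Points are classes, while conditions concern places. By \<open>C_equiv\<close> the
  conditions do not depend on the representative, so the intersection of two basic sets is given by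
  the union of their conditions, and density means meeting every nonempty basic set.\<close>

lemma patch_dense:
  assumes F: "is_subfield F" and N: "N \<subseteq> places F K"
    and hit: "\<And>A B Q. finite A \<Longrightarrow> finite B \<Longrightarrow> A \<subseteq> F - {0} \<Longrightarrow> B \<subseteq> F - {0} \<Longrightarrow> Q \<in> places F K \<Longrightarrow>
      \<forall>a\<in>A. Q a \<noteq> Some 0 \<Longrightarrow> \<forall>b\<in>B. Q b = Some 0 \<Longrightarrow>
      \<exists>P\<in>N. (\<forall>a\<in>A. P a \<noteq> Some 0) \<and> (\<forall>b\<in>B. P b = Some 0)"
  shows "zariski_patch F K closure_of zariski_points F K N = zariski_space F K"
proof -
  let ?cl = "\<lambda>P. place_equiv F K `` {P}"
  define C where "C A B = {P \<in> places F K. (\<forall>a\<in>A. P a \<noteq> Some 0) \<and> (\<forall>b\<in>B. P b = Some 0)}" for A B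
  have basic: "patch_basic F K A B = ?cl ` C A B" for A B
    by (simp add: patch_basic_def zariski_points_def C_def)
  define \<B> where "\<B> = {patch_basic F K A B | A B. finite A \<and> finite B \<and> A \<subseteq> F - {0} \<and> B \<subseteq> F - {0}}"
  have C_equiv: "P' \<in> C A B" if "P \<in> C A B" "P' \<in> places F K" "?cl P = ?cl P'" "A \<subseteq> F - {0}" "B \<subseteq> F - {0}"
    for P P' A B
  proof -
    have P: "P \<in> places F K" using that(1) by (simp add: C_def)
    then have "P \<in> ?cl P'" unfolding that(3)[symmetric] by (simp add: place_equiv_def)
    then have v: "val_ring F P' = val_ring F P" by (simp add: place_equiv_def)
    have pl: "is_place F P" "is_place F P'" using P that(2) by (simp_all add: places_def)
    have "P a = Some 0 \<longleftrightarrow> P' a = Some 0" if "a \<in> F - {0}" for a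
      using place_eq_0_iff[OF F pl(1), of a] place_eq_0_iff[OF F pl(2), of a] v that by simp
    then show ?thesis using that(1,2,4,5) unfolding C_def by blast
  qed
  have base: "\<exists>W\<in>\<B>. x \<in> W \<and> W \<subseteq> U \<inter> U'" if U: "U \<in> \<B>" "U' \<in> \<B>" "x \<in> U" "x \<in> U'" for x U U'
  proof -
    obtain A B where A: "U = ?cl ` C A B" "finite A" "finite B" "A \<subseteq> F - {0}" "B \<subseteq> F - {0}"
      using U(1) unfolding \<B>_def basic by blast
    obtain A' B' where A': "U' = ?cl ` C A' B'" "finite A'" "finite B'" "A' \<subseteq> F - {0}" "B' \<subseteq> F - {0}"
      using U(2) unfolding \<B>_def basic by blast
    obtain P where P: "P \<in> C A B" "x = ?cl P" using U(3) A(1) by blast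
    obtain P' where P': "P' \<in> C A' B'" "x = ?cl P'" using U(4) A'(1) by blast
    have pl: "P \<in> places F K" using P(1) by (simp add: C_def)
    have "?cl P' = ?cl P" using P(2) P'(2) by simp
    from C_equiv[OF P'(1) pl this A'(4,5)] have "P \<in> C (A \<union> A') (B \<union> B')"
      using P(1) unfolding C_def by blast
    moreover have "C (A \<union> A') (B \<union> B') \<subseteq> C A B \<inter> C A' B'" unfolding C_def by blast
    moreover have "?cl ` C (A \<union> A') (B \<union> B') \<in> \<B>" unfolding \<B>_def basic[symmetric]
      using A(2-5) A'(2-5) by (intro CollectI exI[of _ "A \<union> A'"] exI[of _ "B \<union> B'"]) simp
    ultimately show ?thesis unfolding P(2) A(1) A'(1)
      by (intro bexI[of _ "?cl ` C (A \<union> A') (B \<union> B')"]) blast+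
  qed
  have "\<exists>y\<in>zariski_points F K N. y \<in> U" if U: "openin (zariski_patch F K) U" "x \<in> U" for x U
  proof -
    have "generate_topology_on \<B> U"
      using U(1) unfolding zariski_patch_def \<B>_def openin_topology_generated_by_iff .
    from openin_generated_base[OF this U(2) base] obtain W where W: "W \<in> \<B>" "x \<in> W" "W \<subseteq> U" by blast
    then obtain A B where A: "W = ?cl ` C A B" "finite A" "finite B" "A \<subseteq> F - {0}" "B \<subseteq> F - {0}"
      unfolding \<B>_def basic by blast
    obtain Q where Q: "Q \<in> places F K" "\<forall>a\<in>A. Q a \<noteq> Some 0" "\<forall>b\<in>B. Q b = Some 0"
      using W(2) A(1) unfolding C_def by blast
    from hit[OF A(2-5) Q] obtain P where P: "P \<in> N" "\<forall>a\<in>A. P a \<noteq> Some 0" "\<forall>b\<in>B. P b = Some 0" by (elim bexE conjE)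
    then have "P \<in> C A B" using N unfolding C_def by blast
    then have "?cl P \<in> U" using W(3) A(1) by blast
    then show ?thesis using P(1) unfolding zariski_points_def by blast
  qed
  then have "zariski_patch F K closure_of zariski_points F K N = topspace (zariski_patch F K)"
    unfolding closure_of_def by blast
  then show ?thesis by (simp only: topspace_zariski_patch)
qed

subsection \<open>Perfect fields\<close>

lemma is_alg_closed_perfect:
  fixes K :: "'a::field set"
  assumes K: "is_subfield K" and "is_alg_closed K" shows "is_perfect K"
proof (cases "CHAR('a) = 0")
  case False
  let ?p = "CHAR('a)"
  have "\<exists>y\<in>K. y ^ ?p = x" if x: "x \<in> K" for x
  proof -
    let ?q = "monom 1 ?p + [:- x:]"
    have "degree ?q = ?p" using False by (subst degree_add_eq_left) (simp_all add: degree_monom_eq)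
    moreover have "?q \<in> polys K"
      using x subfield_intros(1,2,5)[OF K] subfield_subring[OF K] by (intro polys_add polys_monom polys_const) auto
    ultimately obtain y where "y \<in> K" "poly ?q y = 0"
      using assms(2) False polys_iff_coeffs[OF subfield_intros(1)[OF K], of ?q] unfolding is_alg_closed_def by auto
    then show ?thesis by (auto simp: poly_monom)
  qed
  then show ?thesis unfolding is_perfect_def by blast
qed (simp add: is_perfect_def)

lemma perfect_frob:
  fixes K :: "'a::field set"
  assumes K: "is_subfield K" and "is_perfect K" "CHAR('a) > 0" shows "frob K = K"
proof
  show "frob K \<subseteq> K" by (rule frob_subset[OF refl assms(3) subfield_subring[OF K]])
  show "K \<subseteq> frob K" using assms(2,3) unfolding is_perfect_def frob_def by force
qed

text \<open>Serves for the choice K' = K: an irreducible polynomial over K with a root in K is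
  linear, and linear polynomials are separable.\<close>

lemma finite_galois_refl:
  fixes K :: "'a::alg_closed_field set"
  assumes K: "is_subfield K" shows "finite_galois K K"
  unfolding finite_galois_def
proof (intro conjI)
  have "\<exists>c. (\<forall>b\<in>{1}. c b \<in> K) \<and> x = (\<Sum>b\<in>{1}. c b * b)" if "x \<in> K" for x
    using that by (intro exI[of _ "\<lambda>_. x"]) simp
  then show "finite_ext K K"
    unfolding finite_ext_def field_ext_def using K subfield_intros(2)[OF K] by (intro conjI exI[of _ "{1}"]) auto
  note coeffs = polys_iff_coeffs[OF subfield_intros(1)[OF K], symmetric]
  have lin: "[:- x, 1:] \<in> polys K" if "x \<in> K" for x
    using subfield_subring[OF K] that subfield_intros(2,5)[OF K] by (intro polys_intros(8) polys_0) auto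
  show "normal_ext K K"
    unfolding normal_ext_def
  proof (intro allI impI, elim conjE bexE)
    fix p x assume p: "irreducible_over K p" and x: "x \<in> K" "poly p x = 0"
    note ip = p[unfolded irreducible_over_def coeffs]
    have "\<exists>q\<in>polys K. p = [:- x, 1:] * q"
    proof -
      have "\<exists>q r. q \<in> polys K \<and> r \<in> polys K \<and> p = [:- x, 1:] * q + r \<and> (r = 0 \<or> degree r < degree [:- x, 1:])"
        by (rule polys_division[OF K]) (use lin[OF x(1)] ip in auto)
      then obtain q r where q: "q \<in> polys K" "p = [:- x, 1:] * q + r" "r = 0 \<or> degree r < 1" by auto
      have "poly r x = 0" using x(2) unfolding q(2) by simp
      then have "r = 0" using q(3) by (auto elim: degree_eq_zeroE)
      then show ?thesis using q by auto
    qed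
    then obtain q where q: "q \<in> polys K" "p = [:- x, 1:] * q" by blast
    have "\<forall>q r. q \<in> polys K \<and> r \<in> polys K \<and> p = q * r \<longrightarrow> degree q = 0 \<or> degree r = 0" using ip by (elim conjE)
    from this[rule_format, OF conjI[OF lin[OF x(1)] conjI[OF q]]] have "degree q = 0" by simp
    then obtain a where a: "q = [:a:]" by (auto elim: degree_eq_zeroE)
    show "splits_in K p" unfolding splits_in_def
      by (intro exI[of _ "[x]"]) (use x(1) in \<open>simp add: q(2) a\<close>)
  qed
  show "separable_ext K K"
    unfolding separable_ext_def
  proof
    fix x assume x: "x \<in> K"
    have "irreducible_over K [:- x, 1:]"
      unfolding irreducible_over_def coeffs
    proof (intro conjI allI impI)
      show "[:- x, 1:] \<in> polys K" by (rule lin[OF x])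
      fix q r assume qr: "q \<in> polys K \<and> r \<in> polys K \<and> [:- x, 1:] = q * r"
      then have "q \<noteq> 0" "r \<noteq> 0" by auto
      then have "degree q + degree r = 1" using qr degree_mult_eq[of q r] by (metis degree_pCons_eq_if one_neq_zero pCons_eq_0_iff degree_pCons_0 One_nat_def)
      then show "degree q = 0 \<or> degree r = 0" by linarith
    qed simp
    moreover have "rsquarefree [:- x, 1:]"
      using order_degree[of "[:- x, 1:]"] unfolding rsquarefree_def by (auto simp: le_Suc_eq)
    moreover have "poly [:- x, 1:] x = 0" by simp
    ultimately show "\<exists>p. irreducible_over K p \<and> poly p x = 0 \<and> rsquarefree p" by blast
  qed
qed

subsection \<open>Uniformizable places in basic open sets\<close>

text \<open>The finitely many generators of F are algebraic over K(c, Y), so F is finite over that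
  field; this is what \<open>div_place\<close> asks for.\<close>

lemma divisorial_uniformizable:
  fixes F K :: "'a::alg_closed_field set"
  assumes F: "is_subfield F" and K: "is_subfield K" "K \<subseteq> F" "is_perfect K"
    and S: "finite S" "F = adjoin K S" and div: "divisorial F K P Y c"
  shows "uniformizable F K P"
proof -
  note d = div[unfolded divisorial_def]
  let ?k = "adjoin K Y" and ?E = "adjoin K (insert c Y)"
  have Eeq: "?E = adjoin ?k {c}" by (simp add: adjoin_adjoin)
  have E: "is_subfield ?E" by (rule is_subfield_adjoin)
  have kF: "?k \<subseteq> F" using adjoin_least[OF F K(2)] d by blast
  have EF: "?E \<subseteq> F" using adjoin_least[OF F K(2), of "insert c Y"] d by blast
  have SF: "S \<subseteq> F" using S(2) adjoin_gens by blast
  have "\<exists>n. has_dim ?E (adjoin ?E S) n"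
    by (rule finite_adjoin_algebraic[OF E S(1)]) (use d SF in blast)
  then obtain n where n: "has_dim ?E (adjoin ?E S) n" by (elim exE)
  have "adjoin ?E S = F"
  proof
    show "adjoin ?E S \<subseteq> F" by (rule adjoin_least[OF F EF SF])
    show "F \<subseteq> adjoin ?E S" unfolding S(2) by (rule adjoin_mono[OF adjoin_base order_refl])
  qed
  with n have dim: "has_dim (adjoin ?k {c}) F n" unfolding Eeq by (simp only:)
  interpret div_place P F ?k c n
    by unfold_locales (use d F is_subfield_adjoin kF dim in blast)+
  have "\<exists>T. immediate F K T"
  proof (cases "CHAR('a) = 0")
    case True
    then show ?thesis using immediate_char_0[OF True K(1) _ _ refl S] d by blast
  next
    case False
    then have p: "CHAR('a) > 0" by simp
    have "finite Y" using d by blast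
    from immediate_char_p[OF refl p K(1) perfect_frob[OF K(1,3) p] this refl S] show ?thesis .
  qed
  then obtain T where T: "immediate F K T" by (elim exE)
  have "P a = Some a" if "a \<in> K" for a using d that adjoin_base[of K Y] by blast
  from immediate_uniformizable[OF F K(1,2) this S T] show ?thesis .
qed

lemma is_place_subfield:
  assumes F: "is_subfield F" and P: "is_place UNIV P" shows "is_place F P"
proof -
  have v: "val_ring F P = F \<inter> val_ring UNIV P" by (auto simp: val_ring_def)
  have "is_subring (val_ring F P)"
    unfolding v using P subfield_subring[OF F] by (intro is_subring_Int) (simp_all add: is_place_def)
  then show ?thesis using P unfolding is_place_def v by blast
qed

lemma ex_uniformizable:
  fixes F K :: "'a::alg_closed_field set"
  assumes FK: "function_field F K" and alg: "\<forall>x::'a. algebraic_over F x" and perf: "is_perfect K"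
    and A: "finite A" "A \<subseteq> F - {0}" and B: "finite B" "B \<subseteq> F - {0}"
    and Q: "Q \<in> places F K" "\<forall>a\<in>A. Q a \<noteq> Some 0" "\<forall>b\<in>B. Q b = Some 0"
  shows "\<exists>P\<in>places F K. (\<forall>a\<in>A. P a \<noteq> Some 0) \<and> (\<forall>b\<in>B. P b = Some 0) \<and> uniformizable F K P"
proof -
  have F: "is_subfield F" and K: "is_subfield K" "K \<subseteq> F"
    using FK by (simp_all add: function_field_def finitely_generated_def field_ext_def)
  obtain S where S: "finite S" "F = adjoin K S" using FK by (auto simp: function_field_def finitely_generated_def)
  have SF: "S \<subseteq> F" using S(2) adjoin_gens by blast
  obtain T where T: "transcendence_basis F K T" "card T \<ge> 1"
    using FK by (auto simp: function_field_def has_trdeg_def)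
  then obtain t where t: "t \<in> T" by fastforce
  have tF: "t \<in> F" using T(1) t by (auto simp: transcendence_basis_def)
  have ind: "alg_indep K T" using T(1) by (simp add: transcendence_basis_def)
  have tr: "\<not> algebraic_over K t"
    using alg_indep_transcendental[OF K(1) ind t] algebraic_mono[OF adjoin_base] by blast
  have Qp: "is_place F Q" "\<And>a. a \<in> K \<Longrightarrow> Q a = Some a" using Q(1) by (simp_all add: places_def)
  obtain Q' where Q': "is_place UNIV Q'" "\<forall>x\<in>F. Q' x = Q x" using place_extend[OF F Qp(1)] by blast
  interpret Q': place Q' by unfold_locales (rule Q')
  have inV: "Q x \<noteq> None \<longleftrightarrow> x \<in> Q'.V" if "x \<in> F" for x using Q'(2) that by (simp add: Q'.V_def)
  define g where "g s = (if Q s \<noteq> None then s else inverse s)" for s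
  \<comment> \<open>All conditions except vanishing become finiteness: of a generator or its
    inverse, as the normalization requires, and of \<open>inverse a\<close> where a must not
    vanish.\<close>
  define X where "X = g ` S \<union> inverse ` A"
  have iA: "Q (inverse a) \<noteq> None" if "a \<in> A" for a
  proof -
    have "a \<in> F" "a \<noteq> 0" using that A(2) by auto
    then show ?thesis using Q(2) that place_eq_0_iff[OF F Qp(1)] by (auto simp: val_ring_def)
  qed
  have X: "finite X" "X \<subseteq> F" "\<And>s. s \<in> S \<Longrightarrow> s \<in> X \<or> inverse s \<in> X" "\<And>x. x \<in> X \<Longrightarrow> Q x \<noteq> None"
  proof -
    show "finite X" using S(1) A(1) by (simp add: X_def)
    show "X \<subseteq> F" using SF A(2) subfield_inverse[OF F] by (auto simp: X_def g_def)
    have gX: "g s \<in> X" if "s \<in> S" for s using that by (simp add: X_def)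
    show "s \<in> X \<or> inverse s \<in> X" if "s \<in> S" for s using gX[OF that] by (auto simp: g_def split: if_splits)
    have "Q (g s) \<noteq> None" if "s \<in> S" for s
    proof (cases "Q s = None")
      case True
      then have "Q (inverse s) = Some 0" using Qp(1) SF that unfolding is_place_def by blast
      then show ?thesis using True by (simp add: g_def)
    qed (simp add: g_def)
    then show "Q x \<noteq> None" if "x \<in> X" for x using that iA unfolding X_def by blast
  qed
  have alg': "algebraic_over F x" for x using alg by blast
  have "\<exists>P Y c. divisorial F K P Y c \<and> (\<forall>x\<in>X. P x \<noteq> None) \<and> (\<forall>b\<in>B. P b = Some 0)"
  proof (cases "B = {}")
    case True
    have "\<exists>P Y c. divisorial F K P Y c \<and> (\<forall>x\<in>X. P x \<noteq> None)"
      by (rule ex_divisorial_trivial[OF K(1) F K(2) S alg' tF tr X(1,2)]) (erule X(3))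
    then show ?thesis using True by simp
  next
    case False
    have "\<exists>b\<in>B. b \<noteq> 0" using False B(2) by blast
    \<comment> \<open>b has least value in B at Q. If b goes to 0 and the quotients x/b stay finite,
      then every x in B goes to 0; so a single vanishing condition remains.\<close>
    from Q'.ex_dominant[OF B(1) this] obtain b where b: "b \<in> B" "b \<noteq> 0" "\<forall>x\<in>B. x / b \<in> Q'.V" by blast
    have bF: "b \<in> F" using b(1) B(2) by blast
    define X' where "X' = X \<union> insert b ((\<lambda>x. x / b) ` B)"
    have X': "finite X'" "X' \<subseteq> F" "\<And>s. s \<in> S \<Longrightarrow> s \<in> X' \<or> inverse s \<in> X'" "\<And>x. x \<in> X' \<Longrightarrow> Q x \<noteq> None"
    proof -
      show "finite X'" using X(1) B(1) by (simp add: X'_def)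
      have dF: "x / b \<in> F" if "x \<in> B" for x using that B(2) subfield_divide[OF F _ bF] by blast
      show "X' \<subseteq> F" using X(2) bF dF unfolding X'_def by blast
      show "s \<in> X' \<or> inverse s \<in> X'" if "s \<in> S" for s using X(3)[OF that] unfolding X'_def by blast
      have "Q (x / b) \<noteq> None" if "x \<in> B" for x using inV[OF dF[OF that]] b(3) that by blast
      moreover have "Q b \<noteq> None" using Q(3) b(1) by simp
      ultimately show "Q x \<noteq> None" if "x \<in> X'" for x using that X(4) unfolding X'_def by blast
    qed
    have "b \<in> X'" by (simp add: X'_def)
    have Qb: "Q b = Some 0" using Q(3) b(1) by blast
    have "\<exists>P Y c. divisorial F K P Y c \<and> (\<forall>x\<in>X'. P x \<noteq> None) \<and> P b = Some 0"
      by (rule ex_divisorial[OF K(1) F K(2) S alg' tF tr X'(1,2) _ Qp(1) _ _ \<open>b \<in> X'\<close> b(2) Qb])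
        (erule X'(3), erule Qp(2), erule X'(4))
    then obtain P Y c where P: "divisorial F K P Y c" "\<forall>x\<in>X'. P x \<noteq> None" "P b = Some 0" by (elim exE conjE)
    interpret P: place P by unfold_locales (use P(1) in \<open>simp add: divisorial_def\<close>)
    have "P x = Some 0" if "x \<in> B" for x
    proof -
      have "x / b \<in> X'" using that by (auto simp: X'_def)
      then have "P (x / b) \<noteq> None" by (rule bspec[OF P(2)])
      then have xb: "x / b \<in> P.V" by (simp add: P.V_def)
      have bV: "b \<in> P.V" "P.res b = 0" using P(3) by (simp_all add: P.P_eq_Some)
      have "x = x / b * b" using b(2) by simp
      then show ?thesis using P.V_intros(4)[OF xb bV(1)] P.res_mult[OF xb bV(1)] bV(2) by (simp add: P.P_eq_Some)
    qed
    moreover have "\<forall>x\<in>X. P x \<noteq> None" using P(2) unfolding X'_def ball_Un by (rule conjunct1)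
    ultimately show ?thesis using P(1) by (intro exI[of _ P] exI[of _ Y] exI[of _ c] conjI ballI) simp_all
  qed
  then obtain P Y c where P: "divisorial F K P Y c" "\<forall>x\<in>X. P x \<noteq> None" "\<forall>b\<in>B. P b = Some 0" by (elim exE conjE)
  note d = P(1)[unfolded divisorial_def]
  have pl: "is_place F P" using is_place_subfield[OF F] d by blast
  have "P a = Some a" if "a \<in> K" for a using d that adjoin_base[of K Y] by blast
  then have "P \<in> places F K" using pl by (simp add: places_def)
  moreover have "P a \<noteq> Some 0" if "a \<in> A" for a
  proof -
    have "a \<in> F" "a \<noteq> 0" using that A(2) by auto
    moreover have "P (inverse a) \<noteq> None" using P(2) that by (simp add: X_def)
    ultimately show ?thesis using place_eq_0_iff[OF F pl] subfield_inverse[OF F] by (auto simp: val_ring_def)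
  qed
  moreover have "uniformizable F K P" using divisorial_uniformizable[OF F K perf S P(1)] .
  ultimately show ?thesis using P(3) by (intro bexI[of _ P]) auto
qed

theorem corollary1p10:
  fixes F K :: "'a::alg_closed_field set"
  assumes "function_field F K"
    and "\<forall>x::'a. algebraic_over F x"
  shows "(is_alg_closed K \<longrightarrow>
            zariski_patch F K closure_of
              zariski_points F K {P \<in> places F K. uniformizable F K P}
            = zariski_space F K) \<and>
         (is_perfect K \<longrightarrow>
            zariski_patch F K closure_of
              zariski_points F K
                {P \<in> places F K.
                   \<forall>Z. finite Z \<and> Z \<subseteq> val_ring F P \<longrightarrow>
                     (\<exists>K' P'. finite_galois K' K \<and>
                        is_place (compositum F K') (P' :: 'a \<Rightarrow> 'a option) \<and>
                        (\<forall>x\<in>F. P' x = P x) \<and>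
                        uniformizable_wrt (compositum F K') K' P' Z)}
            = zariski_space F K)"
proof -
  have F: "is_subfield F" and K: "is_subfield K" "K \<subseteq> F"
    using assms(1) by (simp_all add: function_field_def finitely_generated_def field_ext_def)
  \<comment> \<open>Both densities are instances of this one, N being any set of places of F|K that
    contains the uniformizable ones.\<close>
  have dense: "zariski_patch F K closure_of zariski_points F K N = zariski_space F K"
    if perf: "is_perfect K" and N: "N \<subseteq> places F K" "{P \<in> places F K. uniformizable F K P} \<subseteq> N" for N
  proof (rule patch_dense[OF F N(1)])
    fix A B Q
    assume AB: "finite A" "finite B" "A \<subseteq> F - {0}" "B \<subseteq> F - {0}"
      and Q: "Q \<in> places F K" "\<forall>a\<in>A. Q a \<noteq> Some 0" "\<forall>b\<in>B. Q b = Some 0"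
    from ex_uniformizable[OF assms perf AB(1,3,2,4) Q] obtain P where
      P: "P \<in> places F K" "uniformizable F K P" "\<forall>a\<in>A. P a \<noteq> Some 0" "\<forall>b\<in>B. P b = Some 0" by (elim bexE conjE)
    then have "P \<in> N" using N(2) by blast
    then show "\<exists>P\<in>N. (\<forall>a\<in>A. P a \<noteq> Some 0) \<and> (\<forall>b\<in>B. P b = Some 0)" using P(3,4) by (intro bexI[of _ P] conjI)
  qed
  have FK: "compositum F K = F" by (rule adjoin_absorb[OF F K(2)])
  have galois: "\<exists>K' P'. finite_galois K' K \<and> is_place (compositum F K') (P' :: 'a \<Rightarrow> 'a option) \<and>
      (\<forall>x\<in>F. P' x = P x) \<and> uniformizable_wrt (compositum F K') K' P' Z"
    if "P \<in> places F K" "uniformizable F K P" "finite Z" "Z \<subseteq> val_ring F P" for P Z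
    using that finite_galois_refl[OF K(1)] unfolding places_def uniformizable_def
    by (intro exI[of _ K] exI[of _ P]) (simp add: FK)
  show ?thesis
  proof (intro conjI impI dense)
    assume "is_alg_closed K" then show "is_perfect K" by (rule is_alg_closed_perfect[OF K(1)])
  qed (use galois in blast)+
qed

end
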